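(* Let $d\geq 1$, $s\geq 0$, $r>p\geq 3$ (integers $r,p$), $\mathbf{Z}_d \subset \mathbb{Z}^d$, $N_{\max}\in [1,+\infty]$ and $\eta>0$. Let $Z_2 : h^s(\mathbf{Z}_d) \to \mathbb{R}$ be of the form $Z_2(u) = \frac12 \sum_{n\in \mathbf{Z}_d} \omega_n |u_n|^2$ where $\omega_n\in\mathbb{R}$, $( \langle n \rangle^{-2s} \omega_n)_{n\in \mathbf{Z}_d}$ is bounded and $\omega \in \mathcal{D}_{\gamma,N_{\max}}^{\beta,r}(\mathbf{Z}_d)$, i.e. $\omega$ is strongly non-resonant, up to order $r$, for small divisors involving at least one mode of index smaller than $N_{\max}$, for some positive constants $\beta=(\beta_j)_j$, $\gamma=(\gamma_j)_j$. Let $P : h^s(\mathbf{Z}_d) \to \mathbb{R}$ be of the form $P(u) = \sum_{p\leq j\leq r-1} P^{(j)}(u)$ where $P^{(j)} \in \mathcal{H}_{q,\alpha}^j(\mathbf{Z}_d)$ satisfies $\| P^{(j)}\|_{q,\alpha} \leq c_j \eta^{-(j-2)}$, $c=(c_j)_{p\leq j\leq r-1}$ is a sequence of positive constants and $(\alpha,q)$ satisfy $\alpha >\max(d-q,d/2)$, $d/2-q<s<\alpha-d/2+q$ and $q\geq 0$. Let $K>0$, $\varepsilon_1>0$ be arbitrary constants. Assume that $u\in C^0_b(\mathbb{R};h^s(\mathbf{Z}_d))\cap C^1(\mathbb{R};h^{-s}(\mathbf{Z}_d))$ is a global solution of $$i\partial_t u(t) = \nabla Z_2(u(t)) + \nabla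 P(u(t)) + F(t)$$ where $F\in C^0_b(\mathbb{R};h^{-s}(\mathbf{Z}_d))$ and $u$ satisfy $$\forall t\in \mathbb{R}, \quad \| F(t) \|_{h^{-s}} \leq K \eta^{-(r-2)}\varepsilon_1^{r-1} \quad \mathrm{and} \quad \| u(t) \|_{h^s} \leq \varepsilon_1,$$ and that the frequencies are coercive (i.e. $|\omega_n| \to \infty$ as $|n| \to \infty$; by convention this holds if $\mathbf{Z}_d$ is bounded). Then, for all $n\in\mathbf{Z}_d$ and $t\in\mathbb{R}$, $$|t|< \left(\frac{\varepsilon_1 }{\eta} \right)^{-(r-p)} \ \mathrm{and} \ \ \langle n \rangle \leq N_{\max} \quad \Longrightarrow \quad |J_n(u(t))-J_n(u(0))|\leq M \eta ^{-(p-2)} \langle n \rangle^{\mathfrak{b}} \varepsilon_1^{p},$$ where $J_n(u)=\sum_{k\in\mathbf{Z}_d,\ \omega_k=\omega_n}|u_k|^2$, $M>0$ depends only on $(K,r,s,(\gamma_j)_{3\le j\le r},\alpha,d,q,c)$ and $\mathfrak{b}$ depends only on $((\beta_j)_{3\le j\le r},r)$.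
   Context: Notation: $\langle x\rangle=\sqrt{1+|x|^2}$; $\mathfrak{S}_r$ is the symmetric group; $C^0_b$ denotes bounded continuous functions. Spaces and calculus: $h^s(\mathbf{Z}_d)=\{u\in\mathbb{C}^{\mathbf{Z}_d}: \|u\|_{h^s}^2=\sum_{k\in\mathbf{Z}_d}\langle k\rangle^{2s}|u_k|^2<\infty\}$, viewed as a real Hilbert space; $(u,v)_{\ell^2}=\sum_k\Re(\overline{u_k}v_k)$, extended to $h^s\times h^{-s}$. For a smooth real valued $H$ on $h^s$, $\nabla H(u)\in h^{-s}$ is defined by $(\nabla H(u),v)_{\ell^2}=\mathrm{d}H(u)(v)$ for all $v\in h^s$; in particular $(\nabla Z_2(u))_n=\omega_nu_n$. Class of Hamiltonians: for $q,\alpha\ge0$ and an integer $r\ge2$, $\mathcal{H}_{q,\alpha}^{r}(\mathbf{Z}_d)$ is the space of formal Hamiltonians $$H(u) = \sum_{\sigma \in \{-1,1\}^r} \sum_{n\in \mathbf{Z}_d^r } H_{n}^{\sigma} u_{n_1}^{\sigma_1} \cdots u_{n_r}^{\sigma_r},\qquad u_k^{1}:=u_k,\ u_k^{-1}:=\overline{u_k},$$ with $H_n^\sigma\in\mathbb{C}$ satisfying $H_{n}^{-\sigma} = \overline{H_{n}^{\sigma}}$, the symmetry $H_{n_1,\dots,n_r}^{\sigma_1,\dots,\sigma_r} = H_{n_{\phi_1},\dots,n_{\phi_r}}^{\sigma_{\phi_1},\dots,\sigma_{\phi_r}}$ for all $\phi\in\mathfrak{S}_r$, and $$\| H \|_{q,\alpha}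 = \sup_{\sigma,n}\left[ \mathop{\mathrm{hmean}}_{\nu \in (\{-1,1\}^d)^r} \Big\langle \sum_{\ell =1}^r \nu_{\ell} \diamond n_{\ell} \Big\rangle^{\alpha} \right] \langle n_1 \rangle^q \cdots \langle n_r \rangle^q | H_{n}^{\sigma} | < \infty,$$ where $\nu_\ell\diamond n_\ell\in\mathbb{Z}^d$ is the coordinatewise product and $\mathrm{hmean}_{j\in S}(x_j)=\big(\frac1{\#S}\sum_{j\in S}x_j^{-1}\big)^{-1}$ is the harmonic mean. When $s>d/2-q$ the series converges absolutely on $h^s(\mathbf{Z}_d)$ and such Hamiltonians are identified with the smooth real valued functions they define. Strong non-resonance: for $\omega\in\mathbb{R}^{\mathbf{Z}_d}$, $\sigma\in\{-1,1\}^j$ and $n\in\mathbf{Z}_d^j$, let $$\kappa_\omega(\sigma,n) = \min \Big\{ \langle n_i \rangle \ : \ 1\le i\le j \ \text{ and } \sum_{k:\ \omega_{n_k} = \omega_{n_i}} \sigma_k \neq 0\Big\}\qquad(\min\emptyset=+\infty).$$ $\omega\in\mathcal{D}_{\gamma,N_{\max}}^{\beta,r}(\mathbf{Z}_d)$ means that for all $j\in\{1,\dots,r\}$, with constants $\gamma_j>0$, $\beta_j>0$, for all $n \in \mathbf{Z}_d^{j}$, $\sigma \in \{ -1,1\}^{j}$ with $\kappa_\omega(\sigma,n)\leq N_{\max}$, either $\big|\sum_{i=1}^{j} \sigma_i \omega_{n_i}\big| \geq \gamma_j \, \kappa_\omega(\sigma,n)^{-\beta_j}$, or $j$ is even and there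 exists $\rho \in \mathfrak{S}_{j}$ such that $\sigma_{\rho_{2i-1}}= -\sigma_{\rho_{2i}}$ and $\omega_{n_{\rho_{2i-1}}}=\omega_{n_{\rho_{2i}}}$ for all $1\le i\le j/2$. *)

theory Defs
  imports "HOL-Analysis.Analysis" "HOL-Combinatorics.Permutations"
begin

text \<open>
  Since one of the constants in the theorem must not depend on the dimension \<open>d\<close>, the dimension is a
  natural number and not a type: a point of \<open>\<int>\<^sup>d\<close> is an extensional function on \<open>{..<d}\<close>. Likewise
  \<open>r\<close>-tuples (of signs or of sites) are extensional functions on \<open>{..<r}\<close>; all indices start at 0.
\<close>

type_synonym site = "nat \<Rightarrow> int"
type_synonym field = "site \<Rightarrow> complex"

definition Zd :: "nat \<Rightarrow> site set" where
  "Zd d = {..<d} \<rightarrow>\<^sub>E UNIV"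

definition site_norm :: "nat \<Rightarrow> site \<Rightarrow> real" where
  "site_norm d n = sqrt (\<Sum>i<d. (real_of_int (n i))\<^sup>2)"

definition jap :: "nat \<Rightarrow> site \<Rightarrow> real" where
  "jap d n = sqrt (1 + (site_norm d n)\<^sup>2)"

definition tuples :: "nat \<Rightarrow> 'a set \<Rightarrow> (nat \<Rightarrow> 'a) set" where
  "tuples r A = {..<r} \<rightarrow>\<^sub>E A"

definition signs :: "nat \<Rightarrow> (nat \<Rightarrow> int) set" where
  "signs r = tuples r {-1, 1}"

text \<open>An element of \<open>\<complex>\<^bsup>Z\<^esup>\<close> is a function on all sites that vanishes outside \<open>Z\<close>.\<close>

definition hspace :: "nat \<Rightarrow> site set \<Rightarrow> real \<Rightarrow> field set" where
  "hspace d Z s = {u. (\<forall>k. k \<notin> Z \<longrightarrow> u k = 0) \<and>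
      (\<lambda>k. jap d k powr (2 * s) * (cmod (u k))\<^sup>2) summable_on Z}"

definition hnorm :: "nat \<Rightarrow> site set \<Rightarrow> real \<Rightarrow> field \<Rightarrow> real" where
  "hnorm d Z s u = sqrt (\<Sum>\<^sub>\<infinity>k\<in>Z. jap d k powr (2 * s) * (cmod (u k))\<^sup>2)"

definition l2_pair :: "site set \<Rightarrow> field \<Rightarrow> field \<Rightarrow> real" where
  "l2_pair Z u v = (\<Sum>\<^sub>\<infinity>k\<in>Z. Re (cnj (u k) * v k))"

definition h_C0 :: "nat \<Rightarrow> site set \<Rightarrow> real \<Rightarrow> (real \<Rightarrow> field) set" where
  "h_C0 d Z s = {f. (\<forall>t. f t \<in> hspace d Z s) \<and>
      (\<forall>t. ((\<lambda>\<tau>. hnorm d Z s (\<lambda>k. f \<tau> k - f t k)) \<longlongrightarrow> 0) (at t))}"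

definition h_C0b :: "nat \<Rightarrow> site set \<Rightarrow> real \<Rightarrow> (real \<Rightarrow> field) set" where
  "h_C0b d Z s = {f \<in> h_C0 d Z s. \<exists>B. \<forall>t. hnorm d Z s (f t) \<le> B}"

definition h_C1_deriv ::
  "nat \<Rightarrow> site set \<Rightarrow> real \<Rightarrow> (real \<Rightarrow> field) \<Rightarrow> (real \<Rightarrow> field) \<Rightarrow> bool" where
  "h_C1_deriv d Z s f f' \<longleftrightarrow> (\<forall>t. f t \<in> hspace d Z s) \<and> f' \<in> h_C0 d Z s \<and>
      (\<forall>t. ((\<lambda>\<tau>. hnorm d Z s (\<lambda>k. (f \<tau> k - f t k) / of_real (\<tau> - t) - f' t k)) \<longlongrightarrow> 0) (at t))"

text \<open>
  \<open>g \<in> h\<^bsup>-s\<^esup>\<close> represents the Frechet derivative at \<open>u\<close> of the function \<open>H\<close> on the real Hilbert space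
  \<open>h\<^sup>s\<close>. (For such \<open>g\<close> the pairing with \<open>g\<close> is a bounded real linear form on \<open>h\<^sup>s\<close>.)
\<close>

definition has_h_gradient ::
  "nat \<Rightarrow> site set \<Rightarrow> real \<Rightarrow> (field \<Rightarrow> real) \<Rightarrow> field \<Rightarrow> field \<Rightarrow> bool" where
  "has_h_gradient d Z s H u g \<longleftrightarrow> g \<in> hspace d Z (- s) \<and>
      (\<forall>e>0. \<exists>\<delta>>0. \<forall>v\<in>hspace d Z s. hnorm d Z s v < \<delta> \<longrightarrow>
         \<bar>H (\<lambda>k. u k + v k) - H u - l2_pair Z g v\<bar> \<le> e * hnorm d Z s v)"

definition h_gradient ::
  "nat \<Rightarrow> site set \<Rightarrow> real \<Rightarrow> (field \<Rightarrow> real) \<Rightarrow> field \<Rightarrow> field" where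
  "h_gradient d Z s H u = (THE g. has_h_gradient d Z s H u g)"

definition Z2 :: "site set \<Rightarrow> (site \<Rightarrow> real) \<Rightarrow> field \<Rightarrow> real" where
  "Z2 Z \<omega> u = 1 / 2 * (\<Sum>\<^sub>\<infinity>n\<in>Z. \<omega> n * (cmod (u n))\<^sup>2)"

definition hmean :: "'a set \<Rightarrow> ('a \<Rightarrow> real) \<Rightarrow> real" where
  "hmean S x = inverse (1 / real (card S) * (\<Sum>j\<in>S. inverse (x j)))"

text \<open>A formal Hamiltonian of degree \<open>r\<close> is given by its coefficients \<open>H \<sigma> n\<close>.\<close>

type_synonym hamiltonian = "(nat \<Rightarrow> int) \<Rightarrow> (nat \<Rightarrow> site) \<Rightarrow> complex"

definition signed_sum :: "nat \<Rightarrow> nat \<Rightarrow> (nat \<Rightarrow> nat \<Rightarrow> int) \<Rightarrow> (nat \<Rightarrow> site) \<Rightarrow> site" where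
  "signed_sum d r \<nu> n = (\<lambda>i\<in>{..<d}. \<Sum>l<r. \<nu> l i * n l i)"

definition ham_weight :: "nat \<Rightarrow> real \<Rightarrow> real \<Rightarrow> nat \<Rightarrow> (nat \<Rightarrow> site) \<Rightarrow> real" where
  "ham_weight d q \<alpha> r n =
     hmean (tuples r (signs d)) (\<lambda>\<nu>. jap d (signed_sum d r \<nu> n) powr \<alpha>) *
     (\<Prod>l<r. jap d (n l) powr q)"

definition ham_norm ::
  "nat \<Rightarrow> site set \<Rightarrow> real \<Rightarrow> real \<Rightarrow> nat \<Rightarrow> hamiltonian \<Rightarrow> ennreal" where
  "ham_norm d Z q \<alpha> r H =
     (SUP (\<sigma>, n) \<in> signs r \<times> tuples r Z. ennreal (ham_weight d q \<alpha> r n * cmod (H \<sigma> n)))"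

definition ham_class ::
  "nat \<Rightarrow> site set \<Rightarrow> real \<Rightarrow> real \<Rightarrow> nat \<Rightarrow> hamiltonian set" where
  "ham_class d Z q \<alpha> r = {H.
     (\<forall>\<sigma>\<in>signs r. \<forall>n\<in>tuples r Z. H (\<lambda>i\<in>{..<r}. - \<sigma> i) n = cnj (H \<sigma> n)) \<and>
     (\<forall>\<sigma>\<in>signs r. \<forall>n\<in>tuples r Z. \<forall>\<phi>. \<phi> permutes {..<r} \<longrightarrow> H \<sigma> n = H (\<sigma> \<circ> \<phi>) (n \<circ> \<phi>)) \<and>
     ham_norm d Z q \<alpha> r H < \<infinity>}"

definition sign_conj :: "int \<Rightarrow> complex \<Rightarrow> complex" where
  "sign_conj \<sigma> z = (if \<sigma> = 1 then z else cnj z)"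

text \<open>
  The function defined by a formal Hamiltonian. For \<open>H\<close> in \<open>ham_class\<close> the complex sum is real, by the
  first condition in \<open>ham_class\<close>; \<open>Re\<close> is only a coercion.
\<close>

definition ham_fun :: "site set \<Rightarrow> nat \<Rightarrow> hamiltonian \<Rightarrow> field \<Rightarrow> real" where
  "ham_fun Z r H u =
     Re (\<Sum>\<sigma>\<in>signs r. \<Sum>\<^sub>\<infinity>n\<in>tuples r Z. H \<sigma> n * (\<Prod>i<r. sign_conj (\<sigma> i) (u (n i))))"

definition kappa ::
  "nat \<Rightarrow> (site \<Rightarrow> real) \<Rightarrow> nat \<Rightarrow> (nat \<Rightarrow> int) \<Rightarrow> (nat \<Rightarrow> site) \<Rightarrow> ereal" where
  "kappa d \<omega> j \<sigma> n =
     (INF i \<in> {i. i < j \<and> (\<Sum>k | k < j \<and> \<omega> (n k) = \<omega> (n i). \<sigma> k) \<noteq> 0}. ereal (jap d (n i)))"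

text \<open>
  If \<open>kappa\<close> is infinite, \<open>real_of_ereal\<close> and \<open>powr\<close> turn the lower bound into 0, the value expected for
  a negative power of infinity.
\<close>

definition strongly_nonresonant ::
  "nat \<Rightarrow> site set \<Rightarrow> (nat \<Rightarrow> real) \<Rightarrow> (nat \<Rightarrow> real) \<Rightarrow> ereal \<Rightarrow> nat \<Rightarrow> (site \<Rightarrow> real) \<Rightarrow> bool" where
  "strongly_nonresonant d Z \<beta> \<gamma> Nmax r \<omega> \<longleftrightarrow>
     (\<forall>j\<in>{1..r}. \<forall>n\<in>tuples j Z. \<forall>\<sigma>\<in>signs j. kappa d \<omega> j \<sigma> n \<le> Nmax \<longrightarrow>
        \<bar>\<Sum>i<j. of_int (\<sigma> i) * \<omega> (n i)\<bar> \<ge> \<gamma> j * real_of_ereal (kappa d \<omega> j \<sigma> n) powr (- \<beta> j) \<or>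
        even j \<and> (\<exists>\<rho>. \<rho> permutes {..<j} \<and>
          (\<forall>i < j div 2. \<sigma> (\<rho> (2 * i)) = - \<sigma> (\<rho> (2 * i + 1)) \<and>
                         \<omega> (n (\<rho> (2 * i))) = \<omega> (n (\<rho> (2 * i + 1))))))"

text \<open>For bounded \<open>Z\<close> the source filter is trivial and the condition holds.\<close>

definition coercive :: "nat \<Rightarrow> site set \<Rightarrow> (site \<Rightarrow> real) \<Rightarrow> bool" where
  "coercive d Z \<omega> \<longleftrightarrow>
     filterlim (\<lambda>n. \<bar>\<omega> n\<bar>) at_top (inf (filtercomap (site_norm d) at_top) (principal Z))"

definition super_action :: "site set \<Rightarrow> (site \<Rightarrow> real) \<Rightarrow> site \<Rightarrow> field \<Rightarrow> real" where
  "super_action Z \<omega> n u = (\<Sum>\<^sub>\<infinity>k\<in>{k \<in> Z. \<omega> k = \<omega> n}. (cmod (u k))\<^sup>2)"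

end

theory Submission imports Defs begin

text \<open>
  Fix a site \<open>n\<close> with \<open>\<langle>n\<rangle> \<le> N\<^sub>m\<^sub>a\<^sub>x\<close> and let \<open>J\<close> be the sum of \<open>|u\<^sub>k|\<^sup>2\<close> over the cluster of the sites
  with the same frequency as \<open>n\<close>. The flow of \<open>J\<close> rotates the modes of the cluster and fixes the
  others. A monomial is an eigenvector of the bracket with \<open>J\<close>, and its eigenvalue, the
  \<open>J\<close>-weight, is the signed number of its factors from the cluster. The quadratic part \<open>Z\<^sub>2\<close>
  commutes with \<open>J\<close>, so that \<open>J\<close> is moved only by the force and by the monomials of \<open>P\<close> of nonzero
  \<open>J\<close>-weight. The small divisors of these monomials are controlled by \<open>n\<close> (\<open>small_divisor_bound\<close>):
  a nonzero \<open>J\<close>-weight excludes that the modes cancel in pairs of equal frequency, and it forces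
  \<open>\<kappa> \<le> \<langle>n\<rangle>\<close> once the sites of the cluster are replaced by \<open>n\<close>. Let \<open>\<Lambda>\<close>, a constant times a power
  of \<open>\<langle>n\<rangle>\<close>, bound the inverses of these divisors.

  It therefore suffices to remove the monomials of nonzero \<open>J\<close>-weight. A Birkhoff normal form
  (\<open>normal_form\<close>) writes \<open>Z\<^sub>2 + P\<close>, through degree \<open>r - 1\<close>, as the formal Lie transform of
  \<open>Z\<^sub>2 + Q\<close>, where \<open>Q\<close> commutes with \<open>J\<close>. Lie transforms preserve brackets, so the transform
  \<open>E = J + \<dots>\<close> of \<open>J\<close> itself commutes with \<open>Z\<^sub>2 + P\<close> up to terms of degree at least \<open>r\<close>
  (\<open>modified_action\<close>). No change of variables is performed: the transforms are defined by an
  algebraic recursion, and only the polynomial \<open>E\<close> is differentiated along the solution. Write \<open>\<epsilon>\<close>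
  for the bound on the norm of \<open>u\<close>. For \<open>\<epsilon> \<le> \<eta>\<close>, the correction \<open>E - J\<close> has size \<open>\<epsilon>\<^sup>2 (\<epsilon>/\<eta>)\<^bsup>p-2\<^esup>\<close> and
  the derivative of \<open>E\<close> along the solution has size \<open>\<epsilon>\<^sup>2 (\<epsilon>/\<eta>)\<^bsup>r-2\<^esup>\<close>, up to powers of \<open>\<Lambda>\<close>; over a
  time \<open>(\<epsilon>/\<eta>)\<^bsup>-(r-p)\<^esup>\<close> both contribute the same to the drift of \<open>J\<close>. For \<open>\<epsilon> > \<eta>\<close> the claim follows
  from the trivial bound \<open>J \<le> \<epsilon>\<^sup>2\<close>.

  All estimates are made on one norm of a homogeneous polynomial: the best constant \<open>C\<close> for which
  the gradient of its majorant maps the ball of radius \<open>R\<close> of \<open>h\<^sup>s\<close> into the ball of radius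
  \<open>C R\<^bsup>j-1\<^esup>\<close> of \<open>h\<^sup>s\<close>. It is stable under brackets (\<open>adm_pb\<close>) and under the division by small
  divisors (\<open>tame_multiplier\<close>). The weights that define the class of Hamiltonians are used only
  once, to bound this norm for \<open>P\<close>; that is the multilinear estimate \<open>multilinear_kernel_bound\<close>.

  The algebra takes place in finitely many variables. On a bounded time interval the solution
  describes a compact curve in \<open>h\<^sup>s\<close>, so that all but an arbitrarily small part of it is carried by
  a finite set \<open>B\<close> of modes (\<open>uniform_tail\<close>), which can be chosen to contain the cluster because
  the cluster is finite by coercivity. The modes in \<open>B\<close> solve the truncated Hamiltonian system up
  to an error that is absorbed in the force. Since no constant depends on \<open>B\<close>, nothing is lost.
\<close>

section \<open>Polynomials and Poisson brackets\<close>

text \<open>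
  A polynomial is presented by a list of coefficients and monomials in which a monomial may occur
  several times. Like terms never have to be collected, because all bounds refer to the majorant
  of some presentation.
\<close>

type_synonym 'v poly_terms = "(complex \<times> 'v multiset) list"

definition mon :: "'v multiset \<Rightarrow> ('v \<Rightarrow> 'b::comm_monoid_mult) \<Rightarrow> 'b" where
  "mon m z = (\<Prod>x\<in>#m. z x)"

definition ev :: "'v poly_terms \<Rightarrow> ('v \<Rightarrow> complex) \<Rightarrow> complex" where
  "ev ts z = (\<Sum>(a, m)\<leftarrow>ts. a * mon m z)"

definition maj :: "'v poly_terms \<Rightarrow> ('v \<Rightarrow> real) \<Rightarrow> real" where
  "maj ts z = (\<Sum>(a, m)\<leftarrow>ts. cmod a * mon m z)"

definition dterms :: "'v \<Rightarrow> 'v poly_terms \<Rightarrow> 'v poly_terms" where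
  "dterms v ts = map (\<lambda>(a, m). (of_nat (count m v) * a, m - {#v#})) ts"

definition mult_terms :: "'v poly_terms \<Rightarrow> 'v poly_terms \<Rightarrow> 'v poly_terms" where
  "mult_terms ts us = concat (map (\<lambda>(a, m). map (\<lambda>(b, k). (a * b, m + k)) us) ts)"

definition scale_terms :: "complex \<Rightarrow> 'v poly_terms \<Rightarrow> 'v poly_terms" where
  "scale_terms c ts = map (\<lambda>(a, m). (c * a, m)) ts"

lemma mon_simps [simp]:
  "mon {#} z = 1" "mon (add_mset x m) z = z x * mon m z" "mon (m + k) z = mon m z * mon k z"
  by (simp_all add: mon_def)

lemma ev_simps [simp]:
  "ev [] z = 0" "ev ((a, m) # ts) z = a * mon m z + ev ts z" "ev (ts @ us) z = ev ts z + ev us z"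
  by (simp_all add: ev_def)

lemma maj_simps [simp]:
  "maj [] z = 0" "maj ((a, m) # ts) z = cmod a * mon m z + maj ts z"
  "maj (ts @ us) z = maj ts z + maj us z"
  by (simp_all add: maj_def)

lemma dterms_simps [simp]:
  "dterms v [] = []"
  "dterms v ((a, m) # ts) = (of_nat (count m v) * a, m - {#v#}) # dterms v ts"
  "dterms v (ts @ us) = dterms v ts @ dterms v us"
  by (simp_all add: dterms_def)

lemma ev_scale [simp]: "ev (scale_terms c ts) z = c * ev ts z"
  by (induction ts) (auto simp: scale_terms_def algebra_simps)

lemma maj_scale [simp]: "maj (scale_terms c ts) z = cmod c * maj ts z"
  by (induction ts) (auto simp: scale_terms_def algebra_simps norm_mult)

lemma ev_mult [simp]: "ev (mult_terms ts us) z = ev ts z * ev us z"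
proof -
  have "ev (map (\<lambda>(b, k). (a * b, m + k)) us) z = a * mon m z * ev us z" for a m
    by (induction us) (auto simp: algebra_simps)
  then show ?thesis
    by (induction ts) (auto simp: mult_terms_def algebra_simps)
qed

lemma maj_mult [simp]: "maj (mult_terms ts us) z = maj ts z * maj us z"
proof -
  have "maj (map (\<lambda>(b, k). (a * b, m + k)) us) z = cmod a * mon m z * maj us z" for a m
    by (induction us) (auto simp: algebra_simps norm_mult)
  then show ?thesis
    by (induction ts) (auto simp: mult_terms_def algebra_simps)
qed

lemma mon_nonneg: "(\<And>x. 0 \<le> (z x :: real)) \<Longrightarrow> 0 \<le> mon m z"
  by (induction m) auto

lemma mon_mono: "(\<And>x. 0 \<le> (z x :: real)) \<Longrightarrow> (\<And>x. z x \<le> y x) \<Longrightarrow> mon m z \<le> mon m y"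
proof (induction m)
  case (add x m)
  moreover have "0 \<le> y x" using add.prems order_trans by blast
  ultimately show ?case by (auto intro!: mult_mono mon_nonneg)
qed auto

lemma norm_mon: "norm (mon m z) = mon m (\<lambda>x. cmod (z x))"
  by (induction m) (auto simp: norm_mult)

lemma maj_nonneg: "(\<And>x. 0 \<le> z x) \<Longrightarrow> 0 \<le> maj ts z"
  by (induction ts) (auto intro!: add_nonneg_nonneg mult_nonneg_nonneg mon_nonneg)

lemma norm_ev_le_maj: "cmod (ev ts z) \<le> maj ts (\<lambda>x. cmod (z x))"
  by (induction ts) (auto simp: norm_mult norm_mon intro!: norm_triangle_mono)

text \<open>
  The factor \<open>count m v\<close> makes the identity true also when \<open>v\<close> does not occur in \<open>m\<close>, where
  \<open>m - {#v#}\<close> is \<open>m\<close>.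
\<close>

lemma mon_minus_single:
  "of_nat (count m v) * (z v * mon (m - {#v#}) z) = of_nat (count m v) * (mon m z :: 'b::comm_semiring_1)"
proof (cases "v \<in># m")
  case True
  then obtain k where "m = add_mset v k" by (meson multi_member_split)
  then show ?thesis by simp
qed (simp add: not_in_iff)

lemma mon_has_partial_derivative:
  fixes z :: "'v \<Rightarrow> 'b::real_normed_field"
  shows "((\<lambda>t. mon m (z(v := t))) has_field_derivative of_nat (count m v) * mon (m - {#v#}) z) (at (z v))"
proof (induction m)
  case empty
  show ?case by simp
next
  case (add x m)
  show ?case
  proof (cases "x = v")
    case True
    have eq: "of_nat (count m v) * (z v * mon (m - {#v#}) z) = of_nat (count m v) * mon m z"
      by (rule mon_minus_single)
    have "((\<lambda>t. t * mon m (z(v := t))) has_field_derivative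
        1 * mon m (z(v := z v)) + of_nat (count m v) * mon (m - {#v#}) z * z v) (at (z v))"
      by (rule DERIV_mult[OF DERIV_ident add.IH])
    moreover have "1 * mon m (z(v := z v)) + of_nat (count m v) * mon (m - {#v#}) z * z v =
        of_nat (count (add_mset x m) v) * mon (add_mset x m - {#v#}) z"
      using eq True by (simp only: mult.commute mult.left_commute fun_upd_triv count_add_mset) (simp add: algebra_simps)
    ultimately show ?thesis using True by (simp add: fun_upd_same del: fun_upd_apply)
  next
    case False
    then have "add_mset x m - {#v#} = add_mset x (m - {#v#})" by (simp add: diff_add_mset_swap)
    then show ?thesis using False DERIV_cmult[OF add.IH, of "z x"]
      by (simp add: mult.left_commute del: fun_upd_apply) (simp add: mult_ac)
  qed
qed

lemma ev_has_partial_derivative: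
  "((\<lambda>t. ev ts (z(v := t))) has_field_derivative ev (dterms v ts) z) (at (z v))"
proof (induction ts)
  case (Cons am ts)
  obtain a m where am: "am = (a, m)" by force
  have "((\<lambda>t. a * mon m (z(v := t)) + ev ts (z(v := t))) has_field_derivative
      a * (of_nat (count m v) * mon (m - {#v#}) z) + ev (dterms v ts) z) (at (z v))"
    by (intro DERIV_add DERIV_cmult mon_has_partial_derivative Cons.IH)
  then show ?case by (simp add: am mult.assoc mult.left_commute del: fun_upd_apply)
qed simp

text \<open>
  Partial derivatives are defined analytically, hence do not depend on a presentation of the
  polynomial; they are therefore available for polynomials as functions, which is what the
  brackets and Lie transforms act on.
\<close>

definition pd :: "'v \<Rightarrow> (('v \<Rightarrow> complex) \<Rightarrow> complex) \<Rightarrow> ('v \<Rightarrow> complex) \<Rightarrow> complex" where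
  "pd v F z = deriv (\<lambda>t. F (z(v := t))) (z v)"

definition is_poly :: "(('v \<Rightarrow> complex) \<Rightarrow> complex) \<Rightarrow> bool" where
  "is_poly F \<longleftrightarrow> F \<in> range ev"

lemma pd_ev [simp]: "pd v (ev ts) = ev (dterms v ts)"
  by (rule ext) (auto simp: pd_def intro!: DERIV_imp_deriv ev_has_partial_derivative)

lemma is_poly_ev [simp, intro]: "is_poly (ev ts)"
  by (simp add: is_poly_def)

lemma is_polyE: assumes "is_poly F" obtains ts where "F = ev ts"
  using assms by (auto simp: is_poly_def)

lemma is_poly_has_pd:
  assumes "is_poly F"
  shows "((\<lambda>t. F (z(v := t))) has_field_derivative pd v F z) (at (z v))"
  using assms ev_has_partial_derivative by (auto elim!: is_polyE)

lemma pd_eqI: "((\<lambda>t. F (z(v := t))) has_field_derivative D) (at (z v)) \<Longrightarrow> pd v F z = D"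
  by (simp add: pd_def DERIV_imp_deriv)

lemma is_poly_pd [simp, intro]: "is_poly F \<Longrightarrow> is_poly (pd v F)"
  by (auto elim!: is_polyE)

lemma is_poly_add [simp, intro]: "is_poly F \<Longrightarrow> is_poly G \<Longrightarrow> is_poly (\<lambda>z. F z + G z)"
proof -
  assume "is_poly F" "is_poly G"
  then obtain ts us where "F = ev ts" "G = ev us" by (auto elim!: is_polyE)
  then have "(\<lambda>z. F z + G z) = ev (ts @ us)" by auto
  then show ?thesis by (simp only: is_poly_ev)
qed

lemma is_poly_mult [simp, intro]: "is_poly F \<Longrightarrow> is_poly G \<Longrightarrow> is_poly (\<lambda>z. F z * G z)"
proof -
  assume "is_poly F" "is_poly G"
  then obtain ts us where "F = ev ts" "G = ev us" by (auto elim!: is_polyE)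
  then have "(\<lambda>z. F z * G z) = ev (mult_terms ts us)" by auto
  then show ?thesis by (simp only: is_poly_ev)
qed

lemma is_poly_const [simp, intro]: "is_poly (\<lambda>z :: 'v \<Rightarrow> complex. c)"
proof -
  have "(\<lambda>z::'v \<Rightarrow> complex. c) = ev [(c, {#})]" by auto
  then show ?thesis by (simp only: is_poly_ev)
qed

lemma is_poly_var [simp, intro]: "is_poly (\<lambda>z. z v)"
proof -
  have "(\<lambda>z. z v) = ev [(1, {#v#})]" by auto
  then show ?thesis by (simp only: is_poly_ev)
qed

lemma is_poly_sum [simp, intro]: "(\<And>i. i \<in> I \<Longrightarrow> is_poly (F i)) \<Longrightarrow> is_poly (\<lambda>z. \<Sum>i\<in>I. F i z)"
  by (induction I rule: infinite_finite_induct) auto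

lemma pd_add: "is_poly F \<Longrightarrow> is_poly G \<Longrightarrow> pd v (\<lambda>z. F z + G z) z = pd v F z + pd v G z"
  by (intro pd_eqI DERIV_add is_poly_has_pd)

lemma pd_mult: "is_poly F \<Longrightarrow> is_poly G \<Longrightarrow> pd v (\<lambda>z. F z * G z) z = pd v F z * G z + F z * pd v G z"
  by (rule pd_eqI) (auto intro!: derivative_eq_intros is_poly_has_pd simp: algebra_simps)

lemma pd_const [simp]: "pd v (\<lambda>z. c) z = 0"
  by (intro pd_eqI) auto

lemma pd_cmult: "is_poly F \<Longrightarrow> pd v (\<lambda>z. c * F z) z = c * pd v F z"
  by (simp add: pd_mult)

lemma pd_sum: "(\<And>i. i \<in> I \<Longrightarrow> is_poly (F i)) \<Longrightarrow> pd v (\<lambda>z. \<Sum>i\<in>I. F i z) z = (\<Sum>i\<in>I. pd v (F i) z)"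
  by (induction I rule: infinite_finite_induct) (auto simp: pd_add)

lemma dterms_commute: "dterms v (dterms w ts) = dterms w (dterms v ts)"
proof -
  have "of_nat (count (m - {#w#}) v) * (of_nat (count m w) * a) =
      of_nat (count (m - {#v#}) w) * (of_nat (count m v) * (a::complex))" for a m
    by (cases "v = w") auto
  moreover have "m - {#w#} - {#v#} = m - {#v#} - {#w#}" for m
    by (rule diff_right_commute)
  ultimately show ?thesis by (simp only: dterms_def map_map) (simp only: o_def case_prod_unfold fst_conv snd_conv)
qed

lemma pd_commute: "is_poly F \<Longrightarrow> pd v (pd w F) = pd w (pd v F)"
  by (elim is_polyE) (simp add: dterms_commute)

text \<open>
  The variables \<open>(k, True)\<close> and \<open>(k, False)\<close> stand for \<open>u\<^sub>k\<close> and its conjugate, treated as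
  independent.
\<close>

fun bar :: "'a \<times> bool \<Rightarrow> 'a \<times> bool" where "bar (k, b) = (k, \<not> b)"
fun sg :: "'a \<times> bool \<Rightarrow> complex" where "sg (k, b) = (if b then 1 else - 1)"

lemma bar_bar [simp]: "bar (bar v) = v" by (cases v) auto
lemma sg_bar [simp]: "sg (bar v) = - sg v" by (cases v) auto
lemma fst_bar [simp]: "fst (bar v) = fst v" by (cases v) auto
lemma norm_sg [simp]: "cmod (sg v) = 1" by (cases v) auto

abbreviation vars :: "'a set \<Rightarrow> ('a \<times> bool) set" where "vars B \<equiv> B \<times> UNIV"

lemma sum_bar: "(\<Sum>v\<in>vars B. f (bar v)) = (\<Sum>v\<in>vars B. f v)"
  by (rule sum.reindex_bij_witness[of _ bar bar]) auto

text \<open>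
  In these variables the Hamiltonian equation with Hamiltonian \<open>H\<close> makes every polynomial \<open>F\<close>
  evolve with the derivative \<open>-2\<i>\<close> times the bracket of \<open>F\<close> and \<open>H\<close>, because the gradient of \<open>H\<close>
  is twice its derivative with respect to the conjugate variable.
\<close>

definition pb :: "'a set \<Rightarrow> (('a \<times> bool \<Rightarrow> complex) \<Rightarrow> complex) \<Rightarrow> (('a \<times> bool \<Rightarrow> complex) \<Rightarrow> complex) \<Rightarrow>
    ('a \<times> bool \<Rightarrow> complex) \<Rightarrow> complex" where
  "pb B F G z = (\<Sum>v\<in>vars B. sg v * pd v F z * pd (bar v) G z)"

lemma is_poly_pb [simp, intro]: "is_poly F \<Longrightarrow> is_poly G \<Longrightarrow> is_poly (pb B F G)"
  unfolding pb_def by auto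

lemma pb_antisym: "pb B F G z = - pb B G F z"
proof -
  have "pb B F G z = (\<Sum>v\<in>vars B. sg (bar v) * pd (bar v) F z * pd (bar (bar v)) G z)"
    unfolding pb_def by (rule sum_bar[symmetric])
  then show ?thesis unfolding pb_def by (simp add: sum_negf mult_ac)
qed

lemma pb_sum_left:
  "(\<And>i. i \<in> I \<Longrightarrow> is_poly (F i)) \<Longrightarrow> pb B (\<lambda>z. \<Sum>i\<in>I. F i z) G z = (\<Sum>i\<in>I. pb B (F i) G z)"
  unfolding pb_def
  by (subst sum.swap) (simp add: pd_sum sum_distrib_left sum_distrib_right)

lemma pb_sum_right:
  "(\<And>i. i \<in> I \<Longrightarrow> is_poly (G i)) \<Longrightarrow> pb B F (\<lambda>z. \<Sum>i\<in>I. G i z) z = (\<Sum>i\<in>I. pb B F (G i) z)"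
  unfolding pb_def
  by (subst sum.swap) (simp add: pd_sum sum_distrib_left sum_distrib_right)

lemma pb_cmult_left: "is_poly F \<Longrightarrow> pb B (\<lambda>z. c * F z) G z = c * pb B F G z"
  unfolding pb_def by (simp add: pd_cmult sum_distrib_left mult_ac)

lemma pb_cmult_right: "is_poly G \<Longrightarrow> pb B F (\<lambda>z. c * G z) z = c * pb B F G z"
  unfolding pb_def by (simp add: pd_cmult sum_distrib_left mult_ac)

lemma pb_zero [simp]: "pb B (\<lambda>z. 0) G z = 0" "pb B F (\<lambda>z. 0) z = 0"
  by (simp_all add: pb_def)

text \<open>
  The Leibniz rule splits an iterated bracket into two double sums of the same shape. The sum
  \<open>X F G H\<close>, in which \<open>F\<close> is differentiated twice, is symmetric in \<open>G\<close> and \<open>H\<close> because partial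
  derivatives commute; the Jacobi identity is then the cancellation of six such sums.
\<close>

lemma pb_pb_left:
  fixes B :: "'a set" and z
  assumes "is_poly F" "is_poly G"
  defines "X \<equiv> \<lambda>F G H. \<Sum>v\<in>vars B. \<Sum>w\<in>vars B. sg v * sg w * pd w (pd v F) z * pd (bar v) G z * pd (bar w) H z"
  shows "pb B (pb B F G) H z = X F G H - X G F H"
proof -
  have 1: "pd w (pb B F G) z =
      (\<Sum>v\<in>vars B. sg v * (pd w (pd v F) z * pd (bar v) G z + pd v F z * pd w (pd (bar v) G) z))" for w
    unfolding pb_def using assms(1,2)
    by (subst pd_sum) (auto simp: pd_mult pd_cmult mult.assoc)
  have "pb B (pb B F G) H z = (\<Sum>w\<in>vars B. \<Sum>v\<in>vars B.
      sg v * sg w * pd w (pd v F) z * pd (bar v) G z * pd (bar w) H z +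
      sg v * sg w * pd v F z * pd w (pd (bar v) G) z * pd (bar w) H z)"
    unfolding pb_def[of B "pb B F G"] 1 sum_distrib_left sum_distrib_right
    by (intro sum.cong) (auto simp: algebra_simps)
  also have "\<dots> = X F G H + (\<Sum>w\<in>vars B. \<Sum>v\<in>vars B. sg v * sg w * pd v F z * pd w (pd (bar v) G) z * pd (bar w) H z)"
    unfolding sum.distrib X_def by (subst sum.swap) simp
  also have "(\<Sum>w\<in>vars B. \<Sum>v\<in>vars B. sg v * sg w * pd v F z * pd w (pd (bar v) G) z * pd (bar w) H z) =
      (\<Sum>w\<in>vars B. \<Sum>v\<in>vars B. sg (bar v) * sg w * pd (bar v) F z * pd w (pd (bar (bar v)) G) z * pd (bar w) H z)"
    by (rule sum.cong[OF refl], rule sum_bar[of "\<lambda>v. sg v * sg _ * pd v F z * pd _ (pd (bar v) G) z * pd (bar _) H z", symmetric])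
  also have "\<dots> = - X G F H"
    unfolding X_def by (subst sum.swap) (simp add: sum_negf mult_ac)
  finally show ?thesis by simp
qed

lemma jacobi:
  assumes F: "is_poly F" and G: "is_poly G" and H: "is_poly H"
  shows "pb B (pb B F G) H z + pb B F (pb B H G) z = pb B (pb B F H) G z"
proof -
  define X where "X \<equiv> \<lambda>F G H. \<Sum>v\<in>vars B. \<Sum>w\<in>vars B.
      sg v * sg w * pd w (pd v F) z * pd (bar v) G z * pd (bar w) H z"
  have X: "X F G H = X F H G" if "is_poly F" for F G H
    unfolding X_def by (subst sum.swap) (simp add: pd_commute[OF that] mult_ac)
  have "pb B F (pb B H G) z = - pb B (pb B H G) F z" by (rule pb_antisym)
  also have "\<dots> = X G H F - X H G F"
    using pb_pb_left[OF H G, of B F z] by (simp add: X_def)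
  finally have "pb B F (pb B H G) z = X G H F - X H G F" .
  moreover have "pb B (pb B F G) H z = X F G H - X G F H" "pb B (pb B F H) G z = X F H G - X H F G"
    using pb_pb_left[OF F G] pb_pb_left[OF F H] by (auto simp: X_def)
  ultimately show ?thesis using X[OF F, of G H] X[OF G, of H F] X[OF H, of G F] by simp
qed

section \<open>Lie transforms\<close>

type_synonym 'a poly_fun = "('a \<times> bool \<Rightarrow> complex) \<Rightarrow> complex"

text \<open>
  The component of degree \<open>j\<close> of the Lie transform of a polynomial \<open>F\<close> of degree \<open>d\<close>, generated by
  the homogeneous polynomials \<open>S 3, S 4, \<dots>\<close> (the triangle algorithm of Deprit). The recursion says
  that \<open>T(\<lambda>) = \<Sum>\<^sub>j \<lambda>\<^bsup>j-d\<^esup> T\<^sub>j\<close> solves \<open>\<lambda> T' = {T, \<Sum>\<^sub>k \<lambda>\<^bsup>k-2\<^esup> S\<^sub>k}\<close> with \<open>T(0) = F\<close>. Thus \<open>T\<close> is the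
  transport of \<open>F\<close> by a time-dependent Hamiltonian flow, read degree by degree; the flow itself is
  not needed.
\<close>

function lie_transform :: "'a set \<Rightarrow> (nat \<Rightarrow> 'a poly_fun) \<Rightarrow> 'a poly_fun \<Rightarrow> nat \<Rightarrow> nat \<Rightarrow> 'a poly_fun" where
  "lie_transform B S F d j =
     (if j < d then (\<lambda>z. 0) else if j = d then F
      else (\<lambda>z. (\<Sum>i\<in>{d..<j}. pb B (lie_transform B S F d i) (S (j + 2 - i)) z) / of_nat (j - d)))"
  by pat_completeness auto
termination by (relation "Wellfounded.measure (\<lambda>(B, S, F, d, j). j)") auto

declare lie_transform.simps [simp del]

lemma lie_transform_below [simp]: "j < d \<Longrightarrow> lie_transform B S F d j = (\<lambda>z. 0)"
  by (simp add: lie_transform.simps)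

lemma lie_transform_start [simp]: "lie_transform B S F d d = F"
  by (simp add: lie_transform.simps)

text \<open>
  The component of degree \<open>j\<close> uses only generators of degree at most \<open>j + 2 - d\<close>. This is what
  makes it possible to choose the generators one degree after the other.
\<close>

lemma lie_transform_cong:
  assumes "\<And>i. 3 \<le> i \<Longrightarrow> i \<le> j + 2 - d \<Longrightarrow> S i = S' i"
  shows "lie_transform B S F d j = lie_transform B S' F d j"
  using assms
proof (induction j rule: less_induct)
  case (less j)
  have "pb B (lie_transform B S F d i) (S (j + 2 - i)) =
      pb B (lie_transform B S' F d i) (S' (j + 2 - i))" if "i \<in> {d..<j}" for i
  proof -
    have "S (j + 2 - i) = S' (j + 2 - i)"
      by (rule less.prems) (use that in auto)
    moreover have "lie_transform B S F d i = lie_transform B S' F d i"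
      using that by (intro less.IH less.prems) auto
    ultimately show ?thesis by simp
  qed
  then show ?case
    by (subst (1 2) lie_transform.simps) (auto intro!: sum.cong)
qed

lemma is_poly_divide [simp, intro]: "is_poly F \<Longrightarrow> is_poly (\<lambda>z. F z / c)"
  using is_poly_mult[of "\<lambda>_. inverse c" F] by (simp add: divide_inverse mult.commute)

lemma is_poly_lie_transform:
  assumes "is_poly F" "\<And>i. i \<ge> 3 \<Longrightarrow> i \<le> j + 2 - d \<Longrightarrow> is_poly (S i)"
  shows "is_poly (lie_transform B S F d j)"
  using assms(2)
proof (induction j rule: less_induct)
  case (less j)
  then have "is_poly (pb B (lie_transform B S F d i) (S (j + 2 - i)))" if "i \<in> {d..<j}" for i
    using that by (intro is_poly_pb) auto
  then show ?case using assms(1)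
    by (subst lie_transform.simps) (auto intro!: is_poly_divide is_poly_sum)
qed

text \<open>
  The recursion in a form that is uniform in \<open>l\<close>, because both sides vanish for \<open>l \<le> d\<close>. The
  factor \<open>l - d\<close> is additive under brackets of two transforms, so it acts on them as a derivation.
\<close>

lemma lie_transform_degree_derivation:
  assumes "d \<ge> 2" "l \<ge> 2"
  shows "(of_nat l - of_nat d) * lie_transform B S F d l z =
     (\<Sum>c\<in>{2..<l}. pb B (lie_transform B S F d c) (S (l + 2 - c)) z)"
proof (cases "l \<le> d")
  case True
  then have "(\<Sum>c\<in>{2..<l}. pb B (lie_transform B S F d c) (S (l + 2 - c)) z) = 0"
    by (intro sum.neutral) auto
  then show ?thesis using True by (cases "l = d") auto
next
  case False
  have "(\<Sum>c\<in>{2..<l}. pb B (lie_transform B S F d c) (S (l + 2 - c)) z) =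
      (\<Sum>c\<in>{d..<l}. pb B (lie_transform B S F d c) (S (l + 2 - c)) z)"
    using assms by (intro sum.mono_neutral_right) auto
  moreover have "(of_nat l - of_nat d :: complex) = of_nat (l - d)" "(of_nat (l - d) :: complex) \<noteq> 0"
    using False by (auto simp: of_nat_diff)
  ultimately show ?thesis using False by (subst lie_transform.simps) simp
qed

text \<open>
  The sum is the component of degree \<open>m\<close> of the bracket of the transforms of \<open>J\<close> and \<open>Q\<close>. Call it
  \<open>X\<^sub>m\<close>. By the Leibniz rule and the Jacobi identity the components of the bracket obey the
  recursion of a Lie transform, \<open>(m - d) X\<^sub>m = \<Sum>\<^sub>k {X\<^sub>k, S\<^bsub>m+2-k\<^esub>}\<close> with \<open>k < m\<close>, and \<open>X\<^sub>d\<close> is the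
  bracket of \<open>J\<close> and \<open>Q\<close>. So all components vanish if that bracket does.
\<close>

lemma lie_transform_preserves_commutation:
  assumes J: "is_poly J" and Q: "is_poly Q" and S: "\<And>i. i \<ge> 3 \<Longrightarrow> i \<le> m \<Longrightarrow> is_poly (S i)"
    and comm: "\<And>z. pb B J Q z = 0" and "d \<ge> 2" "m \<ge> 2"
  shows "(\<Sum>i\<in>{2..m}. pb B (lie_transform B S J 2 i) (lie_transform B S Q d (m + 2 - i)) z) = 0"
  using S \<open>m \<ge> 2\<close>
proof (induction m arbitrary: z rule: less_induct)
  case (less m)
  define e where "e = lie_transform B S J 2"
  define t where "t = lie_transform B S Q d"
  define X where "X = (\<lambda>m z. \<Sum>i\<in>{2..m}. pb B (e i) (t (m + 2 - i)) z)"
  have poly: "is_poly (e i)" "is_poly (t i)" if "i \<le> m" for i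
    unfolding e_def t_def using J Q less.prems(1) that \<open>d \<ge> 2\<close> by (auto intro!: is_poly_lie_transform)
  have polyS: "is_poly (S i)" if "i \<ge> 3" "i \<le> m" for i using less.prems that by auto
  consider "m < d" | "m = d" | "m > d" by linarith
  then show ?case
  proof cases
    case 1
    then show ?thesis by (intro sum.neutral) auto
  next
    case 2
    have "t (m + 2 - i) = (\<lambda>z. 0)" if "i \<in> {2..m} - {2}" for i
      unfolding t_def by (rule lie_transform_below) (use that 2 in auto)
    then have "(\<Sum>i\<in>{2..m}. pb B (e i) (t (m + 2 - i)) z) = (\<Sum>i\<in>{2}. pb B (e i) (t (m + 2 - i)) z)"
      using less.prems 2 by (intro sum.mono_neutral_right) auto
    then show ?thesis using comm 2 by (simp add: e_def t_def)
  next
    case 3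
    have idx: "Suc (Suc (a + b - 2)) - a = b" "m + 4 = Suc (Suc (Suc (Suc m)))"
      if "2 \<le> a" "2 \<le> b" for a b :: nat using that by auto
    \<comment> \<open>The index set of both double sums: the generator in the summand of \<open>(a, l)\<close> has degree
      \<open>m + 4 - a - l\<close>, which is at least \<open>3\<close>.\<close>
    define P where "P = {(a, l). 2 \<le> a \<and> 2 \<le> l \<and> a + l \<le> m + 1}"
    have "finite P" by (rule finite_subset[of _ "{..m+1} \<times> {..m+1}"]) (auto simp: P_def)
    have IH: "X k w = 0" if "2 \<le> k" "k < m" for k w
      unfolding X_def e_def t_def using less.IH[of k w] that less.prems by auto
    have "(of_nat m - of_nat d) * X m z = (\<Sum>i\<in>{2..m}.
        pb B (\<lambda>z. (of_nat i - of_nat 2) * e i z) (t (m + 2 - i)) z +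
        pb B (e i) (\<lambda>z. (of_nat (m + 2 - i) - of_nat d) * t (m + 2 - i) z) z)"
      unfolding X_def sum_distrib_left
    proof (intro sum.cong refl)
      fix i assume i: "i \<in> {2..m}"
      have "is_poly (t (m + 2 - i))" by (rule poly) (use i in auto)
      then show "(of_nat m - of_nat d) * pb B (e i) (t (m + 2 - i)) z =
          pb B (\<lambda>z. (of_nat i - of_nat 2) * e i z) (t (m + 2 - i)) z +
          pb B (e i) (\<lambda>z. (of_nat (m + 2 - i) - of_nat d) * t (m + 2 - i) z) z"
        using i by (simp add: pb_cmult_left pb_cmult_right poly del: of_nat_add)
           (simp add: of_nat_diff algebra_simps)
    qed
    also have "\<dots> = (\<Sum>i\<in>{2..m}. \<Sum>a\<in>{2..<i}. pb B (pb B (e a) (S (i + 2 - a))) (t (m + 2 - i)) z) +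
        (\<Sum>i\<in>{2..m}. \<Sum>c\<in>{2..<m + 2 - i}. pb B (e i) (pb B (t c) (S (m + 2 - i + 2 - c))) z)"
      unfolding sum.distrib
    proof (intro arg_cong2[of _ _ _ _ "(+)"] sum.cong refl)
      fix i assume i: "i \<in> {2..m}"
      have "(\<lambda>z. (of_nat i - of_nat 2) * e i z) = (\<lambda>z. \<Sum>a\<in>{2..<i}. pb B (e a) (S (i + 2 - a)) z)"
        unfolding e_def using i by (intro ext lie_transform_degree_derivation) auto
      then show "pb B (\<lambda>z. (of_nat i - of_nat 2) * e i z) (t (m + 2 - i)) z =
          (\<Sum>a\<in>{2..<i}. pb B (pb B (e a) (S (i + 2 - a))) (t (m + 2 - i)) z)"
        using i by (simp only:, subst pb_sum_left) (auto intro!: is_poly_pb poly polyS)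
      have "(\<lambda>z. (of_nat (m + 2 - i) - of_nat d) * t (m + 2 - i) z) =
          (\<lambda>z. \<Sum>c\<in>{2..<m + 2 - i}. pb B (t c) (S (m + 2 - i + 2 - c)) z)"
        unfolding t_def using i \<open>d \<ge> 2\<close> by (intro ext lie_transform_degree_derivation) auto
      then show "pb B (e i) (\<lambda>z. (of_nat (m + 2 - i) - of_nat d) * t (m + 2 - i) z) z =
          (\<Sum>c\<in>{2..<m + 2 - i}. pb B (e i) (pb B (t c) (S (m + 2 - i + 2 - c))) z)"
        using i by (simp only:, subst pb_sum_right) (auto intro!: is_poly_pb poly polyS)
    qed
    also have "(\<Sum>i\<in>{2..m}. \<Sum>a\<in>{2..<i}. pb B (pb B (e a) (S (i + 2 - a))) (t (m + 2 - i)) z) =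
        (\<Sum>(a, l)\<in>P. pb B (pb B (e a) (S (m + 4 - a - l))) (t l) z)"
      by (subst sum.Sigma, simp, simp, rule sum.reindex_bij_witness[of _
            "\<lambda>(a, l). (m + 2 - l, a)" "\<lambda>(i, a). (a, m + 2 - i)"]) (auto simp: P_def)
    also have "(\<Sum>i\<in>{2..m}. \<Sum>c\<in>{2..<m + 2 - i}. pb B (e i) (pb B (t c) (S (m + 2 - i + 2 - c))) z) =
        (\<Sum>(a, l)\<in>P. pb B (e a) (pb B (t l) (S (m + 2 - a + 2 - l))) z)"
      by (subst sum.Sigma, simp, simp, rule sum.cong) (auto simp: P_def)
    also have "(\<Sum>(a, l)\<in>P. pb B (pb B (e a) (S (m + 4 - a - l))) (t l) z) +
        (\<Sum>(a, l)\<in>P. pb B (e a) (pb B (t l) (S (m + 2 - a + 2 - l))) z) =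
        (\<Sum>(a, l)\<in>P. pb B (pb B (e a) (t l)) (S (m + 4 - a - l)) z)"
      unfolding sum.distrib[symmetric]
    proof (intro sum.cong refl, clarify)
      fix a l assume al: "(a, l) \<in> P"
      then have "m + 2 - a + 2 - l = m + 4 - a - l" by (auto simp: P_def)
      then show "pb B (pb B (e a) (S (m + 4 - a - l))) (t l) z + pb B (e a) (pb B (t l) (S (m + 2 - a + 2 - l))) z =
          pb B (pb B (e a) (t l)) (S (m + 4 - a - l)) z"
        using al by (simp only:, intro jacobi) (auto simp: P_def intro!: poly polyS)
    qed
    also have "\<dots> = (\<Sum>k\<in>{2..<m}. \<Sum>i\<in>{2..k}. pb B (pb B (e i) (t (k + 2 - i))) (S (m + 2 - k)) z)"
      by (subst sum.Sigma, simp, simp, rule sum.reindex_bij_witness[of _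
            "\<lambda>(k, i). (i, k + 2 - i)" "\<lambda>(a, l). (a + l - 2, a)"]) (auto simp: P_def idx)
    also have "\<dots> = (\<Sum>k\<in>{2..<m}. pb B (X k) (S (m + 2 - k)) z)"
      unfolding X_def by (intro sum.cong refl, subst pb_sum_left) (auto intro!: poly)
    also have "\<dots> = 0"
    proof (intro sum.neutral ballI)
      fix k assume "k \<in> {2..<m}"
      then have "X k = (\<lambda>z. 0)" using IH by auto
      then show "pb B (X k) (S (m + 2 - k)) z = 0" by simp
    qed
    finally have "X m z = 0" using 3 by simp
    then show ?thesis by (simp add: X_def e_def t_def)
  qed
qed

section \<open>Polynomials with a bounded vector field\<close>

text \<open>
  For \<open>W k = \<langle>k\<rangle>\<^sup>s\<close> these are the norms of \<open>h\<^sup>s\<close> and of its dual \<open>h\<^bsup>-s\<^esup>\<close>, on the variables attached to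
  a finite set of modes.
\<close>

definition wnorm :: "('a \<Rightarrow> real) \<Rightarrow> 'a set \<Rightarrow> ('a \<times> bool \<Rightarrow> real) \<Rightarrow> real" where
  "wnorm W B z = L2_set (\<lambda>v. W (fst v) * z v) (vars B)"

definition dnorm :: "('a \<Rightarrow> real) \<Rightarrow> 'a set \<Rightarrow> ('a \<times> bool \<Rightarrow> real) \<Rightarrow> real" where
  "dnorm W B h = L2_set (\<lambda>v. h v / W (fst v)) (vars B)"

definition homog :: "'a set \<Rightarrow> nat \<Rightarrow> ('a \<times> bool) poly_terms \<Rightarrow> bool" where
  "homog B j ts \<longleftrightarrow> (\<forall>(a, m)\<in>set ts. a \<noteq> 0 \<longrightarrow> size m = j \<and> set_mset m \<subseteq> vars B)"

text \<open>
  By duality the inequality bounds the gradient of the majorant in the norm \<open>wnorm\<close>. Testing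
  against \<open>h\<close> keeps the condition linear in the polynomial and is the form in which the
  multilinear estimate provides it.
\<close>

definition tame :: "('a \<Rightarrow> real) \<Rightarrow> 'a set \<Rightarrow> nat \<Rightarrow> real \<Rightarrow> ('a \<times> bool) poly_terms \<Rightarrow> bool" where
  "tame W B j C ts \<longleftrightarrow> homog B j ts \<and>
     (\<forall>R h z. R > 0 \<longrightarrow> (\<forall>v. 0 \<le> h v) \<longrightarrow> (\<forall>v. 0 \<le> z v) \<longrightarrow> wnorm W B z \<le> R \<longrightarrow>
        (\<Sum>v\<in>vars B. h v * maj (dterms v ts) z) \<le> C * R ^ (j - 1) * dnorm W B h)"

definition adm :: "('a \<Rightarrow> real) \<Rightarrow> 'a set \<Rightarrow> nat \<Rightarrow> real \<Rightarrow> 'a poly_fun \<Rightarrow> bool" where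
  "adm W B j C F \<longleftrightarrow> (\<exists>ts. F = ev ts \<and> tame W B j C ts)"

lemma adm_is_poly: "adm W B j C F \<Longrightarrow> is_poly F"
  by (auto simp: adm_def)

lemma wnorm_nonneg [simp]: "0 \<le> wnorm W B z" and dnorm_nonneg [simp]: "0 \<le> dnorm W B z"
  by (simp_all add: wnorm_def dnorm_def)

lemma wnorm_triangle: "wnorm W B (\<lambda>v. z v + y v) \<le> wnorm W B z + wnorm W B y"
  unfolding wnorm_def by (simp add: distrib_left L2_set_triangle_ineq)

lemma wnorm_scale: "0 \<le> t \<Longrightarrow> wnorm W B (\<lambda>v. t * z v) = t * wnorm W B z"
  unfolding wnorm_def by (simp add: L2_set_right_distrib mult_ac)

lemma wnorm_bar: "wnorm W B (\<lambda>v. z (bar v)) = wnorm W B z"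
proof -
  have "(\<Sum>v\<in>vars B. (W (fst v) * z (bar v))\<^sup>2) = (\<Sum>v\<in>vars B. (W (fst (bar v)) * z (bar v))\<^sup>2)"
    by (simp only: fst_bar)
  also have "\<dots> = (\<Sum>v\<in>vars B. (W (fst v) * z v)\<^sup>2)"
    by (rule sum_bar)
  finally show ?thesis unfolding wnorm_def L2_set_def by simp
qed

lemma maj_has_partial_derivative:
  "((\<lambda>t. maj ts (z(v := t))) has_field_derivative maj (dterms v ts) z) (at (z v))"
proof (induction ts)
  case (Cons am ts)
  obtain a m where am: "am = (a, m)" by force
  have "((\<lambda>t. cmod a * mon m (z(v := t)) + maj ts (z(v := t))) has_field_derivative
      cmod a * (of_nat (count m v) * mon (m - {#v#}) z) + maj (dterms v ts) z) (at (z v))"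
    by (intro DERIV_add DERIV_cmult mon_has_partial_derivative Cons.IH)
  then show ?case by (simp add: am norm_mult mult.assoc mult.left_commute del: fun_upd_apply)
qed simp

lemma maj_dterms_mult:
  "maj (dterms v (mult_terms ts us)) z = maj (dterms v ts) z * maj us z + maj ts z * maj (dterms v us) z"
proof -
  have "((\<lambda>t. maj ts (z(v := t)) * maj us (z(v := t))) has_field_derivative
      maj (dterms v ts) z * maj us (z(v := z v)) + maj (dterms v us) z * maj ts (z(v := z v))) (at (z v))"
    by (rule DERIV_mult[OF maj_has_partial_derivative maj_has_partial_derivative])
  moreover have "((\<lambda>t. maj ts (z(v := t)) * maj us (z(v := t))) has_field_derivative
      maj (dterms v (mult_terms ts us)) z) (at (z v))"
    using maj_has_partial_derivative[of "mult_terms ts us"] by simp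
  ultimately show ?thesis using DERIV_unique by (fastforce simp: mult.commute)
qed

lemma sum_count_eq_sum_mset:
  fixes f :: "'v \<Rightarrow> 'b::comm_semiring_1"
  assumes "finite V" "set_mset m \<subseteq> V"
  shows "(\<Sum>v\<in>V. of_nat (count m v) * f v) = (\<Sum>v\<in>#m. f v)"
  using assms(2)
proof (induction m)
  case (add x m)
  have "(\<Sum>v\<in>V. of_nat (count (add_mset x m) v) * f v) =
      (\<Sum>v\<in>V. (if v = x then f v else 0) + of_nat (count m v) * f v)"
    by (intro sum.cong) (auto simp: algebra_simps)
  also have "\<dots> = f x + (\<Sum>v\<in>#m. f v)"
    using add assms(1) by (simp add: sum.distrib sum.delta)
  finally show ?case by simp
qed simp

text \<open>
  With nonnegative data, a product dominates its Taylor polynomial of degree one. This replaces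
  Cauchy estimates: derivatives of a majorant are bounded by values of the majorant.
\<close>

lemma mon_plus_ge:
  assumes z: "\<And>v. 0 \<le> (z v :: real)" and h: "\<And>v. 0 \<le> h v"
  shows "mon m z + (\<Sum>v\<in>#m. h v * mon (m - {#v#}) z) \<le> mon m (\<lambda>v. z v + h v)"
proof (induction m)
  case (add x m)
  have *: "(\<Sum>v\<in>#m. h v * mon (add_mset x m - {#v#}) z) = z x * (\<Sum>v\<in>#m. h v * mon (m - {#v#}) z)"
    unfolding sum_mset_distrib_left
    by (intro arg_cong[of _ _ sum_mset] image_mset_cong) (auto simp: diff_add_mset_swap dest!: multi_member_split)
  have "mon m z \<le> mon m (\<lambda>v. z v + h v)" by (intro mon_mono) (auto simp: z h)
  then have "z x * (mon m z + (\<Sum>v\<in>#m. h v * mon (m - {#v#}) z)) + h x * mon m z \<le>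
      z x * mon m (\<lambda>v. z v + h v) + h x * mon m (\<lambda>v. z v + h v)"
    by (intro add_mono mult_left_mono add.IH z h)
  then show ?case using * by (simp add: algebra_simps)
qed simp

lemma sum_dmon:
  fixes h :: "'v \<Rightarrow> real"
  assumes "finite V" "set_mset m \<subseteq> V"
  shows "(\<Sum>v\<in>V. h v * (of_nat (count m v) * mon (m - {#v#}) z)) = (\<Sum>v\<in>#m. h v * mon (m - {#v#}) z)"
  using sum_count_eq_sum_mset[OF assms, of "\<lambda>v. h v * mon (m - {#v#}) z"] by (simp add: mult_ac)

lemma maj_plus_ge:
  assumes z: "\<And>v. 0 \<le> z v" and h: "\<And>v. 0 \<le> h v" and "finite V"
    and V: "\<And>a m. (a, m) \<in> set ts \<Longrightarrow> a \<noteq> 0 \<Longrightarrow> set_mset m \<subseteq> V"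
  shows "(\<Sum>v\<in>V. h v * maj (dterms v ts) z) \<le> maj ts (\<lambda>v. z v + h v)"
  using V
proof (induction ts)
  case (Cons am ts)
  obtain a m where am: "am = (a, m)" by force
  have "(\<Sum>v\<in>#m. h v * mon (m - {#v#}) z) \<le> mon m (\<lambda>v. z v + h v)"
    using mon_plus_ge[of z h m] mon_nonneg[of z m] z h by fastforce
  then have "cmod a * (\<Sum>v\<in>V. h v * (of_nat (count m v) * mon (m - {#v#}) z)) \<le> cmod a * mon m (\<lambda>v. z v + h v)"
    using Cons.prems[of a m] am by (cases "a = 0") (auto simp: sum_dmon[OF \<open>finite V\<close>] intro!: mult_left_mono)
  moreover have "(\<Sum>v\<in>V. h v * maj (dterms v ts) z) \<le> maj ts (\<lambda>v. z v + h v)"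
    using Cons by auto
  ultimately show ?case
    by (simp add: am norm_mult sum_distrib_left distrib_left sum.distrib mult_ac)
qed simp

lemma euler_maj:
  assumes "finite B" "homog B j ts"
  shows "(\<Sum>v\<in>vars B. z v * maj (dterms v ts) z) = real j * maj ts z"
  using assms(2)
proof (induction ts)
  case (Cons am ts)
  obtain a m where am: "am = (a, m)" by force
  have m: "a \<noteq> 0 \<Longrightarrow> size m = j" "a \<noteq> 0 \<Longrightarrow> set_mset m \<subseteq> vars B" and "homog B j ts"
    using Cons.prems by (auto simp: homog_def am)
  have "cmod a * (\<Sum>v\<in>vars B. z v * (of_nat (count m v) * mon (m - {#v#}) z)) =
      cmod a * (\<Sum>v\<in>vars B. of_nat (count m v) * mon m z)"
    by (intro arg_cong[of _ _ "(*) (cmod a)"] sum.cong refl, subst mon_minus_single[symmetric]) (simp add: mult_ac)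
  also have "\<dots> = cmod a * (real j * mon m z)"
  proof (cases "a = 0")
    case False
    then have "(\<Sum>v\<in>vars B. real (count m v) * mon m z) = real j * mon m z"
      using sum_count_eq_sum_mset[of "vars B" m "\<lambda>_. mon m z"] m assms(1) by simp
    then show ?thesis by simp
  qed simp
  finally have *: "cmod a * (\<Sum>v\<in>vars B. z v * (of_nat (count m v) * mon (m - {#v#}) z)) = cmod a * (real j * mon m z)" .
  have "(\<Sum>v\<in>vars B. z v * maj (dterms v (am # ts)) z) =
      cmod a * (\<Sum>v\<in>vars B. z v * (of_nat (count m v) * mon (m - {#v#}) z)) +
      (\<Sum>v\<in>vars B. z v * maj (dterms v ts) z)"
    by (simp add: am norm_mult sum_distrib_left distrib_left sum.distrib mult_ac)
  then show ?case using Cons.IH \<open>homog B j ts\<close> * by (simp add: am algebra_simps)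
qed simp

lemma homog_dterms:
  "homog B j ts \<Longrightarrow> (a, m) \<in> set (dterms v ts) \<Longrightarrow> a \<noteq> 0 \<Longrightarrow> set_mset m \<subseteq> vars B"
  by (fastforce simp: homog_def dterms_def dest: in_diffD)

lemma dnorm_pairing_wnorm:
  assumes "\<And>k. W k \<ge> 1"
  shows "dnorm W B (\<lambda>v. (W (fst v))\<^sup>2 * g v) = wnorm W B g"
  unfolding wnorm_def dnorm_def
proof (intro L2_set_cong refl)
  fix v :: "'a \<times> bool"
  have "W (fst v) \<noteq> 0" using assms[of "fst v"] by auto
  then show "(W (fst v))\<^sup>2 * g v / W (fst v) = W (fst v) * g v"
    by (simp add: power2_eq_square)
qed

text \<open>
  The dual form of \<open>tame\<close>, obtained by testing with \<open>h = W\<^sup>2 g\<close> for the gradient \<open>g\<close>.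
\<close>

lemma tame_gradient:
  assumes W: "\<And>k. W k \<ge> 1" and "tame W B j C ts" "R > 0" "\<And>v. 0 \<le> z v" "wnorm W B z \<le> R"
    and "0 \<le> C"
  shows "wnorm W B (\<lambda>v. maj (dterms v ts) z) \<le> C * R ^ (j - 1)"
proof -
  define g where "g = (\<lambda>v. maj (dterms v ts) z)"
  have g: "0 \<le> g v" for v using assms(4) by (auto simp: g_def intro!: maj_nonneg)
  have "(wnorm W B g)\<^sup>2 = (\<Sum>v\<in>vars B. ((W (fst v))\<^sup>2 * g v) * g v)"
    unfolding wnorm_def L2_set_def by (simp add: sum_nonneg) (simp add: power2_eq_square mult_ac)
  also have "\<dots> \<le> C * R ^ (j - 1) * dnorm W B (\<lambda>v. (W (fst v))\<^sup>2 * g v)"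
    using assms g unfolding g_def tame_def by auto
  also have "dnorm W B (\<lambda>v. (W (fst v))\<^sup>2 * g v) = wnorm W B g"
    by (rule dnorm_pairing_wnorm[where W = W, OF W])
  finally have "wnorm W B g * wnorm W B g \<le> C * R ^ (j - 1) * wnorm W B g"
    by (simp only: power2_eq_square)
  then show ?thesis using assms(3) \<open>0 \<le> C\<close> wnorm_nonneg[of W B g] unfolding g_def[symmetric]
    by (cases "wnorm W B g = 0") (auto simp: mult_le_cancel_right)
qed

text \<open>
  The second derivative in a direction \<open>g\<close> is bounded by the first derivative at the larger point
  \<open>z + c g\<close>, divided by \<open>c\<close>. The choice \<open>c = R / G\<close> only doubles the radius, which costs the
  factor \<open>2\<^bsup>j-1\<^esup>\<close>.
\<close>

lemma tame_second_derivative: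
  assumes W: "\<And>k. W k \<ge> 1" and "finite B" and t: "tame W B j C ts" and "R > 0"
    and z: "\<And>v. 0 \<le> z v" "wnorm W B z \<le> R" and g: "\<And>v. 0 \<le> g v" "wnorm W B g \<le> G"
    and h: "\<And>v. 0 \<le> h v" and "j \<ge> 2"
  shows "(\<Sum>w\<in>vars B. h w * (\<Sum>v\<in>vars B. g v * maj (dterms w (dterms v ts)) z)) \<le>
     C * G * 2 ^ (j - 1) * R ^ (j - 2) * dnorm W B h"
proof (cases "G = 0")
  case True
  then have "wnorm W B g = 0" using g wnorm_nonneg[of W B g] by linarith
  then have "g v = 0" if "v \<in> vars B" for v
    using W[of "fst v"] that \<open>finite B\<close> unfolding wnorm_def by (subst (asm) L2_set_eq_0_iff) force+
  then have "(\<Sum>w\<in>vars B. h w * (\<Sum>v\<in>vars B. g v * maj (dterms w (dterms v ts)) z)) = 0"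
    by (intro sum.neutral ballI) simp
  then show ?thesis using True by simp
next
  case False
  then have "G > 0" using g wnorm_nonneg[of W B g] by linarith
  define c where "c = R / G"
  have "c > 0" using \<open>R > 0\<close> \<open>G > 0\<close> by (simp add: c_def)
  define y where "y = (\<lambda>v. z v + c * g v)"
  have "wnorm W B y \<le> R + c * G"
    unfolding y_def using z g \<open>c > 0\<close>
    by (intro order_trans[OF wnorm_triangle] add_mono) (auto simp: wnorm_scale)
  then have y: "wnorm W B y \<le> 2 * R" "\<And>v. 0 \<le> y v"
    using \<open>G > 0\<close> z g \<open>c > 0\<close> by (simp add: c_def, simp add: y_def)
  have "c * (\<Sum>w\<in>vars B. h w * (\<Sum>v\<in>vars B. g v * maj (dterms w (dterms v ts)) z)) =
      (\<Sum>w\<in>vars B. h w * (\<Sum>v\<in>vars B. (c * g v) * maj (dterms v (dterms w ts)) z))"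
    by (simp add: sum_distrib_left mult_ac dterms_commute)
  also have "\<dots> \<le> (\<Sum>w\<in>vars B. h w * maj (dterms w ts) y)"
    unfolding y_def using z g h \<open>c > 0\<close> t \<open>finite B\<close>
    by (intro sum_mono mult_left_mono maj_plus_ge) (auto simp: tame_def dest: homog_dterms)
  also have "\<dots> \<le> C * (2 * R) ^ (j - 1) * dnorm W B h"
  proof -
    have "2 * R > 0" using \<open>R > 0\<close> by simp
    with t y h show ?thesis unfolding tame_def by blast
  qed
  finally have *: "c * (\<Sum>w\<in>vars B. h w * (\<Sum>v\<in>vars B. g v * maj (dterms w (dterms v ts)) z)) \<le>
      C * (2 * R) ^ (j - 1) * dnorm W B h" .
  have "j - 1 = Suc (j - 2)" using \<open>j \<ge> 2\<close> by simp
  then have "R ^ (j - 1) = R * R ^ (j - 2)" by (simp only: power_Suc)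
  then have "C * (2 * R) ^ (j - 1) * dnorm W B h = c * (C * G * 2 ^ (j - 1) * R ^ (j - 2) * dnorm W B h)"
    using \<open>G > 0\<close> by (simp add: power_mult_distrib c_def)
  with * have "c * (\<Sum>w\<in>vars B. h w * (\<Sum>v\<in>vars B. g v * maj (dterms w (dterms v ts)) z)) \<le>
      c * (C * G * 2 ^ (j - 1) * R ^ (j - 2) * dnorm W B h)"
    by (simp only:)
  then show ?thesis using \<open>c > 0\<close> by (simp only: mult_le_cancel_left_pos)
qed

lemma adm_mono: assumes "adm W B j C F" "C \<le> D" shows "adm W B j D F"
proof -
  have "C * R ^ (j - 1) * dnorm W B h \<le> D * R ^ (j - 1) * dnorm W B h" if "R > 0" for R h
    using that assms(2) by (intro mult_right_mono) auto
  then have "tame W B j D ts" if "tame W B j C ts" for ts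
    using that unfolding tame_def by (blast intro: order_trans)
  then show ?thesis using assms(1) unfolding adm_def by blast
qed

lemma adm_zero: "adm W B j 0 (\<lambda>z. 0)"
proof -
  have "(\<lambda>z. 0) = ev []" by auto
  moreover have "tame W B j 0 []" by (auto simp: tame_def homog_def)
  ultimately show ?thesis unfolding adm_def by blast
qed

lemma dterms_scale: "dterms v (scale_terms c ts) = scale_terms c (dterms v ts)"
  by (auto simp: dterms_def scale_terms_def)

lemma adm_add: assumes "adm W B j C F" "adm W B j D G" shows "adm W B j (C + D) (\<lambda>z. F z + G z)"
proof -
  obtain ts us where *: "F = ev ts" "tame W B j C ts" "G = ev us" "tame W B j D us"
    using assms by (auto simp: adm_def)
  have "(\<lambda>z. F z + G z) = ev (ts @ us)" using * by auto
  moreover have "tame W B j (C + D) (ts @ us)"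
    using *(2,4) unfolding tame_def homog_def
    by (auto simp: distrib_left distrib_right sum.distrib intro!: add_mono)
  ultimately show ?thesis unfolding adm_def by blast
qed

lemma adm_sum:
  assumes "\<And>i. i \<in> I \<Longrightarrow> adm W B j (C i) (F i)"
  shows "adm W B j (\<Sum>i\<in>I. C i) (\<lambda>z. \<Sum>i\<in>I. F i z)"
  using assms
proof (induction I rule: infinite_finite_induct)
  case (insert x I)
  then show ?case using adm_add[of W B j "C x" "F x" "\<Sum>i\<in>I. C i" "\<lambda>z. \<Sum>i\<in>I. F i z"] by simp
qed (auto intro: adm_zero)

text \<open>
  Solving a homological equation and projecting on monomials of weight zero are operations of this
  kind.
\<close>

definition multiplier :: "('v multiset \<Rightarrow> complex) \<Rightarrow> 'v poly_terms \<Rightarrow> 'v poly_terms" where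
  "multiplier \<mu> ts = map (\<lambda>(a, m). (\<mu> m * a, m)) ts"

lemma maj_dterms_multiplier_le:
  assumes "\<And>a m. (a, m) \<in> set ts \<Longrightarrow> a \<noteq> 0 \<Longrightarrow> cmod (\<mu> m) \<le> A" "\<And>v. 0 \<le> z v"
  shows "maj (dterms v (multiplier \<mu> ts)) z \<le> A * maj (dterms v ts) z"
  using assms(1)
proof (induction ts)
  case (Cons am ts)
  obtain a m where am: "am = (a, m)" by force
  let ?d = "real (count m v) * cmod a * mon (m - {#v#}) z"
  have "cmod (\<mu> m) * ?d \<le> A * ?d"
    using Cons.prems am assms(2)
    by (cases "a = 0") (auto intro!: mult_right_mono mult_nonneg_nonneg mon_nonneg)
  moreover have "maj (dterms v (multiplier \<mu> ts)) z \<le> A * maj (dterms v ts) z"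
    using Cons by auto
  moreover have "maj (dterms v (multiplier \<mu> (am # ts))) z = cmod (\<mu> m) * ?d + maj (dterms v (multiplier \<mu> ts)) z"
    by (simp add: multiplier_def am norm_mult)
  moreover have "maj (dterms v (am # ts)) z = ?d + maj (dterms v ts) z"
    by (simp add: am norm_mult)
  ultimately show ?case by (simp only: distrib_left)
qed (simp add: multiplier_def)

lemma tame_multiplier:
  assumes "tame W B j C ts" "\<And>a m. (a, m) \<in> set ts \<Longrightarrow> a \<noteq> 0 \<Longrightarrow> cmod (\<mu> m) \<le> A" "0 \<le> A"
  shows "tame W B j (A * C) (multiplier \<mu> ts)"
proof -
  have "homog B j (multiplier \<mu> ts)"
    using assms(1) by (auto simp: tame_def homog_def multiplier_def)
  moreover have "(\<Sum>v\<in>vars B. h v * maj (dterms v (multiplier \<mu> ts)) z) \<le> A * C * R ^ (j - 1) * dnorm W B h"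
    if "R > 0" "\<forall>v. 0 \<le> h v" "\<forall>v. 0 \<le> z v" "wnorm W B z \<le> R" for R h z
  proof -
    have "(\<Sum>v\<in>vars B. h v * maj (dterms v (multiplier \<mu> ts)) z) \<le>
        (\<Sum>v\<in>vars B. h v * (A * maj (dterms v ts) z))"
      using that assms(2) by (intro sum_mono mult_left_mono maj_dterms_multiplier_le) auto
    also have "\<dots> = A * (\<Sum>v\<in>vars B. h v * maj (dterms v ts) z)"
      by (simp add: sum_distrib_left mult_ac)
    also have "\<dots> \<le> A * (C * R ^ (j - 1) * dnorm W B h)"
      using that assms unfolding tame_def by (intro mult_left_mono) auto
    finally show ?thesis by (simp add: mult_ac)
  qed
  ultimately show ?thesis unfolding tame_def by blast
qed

lemma adm_cmult: assumes "adm W B j C F" shows "adm W B j (cmod c * C) (\<lambda>z. c * F z)"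
proof -
  obtain ts where *: "F = ev ts" "tame W B j C ts" using assms by (auto simp: adm_def)
  have "multiplier (\<lambda>_. c) ts = scale_terms c ts" by (simp add: multiplier_def scale_terms_def)
  then have "(\<lambda>z. c * F z) = ev (multiplier (\<lambda>_. c) ts)" using * by auto
  moreover have "tame W B j (cmod c * C) (multiplier (\<lambda>_. c) ts)"
    using * by (intro tame_multiplier) auto
  ultimately show ?thesis unfolding adm_def by blast
qed

lemma maj_concat_map: "maj (concat (map f xs)) z = (\<Sum>x\<leftarrow>xs. maj (f x) z)"
  by (induction xs) auto

lemma ev_concat_map: "ev (concat (map f xs)) z = (\<Sum>x\<leftarrow>xs. ev (f x) z)"
  by (induction xs) auto

lemma dterms_concat_map: "dterms v (concat (map f xs)) = concat (map (\<lambda>x. dterms v (f x)) xs)"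
  by (induction xs) auto

text \<open>
  Differentiating the bracket once gives products of a first and a second derivative. The first
  derivative of one factor is bounded by \<open>tame_gradient\<close> and is the direction in which the other
  factor is differentiated.
\<close>

lemma adm_pb:
  assumes W: "\<And>k. W k \<ge> 1" and "finite B" and F: "adm W B j C F" and G: "adm W B l D G"
    and "0 \<le> C" "0 \<le> D" "j \<ge> 2" "l \<ge> 2"
  shows "adm W B (j + l - 2) ((2 ^ (j - 1) + 2 ^ (l - 1)) * C * D) (pb B F G)"
proof -
  obtain ts us where F: "F = ev ts" and ts: "tame W B j C ts" and G: "G = ev us" and us: "tame W B l D us"
    using F G by (auto simp: adm_def)
  obtain xs where xs: "set xs = vars B" "distinct xs"
    using finite_distinct_list[of "vars B"] \<open>finite B\<close> by auto
  have sum_xs: "(\<Sum>x\<leftarrow>xs. f x) = (\<Sum>x\<in>vars B. f x)" for f :: "'a \<times> bool \<Rightarrow> 'c::comm_monoid_add"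
    using xs by (simp add: sum_list_distinct_conv_sum_set)
  \<comment> \<open>the presentation of the bracket given by its definition, without collecting terms\<close>
  define ps where "ps = concat (map (\<lambda>v. mult_terms (scale_terms (sg v) (dterms v ts)) (dterms (bar v) us)) xs)"
  have "pb B F G = ev ps"
    by (rule ext) (simp add: pb_def ps_def F G ev_concat_map sum_xs)
  moreover have "homog B (j + l - 2) ps"
    unfolding homog_def
  proof clarify
    fix a m assume "(a, m) \<in> set ps" "a \<noteq> 0"
    then obtain v where "(a, m) \<in> set (mult_terms (scale_terms (sg v) (dterms v ts)) (dterms (bar v) us))"
      by (auto simp: ps_def)
    then obtain c m1 b m2 where 1: "(c, m1) \<in> set ts" "(b, m2) \<in> set us"
        and a: "a = sg v * (of_nat (count m1 v) * c) * (of_nat (count m2 (bar v)) * b)"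
        and m: "m = (m1 - {#v#}) + (m2 - {#bar v#})"
      by (auto simp: mult_terms_def scale_terms_def dterms_def)
    have 2: "v \<in># m1" "bar v \<in># m2" "c \<noteq> 0" "b \<noteq> 0"
    proof -
      have "count m1 v \<noteq> 0 \<and> count m2 (bar v) \<noteq> 0 \<and> c \<noteq> 0 \<and> b \<noteq> 0"
        using \<open>a \<noteq> 0\<close> unfolding a by auto
      then show "v \<in># m1" "bar v \<in># m2" "c \<noteq> 0" "b \<noteq> 0" using count_inI by auto
    qed
    have "size m1 = j" "set_mset m1 \<subseteq> vars B" "size m2 = l" "set_mset m2 \<subseteq> vars B"
    proof -
      have "homog B j ts" "homog B l us" using ts us by (auto simp: tame_def)
      then show "size m1 = j" "set_mset m1 \<subseteq> vars B" "size m2 = l" "set_mset m2 \<subseteq> vars B"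
        using 1 2(3,4) unfolding homog_def by auto
    qed
    moreover from this have "size (m1 - {#v#}) = j - 1" "size (m2 - {#bar v#}) = l - 1"
      using 2(1,2) by (simp_all add: size_Diff_singleton)
    moreover have "set_mset (m1 - {#v#}) \<subseteq> set_mset m1" "set_mset (m2 - {#bar v#}) \<subseteq> set_mset m2"
      by (meson in_diffD subsetI)+
    ultimately show "size m = j + l - 2 \<and> set_mset m \<subseteq> vars B"
      unfolding m size_union set_mset_union using \<open>j \<ge> 2\<close> \<open>l \<ge> 2\<close>
      by (intro conjI Un_least) (linarith, blast, blast)
  qed
  moreover have "(\<Sum>w\<in>vars B. h w * maj (dterms w ps) z) \<le>
        (2 ^ (j - 1) + 2 ^ (l - 1)) * C * D * R ^ (j + l - 2 - 1) * dnorm W B h"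
    if R: "R > 0" and h: "\<forall>v. 0 \<le> h v" and z: "\<forall>v. 0 \<le> z v" "wnorm W B z \<le> R" for R h z
  proof -
    define f where "f = (\<lambda>v. maj (dterms (bar v) ts) z)"
    define g where "g = (\<lambda>v. maj (dterms (bar v) us) z)"
    have nonneg: "0 \<le> f v" "0 \<le> g v" for v using z by (auto simp: f_def g_def intro!: maj_nonneg)
    have wf: "wnorm W B f \<le> C * R ^ (j - 1)" and wg: "wnorm W B g \<le> D * R ^ (l - 1)"
      unfolding f_def g_def wnorm_bar[of W B "\<lambda>v. maj (dterms v _) z"]
      using tame_gradient[where W = W, OF W ts R, of z] tame_gradient[where W = W, OF W us R, of z] z \<open>0 \<le> C\<close> \<open>0 \<le> D\<close> by auto
    have "maj (dterms w ps) z = (\<Sum>v\<in>vars B. g v * maj (dterms w (dterms v ts)) z) +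
        (\<Sum>v\<in>vars B. f v * maj (dterms w (dterms v us)) z)" for w
    proof -
      have "maj (dterms w ps) z = (\<Sum>v\<in>vars B. g v * maj (dterms w (dterms v ts)) z) +
          (\<Sum>v\<in>vars B. maj (dterms v ts) z * maj (dterms w (dterms (bar v) us)) z)"
        by (simp add: ps_def dterms_concat_map maj_concat_map sum_xs maj_dterms_mult dterms_scale
            sum.distrib g_def mult.commute)
      then show ?thesis
        using sum_bar[of "\<lambda>v. f v * maj (dterms w (dterms v us)) z" B] by (simp add: f_def)
    qed
    then have "(\<Sum>w\<in>vars B. h w * maj (dterms w ps) z) =
        (\<Sum>w\<in>vars B. h w * (\<Sum>v\<in>vars B. g v * maj (dterms w (dterms v ts)) z)) +
        (\<Sum>w\<in>vars B. h w * (\<Sum>v\<in>vars B. f v * maj (dterms w (dterms v us)) z))"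
      by (simp add: distrib_left sum.distrib)
    also have "\<dots> \<le> C * (D * R ^ (l - 1)) * 2 ^ (j - 1) * R ^ (j - 2) * dnorm W B h +
        D * (C * R ^ (j - 1)) * 2 ^ (l - 1) * R ^ (l - 2) * dnorm W B h"
      using z h nonneg wf wg assms(7,8)
      by (intro add_mono tame_second_derivative[OF W \<open>finite B\<close> ts R] tame_second_derivative[OF W \<open>finite B\<close> us R]) auto
    also have "\<dots> = (2 ^ (j - 1) + 2 ^ (l - 1)) * C * D * R ^ (j + l - 2 - 1) * dnorm W B h"
    proof -
      have "R ^ (l - 1) * R ^ (j - 2) = R ^ (j + l - 2 - 1)" "R ^ (j - 1) * R ^ (l - 2) = R ^ (j + l - 2 - 1)"
        using assms(7,8) by (auto simp flip: power_add intro!: arg_cong[of _ _ "(^) R"])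
      moreover have "C * (D * R ^ (l - 1)) * 2 ^ (j - 1) * R ^ (j - 2) * dnorm W B h +
          D * (C * R ^ (j - 1)) * 2 ^ (l - 1) * R ^ (l - 2) * dnorm W B h =
          C * D * dnorm W B h * (2 ^ (j - 1) * (R ^ (l - 1) * R ^ (j - 2)) + 2 ^ (l - 1) * (R ^ (j - 1) * R ^ (l - 2)))"
        by (simp add: algebra_simps)
      ultimately show ?thesis by (simp only: distrib_right [symmetric] mult_ac)
    qed
    finally show ?thesis .
  qed
  ultimately show ?thesis unfolding adm_def tame_def by blast
qed

lemma norm_pd_le_maj: "cmod (pd v (ev ts) z) \<le> maj (dterms v ts) (\<lambda>x. cmod (z x))"
  by (simp add: norm_ev_le_maj)

lemma adm_pairing:
  assumes "adm W B j C F" "R > 0" "wnorm W B (\<lambda>v. cmod (z v)) \<le> R" "\<And>v. 0 \<le> h v"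
  shows "(\<Sum>v\<in>vars B. h v * cmod (pd v F z)) \<le> C * R ^ (j - 1) * dnorm W B h"
proof -
  obtain ts where F: "F = ev ts" and ts: "tame W B j C ts" using assms(1) by (auto simp: adm_def)
  have "(\<Sum>v\<in>vars B. h v * cmod (pd v F z)) \<le> (\<Sum>v\<in>vars B. h v * maj (dterms v ts) (\<lambda>x. cmod (z x)))"
    unfolding F using assms(4) by (intro sum_mono mult_left_mono norm_pd_le_maj) auto
  also have "\<dots> \<le> C * R ^ (j - 1) * dnorm W B h"
    using ts assms(2-4) unfolding tame_def by auto
  finally show ?thesis .
qed

lemma dnorm_le_wnorm:
  assumes W: "\<And>k. W k \<ge> 1" and "\<And>v. 0 \<le> h v"
  shows "dnorm W B h \<le> wnorm W B h"
  unfolding dnorm_def wnorm_def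
proof (rule L2_set_mono)
  fix v :: "'a \<times> bool"
  have W: "1 \<le> W (fst v)" by (rule W)
  then have "h v / W (fst v) \<le> h v / 1" using assms(2) by (intro divide_left_mono) auto
  also have "\<dots> \<le> W (fst v) * h v" using W assms(2) mult_right_mono[of 1 "W (fst v)" "h v"] by simp
  finally show "h v / W (fst v) \<le> W (fst v) * h v" .
  show "0 \<le> h v / W (fst v)" using W assms(2) by simp
qed

text \<open>
  By Euler's identity the value is \<open>1 / j\<close> times the derivative in the direction of the point
  itself.
\<close>

lemma adm_value:
  assumes W: "\<And>k. W k \<ge> 1" and "finite B" "adm W B j C F" "R > 0" "wnorm W B (\<lambda>v. cmod (z v)) \<le> R" "0 \<le> C" "j \<ge> 1"
  shows "cmod (F z) \<le> C * R ^ j"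
proof -
  obtain ts where F: "F = ev ts" and ts: "tame W B j C ts" using assms(3) by (auto simp: adm_def)
  let ?y = "\<lambda>x. cmod (z x)"
  have m: "0 \<le> maj ts ?y" by (auto intro!: maj_nonneg)
  have "cmod (F z) \<le> maj ts ?y" unfolding F by (rule norm_ev_le_maj)
  also have "\<dots> \<le> real j * maj ts ?y" using \<open>j \<ge> 1\<close> m mult_right_mono[of 1 "real j"] by simp
  also have "\<dots> = (\<Sum>v\<in>vars B. ?y v * maj (dterms v ts) ?y)"
    using ts \<open>finite B\<close> euler_maj[of B j ts ?y] by (simp add: tame_def)
  also have "\<dots> \<le> C * R ^ (j - 1) * dnorm W B ?y"
    using ts assms(4,5) unfolding tame_def by auto
  also have "\<dots> \<le> C * R ^ (j - 1) * R"
    using assms dnorm_le_wnorm[where W = W, OF W, where h = ?y and B = B] by (intro mult_left_mono) auto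
  also have "\<dots> = C * R ^ j" using \<open>j \<ge> 1\<close> power_minus_mult[of j R] by simp
  finally show ?thesis .
qed

lemma adm_pb_value:
  assumes W: "\<And>k. W k \<ge> 1" and "finite B" "adm W B j C F" "adm W B l D G" "R > 0"
    "wnorm W B (\<lambda>v. cmod (z v)) \<le> R" "0 \<le> C" "0 \<le> D" "j \<ge> 1" "l \<ge> 1"
  shows "cmod (pb B F G z) \<le> C * D * R ^ (j + l - 2)"
proof -
  obtain us where G: "G = ev us" and us: "tame W B l D us" using assms(4) by (auto simp: adm_def)
  let ?y = "\<lambda>x. cmod (z x)"
  define g where "g = (\<lambda>v. maj (dterms (bar v) us) ?y)"
  have g: "0 \<le> g v" for v by (auto simp: g_def intro!: maj_nonneg)
  have "wnorm W B g = wnorm W B (\<lambda>v. maj (dterms v us) ?y)" unfolding g_def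
    by (rule wnorm_bar)
  also have "\<dots> \<le> D * R ^ (l - 1)" using assms by (intro tame_gradient[OF W us]) auto
  finally have wg: "dnorm W B g \<le> D * R ^ (l - 1)" using dnorm_le_wnorm[where W = W and h = g and B = B, OF W g] by linarith
  have "cmod (pb B F G z) \<le> (\<Sum>v\<in>vars B. cmod (sg v * pd v F z * pd (bar v) G z))"
    unfolding pb_def by (rule norm_sum)
  also have "\<dots> \<le> (\<Sum>v\<in>vars B. g v * cmod (pd v F z))"
    unfolding g_def G norm_mult norm_sg mult_1
    by (subst mult.commute, intro sum_mono mult_right_mono norm_pd_le_maj) auto
  also have "\<dots> \<le> C * R ^ (j - 1) * dnorm W B g"
    by (rule adm_pairing[OF assms(3) \<open>R > 0\<close> assms(6)]) (rule g)
  also have "\<dots> \<le> C * R ^ (j - 1) * (D * R ^ (l - 1))"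
    using wg assms by (intro mult_left_mono) auto
  also have "\<dots> = C * D * R ^ (j + l - 2)"
    using assms(9,10) by (auto simp flip: power_add simp: mult_ac intro!: arg_cong[of _ _ "(^) R"])
  finally show ?thesis .
qed

section \<open>Birkhoff normal form relative to a cluster\<close>

lemma multiplier_simps [simp]:
  "multiplier \<mu> [] = []" "multiplier \<mu> ((a, m) # ts) = (\<mu> m * a, m) # multiplier \<mu> ts"
  by (simp_all add: multiplier_def)

definition quad :: "'a set \<Rightarrow> ('a \<Rightarrow> complex) \<Rightarrow> 'a poly_fun" where
  "quad B c z = (\<Sum>k\<in>B. c k * z (k, True) * z (k, False))"

text \<open>
  The weight of a monomial under the rotation of \<open>u\<^sub>k\<close> with speed \<open>c k\<close>. For the frequencies it is
  the small divisor, for the indicator of a cluster it is the signed number of factors from the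
  cluster.
\<close>

definition qweight :: "('a \<Rightarrow> complex) \<Rightarrow> ('a \<times> bool) multiset \<Rightarrow> complex" where
  "qweight c m = (\<Sum>v\<in>#m. sg v * c (fst v))"

lemma is_poly_quad [simp, intro]: "is_poly (quad B c)"
  unfolding quad_def by (intro is_poly_sum is_poly_mult) auto

lemma pd_var: "pd v (\<lambda>z. z x) z = (if x = v then 1 else 0)"
  by (rule pd_eqI) auto

lemma pd_quad:
  assumes "finite B" "v \<in> vars B"
  shows "pd v (quad B c) z = c (fst v) * z (bar v)"
proof -
  have "pd v (quad B c) z = (\<Sum>k\<in>B. pd v (\<lambda>z. c k * z (k, True) * z (k, False)) z)"
    unfolding quad_def by (subst pd_sum) auto
  also have "\<dots> = (\<Sum>k\<in>B. if k = fst v then c (fst v) * z (bar v) else 0)"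
    by (intro sum.cong refl, subst pd_mult, simp, simp, subst pd_mult, simp, simp) (cases v; auto simp: pd_var)
  also have "\<dots> = c (fst v) * z (bar v)" using assms by (subst sum.delta) auto
  finally show ?thesis .
qed

text \<open>
  This is why homological equations can be solved one monomial at a time.
\<close>

lemma pb_quad:
  assumes "finite B" "homog B j ts"
  shows "pb B (ev ts) (quad B c) = ev (multiplier (qweight c) ts)"
proof
  fix z
  have "pb B (ev ts) (quad B c) z = (\<Sum>v\<in>vars B. (sg v * c (fst v)) * (z v * ev (dterms v ts) z))"
    unfolding pb_def using assms(1) by (intro sum.cong refl, subst pd_quad) auto
  also have "\<dots> = ev (multiplier (qweight c) ts) z"
    using assms(2)
  proof (induction ts)
    case (Cons am ts)
    obtain a m where am: "am = (a, m)" by force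
    have "homog B j ts" and m: "a \<noteq> 0 \<Longrightarrow> set_mset m \<subseteq> vars B"
      using Cons.prems by (auto simp: homog_def am)
    have "a * (\<Sum>v\<in>vars B. (sg v * c (fst v)) * (z v * (of_nat (count m v) * mon (m - {#v#}) z))) =
        a * (\<Sum>v\<in>vars B. of_nat (count m v) * ((sg v * c (fst v)) * mon m z))"
    proof (intro arg_cong[of _ _ "(*) a"] sum.cong refl)
      fix v
      show "(sg v * c (fst v)) * (z v * (of_nat (count m v) * mon (m - {#v#}) z)) =
          of_nat (count m v) * ((sg v * c (fst v)) * mon m z)"
        using mon_minus_single[of m v z] by (simp add: mult_ac)
    qed
    also have "\<dots> = a * (qweight c m * mon m z)"
    proof (cases "a = 0")
      case False
      then have "(\<Sum>v\<in>vars B. of_nat (count m v) * ((sg v * c (fst v)) * mon m z)) = qweight c m * mon m z"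
        using sum_count_eq_sum_mset[of "vars B" m "\<lambda>v. (sg v * c (fst v)) * mon m z"] m assms(1)
        by (simp add: qweight_def sum_mset_distrib_right)
      then show ?thesis by simp
    qed simp
    finally have *: "a * (\<Sum>v\<in>vars B. (sg v * c (fst v)) * (z v * (of_nat (count m v) * mon (m - {#v#}) z))) =
        a * (qweight c m * mon m z)" .
    have "(\<Sum>v\<in>vars B. (sg v * c (fst v)) * (z v * ev (dterms v (am # ts)) z)) =
       a * (\<Sum>v\<in>vars B. (sg v * c (fst v)) * (z v * (of_nat (count m v) * mon (m - {#v#}) z))) +
       (\<Sum>v\<in>vars B. (sg v * c (fst v)) * (z v * ev (dterms v ts) z))"
      by (simp add: am sum_distrib_left distrib_left sum.distrib mult_ac)
    then show ?case using Cons.IH \<open>homog B j ts\<close> * by (simp add: am multiplier_def mult_ac)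
  qed (simp add: multiplier_def)
  finally show "pb B (ev ts) (quad B c) z = ev (multiplier (qweight c) ts) z" .
qed

lemma pb_quad_quad:
  assumes "finite B"
  shows "pb B (quad B c) (quad B c') z = 0"
proof -
  define X where "X = (\<Sum>v\<in>vars B. sg v * (c (fst v) * c' (fst v) * z v * z (bar v)))"
  have "pb B (quad B c) (quad B c') z = X"
    unfolding pb_def X_def using assms by (intro sum.cong refl, subst (1 2) pd_quad) auto
  moreover have "X = (\<Sum>v\<in>vars B. sg (bar v) * (c (fst (bar v)) * c' (fst (bar v)) * z (bar v) * z (bar (bar v))))"
    unfolding X_def by (rule sum_bar[symmetric])
  then have "X = - X"
    unfolding X_def by (simp add: sum_negf mult_ac)
  ultimately show ?thesis by simp
qed

lemma norm_qweight_le: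
  assumes "\<And>k. cmod (c k) \<le> 1"
  shows "cmod (qweight c m) \<le> size m"
proof (induction m)
  case (add x m)
  have "cmod (sg x * c (fst x) + qweight c m) \<le> 1 + size m"
    using assms[of "fst x"] add by (intro order_trans[OF norm_triangle_ineq] add_mono) (auto simp: norm_mult)
  then show ?case by (simp add: qweight_def)
qed (simp add: qweight_def)

definition bracket_const :: "nat \<Rightarrow> real" where "bracket_const r = 2 * 2 ^ r"

definition lie_growth :: "nat \<Rightarrow> real \<Rightarrow> real" where "lie_growth r D = 1 + bracket_const r * D * real r"

text \<open>
  The bound for the generators of the normal form below degree \<open>N\<close>. The increment from \<open>N\<close> to
  \<open>N + 1\<close> is \<open>2 r\<close>, the cost of the homological equation, times the bound for its right-hand side:
  \<open>C\<close> for the perturbation, and one half of the second summand for each of the two sums of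
  brackets of the previous generators. The constant depends neither on the modes nor on the small
  divisors.
\<close>

fun nf_const :: "nat \<Rightarrow> real \<Rightarrow> nat \<Rightarrow> real" where
  "nf_const r C 0 = 0"
| "nf_const r C (Suc N) = nf_const r C N + 2 * real r *
     (C + 2 * real r * bracket_const r * (nf_const r C N)\<^sup>2 * lie_growth r (nf_const r C N) ^ r)"

lemma lie_growth_ge_1: "0 \<le> D \<Longrightarrow> 1 \<le> lie_growth r D"
  by (simp add: lie_growth_def bracket_const_def)

lemma nf_const_nonneg: "0 \<le> C \<Longrightarrow> 0 \<le> nf_const r C N"
proof (induction N)
  case (Suc N)
  then show ?case using lie_growth_ge_1[of "nf_const r C N" r]
    by (auto intro!: add_nonneg_nonneg mult_nonneg_nonneg simp: bracket_const_def)
qed simp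

text \<open>
  Polynomials of degree \<open>j\<close> are measured in units of \<open>mw j\<close>; the submultiplicativity of \<open>mw\<close> is
  what a bracket needs. In these units generators have size \<open>1\<close> and Hamiltonians size \<open>1 / \<Lambda>\<close>, the
  loss in a homological equation. The cluster is the set of modes of frequency \<open>\<omega>\<^sub>0\<close>, and divisors
  are bounded below only for monomials on which the action of the cluster acts nontrivially.
\<close>

locale birkhoff =
  fixes B :: "'a set" and W :: "'a \<Rightarrow> real" and mw :: "nat \<Rightarrow> real" and r :: nat
    and \<omega> :: "'a \<Rightarrow> real" and \<omega>\<^sub>0 :: real and \<Lambda> :: real
  assumes finB: "finite B" and W: "\<And>k. 1 \<le> W k"
    and mw_nonneg: "\<And>j. 0 \<le> mw j" and mw_mult: "\<And>i l. 3 \<le> i \<Longrightarrow> 3 \<le> l \<Longrightarrow> mw i * mw l \<le> mw (i + l - 2)"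
    and \<Lambda>_pos: "0 < \<Lambda>"
    and nonres: "\<And>m. set_mset m \<subseteq> vars B \<Longrightarrow> 3 \<le> size m \<Longrightarrow> size m < r \<Longrightarrow>
        qweight (\<lambda>k. if \<omega> k = \<omega>\<^sub>0 then 1 else 0) m \<noteq> 0 \<Longrightarrow> 1 / \<Lambda> \<le> cmod (qweight (\<lambda>k. of_real (\<omega> k)) m)"
begin

definition J :: "'a poly_fun" where "J = quad B (\<lambda>k. if \<omega> k = \<omega>\<^sub>0 then 1 else 0)"
definition H2 :: "'a poly_fun" where "H2 = quad B (\<lambda>k. of_real (\<omega> k) / 2)"

lemma poly_J [simp, intro]: "is_poly J" and poly_H2 [simp, intro]: "is_poly H2"
  by (auto simp: J_def H2_def)

lemma pb_J_H2: "pb B J H2 z = 0"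
  unfolding J_def H2_def by (rule pb_quad_quad[OF finB])

lemma adm_bracket:
  assumes "adm W B i (a * mw i) F" "adm W B l (b * mw l) G" "3 \<le> i" "3 \<le> l" "i \<le> r" "l \<le> r" "0 \<le> a" "0 \<le> b"
  shows "adm W B (i + l - 2) (bracket_const r * a * b * mw (i + l - 2)) (pb B F G)"
proof (rule adm_mono[OF adm_pb[OF W finB assms(1,2)]])
  have "(2::real) ^ (i - 1) \<le> 2 ^ r" "(2::real) ^ (l - 1) \<le> 2 ^ r"
    using assms(5,6) by (auto intro!: power_increasing)
  then have "(2::real) ^ (i - 1) + 2 ^ (l - 1) \<le> bracket_const r"
    unfolding bracket_const_def by linarith
  then have "(2 ^ (i - 1) + 2 ^ (l - 1)) * (a * b * (mw i * mw l)) \<le> bracket_const r * (a * b * mw (i + l - 2))"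
    using assms mw_mult mw_nonneg by (intro mult_mono mult_left_mono) (simp_all add: bracket_const_def)
  then show "(2 ^ (i - 1) + 2 ^ (l - 1)) * (a * mw i) * (b * mw l) \<le> bracket_const r * a * b * mw (i + l - 2)"
    by (simp add: mult_ac)
qed (use assms mw_nonneg in auto)

text \<open>
  Inverting the bracket with the quadratic part divides the monomials of nonzero weight by their
  small divisors; those of weight zero are put into \<open>Q\<close>, whatever their divisor. The factor
  \<open>j - 2\<close> is the one in the recursion of the Lie transform, and \<open>2\<close> comes from the factor \<open>1 / 2\<close>
  in \<open>H2\<close>. The bound for the bracket of \<open>H2\<close> and \<open>S\<close> has no \<open>\<Lambda>\<close>, because that bracket is \<open>j - 2\<close>
  times a part of \<open>F\<close>.
\<close>

lemma homological_equation:
  assumes F: "adm W B j D F" and j: "3 \<le> j" "j < r" and "0 \<le> D"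
  obtains S Q where "adm W B j (2 * real r * \<Lambda> * D) S" "adm W B j D Q" "adm W B j (real r * D) (pb B H2 S)"
    "\<And>z. pb B J Q z = 0" "\<And>z. F z = Q z + pb B H2 S z / of_nat (j - 2)"
proof -
  obtain ts where F: "F = ev ts" and ts: "tame W B j D ts" using F by (auto simp: adm_def)
  define \<theta> where "\<theta> = qweight (\<lambda>k. if \<omega> k = \<omega>\<^sub>0 then 1 else (0::complex))"
  define \<Omega> where "\<Omega> = qweight (\<lambda>k. of_real (\<omega> k) :: complex)"
  have hom: "homog B j ts" using ts by (simp add: tame_def)
  have lower: "1 / \<Lambda> \<le> cmod (\<Omega> m)" if "(a, m) \<in> set ts" "a \<noteq> 0" "\<theta> m \<noteq> 0" for a m
    using nonres[of m] that hom j by (auto simp: homog_def \<theta>_def \<Omega>_def)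
  define \<mu>Q where "\<mu>Q = (\<lambda>m. if \<theta> m = 0 then 1 else (0::complex))"
  define \<mu>S where "\<mu>S = (\<lambda>m. if \<theta> m = 0 then 0 else (- 2) * of_nat (j - 2) / \<Omega> m)"
  define S where "S = ev (multiplier \<mu>S ts)"
  define Q where "Q = ev (multiplier \<mu>Q ts)"
  have tS: "tame W B j (2 * real r * \<Lambda> * D) (multiplier \<mu>S ts)"
  proof (rule tame_multiplier[OF ts])
    fix a m assume am: "(a, m) \<in> set ts" "a \<noteq> 0"
    show "cmod (\<mu>S m) \<le> 2 * real r * \<Lambda>"
    proof (cases "\<theta> m = 0")
      case False
      have "2 * real (j - 2) / cmod (\<Omega> m) \<le> 2 * real r / (1 / \<Lambda>)"
        using lower[OF am False] j \<Lambda>_pos by (intro frac_le) auto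
      then show ?thesis using False by (simp add: \<mu>S_def norm_divide norm_mult)
    qed (use \<Lambda>_pos in \<open>auto simp: \<mu>S_def\<close>)
  qed (use \<Lambda>_pos in auto)
  have tQ: "tame W B j (1 * D) (multiplier \<mu>Q ts)"
    by (rule tame_multiplier[OF ts]) (auto simp: \<mu>Q_def)
  have H2S: "pb B H2 S = ev (multiplier (\<lambda>m. if \<theta> m = 0 then 0 else of_nat (j - 2)) ts)"
  proof
    fix z
    have half: "qweight (\<lambda>k. of_real (\<omega> k) / 2) = (\<lambda>m. \<Omega> m / 2)"
    proof
      show "qweight (\<lambda>k. of_real (\<omega> k) / 2) m = \<Omega> m / 2" for m
        unfolding qweight_def \<Omega>_def by (induction m) (auto simp: add_divide_distrib)
    qed
    have "pb B H2 S z = - ev (multiplier (\<lambda>m. \<Omega> m / 2) (multiplier \<mu>S ts)) z"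
      using tS pb_antisym[of B H2 S z] pb_quad[OF finB, of j "multiplier \<mu>S ts"] half
      by (simp add: H2_def S_def tame_def)
    also have "\<dots> = ev (multiplier (\<lambda>m. if \<theta> m = 0 then 0 else of_nat (j - 2)) ts) z"
      using lower
    proof (induction ts)
      case (Cons am ts)
      obtain a m where am: "am = (a, m)" by force
      have "- (\<Omega> m / 2 * (\<mu>S m * a)) = (if \<theta> m = 0 then 0 else of_nat (j - 2)) * a"
        using Cons.prems[of a m] \<Lambda>_pos by (cases "a = 0 \<or> \<theta> m = 0") (auto simp: am \<mu>S_def)
      then have "- (\<Omega> m / 2 * (\<mu>S m * a) * mon m z) = (if \<theta> m = 0 then 0 else of_nat (j - 2)) * a * mon m z"
        by (simp only: mult_minus_left[symmetric])
      moreover have "- ev (multiplier (\<lambda>m. \<Omega> m / 2) (multiplier \<mu>S ts)) z = ev (multiplier (\<lambda>m. if \<theta> m = 0 then 0 else of_nat (j - 2)) ts) z"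
        using Cons.prems by (intro Cons.IH) auto
      ultimately show ?case by (simp only: multiplier_simps am ev_simps minus_add_distrib)
    qed simp
    finally show "pb B H2 S z = ev (multiplier (\<lambda>m. if \<theta> m = 0 then 0 else of_nat (j - 2)) ts) z" .
  qed
  show thesis
  proof
    show "adm W B j (2 * real r * \<Lambda> * D) S" using tS by (auto simp: adm_def S_def)
    show "adm W B j D Q" using tQ by (auto simp: adm_def Q_def)
    have "tame W B j (real r * D) (multiplier (\<lambda>m. if \<theta> m = 0 then 0 else of_nat (j - 2)) ts)"
      using j by (intro tame_multiplier[OF ts]) (auto simp del: of_nat_diff)
    then show "adm W B j (real r * D) (pb B H2 S)" unfolding H2S adm_def by blast
    show "F z = Q z + pb B H2 S z / of_nat (j - 2)" for z
    proof -
      have "(of_nat (j - 2) :: complex) \<noteq> 0" using j by (simp del: of_nat_diff)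
      then have "ev ts z = ev (multiplier \<mu>Q ts) z +
          ev (multiplier (\<lambda>m. if \<theta> m = 0 then 0 else of_nat (j - 2)) ts) z / of_nat (j - 2)"
        by (induction ts) (auto simp: \<mu>Q_def add_divide_distrib simp del: of_nat_diff)
      then show ?thesis by (simp only: F Q_def H2S)
    qed
    show "pb B J Q z = 0" for z
    proof -
      have "pb B J Q z = - ev (multiplier \<theta> (multiplier \<mu>Q ts)) z"
        using tQ pb_antisym[of B J Q z] pb_quad[OF finB, of j "multiplier \<mu>Q ts"]
        by (simp add: J_def Q_def tame_def \<theta>_def)
      also have "ev (multiplier \<theta> (multiplier \<mu>Q ts)) z = 0"
        by (induction ts) (auto simp: multiplier_def \<mu>Q_def)
      finally show ?thesis by simp
    qed
  qed
qed

text \<open>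
  The assumption is on the first bracket of \<open>F\<close> with a generator and not on \<open>F\<close> itself, because
  for the quadratic polynomials \<open>H2\<close> and \<open>J\<close> this bracket satisfies better bounds than an estimate
  of the factors would give: for \<open>H2\<close> the frequencies are unbounded.
\<close>

lemma lie_transform_adm:
  assumes S: "\<And>i. 3 \<le> i \<Longrightarrow> i \<le> j + 2 - d \<Longrightarrow> adm W B i (D * mw i) (S i)"
    and FS: "\<And>i. 3 \<le> i \<Longrightarrow> i \<le> j + 2 - d \<Longrightarrow> adm W B (d + i - 2) (a * mw (d + i - 2)) (pb B F (S i))"
    and "2 \<le> d" "d < j" "j \<le> r" "0 \<le> D" "0 \<le> a"
  shows "adm W B j (a * lie_growth r D ^ j * mw j) (lie_transform B S F d j)"
  using S FS \<open>d < j\<close> \<open>j \<le> r\<close>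
proof (induction j rule: less_induct)
  case (less j)
  let ?L = "lie_growth r D"
  have L: "1 \<le> ?L" using \<open>0 \<le> D\<close> by (rule lie_growth_ge_1)
  have Sj: "adm W B (j + 2 - i) (D * mw (j + 2 - i)) (S (j + 2 - i))" if "i \<in> {d..<j}" for i
    by (rule less.prems(1)) (use that \<open>2 \<le> d\<close> in auto)
  \<comment> \<open>Only the summand \<open>i = d\<close> contains \<open>F\<close> itself; the others are brackets of transforms already
    bounded.\<close>
  have first: "adm W B j (a * mw j) (pb B F (S (j + 2 - d)))"
    using less.prems(2)[of "j + 2 - d"] less.prems(3) \<open>2 \<le> d\<close> by simp
  have rest: "adm W B j (bracket_const r * a * D * ?L ^ (j - 1) * mw j) (pb B (lie_transform B S F d i) (S (j + 2 - i)))"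
    if i: "i \<in> {Suc d..<j}" for i
  proof -
    have "adm W B i (a * ?L ^ i * mw i) (lie_transform B S F d i)"
    proof (rule less.IH)
      show "adm W B l (D * mw l) (S l)" if "3 \<le> l" "l \<le> i + 2 - d" for l
        by (rule less.prems(1)) (use that i in auto)
      show "adm W B (d + l - 2) (a * mw (d + l - 2)) (pb B F (S l))" if "3 \<le> l" "l \<le> i + 2 - d" for l
        by (rule less.prems(2)) (use that i in auto)
    qed (use i less.prems in auto)
    then have "adm W B (i + (j + 2 - i) - 2) (bracket_const r * (a * ?L ^ i) * D * mw (i + (j + 2 - i) - 2))
        (pb B (lie_transform B S F d i) (S (j + 2 - i)))"
      using i \<open>2 \<le> d\<close> less.prems(4) \<open>0 \<le> a\<close> \<open>0 \<le> D\<close> L by (intro adm_bracket Sj) auto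
    then have "adm W B j (bracket_const r * (a * ?L ^ i) * D * mw j)
        (pb B (lie_transform B S F d i) (S (j + 2 - i)))" using i by simp
    moreover have "bracket_const r * (a * ?L ^ i) * D * mw j \<le> bracket_const r * (a * ?L ^ (j - 1)) * D * mw j"
      using i L \<open>0 \<le> a\<close> \<open>0 \<le> D\<close> mw_nonneg
      by (intro mult_right_mono mult_left_mono power_increasing) (auto simp: bracket_const_def)
    ultimately show ?thesis using adm_mono by (fastforce simp: mult_ac)
  qed
  have "adm W B j (\<Sum>i\<in>{d..<j}. if i = d then a * mw j else bracket_const r * a * D * ?L ^ (j - 1) * mw j)
     (\<lambda>z. \<Sum>i\<in>{d..<j}. pb B (lie_transform B S F d i) (S (j + 2 - i)) z)"
    using first rest by (intro adm_sum) auto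
  then have "adm W B j (cmod (1 / of_nat (j - d)) * (\<Sum>i\<in>{d..<j}. if i = d then a * mw j else bracket_const r * a * D * ?L ^ (j - 1) * mw j))
     (\<lambda>z. 1 / of_nat (j - d) * (\<Sum>i\<in>{d..<j}. pb B (lie_transform B S F d i) (S (j + 2 - i)) z))"
    by (rule adm_cmult)
  also have "(\<lambda>z. 1 / of_nat (j - d) * (\<Sum>i\<in>{d..<j}. pb B (lie_transform B S F d i) (S (j + 2 - i)) z)) =
      lie_transform B S F d j"
    using less.prems(3) by (subst (2) lie_transform.simps) auto
  finally show ?case
  proof (rule adm_mono)
    let ?K = "bracket_const r * a * D * ?L ^ (j - 1) * mw j"
    have K: "0 \<le> ?K" using L \<open>0 \<le> a\<close> \<open>0 \<le> D\<close> mw_nonneg by (auto simp: bracket_const_def)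
    have "(\<Sum>i\<in>{d..<j}. if i = d then a * mw j else ?K) = a * mw j + (\<Sum>i\<in>{Suc d..<j}. ?K)"
      using less.prems(3) by (subst sum.atLeast_Suc_lessThan) auto
    also have "\<dots> = a * mw j + real (j - Suc d) * ?K" by simp
    also have "\<dots> \<le> a * mw j + real r * ?K"
      using less.prems K by (intro add_left_mono mult_right_mono) auto
    finally have sum: "(\<Sum>i\<in>{d..<j}. if i = d then a * mw j else ?K) \<le> a * mw j + real r * ?K" .
    have nn: "0 \<le> (\<Sum>i\<in>{d..<j}. if i = d then a * mw j else ?K)"
      using K \<open>0 \<le> a\<close> mw_nonneg by (intro sum_nonneg) auto
    have "cmod (1 / of_nat (j - d)) \<le> 1" using less.prems(3) by (simp add: norm_divide del: of_nat_diff)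
    then have "cmod (1 / of_nat (j - d)) * (\<Sum>i\<in>{d..<j}. if i = d then a * mw j else ?K) \<le>
        1 * (a * mw j + real r * ?K)"
      using sum nn by (intro mult_mono) auto
    also have "\<dots> = a * mw j * (1 + bracket_const r * D * real r * ?L ^ (j - 1))"
      by (simp add: algebra_simps)
    also have "\<dots> \<le> a * mw j * ?L ^ j"
    proof (intro mult_left_mono)
      have "1 * 1 + bracket_const r * D * real r * ?L ^ (j - 1) \<le>
          1 * ?L ^ (j - 1) + bracket_const r * D * real r * ?L ^ (j - 1)"
        using L by (intro add_right_mono mult_left_mono one_le_power) auto
      also have "\<dots> = ?L * ?L ^ (j - 1)" by (simp add: lie_growth_def algebra_simps)
      also have "\<dots> = ?L ^ j" using less.prems(3) by (simp flip: power_Suc)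
      finally show "1 + bracket_const r * D * real r * ?L ^ (j - 1) \<le> ?L ^ j" by simp
    qed (use \<open>0 \<le> a\<close> mw_nonneg in auto)
    finally show "cmod (1 / of_nat (j - d)) * (\<Sum>i\<in>{d..<j}. if i = d then a * mw j else ?K) \<le> a * ?L ^ j * mw j"
      by (simp add: mult_ac)
  qed
qed

lemma lie_transform_adm_3:
  assumes "\<And>i. 3 \<le> i \<Longrightarrow> i \<le> j + 2 - d \<Longrightarrow> adm W B i (D * mw i) (S i)"
    and "adm W B d (b * mw d) F"
    and "3 \<le> d" "d < j" "j \<le> r" "0 \<le> D" "0 \<le> b"
  shows "adm W B j (bracket_const r * b * D * lie_growth r D ^ j * mw j) (lie_transform B S F d j)"
proof (rule lie_transform_adm[OF assms(1)])
  fix i assume "3 \<le> i" "i \<le> j + 2 - d"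
  then show "adm W B (d + i - 2) (bracket_const r * b * D * mw (d + i - 2)) (pb B F (S i))"
    using assms by (intro adm_bracket) auto
qed (use assms in \<open>auto simp: bracket_const_def\<close>)

text \<open>
  Both unknowns of degree \<open>N\<close> enter the equation of degree \<open>N\<close> only through \<open>Q\<^sub>N\<close> and the bracket
  of \<open>H2\<close> with \<open>S\<^sub>N\<close>; all other terms consist of brackets of previously chosen polynomials. So the
  equations are solved one degree after the other, each by a homological equation.
\<close>

lemma normal_form:
  assumes P: "\<And>j. 3 \<le> j \<Longrightarrow> j < r \<Longrightarrow> adm W B j (C / \<Lambda> * mw j) (P j)" and "0 \<le> C" and "N \<le> r"
  defines "D \<equiv> nf_const r C"
  shows "\<exists>S Q. Q 2 = H2 \<and> (\<forall>i. 3 \<le> i \<longrightarrow> i < N \<longrightarrow>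
     adm W B i (D N * mw i) (S i) \<and> adm W B i (D N / \<Lambda> * mw i) (Q i) \<and>
     adm W B i (D N / \<Lambda> * mw i) (pb B H2 (S i)) \<and> (\<forall>z. pb B J (Q i) z = 0) \<and>
     (\<forall>z. P i z = (\<Sum>d\<in>{2..i}. lie_transform B S (Q d) d i z)))"
  using \<open>N \<le> r\<close>
proof (induction N)
  case 0
  show ?case by (intro exI[of _ "\<lambda>_. undefined"] exI[of _ "\<lambda>_. H2"]) auto
next
  case (Suc N)
  then obtain S Q where Q2: "Q 2 = H2" and IH: "\<And>i. 3 \<le> i \<Longrightarrow> i < N \<Longrightarrow>
     adm W B i (D N * mw i) (S i) \<and> adm W B i (D N / \<Lambda> * mw i) (Q i) \<and>
     adm W B i (D N / \<Lambda> * mw i) (pb B H2 (S i)) \<and> (\<forall>z. pb B J (Q i) z = 0) \<and>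
     (\<forall>z. P i z = (\<Sum>d\<in>{2..i}. lie_transform B S (Q d) d i z))" by auto
  show ?case
  proof (cases "3 \<le> N")
    case False
    then show ?thesis using Q2 by (intro exI[of _ S] exI[of _ Q]) auto
  next
    case True
    define K where "K = bracket_const r"
    define L where "L = lie_growth r (D N)"
    define X where "X = C + 2 * real r * K * (D N)\<^sup>2 * L ^ r"
    have DN: "0 \<le> D N" unfolding D_def by (rule nf_const_nonneg[OF \<open>0 \<le> C\<close>])
    have L: "1 \<le> L" unfolding L_def by (rule lie_growth_ge_1[OF DN])
    have K: "0 \<le> K" by (simp add: K_def bracket_const_def)
    have X: "0 \<le> X" using \<open>0 \<le> C\<close> K L by (simp add: X_def)
    have DS: "D (Suc N) = D N + 2 * real r * X" by (simp add: D_def X_def K_def L_def)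
    have Npow: "L ^ i \<le> L ^ r" if "i \<le> N" for i using L that Suc.prems by (intro power_increasing) auto
    \<comment> \<open>\<open>V\<close> is what the transform of \<open>H2\<close> contributes in degree \<open>N\<close> besides the bracket of \<open>H2\<close>
      with the new generator, \<open>U\<close> is the contribution of the previous \<open>Q d\<close>.\<close>
    define V where "V = (\<lambda>z. (\<Sum>i\<in>{3..<N}. pb B (lie_transform B S H2 2 i) (S (N + 2 - i)) z) / of_nat (N - 2))"
    define U where "U = (\<lambda>z. \<Sum>d\<in>{3..<N}. lie_transform B S (Q d) d N z)"
    have admV: "adm W B N (real r * K * (D N)\<^sup>2 * L ^ r / \<Lambda> * mw N) V"
    proof -
      have "adm W B N (K * (D N / \<Lambda> * L ^ r) * D N * mw N) (pb B (lie_transform B S H2 2 i) (S (N + 2 - i)))"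
        if i: "i \<in> {3..<N}" for i
      proof -
        have "adm W B i (D N / \<Lambda> * L ^ i * mw i) (lie_transform B S H2 2 i)"
          unfolding L_def using IH i DN \<Lambda>_pos Suc.prems
          by (intro lie_transform_adm) (auto simp del: times_divide_eq_left)
        moreover have "D N / \<Lambda> * L ^ i * mw i \<le> D N / \<Lambda> * L ^ r * mw i"
          using Npow[of i] i DN \<Lambda>_pos mw_nonneg by (intro mult_right_mono mult_left_mono) auto
        ultimately have "adm W B i (D N / \<Lambda> * L ^ r * mw i) (lie_transform B S H2 2 i)"
          by (rule adm_mono)
        moreover have "adm W B (N + 2 - i) (D N * mw (N + 2 - i)) (S (N + 2 - i))"
          using IH[of "N + 2 - i"] i by auto
        ultimately have "adm W B (i + (N + 2 - i) - 2) (K * (D N / \<Lambda> * L ^ r) * D N * mw (i + (N + 2 - i) - 2))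
            (pb B (lie_transform B S H2 2 i) (S (N + 2 - i)))"
          unfolding K_def using i DN L \<Lambda>_pos Suc.prems by (intro adm_bracket) auto
        then show ?thesis using i by simp
      qed
      then have "adm W B N (cmod (1 / of_nat (N - 2)) * (\<Sum>i\<in>{3..<N}. K * (D N / \<Lambda> * L ^ r) * D N * mw N))
          (\<lambda>z. 1 / of_nat (N - 2) * (\<Sum>i\<in>{3..<N}. pb B (lie_transform B S H2 2 i) (S (N + 2 - i)) z))"
        by (intro adm_cmult adm_sum)
      also have "(\<lambda>z. 1 / of_nat (N - 2) * (\<Sum>i\<in>{3..<N}. pb B (lie_transform B S H2 2 i) (S (N + 2 - i)) z)) = V"
        by (simp add: V_def)
      finally show ?thesis
      proof (rule adm_mono)
        define T where "T = K * (D N / \<Lambda> * L ^ r) * D N * mw N"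
        have nn: "0 \<le> T" using K DN L \<Lambda>_pos mw_nonneg by (simp add: T_def)
        then have "real (N - 3) * T \<le> real r * T" using Suc.prems by (intro mult_right_mono) auto
        moreover have "cmod (1 / of_nat (N - 2)) \<le> 1" using True by (simp add: norm_divide del: of_nat_diff)
        ultimately have "cmod (1 / of_nat (N - 2)) * (real (N - 3) * T) \<le> 1 * (real r * T)"
          using nn by (intro mult_mono[where b = "1 :: real"]) auto
        then show "cmod (1 / of_nat (N - 2)) * (\<Sum>i\<in>{3..<N}. K * (D N / \<Lambda> * L ^ r) * D N * mw N) \<le>
            real r * K * (D N)\<^sup>2 * L ^ r / \<Lambda> * mw N"
          by (simp add: power2_eq_square mult_ac T_def)
      qed
    qed
    have admU: "adm W B N (real r * K * (D N)\<^sup>2 * L ^ r / \<Lambda> * mw N) U"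
    proof -
      have "adm W B N (K * (D N / \<Lambda>) * D N * L ^ r * mw N) (lie_transform B S (Q d) d N)"
        if d: "d \<in> {3..<N}" for d
      proof (rule adm_mono)
        show "adm W B N (K * (D N / \<Lambda>) * D N * L ^ N * mw N) (lie_transform B S (Q d) d N)"
          unfolding K_def L_def
        proof (rule lie_transform_adm_3)
          show "adm W B i (D N * mw i) (S i)" if "3 \<le> i" "i \<le> N + 2 - d" for i
            using IH[of i] that d by auto
        qed (use d IH DN \<Lambda>_pos Suc.prems in auto)
        show "K * (D N / \<Lambda>) * D N * L ^ N * mw N \<le> K * (D N / \<Lambda>) * D N * L ^ r * mw N"
          using Npow[of N] K DN \<Lambda>_pos mw_nonneg by (intro mult_right_mono mult_left_mono) auto
      qed
      then have "adm W B N (\<Sum>d\<in>{3..<N}. K * (D N / \<Lambda>) * D N * L ^ r * mw N) U"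
        unfolding U_def by (intro adm_sum)
      then show ?thesis
      proof (rule adm_mono)
        have nn: "0 \<le> K * (D N / \<Lambda>) * D N * L ^ r * mw N" using K DN L \<Lambda>_pos mw_nonneg by simp
        have "real (N - 3) * (K * (D N / \<Lambda>) * D N * L ^ r * mw N) \<le> real r * (K * (D N / \<Lambda>) * D N * L ^ r * mw N)"
          using nn Suc.prems by (intro mult_right_mono) auto
        then show "(\<Sum>d\<in>{3..<N}. K * (D N / \<Lambda>) * D N * L ^ r * mw N) \<le> real r * K * (D N)\<^sup>2 * L ^ r / \<Lambda> * mw N"
          by (simp add: power2_eq_square mult_ac)
      qed
    qed
    define F where "F = (\<lambda>z. P N z + (- 1) * (U z + V z))"
    have "adm W B N (X / \<Lambda> * mw N) F"
    proof (rule adm_mono)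
      show "adm W B N (C / \<Lambda> * mw N + cmod (- 1) * (real r * K * (D N)\<^sup>2 * L ^ r / \<Lambda> * mw N + real r * K * (D N)\<^sup>2 * L ^ r / \<Lambda> * mw N)) F"
        unfolding F_def using Suc.prems True by (intro adm_add adm_cmult P admU admV) auto
      show "C / \<Lambda> * mw N + cmod (- 1) * (real r * K * (D N)\<^sup>2 * L ^ r / \<Lambda> * mw N + real r * K * (D N)\<^sup>2 * L ^ r / \<Lambda> * mw N) \<le> X / \<Lambda> * mw N"
        by (simp add: X_def add_divide_distrib algebra_simps)
    qed
    moreover have "0 \<le> X / \<Lambda> * mw N" using X \<Lambda>_pos mw_nonneg by simp
    moreover have "N < r" using Suc.prems by simp
    ultimately obtain SN QN where new: "adm W B N (2 * real r * \<Lambda> * (X / \<Lambda> * mw N)) SN"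
        "adm W B N (X / \<Lambda> * mw N) QN" "adm W B N (real r * (X / \<Lambda> * mw N)) (pb B H2 SN)"
        "\<And>z. pb B J QN z = 0" "\<And>z. F z = QN z + pb B H2 SN z / of_nat (N - 2)"
      using homological_equation True by blast
    define S' where "S' = S(N := SN)"
    define Q' where "Q' = Q(N := QN)"
    have S': "S' i = S i" "Q' i = Q i" if "i \<noteq> N" for i using that by (auto simp: S'_def Q'_def)
    have lt_eq: "lie_transform B S' G d i = lie_transform B S G d i" if "i + 2 - d < N" for G d i
      by (rule lie_transform_cong) (use that S' in auto)
    have mono: "D N \<le> D (Suc N)" unfolding DS using X by simp
    have XD: "2 * real r * X \<le> D (Suc N)" unfolding DS using DN by simp
    have "X \<le> 2 * real r * X" using X True Suc.prems mult_right_mono[of 1 "2 * real r" X] by simp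
    then have XD': "X \<le> D (Suc N)" "real r * X \<le> D (Suc N)"
      using XD X mult_right_mono[of "real r" "2 * real r" X] by linarith+
    have "adm W B i (D (Suc N) * mw i) (S' i) \<and> adm W B i (D (Suc N) / \<Lambda> * mw i) (Q' i) \<and>
       adm W B i (D (Suc N) / \<Lambda> * mw i) (pb B H2 (S' i)) \<and> (\<forall>z. pb B J (Q' i) z = 0) \<and>
       (\<forall>z. P i z = (\<Sum>d\<in>{2..i}. lie_transform B S' (Q' d) d i z))" if i: "3 \<le> i" "i < Suc N" for i
    proof (cases "i = N")
      case False
      have m1: "D N * mw i \<le> D (Suc N) * mw i" using mono mw_nonneg by (intro mult_right_mono)
      have m2: "D N / \<Lambda> * mw i \<le> D (Suc N) / \<Lambda> * mw i"
        using mono mw_nonneg \<Lambda>_pos by (intro mult_right_mono divide_right_mono) auto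
      have "(\<Sum>d\<in>{2..i}. lie_transform B S' (Q' d) d i z) = (\<Sum>d\<in>{2..i}. lie_transform B S (Q d) d i z)" for z
        using i False by (intro sum.cong refl) (auto simp: lt_eq S')
      then show ?thesis using IH[of i] i False adm_mono[OF _ m1] adm_mono[OF _ m2] by (auto simp: S')
    next
      case True
      have sum_split: "(\<Sum>d\<in>{2..N}. f d) = f 2 + (\<Sum>d\<in>{3..<N}. f d) + f N" for f :: "nat \<Rightarrow> complex"
      proof -
        have "{2..N} = insert 2 (insert N {3..<N})" using \<open>3 \<le> N\<close> by auto
        then show ?thesis using \<open>3 \<le> N\<close> by (simp add: add_ac)
      qed
      have two: "lie_transform B S' H2 2 N z = V z + pb B H2 SN z / of_nat (N - 2)" for z
      proof -
        have "(\<Sum>i\<in>{2..<N}. pb B (lie_transform B S' H2 2 i) (S' (N + 2 - i)) z) =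
            pb B H2 SN z + (\<Sum>i\<in>{3..<N}. pb B (lie_transform B S' H2 2 i) (S' (N + 2 - i)) z)"
          using \<open>3 \<le> N\<close> by (subst sum.atLeast_Suc_lessThan) (auto simp: S'_def eval_nat_numeral)
        also have "(\<Sum>i\<in>{3..<N}. pb B (lie_transform B S' H2 2 i) (S' (N + 2 - i)) z) =
            (\<Sum>i\<in>{3..<N}. pb B (lie_transform B S H2 2 i) (S (N + 2 - i)) z)"
          by (intro sum.cong refl) (auto simp: S' lt_eq)
        finally show ?thesis using \<open>3 \<le> N\<close>
          by (subst lie_transform.simps) (simp add: V_def add_divide_distrib)
      qed
      have mid: "(\<Sum>d\<in>{3..<N}. lie_transform B S' (Q' d) d N z) = U z" for z
        unfolding U_def by (intro sum.cong refl) (auto simp: S' lt_eq)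
      have "P N z = (\<Sum>d\<in>{2..N}. lie_transform B S' (Q' d) d N z)" for z
        unfolding sum_split mid using new(5)[of z] two[of z] Q2 \<open>3 \<le> N\<close>
        by (simp add: F_def Q'_def algebra_simps)
      moreover have "adm W B N (D (Suc N) * mw N) SN"
        by (rule adm_mono[OF new(1)]) (use XD mw_nonneg \<Lambda>_pos mult_right_mono[OF XD mw_nonneg[of N]] in auto)
      moreover have "adm W B N (D (Suc N) / \<Lambda> * mw N) QN"
        by (rule adm_mono[OF new(2)]) (use XD' mw_nonneg \<Lambda>_pos in \<open>auto intro!: mult_right_mono divide_right_mono\<close>)
      moreover have "real r * (X / \<Lambda> * mw N) \<le> D (Suc N) / \<Lambda> * mw N"
        using mult_right_mono[OF XD'(2), of "mw N / \<Lambda>"] mw_nonneg \<Lambda>_pos by (simp add: mult_ac)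
      then have "adm W B N (D (Suc N) / \<Lambda> * mw N) (pb B H2 SN)"
        by (rule adm_mono[OF new(3)])
      ultimately show ?thesis using True new(4) by (simp add: S'_def Q'_def)
    qed
    then show ?thesis using Q2 \<open>3 \<le> N\<close> by (intro exI[of _ S'] exI[of _ Q']) (auto simp: S')
  qed
qed

definition H :: "(nat \<Rightarrow> 'a poly_fun) \<Rightarrow> nat \<Rightarrow> 'a poly_fun" where
  "H P j = (if j = 2 then H2 else P j)"

text \<open>
  The Hamiltonian is the transform of \<open>H2 + Q\<close>, each part of which commutes with \<open>J\<close>. The
  transform \<open>E\<close> of \<open>J\<close> by the same generators therefore commutes with it through degree \<open>r - 1\<close>.
\<close>

lemma modified_action:
  assumes P: "\<And>j. 3 \<le> j \<Longrightarrow> j < r \<Longrightarrow> adm W B j (C / \<Lambda> * mw j) (P j)" and "0 \<le> C"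
  defines "D \<equiv> nf_const r C r"
  shows "\<exists>E. E 2 = J \<and> (\<forall>j. 3 \<le> j \<longrightarrow> j < r \<longrightarrow> adm W B j (real r * D * lie_growth r D ^ r * mw j) (E j)) \<and>
     (\<forall>m z. 2 \<le> m \<longrightarrow> m < r \<longrightarrow> (\<Sum>i\<in>{2..m}. pb B (E i) (H P (m + 2 - i)) z) = 0)"
proof -
  obtain S Q where Q2: "Q 2 = H2" and SQ: "\<And>i. 3 \<le> i \<Longrightarrow> i < r \<Longrightarrow>
     adm W B i (D * mw i) (S i) \<and> adm W B i (D / \<Lambda> * mw i) (Q i) \<and>
     adm W B i (D / \<Lambda> * mw i) (pb B H2 (S i)) \<and> (\<forall>z. pb B J (Q i) z = 0) \<and>
     (\<forall>z. P i z = (\<Sum>d\<in>{2..i}. lie_transform B S (Q d) d i z))"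
    using normal_form[OF P \<open>0 \<le> C\<close> order_refl] unfolding D_def by auto
  have D: "0 \<le> D" unfolding D_def by (rule nf_const_nonneg[OF \<open>0 \<le> C\<close>])
  have L: "1 \<le> lie_growth r D" by (rule lie_growth_ge_1[OF D])
  define E where "E = lie_transform B S J 2"
  \<comment> \<open>The weight of a monomial for the indicator of the cluster is at most its degree, so
    bracketing with \<open>J\<close> costs \<open>r\<close>.\<close>
  have JS: "adm W B i (real r * D * mw i) (pb B J (S i))" if i: "3 \<le> i" "i < r" for i
  proof -
    obtain ts where S: "S i = ev ts" and ts: "tame W B i (D * mw i) ts" using SQ[OF i] by (auto simp: adm_def)
    have hom: "homog B i ts" using ts by (simp add: tame_def)
    define \<mu> where "\<mu> = qweight (\<lambda>k. if \<omega> k = \<omega>\<^sub>0 then 1 else (0::complex))"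
    have "tame W B i (real r * (D * mw i)) (multiplier \<mu> ts)"
    proof (rule tame_multiplier[OF ts])
      fix a m assume "(a, m) \<in> set ts" "a \<noteq> 0"
      then have "size m \<le> r" using hom i by (auto simp: homog_def)
      moreover have "cmod (\<mu> m) \<le> size m" unfolding \<mu>_def by (rule norm_qweight_le) auto
      ultimately show "cmod (\<mu> m) \<le> real r" by linarith
    qed auto
    then have "adm W B i (cmod (- 1) * (real r * (D * mw i))) (\<lambda>z. - 1 * ev (multiplier \<mu> ts) z)"
      by (intro adm_cmult) (auto simp: adm_def)
    moreover have "(\<lambda>z. - 1 * ev (multiplier \<mu> ts) z) = pb B J (S i)"
      unfolding J_def S \<mu>_def using pb_quad[OF finB hom] by (auto simp: pb_antisym[of B "quad _ _"])
    ultimately show ?thesis by (simp add: mult.assoc)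
  qed
  have poly: "is_poly (S i)" "is_poly (Q i)" if "3 \<le> i" "i < r" for i
    using SQ[OF that] adm_is_poly by blast+
  have polyQ: "is_poly (Q i)" if "2 \<le> i" "i < r" for i
    using poly(2)[of i] that Q2 by (cases "i = 2") auto
  have "adm W B j (real r * D * lie_growth r D ^ r * mw j) (E j)" if j: "3 \<le> j" "j < r" for j
  proof (rule adm_mono)
    show "adm W B j (real r * D * lie_growth r D ^ j * mw j) (E j)"
      unfolding E_def using j D SQ JS by (intro lie_transform_adm) auto
    show "real r * D * lie_growth r D ^ j * mw j \<le> real r * D * lie_growth r D ^ r * mw j"
      using j D L mw_nonneg by (intro mult_right_mono mult_left_mono power_increasing) auto
  qed
  moreover have "(\<Sum>i\<in>{2..m}. pb B (E i) (H P (m + 2 - i)) z) = 0" if m: "2 \<le> m" "m < r" for m z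
  proof -
    have Hsum: "H P l = (\<lambda>z. \<Sum>d\<in>{2..m}. lie_transform B S (Q d) d l z)" if l: "2 \<le> l" "l \<le> m" for l
    proof
      fix z
      have "H P l z = (\<Sum>d\<in>{2..l}. lie_transform B S (Q d) d l z)"
        using l m SQ[of l] Q2 by (cases "l = 2") (auto simp: H_def)
      also have "\<dots> = (\<Sum>d\<in>{2..m}. lie_transform B S (Q d) d l z)"
        using l by (intro sum.mono_neutral_left) auto
      finally show "H P l z = (\<Sum>d\<in>{2..m}. lie_transform B S (Q d) d l z)" .
    qed
    have "(\<Sum>i\<in>{2..m}. pb B (E i) (H P (m + 2 - i)) z) =
        (\<Sum>i\<in>{2..m}. \<Sum>d\<in>{2..m}. pb B (E i) (lie_transform B S (Q d) d (m + 2 - i)) z)"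
    proof (intro sum.cong refl)
      fix i assume i: "i \<in> {2..m}"
      then have "H P (m + 2 - i) = (\<lambda>z. \<Sum>d\<in>{2..m}. lie_transform B S (Q d) d (m + 2 - i) z)"
        by (intro Hsum) auto
      moreover have "is_poly (lie_transform B S (Q d) d (m + 2 - i))" if "d \<in> {2..m}" for d
        by (rule is_poly_lie_transform) (use that i m poly(1) polyQ in auto)
      ultimately show "pb B (E i) (H P (m + 2 - i)) z =
          (\<Sum>d\<in>{2..m}. pb B (E i) (lie_transform B S (Q d) d (m + 2 - i)) z)"
        by (simp only: pb_sum_right)
    qed
    also have "\<dots> = (\<Sum>d\<in>{2..m}. \<Sum>i\<in>{2..m}. pb B (E i) (lie_transform B S (Q d) d (m + 2 - i)) z)"
      by (rule sum.swap)
    also have "\<dots> = 0"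
    proof (rule sum.neutral, rule ballI)
      fix d assume d: "d \<in> {2..m}"
      have "pb B J (Q d) z = 0" for z
        using d m SQ[of d] Q2 pb_J_H2 by (cases "d = 2") auto
      then show "(\<Sum>i\<in>{2..m}. pb B (E i) (lie_transform B S (Q d) d (m + 2 - i)) z) = 0"
        unfolding E_def using d m poly(1) polyQ by (intro lie_transform_preserves_commutation) auto
    qed
    finally show ?thesis .
  qed
  ultimately show ?thesis by (intro exI[of _ E]) (auto simp: E_def)
qed

end

section \<open>Almost conservation of an action\<close>

lemma mon_has_vector_derivative:
  fixes \<zeta> :: "real \<Rightarrow> 'v \<Rightarrow> complex"
  assumes V: "\<And>v. v \<in> V \<Longrightarrow> ((\<lambda>\<tau>. \<zeta> \<tau> v) has_vector_derivative \<zeta>' v) (at t)"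
    and "finite V" "set_mset m \<subseteq> V"
  shows "((\<lambda>\<tau>. mon m (\<zeta> \<tau>)) has_vector_derivative
    (\<Sum>v\<in>V. of_nat (count m v) * mon (m - {#v#}) (\<zeta> t) * \<zeta>' v)) (at t)"
proof -
  have "((\<lambda>\<tau>. mon m (\<zeta> \<tau>)) has_vector_derivative (\<Sum>v\<in>#m. mon (m - {#v#}) (\<zeta> t) * \<zeta>' v)) (at t)"
    using assms(3)
  proof (induction m)
    case (add x m)
    have *: "(\<Sum>v\<in>#m. mon (add_mset x m - {#v#}) (\<zeta> t) * \<zeta>' v) =
        \<zeta> t x * (\<Sum>v\<in>#m. mon (m - {#v#}) (\<zeta> t) * \<zeta>' v)"
      unfolding sum_mset_distrib_left
      by (intro arg_cong[of _ _ sum_mset] image_mset_cong) (auto simp: diff_add_mset_swap dest!: multi_member_split)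
    have "((\<lambda>\<tau>. \<zeta> \<tau> x * mon m (\<zeta> \<tau>)) has_vector_derivative
        \<zeta> t x * (\<Sum>v\<in>#m. mon (m - {#v#}) (\<zeta> t) * \<zeta>' v) + \<zeta>' x * mon m (\<zeta> t)) (at t)"
      using add V by (intro has_vector_derivative_mult) auto
    then show ?case using * by (simp add: algebra_simps)
  qed simp
  also have "(\<Sum>v\<in>#m. mon (m - {#v#}) (\<zeta> t) * \<zeta>' v) =
      (\<Sum>v\<in>V. of_nat (count m v) * (mon (m - {#v#}) (\<zeta> t) * \<zeta>' v))"
    using assms by (intro sum_count_eq_sum_mset[symmetric])
  finally show ?thesis by (simp add: mult.assoc)
qed

text \<open>
  Only the finitely many components of the curve have to be differentiable. In particular the
  curve may be differentiable in a weaker norm than the one in which it is bounded.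
\<close>

lemma ev_has_vector_derivative:
  assumes \<zeta>: "\<And>v. v \<in> vars B \<Longrightarrow> ((\<lambda>\<tau>. \<zeta> \<tau> v) has_vector_derivative \<zeta>' v) (at t)"
    and "finite B" "homog B j ts"
  shows "((\<lambda>\<tau>. ev ts (\<zeta> \<tau>)) has_vector_derivative (\<Sum>v\<in>vars B. pd v (ev ts) (\<zeta> t) * \<zeta>' v)) (at t)"
  unfolding pd_ev using assms(3)
proof (induction ts)
  case (Cons am ts)
  obtain a m where am: "am = (a, m)" by force
  have "homog B j ts" and m: "a \<noteq> 0 \<Longrightarrow> set_mset m \<subseteq> vars B"
    using Cons.prems by (auto simp: homog_def am)
  have "((\<lambda>\<tau>. a * mon m (\<zeta> \<tau>)) has_vector_derivative
      a * (\<Sum>v\<in>vars B. of_nat (count m v) * mon (m - {#v#}) (\<zeta> t) * \<zeta>' v)) (at t)"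
  proof (cases "a = 0")
    case False
    then show ?thesis using m \<zeta> \<open>finite B\<close>
      by (intro has_vector_derivative_mult_right mon_has_vector_derivative) auto
  qed simp
  moreover have "a * (\<Sum>v\<in>vars B. of_nat (count m v) * mon (m - {#v#}) (\<zeta> t) * \<zeta>' v) +
      (\<Sum>v\<in>vars B. ev (dterms v ts) (\<zeta> t) * \<zeta>' v) = (\<Sum>v\<in>vars B. ev (dterms v (am # ts)) (\<zeta> t) * \<zeta>' v)"
    unfolding sum_distrib_left sum.distrib[symmetric]
    by (intro sum.cong refl) (simp add: am algebra_simps)
  ultimately show ?case
    using has_vector_derivative_add[OF _ Cons.IH[OF \<open>homog B j ts\<close>]] by (fastforce simp: am)
qed simp

lemma quad_eq_ev:
  assumes "finite B"
  obtains ts where "quad B c = ev ts" "homog B 2 ts"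
proof -
  obtain xs where xs: "set xs = B" "distinct xs" using finite_distinct_list[OF assms] by auto
  define ts where "ts = map (\<lambda>k. (c k, {#(k, True), (k, False)#})) xs"
  have "ev ts z = (\<Sum>k\<leftarrow>xs. c k * z (k, True) * z (k, False))" for z
    unfolding ts_def by (induction xs) (auto simp: mult.assoc)
  then have "quad B c = ev ts"
    using xs by (auto simp: quad_def sum_list_distinct_conv_sum_set)
  moreover have "homog B 2 ts" using xs by (auto simp: ts_def homog_def)
  ultimately show thesis using that by blast
qed

text \<open>The bound for the correction terms of the modified action.\<close>

definition action_const :: "nat \<Rightarrow> real \<Rightarrow> real" where
  "action_const r C = real r * nf_const r C r * lie_growth r (nf_const r C r) ^ r"

lemma action_const_nonneg: "0 \<le> C \<Longrightarrow> 0 \<le> action_const r C"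
  using nf_const_nonneg[of C r r] lie_growth_ge_1[of "nf_const r C r" r] by (simp add: action_const_def)

context birkhoff begin

definition Htot :: "(nat \<Rightarrow> 'a poly_fun) \<Rightarrow> 'a poly_fun" where
  "Htot P z = (\<Sum>l\<in>{2..<r}. H P l z)"

lemma pairing_le:
  assumes "\<And>v. 0 \<le> f v" "\<And>v. 0 \<le> g v"
  shows "(\<Sum>v\<in>vars B. f v * g v) \<le> wnorm W B f * dnorm W B g"
proof -
  have "(\<Sum>v\<in>vars B. f v * g v) = (\<Sum>v\<in>vars B. \<bar>W (fst v) * f v\<bar> * \<bar>g v / W (fst v)\<bar>)"
  proof (rule sum.cong)
    fix v :: "'a \<times> bool"
    have "1 \<le> W (fst v)" by (rule W)
    then show "f v * g v = \<bar>W (fst v) * f v\<bar> * \<bar>g v / W (fst v)\<bar>"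
      using assms by (simp add: abs_mult)
  qed simp
  also have "\<dots> \<le> wnorm W B f * dnorm W B g"
    unfolding wnorm_def dnorm_def by (rule L2_set_mult_ineq)
  finally show ?thesis .
qed

text \<open>
  Along the solution the derivative of \<open>E\<close> consists of the brackets of total degree at least \<open>r\<close>
  and of the work of the force. Replacing \<open>J\<close> by \<open>E\<close> at the two endpoints costs twice the size of
  the corrections.
\<close>

lemma action_drift:
  assumes P: "\<And>j. 3 \<le> j \<Longrightarrow> j < r \<Longrightarrow> adm W B j (C / \<Lambda> * mw j) (P j)" and "0 \<le> C" and "3 \<le> r" and "0 < R"
    and deriv: "\<And>\<tau> v. \<bar>\<tau>\<bar> \<le> \<bar>t\<bar> \<Longrightarrow> v \<in> vars B \<Longrightarrow> ((\<lambda>\<tau>. \<zeta> \<tau> v) has_vector_derivative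
        (- 2 * \<i> * sg v * pd (bar v) (Htot P) (\<zeta> \<tau>) + \<phi> \<tau> v)) (at \<tau>)"
    and size: "\<And>\<tau>. \<bar>\<tau>\<bar> \<le> \<bar>t\<bar> \<Longrightarrow> wnorm W B (\<lambda>v. cmod (\<zeta> \<tau> v)) \<le> R"
    and force: "\<And>\<tau>. \<bar>\<tau>\<bar> \<le> \<bar>t\<bar> \<Longrightarrow> dnorm W B (\<lambda>v. cmod (\<phi> \<tau> v)) \<le> \<Phi>"
  defines "A \<equiv> action_const r C"
  shows "cmod (J (\<zeta> t) - J (\<zeta> 0)) \<le> 2 * (\<Sum>j\<in>{3..<r}. A * (mw j * R ^ j)) +
    \<bar>t\<bar> * (2 * (\<Sum>(i, l)\<in>{(i, l). i \<in> {3..<r} \<and> l \<in> {3..<r} \<and> r + 2 \<le> i + l}. A * (C / \<Lambda>) * (mw i * mw l * R ^ (i + l - 2))) +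
           (R * \<Phi> + (\<Sum>j\<in>{3..<r}. A * (mw j * R ^ (j - 1) * \<Phi>))))"
proof -
  obtain E where E2: "E 2 = J" and admE: "\<And>j. 3 \<le> j \<Longrightarrow> j < r \<Longrightarrow> adm W B j (A * mw j) (E j)"
    and cancel: "\<And>m z. 2 \<le> m \<Longrightarrow> m < r \<Longrightarrow> (\<Sum>i\<in>{2..m}. pb B (E i) (H P (m + 2 - i)) z) = 0"
    using modified_action[OF P \<open>0 \<le> C\<close>] unfolding A_def action_const_def by blast
  have A: "0 \<le> A" unfolding A_def by (rule action_const_nonneg[OF \<open>0 \<le> C\<close>])
  have "\<exists>ts. E j = ev ts \<and> homog B j ts" if "j \<in> {2..<r}" for j
  proof (cases "j = 2")
    case True
    then show ?thesis using quad_eq_ev[OF finB] E2 unfolding J_def by metis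
  next
    case False
    then show ?thesis using admE[of j] that by (auto simp: adm_def tame_def)
  qed
  then obtain ts where ts: "\<And>j. j \<in> {2..<r} \<Longrightarrow> E j = ev (ts j)" "\<And>j. j \<in> {2..<r} \<Longrightarrow> homog B j (ts j)"
    by metis
  have polyH: "is_poly (H P l)" if "l \<in> {2..<r}" for l
    using that P[of l] by (cases "l = 2") (auto simp: H_def dest: adm_is_poly)
  define Et where "Et = (\<lambda>z. \<Sum>j\<in>{2..<r}. E j z)"
  define X where "X = {(i, l). i \<in> {3..<r} \<and> l \<in> {3..<r} \<and> r + 2 \<le> i + l}"
  have finX: "finite X" by (rule finite_subset[of _ "{..r} \<times> {..r}"]) (auto simp: X_def)
  define D where "D = (\<lambda>\<tau>. \<Sum>j\<in>{2..<r}. \<Sum>v\<in>vars B. pd v (E j) (\<zeta> \<tau>) *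
      (- 2 * \<i> * sg v * pd (bar v) (Htot P) (\<zeta> \<tau>) + \<phi> \<tau> v))"
  have dE: "((\<lambda>\<tau>. Et (\<zeta> \<tau>)) has_vector_derivative D \<tau>) (at \<tau>)" if "\<bar>\<tau>\<bar> \<le> \<bar>t\<bar>" for \<tau>
    unfolding Et_def D_def
  proof (rule has_vector_derivative_sum)
    fix j assume j: "j \<in> {2..<r}"
    show "((\<lambda>\<tau>. E j (\<zeta> \<tau>)) has_vector_derivative (\<Sum>v\<in>vars B. pd v (E j) (\<zeta> \<tau>) *
        (- 2 * \<i> * sg v * pd (bar v) (Htot P) (\<zeta> \<tau>) + \<phi> \<tau> v))) (at \<tau>)"
      unfolding ts(1)[OF j] using deriv[OF that] finB ts(2)[OF j] by (rule ev_has_vector_derivative)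
  qed
  define S1 where "S1 = (\<lambda>z. \<Sum>(i, l)\<in>X. pb B (E i) (H P l) z)"
  define S2 where "S2 = (\<lambda>\<tau>. \<Sum>j\<in>{2..<r}. \<Sum>v\<in>vars B. pd v (E j) (\<zeta> \<tau>) * \<phi> \<tau> v)"
  have all_pairs: "(\<Sum>i\<in>{2..<r}. \<Sum>l\<in>{2..<r}. pb B (E i) (H P l) z) = S1 z" for z
  proof -
    have idx: "Suc (Suc (a + b - 2)) - a = b" if "2 \<le> a" "2 \<le> b" for a b :: nat using that by auto
    define Y where "Y = {(i, l). 2 \<le> i \<and> 2 \<le> l \<and> i + l < r + 2}"
    have finY: "finite Y" by (rule finite_subset[of _ "{..r + 2} \<times> {..r + 2}"]) (auto simp: Y_def)
    have "(\<Sum>i\<in>{2..<r}. \<Sum>l\<in>{2..<r}. pb B (E i) (H P l) z) =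
        (\<Sum>(i, l)\<in>{2..<r} \<times> {2..<r}. pb B (E i) (H P l) z)"
      by (simp add: sum.cartesian_product)
    also have "{2..<r} \<times> {2..<r} = Y \<union> X" by (auto simp: X_def Y_def)
    also have "(\<Sum>(i, l)\<in>Y \<union> X. pb B (E i) (H P l) z) = (\<Sum>(i, l)\<in>Y. pb B (E i) (H P l) z) + S1 z"
      unfolding S1_def using finX finY by (intro sum.union_disjoint) (auto simp: X_def Y_def)
    also have "(\<Sum>(i, l)\<in>Y. pb B (E i) (H P l) z) =
        (\<Sum>m\<in>{2..<r}. \<Sum>i\<in>{2..m}. pb B (E i) (H P (m + 2 - i)) z)"
      by (subst sum.Sigma, simp, simp, rule sum.reindex_bij_witness[of _
            "\<lambda>(m, i). (i, m + 2 - i)" "\<lambda>(i, l). (i + l - 2, i)"]) (auto simp: Y_def idx)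
    also have "\<dots> = 0" by (rule sum.neutral) (use cancel in auto)
    finally show ?thesis by simp
  qed
  have pdH: "pd v (Htot P) z = (\<Sum>l\<in>{2..<r}. pd v (H P l) z)" for v z
    unfolding Htot_def using polyH by (subst pd_sum) auto
  have D_eq: "D \<tau> = - 2 * \<i> * S1 (\<zeta> \<tau>) + S2 \<tau>" for \<tau>
  proof -
    have "(\<Sum>v\<in>vars B. pd v (E j) (\<zeta> \<tau>) * (- 2 * \<i> * sg v * pd (bar v) (Htot P) (\<zeta> \<tau>) + \<phi> \<tau> v)) =
       - 2 * \<i> * (\<Sum>l\<in>{2..<r}. pb B (E j) (H P l) (\<zeta> \<tau>)) + (\<Sum>v\<in>vars B. pd v (E j) (\<zeta> \<tau>) * \<phi> \<tau> v)" for j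
    proof -
      have eq: "(\<Sum>l\<in>{2..<r}. pb B (E j) (H P l) (\<zeta> \<tau>)) =
          (\<Sum>v\<in>vars B. sg v * pd v (E j) (\<zeta> \<tau>) * pd (bar v) (Htot P) (\<zeta> \<tau>))"
        unfolding pb_def pdH by (subst sum.swap) (simp add: sum_distrib_left)
      show ?thesis
        unfolding eq sum_distrib_left sum.distrib[symmetric]
        by (intro sum.cong refl) (simp add: algebra_simps)
    qed
    then have "D \<tau> = - 2 * \<i> * (\<Sum>j\<in>{2..<r}. \<Sum>l\<in>{2..<r}. pb B (E j) (H P l) (\<zeta> \<tau>)) + S2 \<tau>"
      by (simp add: D_def S2_def sum.distrib sum_distrib_left sum_negf sum_subtractf)
    then show ?thesis by (simp only: all_pairs)
  qed
  define b1 where "b1 = (\<Sum>(i, l)\<in>X. A * (C / \<Lambda>) * (mw i * mw l * R ^ (i + l - 2)))"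
  define b2 where "b2 = R * \<Phi> + (\<Sum>j\<in>{3..<r}. A * (mw j * R ^ (j - 1) * \<Phi>))"
  have S1_le: "cmod (S1 (\<zeta> \<tau>)) \<le> b1" if \<tau>: "\<bar>\<tau>\<bar> \<le> \<bar>t\<bar>" for \<tau>
    unfolding S1_def b1_def
  proof (rule sum_norm_le, clarify)
    fix i l assume il: "(i, l) \<in> X"
    have "cmod (pb B (E i) (H P l) (\<zeta> \<tau>)) \<le> (A * mw i) * (C / \<Lambda> * mw l) * R ^ (i + l - 2)"
      using il admE P size[OF \<tau>] \<open>0 < R\<close> A \<open>0 \<le> C\<close> \<Lambda>_pos mw_nonneg
      by (intro adm_pb_value[OF W finB]) (auto simp: X_def H_def)
    then show "cmod (pb B (E i) (H P l) (\<zeta> \<tau>)) \<le> A * (C / \<Lambda>) * (mw i * mw l * R ^ (i + l - 2))"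
      by (simp add: mult_ac)
  qed
  have \<Phi>: "0 \<le> \<Phi>" using force[of 0] dnorm_nonneg[of W B "\<lambda>v. cmod (\<phi> 0 v)"] by linarith
  have S2_le: "cmod (S2 \<tau>) \<le> b2" if \<tau>: "\<bar>\<tau>\<bar> \<le> \<bar>t\<bar>" for \<tau>
  proof -
    define p where "p = (\<lambda>j. \<Sum>v\<in>vars B. cmod (\<phi> \<tau> v) * cmod (pd v (E j) (\<zeta> \<tau>)))"
    have pj: "p j \<le> A * (mw j * R ^ (j - 1) * \<Phi>)" if j: "j \<in> {3..<r}" for j
    proof -
      have "p j \<le> A * mw j * R ^ (j - 1) * dnorm W B (\<lambda>v. cmod (\<phi> \<tau> v))"
        unfolding p_def using j size[OF \<tau>] \<open>0 < R\<close> by (intro adm_pairing admE) auto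
      also have "\<dots> \<le> A * mw j * R ^ (j - 1) * \<Phi>"
        using force[OF \<tau>] A mw_nonneg \<open>0 < R\<close> by (intro mult_left_mono) auto
      finally show ?thesis by (simp add: mult_ac)
    qed
    have "p 2 = (\<Sum>v\<in>vars B. cmod (pd v J (\<zeta> \<tau>)) * cmod (\<phi> \<tau> v))" unfolding p_def E2 by (simp add: mult.commute)
    also have "\<dots> \<le> (\<Sum>v\<in>vars B. cmod (\<zeta> \<tau> (bar v)) * cmod (\<phi> \<tau> v))"
      unfolding J_def using finB by (intro sum_mono mult_right_mono) (auto simp: pd_quad norm_mult)
    also have "\<dots> \<le> wnorm W B (\<lambda>v. cmod (\<zeta> \<tau> (bar v))) * dnorm W B (\<lambda>v. cmod (\<phi> \<tau> v))"
      by (rule pairing_le) auto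
    also have "\<dots> \<le> R * \<Phi>"
      unfolding wnorm_bar[of W B "\<lambda>v. cmod (\<zeta> \<tau> v)"] using size[OF \<tau>] force[OF \<tau>] \<open>0 < R\<close> by (intro mult_mono) auto
    finally have p2: "p 2 \<le> R * \<Phi>" .
    have "cmod (S2 \<tau>) \<le> (\<Sum>j\<in>{2..<r}. p j)"
      unfolding S2_def p_def
      by (intro sum_norm_le order_trans[OF norm_sum] sum_mono) (auto simp: norm_mult mult.commute)
    also have "\<dots> = p 2 + (\<Sum>j\<in>{3..<r}. p j)"
      using \<open>3 \<le> r\<close> by (subst sum.atLeast_Suc_lessThan) (auto simp: eval_nat_numeral)
    also have "\<dots> \<le> b2" unfolding b2_def using p2 pj by (intro add_mono sum_mono)
    finally show ?thesis .
  qed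
  have D_le: "cmod (D \<tau>) \<le> 2 * b1 + b2" if \<tau>: "\<bar>\<tau>\<bar> \<le> \<bar>t\<bar>" for \<tau>
  proof -
    have "cmod (D \<tau>) \<le> cmod (- 2 * \<i> * S1 (\<zeta> \<tau>)) + cmod (S2 \<tau>)"
      unfolding D_eq by (rule norm_triangle_ineq)
    also have "cmod (- 2 * \<i> * S1 (\<zeta> \<tau>)) = 2 * cmod (S1 (\<zeta> \<tau>))" by (simp add: norm_mult)
    finally show ?thesis using S1_le[OF \<tau>] S2_le[OF \<tau>] by linarith
  qed
  have Edrift: "cmod (Et (\<zeta> t) - Et (\<zeta> 0)) \<le> (2 * b1 + b2) * \<bar>t\<bar>"
  proof -
    have "norm (Et (\<zeta> t) - Et (\<zeta> 0)) \<le> (2 * b1 + b2) * norm (t - 0)"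
    proof (rule differentiable_bound[where S = "{- \<bar>t\<bar>..\<bar>t\<bar>}"])
      fix \<tau> assume "\<tau> \<in> {- \<bar>t\<bar>..\<bar>t\<bar>}"
      then have \<tau>: "\<bar>\<tau>\<bar> \<le> \<bar>t\<bar>" by auto
      show "((\<lambda>\<tau>. Et (\<zeta> \<tau>)) has_derivative (\<lambda>h. h *\<^sub>R D \<tau>)) (at \<tau> within {- \<bar>t\<bar>..\<bar>t\<bar>})"
        using dE[OF \<tau>] unfolding has_vector_derivative_def by (rule has_derivative_at_withinI)
      show "onorm (\<lambda>h. h *\<^sub>R D \<tau>) \<le> 2 * b1 + b2"
        using D_le[OF \<tau>] by (intro onorm_le) (simp add: mult.commute mult_left_mono)
    qed auto
    then show ?thesis by simp
  qed
  define c where "c = (\<Sum>j\<in>{3..<r}. A * (mw j * R ^ j))"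
  have rest: "cmod (Et (\<zeta> \<tau>) - J (\<zeta> \<tau>)) \<le> c" if \<tau>: "\<bar>\<tau>\<bar> \<le> \<bar>t\<bar>" for \<tau>
  proof -
    have "Et (\<zeta> \<tau>) - J (\<zeta> \<tau>) = (\<Sum>j\<in>{3..<r}. E j (\<zeta> \<tau>))"
      unfolding Et_def using \<open>3 \<le> r\<close> E2 by (subst sum.atLeast_Suc_lessThan) (auto simp: eval_nat_numeral)
    also have "cmod \<dots> \<le> c"
      unfolding c_def
    proof (rule sum_norm_le)
      fix j assume j: "j \<in> {3..<r}"
      have "cmod (E j (\<zeta> \<tau>)) \<le> A * mw j * R ^ j"
        using j admE size[OF \<tau>] \<open>0 < R\<close> A mw_nonneg by (intro adm_value[OF W finB]) auto
      then show "cmod (E j (\<zeta> \<tau>)) \<le> A * (mw j * R ^ j)" by (simp add: mult_ac)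
    qed
    finally show ?thesis .
  qed
  have "J (\<zeta> t) - J (\<zeta> 0) = (Et (\<zeta> t) - Et (\<zeta> 0)) - (Et (\<zeta> t) - J (\<zeta> t)) + (Et (\<zeta> 0) - J (\<zeta> 0))" by simp
  then have "cmod (J (\<zeta> t) - J (\<zeta> 0)) \<le> (2 * b1 + b2) * \<bar>t\<bar> + c + c"
    using norm_triangle_ineq[of "(Et (\<zeta> t) - Et (\<zeta> 0)) - (Et (\<zeta> t) - J (\<zeta> t))" "Et (\<zeta> 0) - J (\<zeta> 0)"]
      norm_triangle_ineq4[of "Et (\<zeta> t) - Et (\<zeta> 0)" "Et (\<zeta> t) - J (\<zeta> t)"]
      rest[of t] rest[of 0] Edrift by simp
  then show ?thesis unfolding c_def[symmetric] X_def[symmetric] b1_def[symmetric] b2_def[symmetric]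
    by (simp add: mult.commute)
qed

end

definition drift_const :: "nat \<Rightarrow> real \<Rightarrow> real \<Rightarrow> real" where
  "drift_const r C k = 2 * real r * action_const r C +
     2 * (real r)\<^sup>2 * action_const r C * C + (2 + real r * action_const r C) * k"

text \<open>
  The previous lemma is applied with \<open>mw j = (\<Lambda> / \<eta>)\<^bsup>j-2\<^esup>\<close>: each degree beyond \<open>2\<close> costs one small
  divisor and one \<open>\<eta>\<close>. Setting \<open>mw j = 0\<close> for \<open>j < p\<close> is consistent with submultiplicativity and
  expresses that the generators, and with them the corrections of the action, start at degree \<open>p\<close>.
  With \<open>x = \<epsilon> / \<eta> \<le> 1\<close> the three kinds of terms are then bounded by powers of \<open>x\<close>, those
  multiplied by the time having the additional factor \<open>x\<^bsup>r-p\<^esup>\<close>. All powers of \<open>2 \<Lambda>\<close> are bounded by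
  the power \<open>2 r\<close>.
\<close>

lemma scaled_action_drift:
  fixes B :: "'a set" and \<Lambda> \<eta> \<epsilon> :: real and p r :: nat
  assumes finB: "finite B" and W: "\<And>k. 1 \<le> W k" and \<Lambda>: "1 \<le> \<Lambda>" and "0 < \<eta>" "0 < \<epsilon>" "\<epsilon> \<le> \<eta>" "3 \<le> p" "p < r"
    and nonres: "\<And>m. set_mset m \<subseteq> vars B \<Longrightarrow> 3 \<le> size m \<Longrightarrow> size m < r \<Longrightarrow>
        qweight (\<lambda>k. if \<omega> k = \<omega>\<^sub>0 then 1 else 0) m \<noteq> 0 \<Longrightarrow> 1 / \<Lambda> \<le> cmod (qweight (\<lambda>k. of_real (\<omega> k)) m)"
    and P: "\<And>j. p \<le> j \<Longrightarrow> j < r \<Longrightarrow> adm W B j (C / \<eta> ^ (j - 2)) (P j)" and "0 \<le> C"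
    and deriv: "\<And>\<tau> v. \<bar>\<tau>\<bar> \<le> \<bar>t\<bar> \<Longrightarrow> v \<in> vars B \<Longrightarrow> ((\<lambda>\<tau>. \<zeta> \<tau> v) has_vector_derivative
        (- 2 * \<i> * sg v * pd (bar v) (\<lambda>z. quad B (\<lambda>k. of_real (\<omega> k) / 2) z + (\<Sum>j\<in>{p..<r}. P j z)) (\<zeta> \<tau>) + \<phi> \<tau> v)) (at \<tau>)"
    and size: "\<And>\<tau>. \<bar>\<tau>\<bar> \<le> \<bar>t\<bar> \<Longrightarrow> wnorm W B (\<lambda>v. cmod (\<zeta> \<tau> v)) \<le> 2 * \<epsilon>"
    and force: "\<And>\<tau>. \<bar>\<tau>\<bar> \<le> \<bar>t\<bar> \<Longrightarrow> dnorm W B (\<lambda>v. cmod (\<phi> \<tau> v)) \<le> k * \<epsilon> * (\<epsilon> / \<eta>) ^ (r - 2)" and "0 \<le> k"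
    and time: "\<bar>t\<bar> * (\<epsilon> / \<eta>) ^ (r - p) \<le> 1"
  defines "act \<equiv> quad B (\<lambda>k. if \<omega> k = \<omega>\<^sub>0 then 1 else 0)"
  shows "cmod (act (\<zeta> t) - act (\<zeta> 0)) \<le> drift_const r C k * (2 * \<Lambda>) ^ (2 * r) * (\<epsilon>\<^sup>2 * (\<epsilon> / \<eta>) ^ (p - 2))"
proof -
  define mw where "mw = (\<lambda>j. if j < p then 0 else (\<Lambda> / \<eta>) ^ (j - 2))"
  define P' where "P' = (\<lambda>j. if j < p then (\<lambda>z. 0) else P j)"
  define x where "x = \<epsilon> / \<eta>"
  \<comment> \<open>each mode and its conjugate are two variables, so the norm of the solution is at most doubled\<close>
  define R where "R = 2 * \<epsilon>"
  have x: "0 < x" "x \<le> 1" using assms(4-6) by (auto simp: x_def)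
  have xp: "x ^ a \<le> x ^ b" if "b \<le> a" for a b using x that by (intro power_decreasing) auto
  have Lp: "(2 * \<Lambda>) ^ a \<le> (2 * \<Lambda>) ^ b" if "a \<le> b" for a b using \<Lambda> that by (intro power_increasing) auto
  interpret birkhoff B W mw r \<omega> \<omega>\<^sub>0 \<Lambda>
  proof
    fix i l :: nat assume il: "3 \<le> i" "3 \<le> l"
    have "(\<Lambda> / \<eta>) ^ (i - 2) * (\<Lambda> / \<eta>) ^ (l - 2) = (\<Lambda> / \<eta>) ^ (i + l - 2 - 2)"
      unfolding power_add[symmetric] using il by (intro arg_cong2[of _ _ _ _ "(^)"]) auto
    then show "mw i * mw l \<le> mw (i + l - 2)"
      using il \<Lambda> \<open>0 < \<eta>\<close> by (auto simp: mw_def)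
  qed (use finB W \<Lambda> nonres \<open>0 < \<eta>\<close> in \<open>auto simp: mw_def\<close>)
  have adm: "adm W B j (C / \<Lambda> * mw j) (P' j)" if j: "3 \<le> j" "j < r" for j
  proof (cases "j < p")
    case True
    then show ?thesis by (simp add: P'_def mw_def adm_zero)
  next
    case False
    have "\<Lambda> * 1 \<le> \<Lambda> ^ (j - 2)"
      using \<Lambda> j power_increasing[of 1 "j - 2" \<Lambda>] by simp
    then have "C / \<eta> ^ (j - 2) * (\<Lambda> / \<Lambda>) \<le> C / \<eta> ^ (j - 2) * (\<Lambda> ^ (j - 2) / \<Lambda>)"
      using \<open>0 \<le> C\<close> \<open>0 < \<eta>\<close> \<Lambda> by (intro mult_left_mono divide_right_mono) auto
    then have "C / \<eta> ^ (j - 2) \<le> C / \<Lambda> * mw j"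
      using False \<Lambda> by (simp add: mw_def power_divide mult_ac)
    then show ?thesis using P[of j] False j by (auto simp: P'_def intro: adm_mono)
  qed
  have Htot: "Htot P' = (\<lambda>z. quad B (\<lambda>k. of_real (\<omega> k) / 2) z + (\<Sum>j\<in>{p..<r}. P j z))"
  proof
    fix z
    have "Htot P' z = H2 z + (\<Sum>j\<in>{3..<r}. P' j z)"
      unfolding Htot_def using assms(7,8) by (subst sum.atLeast_Suc_lessThan) (auto simp: eval_nat_numeral H_def)
    also have "(\<Sum>j\<in>{3..<r}. P' j z) = (\<Sum>j\<in>{p..<r}. P' j z)"
      using assms(7,8) by (intro sum.mono_neutral_right) (auto simp: P'_def)
    finally show "Htot P' z = quad B (\<lambda>k. of_real (\<omega> k) / 2) z + (\<Sum>j\<in>{p..<r}. P j z)"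
      by (simp add: H2_def P'_def)
  qed
  define A where "A = action_const r C"
  have A: "0 \<le> A" unfolding A_def by (rule action_const_nonneg[OF \<open>0 \<le> C\<close>])
  define \<Phi> where "\<Phi> = k * \<epsilon> * x ^ (r - 2)"
  have \<Phi>: "0 \<le> \<Phi>" using \<open>0 \<le> k\<close> \<open>0 < \<epsilon>\<close> x by (simp add: \<Phi>_def)
  define X where "X = {(i, l). i \<in> {3..<r} \<and> l \<in> {3..<r} \<and> r + 2 \<le> i + l}"
  have "cmod (J (\<zeta> t) - J (\<zeta> 0)) \<le> 2 * (\<Sum>j\<in>{3..<r}. A * (mw j * R ^ j)) +
    \<bar>t\<bar> * (2 * (\<Sum>(i, l)\<in>X. A * (C / \<Lambda>) * (mw i * mw l * R ^ (i + l - 2))) +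
           (R * \<Phi> + (\<Sum>j\<in>{3..<r}. A * (mw j * R ^ (j - 1) * \<Phi>))))"
    unfolding A_def X_def
    by (rule action_drift[OF adm \<open>0 \<le> C\<close>, where \<phi> = \<phi>])
       (use assms(4-8) deriv size force in \<open>auto simp: Htot R_def \<Phi>_def x_def\<close>)
  also have "J = act"
    by (simp add: J_def act_def)
  finally have main: "cmod (act (\<zeta> t) - act (\<zeta> 0)) \<le> 2 * (\<Sum>j\<in>{3..<r}. A * (mw j * R ^ j)) +
    \<bar>t\<bar> * (2 * (\<Sum>(i, l)\<in>X. A * (C / \<Lambda>) * (mw i * mw l * R ^ (i + l - 2))) +
           (R * \<Phi> + (\<Sum>j\<in>{3..<r}. A * (mw j * R ^ (j - 1) * \<Phi>))))" .
  define G where "G = (2 * \<Lambda>) ^ (2 * r)"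
  have G: "1 \<le> G" unfolding G_def using \<Lambda> by (intro one_le_power) auto
  have low: "(\<Lambda> / \<eta>) ^ a * R ^ a = (2 * \<Lambda>) ^ a * x ^ a" for a
    unfolding power_mult_distrib[symmetric] by (simp add: R_def x_def mult_ac)
  have pw: "y ^ a * y ^ b = y ^ c" if "a + b = c" for y :: real and a b c
    using that by (simp flip: power_add)
  have split: "R ^ (a + b) = R ^ a * R ^ b" for a b by (rule power_add)
  have t1: "mw j * R ^ j \<le> G * (\<epsilon>\<^sup>2 * x ^ (p - 2))" if j: "3 \<le> j" "j < r" for j
  proof (cases "j < p")
    case False
    have "R ^ j = R ^ (j - 2) * R ^ 2" unfolding split[symmetric] using j by (intro arg_cong[of _ _ "(^) R"]) simp
    then have "mw j * R ^ j = (2 * \<Lambda>) ^ (j - 2) * x ^ (j - 2) * (4 * \<epsilon>\<^sup>2)"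
      using False low[of "j - 2"] by (simp add: mw_def R_def power2_eq_square)
    also have "\<dots> \<le> (2 * \<Lambda>) ^ (j - 2) * x ^ (p - 2) * ((2 * \<Lambda>)\<^sup>2 * \<epsilon>\<^sup>2)"
    proof -
      have "4 \<le> (2 * \<Lambda>)\<^sup>2" using \<Lambda> power_mono[of 2 "2 * \<Lambda>" 2] by simp
      then show ?thesis using xp[of "p - 2" "j - 2"] False \<Lambda> x
        by (intro mult_mono mult_left_mono mult_right_mono) auto
    qed
    also have "\<dots> = (2 * \<Lambda>) ^ j * (\<epsilon>\<^sup>2 * x ^ (p - 2))"
    proof -
      have e: "(2 * \<Lambda>) ^ j = (2 * \<Lambda>) ^ (j - 2) * (2 * \<Lambda>)\<^sup>2" using j by (intro pw[symmetric]) simp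
      show ?thesis unfolding e by (simp only: mult_ac)
    qed
    also have "\<dots> \<le> G * (\<epsilon>\<^sup>2 * x ^ (p - 2))"
      unfolding G_def using Lp[of j "2 * r"] j x by (intro mult_right_mono) auto
    finally show ?thesis .
  qed (use G x in \<open>auto simp: mw_def\<close>)
  have t2: "mw i * mw l * R ^ (i + l - 2) \<le> G * (\<epsilon>\<^sup>2 * x ^ (r - 2))" if il: "(i, l) \<in> X" for i l
  proof (cases "i < p \<or> l < p")
    case False
    have i: "3 \<le> i" "i < r" "3 \<le> l" "l < r" "r + 2 \<le> i + l" using il by (auto simp: X_def)
    have "R ^ (i + l - 2) = R ^ (i - 2) * R ^ (l - 2) * R ^ 2"
      unfolding split[symmetric] using i by (intro arg_cong[of _ _ "(^) R"]) simp
    then have "mw i * mw l * R ^ (i + l - 2) = (2 * \<Lambda>) ^ (i - 2) * x ^ (i - 2) * ((2 * \<Lambda>) ^ (l - 2) * x ^ (l - 2)) * R ^ 2"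
      using False unfolding low[symmetric] by (simp add: mw_def)
    also have "\<dots> = (2 * \<Lambda>) ^ (i + l - 4) * x ^ (i + l - 4) * (4 * \<epsilon>\<^sup>2)"
    proof -
      have e: "y ^ (i + l - 4) = y ^ (i - 2) * y ^ (l - 2)" for y :: real using i by (intro pw[symmetric]) simp
      have "R ^ 2 = 4 * \<epsilon>\<^sup>2" by (simp add: R_def power_mult_distrib)
      then show ?thesis unfolding e by (simp only: mult_ac)
    qed
    also have "\<dots> \<le> (2 * \<Lambda>) ^ (i + l - 4) * x ^ (r - 2) * ((2 * \<Lambda>)\<^sup>2 * \<epsilon>\<^sup>2)"
    proof -
      have "4 \<le> (2 * \<Lambda>)\<^sup>2" using \<Lambda> power_mono[of 2 "2 * \<Lambda>" 2] by simp
      then show ?thesis using xp[of "r - 2" "i + l - 4"] i \<Lambda> x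
        by (intro mult_mono mult_left_mono mult_right_mono) auto
    qed
    also have "\<dots> = (2 * \<Lambda>) ^ (i + l - 2) * (\<epsilon>\<^sup>2 * x ^ (r - 2))"
    proof -
      have e: "(2 * \<Lambda>) ^ (i + l - 2) = (2 * \<Lambda>) ^ (i + l - 4) * (2 * \<Lambda>)\<^sup>2" using i by (intro pw[symmetric]) simp
      show ?thesis unfolding e by (simp only: mult_ac)
    qed
    also have "\<dots> \<le> G * (\<epsilon>\<^sup>2 * x ^ (r - 2))"
      unfolding G_def using Lp[of "i + l - 2" "2 * r"] i x by (intro mult_right_mono) auto
    finally show ?thesis .
  qed (use G x in \<open>auto simp: mw_def\<close>)
  have t3: "mw j * R ^ (j - 1) * \<Phi> \<le> G * (k * (\<epsilon>\<^sup>2 * x ^ (r - 2)))" if j: "3 \<le> j" "j < r" for j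
  proof (cases "j < p")
    case False
    have "R ^ (j - 1) = R ^ (j - 2) * R ^ 1" unfolding split[symmetric] using j by (intro arg_cong[of _ _ "(^) R"]) simp
    then have "mw j * R ^ (j - 1) = (2 * \<Lambda>) ^ (j - 2) * x ^ (j - 2) * (2 * \<epsilon>)"
      using False low[of "j - 2"] by (simp add: mw_def R_def)
    also have "\<dots> \<le> (2 * \<Lambda>) ^ (j - 2) * 1 * ((2 * \<Lambda>) ^ 1 * \<epsilon>)"
      using \<Lambda> x \<open>0 < \<epsilon>\<close> by (intro mult_mono mult_left_mono mult_right_mono power_le_one) auto
    also have "\<dots> = (2 * \<Lambda>) ^ (j - 1) * \<epsilon>"
    proof -
      have e: "(2 * \<Lambda>) ^ (j - 1) = (2 * \<Lambda>) ^ (j - 2) * (2 * \<Lambda>) ^ 1" using j by (intro pw[symmetric]) simp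
      show ?thesis unfolding e by simp
    qed
    also have "\<dots> \<le> G * \<epsilon>"
      unfolding G_def using Lp[of "j - 1" "2 * r"] j \<open>0 < \<epsilon>\<close> by (intro mult_right_mono) auto
    finally have "mw j * R ^ (j - 1) * \<Phi> \<le> G * \<epsilon> * \<Phi>" using \<Phi> by (rule mult_right_mono)
    then show ?thesis by (simp add: \<Phi>_def power2_eq_square mult_ac)
  qed (use G x \<open>0 \<le> k\<close> in \<open>auto simp: mw_def\<close>)
  define Q where "Q = \<epsilon>\<^sup>2 * x ^ (r - 2)"
  have Q: "0 \<le> Q" using x by (simp add: Q_def)
  have s1: "2 * (\<Sum>j\<in>{3..<r}. A * (mw j * R ^ j)) \<le> 2 * (real r * (A * (G * (\<epsilon>\<^sup>2 * x ^ (p - 2)))))"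
  proof (rule mult_left_mono)
    have "(\<Sum>j\<in>{3..<r}. A * (mw j * R ^ j)) \<le> of_nat (card {3..<r}) * (A * (G * (\<epsilon>\<^sup>2 * x ^ (p - 2))))"
      using t1 A by (intro sum_bounded_above mult_left_mono) auto
    also have "\<dots> \<le> real r * (A * (G * (\<epsilon>\<^sup>2 * x ^ (p - 2))))"
      using A G x by (intro mult_right_mono) auto
    finally show "(\<Sum>j\<in>{3..<r}. A * (mw j * R ^ j)) \<le> real r * (A * (G * (\<epsilon>\<^sup>2 * x ^ (p - 2))))" .
  qed simp
  have s2: "(\<Sum>(i, l)\<in>X. A * (C / \<Lambda>) * (mw i * mw l * R ^ (i + l - 2))) \<le> (real r)\<^sup>2 * (A * C * (G * Q))"
  proof -
    have sub: "X \<subseteq> {..<r} \<times> {..<r}" by (auto simp: X_def)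
    have "card X \<le> r * r" using card_mono[OF _ sub] by simp
    then have cX: "real (card X) \<le> (real r)\<^sup>2" by (simp add: power2_eq_square flip: of_nat_mult)
    have "C / \<Lambda> \<le> C / 1" using \<Lambda> \<open>0 \<le> C\<close> by (intro divide_left_mono) auto
    then have AC: "A * (C / \<Lambda>) \<le> A * C" using A by (intro mult_left_mono) auto
    have "(\<Sum>(i, l)\<in>X. A * (C / \<Lambda>) * (mw i * mw l * R ^ (i + l - 2))) \<le> of_nat (card X) * (A * C * (G * Q))"
    proof (rule sum_bounded_above)
      fix il assume il: "il \<in> X"
      obtain i l where [simp]: "il = (i, l)" by force
      have "A * (C / \<Lambda>) * (mw i * mw l * R ^ (i + l - 2)) \<le> A * C * (G * Q)"
      proof (rule mult_mono[OF AC])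
        show "mw i * mw l * R ^ (i + l - 2) \<le> G * Q" using t2[of i l] il by (simp add: Q_def)
        show "0 \<le> A * C" "0 \<le> mw i * mw l * R ^ (i + l - 2)"
          using A \<open>0 \<le> C\<close> mw_nonneg \<open>0 < \<epsilon>\<close> by (auto simp: R_def)
      qed
      then show "(case il of (i, l) \<Rightarrow> A * (C / \<Lambda>) * (mw i * mw l * R ^ (i + l - 2))) \<le> A * C * (G * Q)" by simp
    qed
    also have "\<dots> \<le> (real r)\<^sup>2 * (A * C * (G * Q))"
      using cX A \<open>0 \<le> C\<close> G Q by (intro mult_right_mono) auto
    finally show ?thesis .
  qed
  have s3: "(\<Sum>j\<in>{3..<r}. A * (mw j * R ^ (j - 1) * \<Phi>)) \<le> real r * (A * (G * (k * Q)))"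
  proof -
    have "(\<Sum>j\<in>{3..<r}. A * (mw j * R ^ (j - 1) * \<Phi>)) \<le> of_nat (card {3..<r}) * (A * (G * (k * Q)))"
      unfolding Q_def using t3 A by (intro sum_bounded_above mult_left_mono) auto
    also have "\<dots> \<le> real r * (A * (G * (k * Q)))"
      using A G Q \<open>0 \<le> k\<close> by (intro mult_right_mono) auto
    finally show ?thesis .
  qed
  have s4: "R * \<Phi> \<le> 2 * (G * (k * Q))"
  proof -
    have "R * \<Phi> = 2 * (k * Q)" by (simp add: R_def \<Phi>_def Q_def power2_eq_square mult_ac)
    also have "\<dots> \<le> 2 * (G * (k * Q))" using mult_right_mono[OF G, of "k * Q"] \<open>0 \<le> k\<close> Q by simp
    finally show ?thesis .
  qed
  have tQ: "\<bar>t\<bar> * Q \<le> \<epsilon>\<^sup>2 * x ^ (p - 2)"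
  proof -
    have "r - 2 = (r - p) + (p - 2)" using assms(7,8) by simp
    then have "\<bar>t\<bar> * Q = (\<bar>t\<bar> * x ^ (r - p)) * (\<epsilon>\<^sup>2 * x ^ (p - 2))" by (simp add: Q_def power_add mult_ac)
    also have "\<dots> \<le> 1 * (\<epsilon>\<^sup>2 * x ^ (p - 2))" using time x by (intro mult_right_mono) (auto simp: x_def)
    finally show ?thesis by simp
  qed
  define T where "T = 2 * (real r)\<^sup>2 * A * C + (2 + real r * A) * k"
  have T: "0 \<le> T" using A \<open>0 \<le> C\<close> \<open>0 \<le> k\<close> by (simp add: T_def)
  have "\<bar>t\<bar> * (2 * (\<Sum>(i, l)\<in>X. A * (C / \<Lambda>) * (mw i * mw l * R ^ (i + l - 2))) +
           (R * \<Phi> + (\<Sum>j\<in>{3..<r}. A * (mw j * R ^ (j - 1) * \<Phi>)))) \<le>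
      \<bar>t\<bar> * (2 * ((real r)\<^sup>2 * (A * C * (G * Q))) + (2 * (G * (k * Q)) + real r * (A * (G * (k * Q)))))"
    using s2 s3 s4 by (intro mult_left_mono add_mono) auto
  also have "\<dots> = T * G * (\<bar>t\<bar> * Q)" by (simp add: T_def algebra_simps)
  also have "\<dots> \<le> T * G * (\<epsilon>\<^sup>2 * x ^ (p - 2))" using tQ T G by (intro mult_left_mono) auto
  finally have "cmod (act (\<zeta> t) - act (\<zeta> 0)) \<le> 2 * (real r * (A * (G * (\<epsilon>\<^sup>2 * x ^ (p - 2))))) + T * G * (\<epsilon>\<^sup>2 * x ^ (p - 2))"
    using main s1 by linarith
  also have "\<dots> = drift_const r C k * G * (\<epsilon>\<^sup>2 * x ^ (p - 2))"
    by (simp add: drift_const_def T_def A_def algebra_simps)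
  finally show ?thesis by (simp add: G_def x_def)
qed

section \<open>A multilinear estimate on the lattice\<close>

lemma site_norm_L2: "site_norm d n = L2_set (\<lambda>i. real_of_int (n i)) {..<d}"
  by (simp add: site_norm_def L2_set_def)

lemma site_norm_nonneg [simp]: "0 \<le> site_norm d n"
  by (simp add: site_norm_L2)

lemma jap_ge_1 [simp]: "1 \<le> jap d n"
  by (simp add: jap_def)

lemma jap_pos [simp]: "0 < jap d n"
  using jap_ge_1[of d n] by linarith

lemma jap_nonneg [simp]: "0 \<le> jap d n"
  using jap_ge_1[of d n] by linarith

lemma site_norm_le_jap: "site_norm d n \<le> jap d n"
  unfolding jap_def by (rule real_le_rsqrt) simp

lemma jap_le: "jap d n \<le> 1 + site_norm d n"
  unfolding jap_def by (rule real_le_lsqrt) (auto simp: power2_eq_square algebra_simps)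

lemma site_norm_sum: "site_norm d (\<lambda>i. \<Sum>l\<in>S. f l i) \<le> (\<Sum>l\<in>S. site_norm d (f l))"
proof (induction S rule: infinite_finite_induct)
  case (insert x S)
  have "site_norm d (\<lambda>i. f x i + (\<Sum>l\<in>S. f l i)) \<le> site_norm d (f x) + site_norm d (\<lambda>i. \<Sum>l\<in>S. f l i)"
    unfolding site_norm_L2 using L2_set_triangle_ineq by fastforce
  then show ?case using insert by simp
qed (auto simp: site_norm_L2 L2_set_def)

lemma signs_cases: "\<nu> \<in> signs d \<Longrightarrow> i < d \<Longrightarrow> \<nu> i = 1 \<or> \<nu> i = -1"
  by (auto simp: signs_def tuples_def PiE_def Pi_def)

lemma site_norm_reflect:
  assumes "\<nu> \<in> signs d"
  shows "site_norm d (\<lambda>i. \<nu> i * n i) = site_norm d n"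
  unfolding site_norm_def
proof (intro arg_cong[of _ _ sqrt] sum.cong refl)
  fix i assume "i \<in> {..<d}"
  then have "\<nu> i = 1 \<or> \<nu> i = -1" using signs_cases[OF assms] by auto
  then show "(real_of_int (\<nu> i * n i))\<^sup>2 = (real_of_int (n i))\<^sup>2" by auto
qed

lemma site_norm_uminus: "site_norm d (\<lambda>i. - n i) = site_norm d n"
  by (simp add: site_norm_def)

lemma site_norm_cong: "(\<And>i. i < d \<Longrightarrow> n i = m i) \<Longrightarrow> site_norm d n = site_norm d m"
  by (simp add: site_norm_def)

text \<open>
  Reflections of coordinates preserve the norm, so one site of a tuple is controlled by the signed
  sum and the other sites.
\<close>

lemma site_norm_le_others:
  assumes \<nu>: "\<nu> \<in> tuples r (signs d)" and i: "i < r"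
  shows "site_norm d (n i) \<le> site_norm d (signed_sum d r \<nu> n) + (\<Sum>l\<in>{..<r} - {i}. site_norm d (n l))"
proof -
  have \<nu>l: "\<nu> l \<in> signs d" if "l < r" for l using \<nu> that by (auto simp: tuples_def)
  define f where "f = (\<lambda>l j. if l = i then signed_sum d r \<nu> n j else - (\<nu> l j * n l j))"
  have "site_norm d (n i) = site_norm d (\<lambda>j. \<nu> i j * n i j)"
    by (rule site_norm_reflect[OF \<nu>l[OF i], symmetric])
  also have "\<dots> = site_norm d (\<lambda>j. \<Sum>l\<in>{..<r}. f l j)"
  proof (rule site_norm_cong)
    fix j assume j: "j < d"
    have "(\<Sum>l\<in>{..<r}. f l j) = signed_sum d r \<nu> n j - (\<Sum>l\<in>{..<r} - {i}. \<nu> l j * n l j)"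
      using i by (subst sum.remove[of _ i]) (auto simp: f_def sum_negf)
    also have "signed_sum d r \<nu> n j = \<nu> i j * n i j + (\<Sum>l\<in>{..<r} - {i}. \<nu> l j * n l j)"
      using i j by (simp add: signed_sum_def) (subst sum.remove[of _ i], auto)
    finally show "\<nu> i j * n i j = (\<Sum>l\<in>{..<r}. f l j)" by simp
  qed
  also have "\<dots> \<le> (\<Sum>l\<in>{..<r}. site_norm d (f l))" by (rule site_norm_sum)
  also have "\<dots> = site_norm d (f i) + (\<Sum>l\<in>{..<r} - {i}. site_norm d (f l))"
    using i by (subst sum.remove[of _ i]) auto
  also have "(\<Sum>l\<in>{..<r} - {i}. site_norm d (f l)) = (\<Sum>l\<in>{..<r} - {i}. site_norm d (n l))"
  proof (intro sum.cong refl)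
    fix l assume "l \<in> {..<r} - {i}"
    then have "site_norm d (f l) = site_norm d (\<lambda>j. \<nu> l j * n l j)"
      using site_norm_uminus[of d "\<lambda>j. \<nu> l j * n l j"] by (simp add: f_def)
    then show "site_norm d (f l) = site_norm d (n l)"
      using \<open>l \<in> _\<close> site_norm_reflect[OF \<nu>l] by simp
  qed
  finally show ?thesis by (simp add: f_def)
qed

lemma weight_sum_1d:
  assumes "y > 1 / 2"
  shows "\<exists>C. \<forall>m::nat. (\<Sum>k\<in>{- int m..int m}. (1 + (real_of_int k)\<^sup>2) powr (- y)) \<le> C"
proof -
  define g where "g = (\<lambda>n. real n powr (- 2 * y))"
  have "summable g" unfolding g_def using assms by (subst summable_real_powr_iff) auto
  have pt: "(1 + (real_of_int k)\<^sup>2) powr (- y) \<le> (if k = 0 then 1 else g (nat \<bar>k\<bar>))" for k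
  proof (cases "k = 0")
    case False
    have "(1 + (real_of_int k)\<^sup>2) powr (- y) \<le> ((real_of_int k)\<^sup>2) powr (- y)"
      using False assms by (intro powr_mono2') auto
    also have "(real_of_int k)\<^sup>2 = real (nat \<bar>k\<bar>) powr 2" using False by simp
    also have "(real (nat \<bar>k\<bar>) powr 2) powr (- y) = g (nat \<bar>k\<bar>)" unfolding powr_powr g_def by simp
    finally show ?thesis using False by simp
  qed simp
  have "(\<Sum>k\<in>{- int m..int m}. (1 + (real_of_int k)\<^sup>2) powr (- y)) \<le> 1 + 2 * suminf g" for m
  proof -
    have "{- int m..int m} = insert 0 (int ` {1..m} \<union> (\<lambda>n. - int n) ` {1..m})"
    proof (intro equalityI subsetI)
      fix k assume "k \<in> {- int m..int m}"
      then show "k \<in> insert 0 (int ` {1..m} \<union> (\<lambda>n. - int n) ` {1..m})"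
        by (cases k rule: int_cases2) (auto simp: image_iff intro: bexI[of _ "nat k"])
    qed auto
    then have "(\<Sum>k\<in>{- int m..int m}. (1 + (real_of_int k)\<^sup>2) powr (- y)) \<le>
        (\<Sum>k\<in>insert 0 (int ` {1..m} \<union> (\<lambda>n. - int n) ` {1..m}). if k = 0 then 1 else g (nat \<bar>k\<bar>))"
      using pt by (simp only:) (rule sum_mono)
    also have "\<dots> = 1 + (\<Sum>k\<in>int ` {1..m} \<union> (\<lambda>n. - int n) ` {1..m}. if k = 0 then 1 else g (nat \<bar>k\<bar>))"
      by (subst sum.insert) auto
    also have "(\<Sum>k\<in>int ` {1..m} \<union> (\<lambda>n. - int n) ` {1..m}. if k = 0 then 1 else g (nat \<bar>k\<bar>)) =
        (\<Sum>k\<in>int ` {1..m}. if k = 0 then 1 else g (nat \<bar>k\<bar>)) + (\<Sum>k\<in>(\<lambda>n. - int n) ` {1..m}. if k = 0 then 1 else g (nat \<bar>k\<bar>))"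
      by (rule sum.union_disjoint) auto
    also have "\<dots> = (\<Sum>n\<in>{1..m}. g n) + (\<Sum>n\<in>{1..m}. g n)"
      by (subst (1 2) sum.reindex) (auto simp: inj_on_def)
    also have "(\<Sum>n\<in>{1..m}. g n) \<le> suminf g"
      by (rule sum_le_suminf[OF \<open>summable g\<close>]) (auto simp: g_def)
    finally show ?thesis by simp
  qed
  then show ?thesis by blast
qed

text \<open>
  As \<open>\<langle>k\<rangle>\<^bsup>2d\<^esup>\<close> dominates the product of the \<open>1 + k\<^sub>i\<^sup>2\<close>, the sum is bounded by a product of \<open>d\<close>
  convergent sums over the integers.
\<close>

lemma weight_sum_bound:
  assumes "d \<ge> 1" "x > real d"
  shows "\<exists>C\<ge>1. \<forall>A. finite A \<longrightarrow> A \<subseteq> Zd d \<longrightarrow> (\<Sum>k\<in>A. jap d k powr (- x)) \<le> C"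
proof -
  define y where "y = x / (2 * real d)"
  have "y > 1 / 2" using assms by (simp add: y_def field_simps)
  then obtain C where C: "\<And>m::nat. (\<Sum>k\<in>{- int m..int m}. (1 + (real_of_int k)\<^sup>2) powr (- y)) \<le> C"
    using weight_sum_1d by blast
  have pt: "jap d k powr (- x) \<le> (\<Prod>i<d. (1 + (real_of_int (k i))\<^sup>2) powr (- y))" for k
  proof -
    have "(\<Prod>i<d. (1 + (real_of_int (k i))\<^sup>2)) \<le> (\<Prod>i<d. (jap d k)\<^sup>2)"
    proof (rule prod_mono, intro conjI)
      fix i assume "i \<in> {..<d}"
      then have "(real_of_int (k i))\<^sup>2 \<le> (\<Sum>j<d. (real_of_int (k j))\<^sup>2)" by (intro member_le_sum) auto
      then show "1 + (real_of_int (k i))\<^sup>2 \<le> (jap d k)\<^sup>2"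
        by (simp add: jap_def site_norm_def sum_nonneg)
    qed auto
    also have "\<dots> = jap d k powr (2 * real d)"
      using powr_realpow[of "jap d k" "2 * d"] by (simp add: power_mult)
    finally have "(jap d k powr (2 * real d)) powr (- y) \<le> (\<Prod>i<d. (1 + (real_of_int (k i))\<^sup>2)) powr (- y)"
      using \<open>y > 1 / 2\<close> by (intro powr_mono2') (auto intro!: prod_pos add_pos_nonneg)
    also have "(jap d k powr (2 * real d)) powr (- y) = jap d k powr (- x)"
      using assms by (simp add: powr_powr y_def)
    also have "(\<Prod>i<d. (1 + (real_of_int (k i))\<^sup>2)) powr (- y) = (\<Prod>i<d. (1 + (real_of_int (k i))\<^sup>2) powr (- y))"
      by (rule prod_powr_distrib)
    finally show ?thesis .
  qed
  have "(\<Sum>k\<in>A. jap d k powr (- x)) \<le> max 1 (C ^ d)" if A: "finite A" "A \<subseteq> Zd d" for A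
  proof -
    define S where "S = (\<lambda>(k, i). \<bar>k i\<bar>) ` (A \<times> {..<d})"
    have "finite S" using A by (simp add: S_def)
    define m where "m = nat (Max (insert 0 S))"
    have m: "\<bar>k i\<bar> \<le> int m" if "k \<in> A" "i < d" for k i
    proof -
      have "\<bar>k i\<bar> \<le> Max (insert 0 S)" using that \<open>finite S\<close> by (intro Max_ge) (auto simp: S_def)
      moreover have "0 \<le> Max (insert 0 S)" using \<open>finite S\<close> by (intro Max_ge) auto
      ultimately show ?thesis by (simp add: m_def)
    qed
    have "A \<subseteq> (\<Pi>\<^sub>E i\<in>{..<d}. {- int m..int m})"
    proof
      fix k assume k: "k \<in> A"
      then have "k \<in> Zd d" using A by blast
      moreover have "k i \<in> {- int m..int m}" if "i < d" for i
        using m[OF k that] by auto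
      ultimately show "k \<in> (\<Pi>\<^sub>E i\<in>{..<d}. {- int m..int m})"
        unfolding Zd_def PiE_def Pi_def by blast
    qed
    then have "(\<Sum>k\<in>A. jap d k powr (- x)) \<le> (\<Sum>k\<in>(\<Pi>\<^sub>E i\<in>{..<d}. {- int m..int m}). jap d k powr (- x))"
      by (intro sum_mono2 finite_PiE) auto
    also have "\<dots> \<le> (\<Sum>k\<in>(\<Pi>\<^sub>E i\<in>{..<d}. {- int m..int m}). \<Prod>i<d. (1 + (real_of_int (k i))\<^sup>2) powr (- y))"
      by (intro sum_mono pt)
    also have "\<dots> = (\<Prod>i<d. \<Sum>j\<in>{- int m..int m}. (1 + (real_of_int j)\<^sup>2) powr (- y))"
      by (rule prod_sum_PiE[symmetric]) auto
    also have "\<dots> \<le> (\<Prod>i<d. C)"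
      by (intro prod_mono conjI C sum_nonneg) auto
    finally show ?thesis by simp
  qed
  then show ?thesis by (intro exI[of _ "max 1 (C ^ d)"]) auto
qed

lemma sum_PiE_insert:
  assumes "finite I" "i \<notin> I" "finite A"
  shows "(\<Sum>n\<in>(insert i I) \<rightarrow>\<^sub>E A. g n) = (\<Sum>h\<in>I \<rightarrow>\<^sub>E A. \<Sum>y\<in>A. g (h(i := y)))"
proof -
  have "(\<Sum>n\<in>(insert i I) \<rightarrow>\<^sub>E A. g n) = (\<Sum>(y, h)\<in>A \<times> (I \<rightarrow>\<^sub>E A). g (h(i := y)))"
    unfolding PiE_insert_eq using inj_combinator[OF \<open>i \<notin> I\<close>, of "\<lambda>_. A"]
    by (subst sum.reindex) (auto simp: case_prod_unfold)
  also have "\<dots> = (\<Sum>y\<in>A. \<Sum>h\<in>I \<rightarrow>\<^sub>E A. g (h(i := y)))"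
    by (rule sum.cartesian_product[symmetric])
  also have "\<dots> = (\<Sum>h\<in>I \<rightarrow>\<^sub>E A. \<Sum>y\<in>A. g (h(i := y)))"
    by (rule sum.swap)
  finally show ?thesis .
qed

text \<open>Cauchy-Schwarz, with the kernel split evenly between the two factors.\<close>

lemma schur_test:
  assumes "\<And>y z. y \<in> A \<Longrightarrow> z \<in> A \<Longrightarrow> 0 \<le> w y z"
    and "\<And>y. y \<in> A \<Longrightarrow> (\<Sum>z\<in>A. w y z) \<le> C" "\<And>z. z \<in> A \<Longrightarrow> (\<Sum>y\<in>A. w y z) \<le> C"
    and "\<And>y. y \<in> A \<Longrightarrow> 0 \<le> a y" "\<And>y. y \<in> A \<Longrightarrow> 0 \<le> b y"
  shows "(\<Sum>y\<in>A. \<Sum>z\<in>A. w y z * (a y * b z)) \<le> C * (L2_set a A * L2_set b A)"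
proof (cases "A = {}")
  case False
  then obtain y0 where "y0 \<in> A" by blast
  then have C: "0 \<le> C" using assms(1,2)[of y0] sum_nonneg[of A "w y0"] by fastforce
  let ?f = "\<lambda>(y, z). sqrt (w y z) * a y" and ?g = "\<lambda>(y, z). sqrt (w y z) * b z"
  have "(\<Sum>y\<in>A. \<Sum>z\<in>A. w y z * (a y * b z)) = (\<Sum>p\<in>A \<times> A. \<bar>?f p\<bar> * \<bar>?g p\<bar>)"
    unfolding sum.cartesian_product
  proof (rule sum.cong, simp, clarify)
    fix y z assume yz: "y \<in> A" "z \<in> A"
    have "sqrt (w y z) * a y * (sqrt (w y z) * b z) = (sqrt (w y z) * sqrt (w y z)) * (a y * b z)"
      by (simp only: mult_ac)
    then show "w y z * (a y * b z) = \<bar>sqrt (w y z) * a y\<bar> * \<bar>sqrt (w y z) * b z\<bar>"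
      using assms(1)[OF yz] assms(4)[OF yz(1)] assms(5)[OF yz(2)] by simp
  qed
  also have "\<dots> \<le> L2_set ?f (A \<times> A) * L2_set ?g (A \<times> A)" by (rule L2_set_mult_ineq)
  also have "\<dots> \<le> (sqrt C * L2_set a A) * (sqrt C * L2_set b A)"
  proof (rule mult_mono)
    have "(\<Sum>p\<in>A \<times> A. (?f p)\<^sup>2) = (\<Sum>y\<in>A. \<Sum>z\<in>A. w y z * (a y)\<^sup>2)"
      unfolding sum.cartesian_product using assms(1) by (intro sum.cong) (auto simp: power_mult_distrib)
    also have "\<dots> = (\<Sum>y\<in>A. (\<Sum>z\<in>A. w y z) * (a y)\<^sup>2)" by (simp add: sum_distrib_right)
    also have "\<dots> \<le> (\<Sum>y\<in>A. C * (a y)\<^sup>2)" by (intro sum_mono mult_right_mono assms(2)) auto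
    also have "\<dots> = C * (\<Sum>y\<in>A. (a y)\<^sup>2)" by (simp add: sum_distrib_left)
    finally show "L2_set ?f (A \<times> A) \<le> sqrt C * L2_set a A"
      by (simp only: L2_set_def real_sqrt_mult[symmetric] real_sqrt_le_iff)
    have "(\<Sum>p\<in>A \<times> A. (?g p)\<^sup>2) = (\<Sum>y\<in>A. \<Sum>z\<in>A. w y z * (b z)\<^sup>2)"
      unfolding sum.cartesian_product using assms(1) by (intro sum.cong) (auto simp: power_mult_distrib)
    also have "\<dots> = (\<Sum>z\<in>A. \<Sum>y\<in>A. w y z * (b z)\<^sup>2)" by (rule sum.swap)
    also have "\<dots> = (\<Sum>z\<in>A. (\<Sum>y\<in>A. w y z) * (b z)\<^sup>2)" by (simp add: sum_distrib_right)
    also have "\<dots> \<le> (\<Sum>z\<in>A. C * (b z)\<^sup>2)" by (intro sum_mono mult_right_mono assms(3)) auto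
    also have "\<dots> = C * (\<Sum>z\<in>A. (b z)\<^sup>2)" by (simp add: sum_distrib_left)
    finally show "L2_set ?g (A \<times> A) \<le> sqrt C * L2_set b A"
      by (simp only: L2_set_def real_sqrt_mult[symmetric] real_sqrt_le_iff)
  qed (use C in auto)
  also have "\<dots> = C * (L2_set a A * L2_set b A)"
  proof -
    have "(sqrt C * L2_set a A) * (sqrt C * L2_set b A) = (sqrt C * sqrt C) * (L2_set a A * L2_set b A)"
      by (simp only: mult_ac)
    then show ?thesis using C by simp
  qed
  finally show ?thesis .
qed simp

lemma signed_sum_upd_inj:
  assumes \<nu>: "\<nu> \<in> tuples r (signs d)" and i: "i < r"
  shows "inj_on (\<lambda>y. signed_sum d r \<nu> (h(i := y))) (Zd d)"
proof (rule inj_onI)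
  fix y z assume yz: "y \<in> Zd d" "z \<in> Zd d" and eq: "signed_sum d r \<nu> (h(i := y)) = signed_sum d r \<nu> (h(i := z))"
  have "y j = z j" if j: "j < d" for j
  proof -
    have s: "signed_sum d r \<nu> (h(i := x)) j = \<nu> i j * x j + (\<Sum>l\<in>{..<r} - {i}. \<nu> l j * h l j)" for x
      using i j by (simp add: signed_sum_def) (subst sum.remove[of _ i], auto intro!: sum.cong)
    have "\<nu> i \<in> signs d" using \<nu> i by (auto simp: tuples_def)
    then have "\<nu> i j = 1 \<or> \<nu> i j = -1" using j by (rule signs_cases)
    then show ?thesis using fun_cong[OF eq, of j] unfolding s by auto
  qed
  then show "y = z" using yz unfolding Zd_def by (intro PiE_ext) auto
qed

lemma signed_sum_in_Zd: "signed_sum d r \<nu> n \<in> Zd d"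
  by (auto simp: signed_sum_def Zd_def)

text \<open>When one entry of a tuple varies, the signed sum takes each value at most once.\<close>

lemma fiber_sum_bound:
  assumes C: "\<And>A. finite A \<Longrightarrow> A \<subseteq> Zd d \<Longrightarrow> (\<Sum>k\<in>A. jap d k powr (- x)) \<le> C"
    and \<nu>: "\<nu> \<in> tuples r (signs d)" and i: "i < r" and A: "finite A" "A \<subseteq> Zd d"
  shows "(\<Sum>y\<in>A. jap d (signed_sum d r \<nu> (h(i := y))) powr (- x)) \<le> C"
proof -
  have inj: "inj_on (\<lambda>y. signed_sum d r \<nu> (h(i := y))) A"
    by (rule inj_on_subset[OF signed_sum_upd_inj[OF \<nu> i] A(2)])
  have "(\<Sum>y\<in>A. jap d (signed_sum d r \<nu> (h(i := y))) powr (- x)) =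
      (\<Sum>k\<in>(\<lambda>y. signed_sum d r \<nu> (h(i := y))) ` A. jap d k powr (- x))"
    using inj by (simp add: sum.reindex)
  also have "\<dots> \<le> C" using A signed_sum_in_Zd by (intro C) auto
  finally show ?thesis .
qed

lemma L2_set_powr: "(L2_set (\<lambda>k. jap d (g k) powr (- x)) A)\<^sup>2 = (\<Sum>k\<in>A. jap d (g k) powr (- (2 * x)))"
proof -
  have "(jap d (g k) powr (- x))\<^sup>2 = jap d (g k) powr (- (2 * x))" for k
    by (simp add: power2_eq_square powr_add[symmetric])
  then show ?thesis by (simp add: L2_set_def sum_nonneg)
qed

text \<open>
  In the application \<open>y\<close> is the weight of the distinguished site and \<open>\<sigma>\<close> may be positive. The
  largest of \<open>N\<close> and the \<open>x l\<close> bounds \<open>y\<close>, and pays for \<open>y\<^sup>\<tau>\<close>: either \<open>N\<close> loses the exponent \<open>\<tau>\<close>,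
  or some \<open>x m\<close> does, in which case what remains of its weight, with exponent \<open>t - \<tau>\<close>, is passed
  on to the smaller \<open>N\<close>.
\<close>

lemma weight_pointwise:
  fixes N :: real and x :: "'i \<Rightarrow> real"
  assumes "finite I" "1 \<le> N" "\<And>l. l \<in> I \<Longrightarrow> 1 \<le> x l" and y: "1 \<le> y" "y \<le> c * (N + sum x I)" "1 \<le> c"
    and "0 \<le> \<tau>" "\<sigma> \<le> \<tau>" "\<tau> \<le> t"
  shows "N powr (- \<alpha>) * y powr \<sigma> * (\<Prod>l\<in>I. x l powr (- t)) \<le>
    (c * (1 + card I)) powr \<tau> * (N powr (- (\<alpha> - \<tau>)) * (\<Prod>l\<in>I. x l powr (- t)) +
      (\<Sum>m\<in>I. N powr (- (\<alpha> + t - \<tau>)) * (\<Prod>l\<in>I - {m}. x l powr (- t))))"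
proof -
  let ?P = "\<lambda>S. \<Prod>l\<in>S. x l powr (- t)"
  define Mx where "Mx = Max (insert N (x ` I))"
  have fin: "finite (insert N (x ` I))" using assms(1) by auto
  have MN: "N \<le> Mx" and Mx: "x l \<le> Mx" if "l \<in> I" for l using fin that by (auto simp: Mx_def)
  have MN: "N \<le> Mx" using fin by (auto simp: Mx_def)
  have M1: "1 \<le> Mx" using MN assms(2) by linarith
  have "sum x I \<le> of_nat (card I) * Mx" using Mx by (rule sum_bounded_above)
  then have "N + sum x I \<le> (1 + card I) * Mx" using MN by (simp add: distrib_right)
  then have "y \<le> c * ((1 + card I) * Mx)" using y \<open>1 \<le> c\<close> by (meson mult_left_mono order_trans zero_le_one)
  then have "y powr \<tau> \<le> (c * (1 + card I) * Mx) powr \<tau>"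
    using y \<open>0 \<le> \<tau>\<close> by (intro powr_mono2) (auto simp: mult.assoc)
  moreover have "y powr \<sigma> \<le> y powr \<tau>" using y \<open>\<sigma> \<le> \<tau>\<close> by (intro powr_mono) auto
  ultimately have y\<sigma>: "y powr \<sigma> \<le> (c * (1 + card I)) powr \<tau> * Mx powr \<tau>"
    using \<open>1 \<le> c\<close> M1 by (simp add: powr_mult)
  have Pnn: "0 \<le> ?P S" for S by (intro prod_nonneg) auto
  have tail_nn: "0 \<le> (\<Sum>m\<in>I. N powr (- (\<alpha> + t - \<tau>)) * ?P (I - {m}))"
    by (intro sum_nonneg mult_nonneg_nonneg Pnn) auto
  have "N powr (- \<alpha>) * Mx powr \<tau> * ?P I \<le> N powr (- (\<alpha> - \<tau>)) * ?P I + (\<Sum>m\<in>I. N powr (- (\<alpha> + t - \<tau>)) * ?P (I - {m}))"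
  proof -
    have "Mx \<in> insert N (x ` I)" unfolding Mx_def using fin by (intro Max_in) auto
    then consider "Mx = N" | m where "m \<in> I" "Mx = x m" by blast
    then show ?thesis
    proof cases
      case 1
      have "N powr (- \<alpha>) * Mx powr \<tau> = N powr (- (\<alpha> - \<tau>))" unfolding 1 by (simp flip: powr_add)
      then show ?thesis using tail_nn by simp
    next
      case 2
      have "?P I = x m powr (- t) * ?P (I - {m})" using 2 assms(1) by (intro prod.remove) auto
      then have "N powr (- \<alpha>) * Mx powr \<tau> * ?P I = N powr (- \<alpha>) * Mx powr (- (t - \<tau>)) * ?P (I - {m})"
        using 2 by (simp add: powr_add[symmetric] mult.assoc[symmetric])
      also have "\<dots> \<le> N powr (- \<alpha>) * N powr (- (t - \<tau>)) * ?P (I - {m})"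
        using MN assms(2,9) Pnn by (intro mult_right_mono mult_left_mono powr_mono2') auto
      also have "\<dots> = N powr (- (\<alpha> + t - \<tau>)) * ?P (I - {m})"
        by (simp add: algebra_simps flip: powr_add)
      also have "\<dots> \<le> (\<Sum>m\<in>I. N powr (- (\<alpha> + t - \<tau>)) * ?P (I - {m}))"
        using 2 assms(1) Pnn by (intro member_le_sum[where f = "\<lambda>m. N powr (- (\<alpha> + t - \<tau>)) * ?P (I - {m})"]) (auto intro!: mult_nonneg_nonneg)
      finally show ?thesis using Pnn[of I] by (simp add: add_increasing)
    qed
  qed
  then have "(c * (1 + card I)) powr \<tau> * (N powr (- \<alpha>) * Mx powr \<tau> * ?P I) \<le>
    (c * (1 + card I)) powr \<tau> * (N powr (- (\<alpha> - \<tau>)) * ?P I + (\<Sum>m\<in>I. N powr (- (\<alpha> + t - \<tau>)) * ?P (I - {m})))"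
    by (rule mult_left_mono) simp
  moreover have "N powr (- \<alpha>) * y powr \<sigma> * ?P I \<le> (c * (1 + card I)) powr \<tau> * (N powr (- \<alpha>) * Mx powr \<tau> * ?P I)"
    using mult_left_mono[OF y\<sigma>, of "N powr (- \<alpha>) * ?P I"] Pnn[of I] by (simp add: mult_ac)
  ultimately show ?thesis by linarith
qed

lemma weighted_l1_le_l2:
  assumes "finite A" and C: "(\<Sum>k\<in>A. jap d k powr (- (2 * t))) \<le> C" and "1 \<le> C" "\<And>k. 0 \<le> b k"
  shows "(\<Sum>k\<in>A. jap d k powr (- t) * b k) \<le> C * L2_set b A"
proof -
  have "(\<Sum>k\<in>A. jap d k powr (- t) * b k) = (\<Sum>k\<in>A. \<bar>jap d k powr (- t)\<bar> * \<bar>b k\<bar>)" using assms(4) by simp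
  also have "\<dots> \<le> L2_set (\<lambda>k. jap d k powr (- t)) A * L2_set b A" by (rule L2_set_mult_ineq)
  also have "L2_set (\<lambda>k. jap d k powr (- t)) A \<le> C"
  proof (rule power2_le_imp_le)
    have "(L2_set (\<lambda>k. jap d k powr (- t)) A)\<^sup>2 \<le> C" using C L2_set_powr[of d "\<lambda>k. k" t A] by simp
    also have "C \<le> C\<^sup>2" using \<open>1 \<le> C\<close> by (simp add: power2_eq_square)
    finally show "(L2_set (\<lambda>k. jap d k powr (- t)) A)\<^sup>2 \<le> C\<^sup>2" .
  qed (use \<open>1 \<le> C\<close> in simp)
  finally show ?thesis by (simp add: mult_right_mono)
qed

text \<open>
  The form is bounded with one argument, in the slot \<open>i\<close>, in \<open>h\<^bsup>-s\<^esup>\<close> and all others in \<open>h\<^sup>s\<close>. After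
  \<open>weight_pointwise\<close> there are two kinds of sums. In the first the kernel is square summable in
  the distinguished site, and all other arguments carry a square summable weight. In the second
  one further argument has lost its weight, but the kernel is summable in each of the two sites,
  and Schur's test applies. The exponents \<open>\<rho>1\<close> and \<open>\<rho>2\<close> are the ones left for the kernel in the
  two cases; they are large enough exactly because of the hypotheses on \<open>\<alpha>\<close>, \<open>q\<close>, \<open>s\<close>.
\<close>

lemma multilinear_kernel_bound:
  assumes "d \<ge> 1" "\<alpha> > real d / 2" "s + q > real d / 2" "\<alpha> - s + q > real d / 2" "\<alpha> + 2 * q > real d" "q \<ge> 0"
  shows "\<exists>C\<ge>0. \<forall>A \<nu> i f. finite A \<longrightarrow> A \<subseteq> Zd d \<longrightarrow> \<nu> \<in> tuples r (signs d) \<longrightarrow> i < r \<longrightarrow> (\<forall>l k. 0 \<le> f l k) \<longrightarrow>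
    (\<Sum>n\<in>tuples r A. jap d (signed_sum d r \<nu> n) powr (- \<alpha>) * (\<Prod>l<r. jap d (n l) powr (- q) * f l (n l))) \<le>
    C * (L2_set (\<lambda>k. jap d k powr (- s) * f i k) A * (\<Prod>l\<in>{..<r} - {i}. L2_set (\<lambda>k. jap d k powr s * f l k) A))"
proof -
  define \<tau> where "\<tau> = max (s - q) 0"
  define t where "t = s + q"
  define \<rho>1 where "\<rho>1 = \<alpha> - \<tau>"
  define \<rho>2 where "\<rho>2 = \<alpha> + t - \<tau>"
  have \<rho>: "2 * \<rho>1 > real d" "\<rho>2 > real d" "2 * t > real d" "0 \<le> \<tau>" "s - q \<le> \<tau>" "\<tau> \<le> t"
    using assms by (auto simp: \<rho>1_def \<rho>2_def t_def \<tau>_def max_def)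
  obtain S1 where S1: "S1 \<ge> 1" "\<And>A. finite A \<Longrightarrow> A \<subseteq> Zd d \<Longrightarrow> (\<Sum>k\<in>A. jap d k powr (- (2 * \<rho>1))) \<le> S1"
    using weight_sum_bound[OF assms(1) \<rho>(1)] by blast
  obtain S2 where S2: "S2 \<ge> 1" "\<And>A. finite A \<Longrightarrow> A \<subseteq> Zd d \<Longrightarrow> (\<Sum>k\<in>A. jap d k powr (- \<rho>2)) \<le> S2"
    using weight_sum_bound[OF assms(1) \<rho>(2)] by blast
  obtain S3 where S3: "S3 \<ge> 1" "\<And>A. finite A \<Longrightarrow> A \<subseteq> Zd d \<Longrightarrow> (\<Sum>k\<in>A. jap d k powr (- (2 * t))) \<le> S3"
    using weight_sum_bound[OF assms(1) \<rho>(3)] by blast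
  define C where "C = (2 * real (Suc r)) powr \<tau> * (S1 * S3 ^ r + real r * (S2 * S3 ^ r))"
  have main: "(\<Sum>n\<in>tuples r A. jap d (signed_sum d r \<nu> n) powr (- \<alpha>) * (\<Prod>l<r. jap d (n l) powr (- q) * f l (n l))) \<le>
    C * (L2_set (\<lambda>k. jap d k powr (- s) * f i k) A * (\<Prod>l\<in>{..<r} - {i}. L2_set (\<lambda>k. jap d k powr s * f l k) A))"
    if A: "finite A" "A \<subseteq> Zd d" and \<nu>: "\<nu> \<in> tuples r (signs d)" and i: "i < r" and f: "\<forall>l k. 0 \<le> f l k" for A \<nu> i f
  proof -
    define I where "I = {..<r} - {i}"
    define N where "N = (\<lambda>n. jap d (signed_sum d r \<nu> n))"
    define a where "a = (\<lambda>k. jap d k powr (- s) * f i k)"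
    define b where "b = (\<lambda>l k. jap d k powr s * f l k)"
    define \<phi> where "\<phi> = (\<lambda>l k. jap d k powr (- t) * b l k)"
    have I: "finite I" "i \<notin> I" "insert i I = {..<r}" "card I \<le> r" using i
      by (auto simp: I_def card_Diff_singleton)
    have nn: "0 \<le> a k" "0 \<le> b l k" "0 \<le> \<phi> l k" for k l using f by (auto simp: a_def b_def \<phi>_def)
    have tup: "tuples r A = (insert i I) \<rightarrow>\<^sub>E A" using I by (simp add: tuples_def)
    define B where "B = (\<Prod>l\<in>I. L2_set (b l) A)"
    have Bnn: "0 \<le> B" by (auto simp: B_def intro!: prod_nonneg)
    have S3A: "(\<Sum>k\<in>A. \<phi> l k) \<le> S3 * L2_set (b l) A" for l
      unfolding \<phi>_def using A S3 nn by (intro weighted_l1_le_l2) auto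
    have Pphi: "(\<Prod>l\<in>K. \<Sum>k\<in>A. \<phi> l k) \<le> S3 ^ r * (\<Prod>l\<in>K. L2_set (b l) A)" if K: "K \<subseteq> I" for K
    proof -
      have "(\<Prod>l\<in>K. \<Sum>k\<in>A. \<phi> l k) \<le> (\<Prod>l\<in>K. S3 * L2_set (b l) A)"
        by (intro prod_mono conjI S3A sum_nonneg nn)
      also have "\<dots> = S3 ^ card K * (\<Prod>l\<in>K. L2_set (b l) A)" by (simp add: prod.distrib)
      also have "\<dots> \<le> S3 ^ r * (\<Prod>l\<in>K. L2_set (b l) A)"
        using S3(1) card_mono[OF I(1) K] I(4) by (intro mult_right_mono power_increasing prod_nonneg) auto
      finally show ?thesis .
    qed
    have Nfib: "(L2_set (\<lambda>y. N (h(i := y)) powr (- \<rho>1)) A) \<le> S1" for h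
    proof (rule power2_le_imp_le)
      have "(L2_set (\<lambda>y. N (h(i := y)) powr (- \<rho>1)) A)\<^sup>2 \<le> S1"
        using L2_set_powr[of d "\<lambda>y. signed_sum d r \<nu> (h(i := y))" \<rho>1 A]
          fiber_sum_bound[OF S1(2) \<nu> i A, of "h"] by (simp add: N_def)
      also have "S1 \<le> S1\<^sup>2" using S1(1) by (simp add: power2_eq_square)
      finally show "(L2_set (\<lambda>y. N (h(i := y)) powr (- \<rho>1)) A)\<^sup>2 \<le> S1\<^sup>2" .
    qed (use S1 in simp)
    have upd: "(\<Prod>l\<in>K. g l ((h(j := y)) l)) = (\<Prod>l\<in>K. g l (h l))" if "j \<notin> K" for g :: "nat \<Rightarrow> site \<Rightarrow> real" and h j y K
      using that by (intro prod.cong) auto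
    have sum1: "(\<Sum>n\<in>tuples r A. N n powr (- \<rho>1) * a (n i) * (\<Prod>l\<in>I. \<phi> l (n l))) \<le> S1 * S3 ^ r * (L2_set a A * B)"
    proof -
      have "(\<Sum>n\<in>tuples r A. N n powr (- \<rho>1) * a (n i) * (\<Prod>l\<in>I. \<phi> l (n l))) =
          (\<Sum>h\<in>I \<rightarrow>\<^sub>E A. (\<Sum>y\<in>A. N (h(i := y)) powr (- \<rho>1) * a y) * (\<Prod>l\<in>I. \<phi> l (h l)))"
        unfolding tup sum_PiE_insert[OF I(1,2) A(1)] upd[OF I(2)] by (simp add: sum_distrib_right)
      also have "\<dots> \<le> (\<Sum>h\<in>I \<rightarrow>\<^sub>E A. (S1 * L2_set a A) * (\<Prod>l\<in>I. \<phi> l (h l)))"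
      proof (intro sum_mono mult_right_mono prod_nonneg ballI nn)
        fix h
        have "(\<Sum>y\<in>A. N (h(i := y)) powr (- \<rho>1) * a y) = (\<Sum>y\<in>A. \<bar>N (h(i := y)) powr (- \<rho>1)\<bar> * \<bar>a y\<bar>)"
          using nn by simp
        also have "\<dots> \<le> L2_set (\<lambda>y. N (h(i := y)) powr (- \<rho>1)) A * L2_set a A" by (rule L2_set_mult_ineq)
        also have "\<dots> \<le> S1 * L2_set a A" using Nfib by (intro mult_right_mono) auto
        finally show "(\<Sum>y\<in>A. N (h(i := y)) powr (- \<rho>1) * a y) \<le> S1 * L2_set a A" .
      qed
      also have "\<dots> = (S1 * L2_set a A) * (\<Prod>l\<in>I. \<Sum>k\<in>A. \<phi> l k)"
        using I A by (simp add: prod_sum_PiE sum_distrib_left)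
      also have "\<dots> \<le> (S1 * L2_set a A) * (S3 ^ r * B)"
        unfolding B_def using S1 by (intro mult_left_mono Pphi) auto
      finally show ?thesis by (simp add: mult_ac)
    qed
    have sum2: "(\<Sum>n\<in>tuples r A. N n powr (- \<rho>2) * a (n i) * (b m (n m) * (\<Prod>l\<in>I - {m}. \<phi> l (n l)))) \<le> S2 * S3 ^ r * (L2_set a A * B)"
      if m: "m \<in> I" for m
    proof -
      define I' where "I' = I - {m}"
      have I': "finite I'" "m \<notin> I'" "insert m I' = I" "i \<notin> I'" "m \<noteq> i" "m < r" using m I by (auto simp: I'_def I_def)
      have "(\<Sum>n\<in>tuples r A. N n powr (- \<rho>2) * a (n i) * (b m (n m) * (\<Prod>l\<in>I'. \<phi> l (n l)))) =
          (\<Sum>h\<in>(insert m I') \<rightarrow>\<^sub>E A. \<Sum>y\<in>A. N (h(i := y)) powr (- \<rho>2) * a y * (b m (h m) * (\<Prod>l\<in>I'. \<phi> l (h l))))"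
        unfolding tup sum_PiE_insert[OF I(1,2) A(1)] upd[OF I'(4)] I'(3) using I' by simp
      also have "\<dots> = (\<Sum>h\<in>I' \<rightarrow>\<^sub>E A. (\<Sum>z\<in>A. \<Sum>y\<in>A. N ((h(m := z))(i := y)) powr (- \<rho>2) * (b m z * a y)) * (\<Prod>l\<in>I'. \<phi> l (h l)))"
        unfolding sum_PiE_insert[OF I'(1,2) A(1)] upd[OF I'(2)] by (simp only: fun_upd_same sum_distrib_right) (simp only: mult_ac)
      also have "\<dots> \<le> (\<Sum>h\<in>I' \<rightarrow>\<^sub>E A. (S2 * (L2_set (b m) A * L2_set a A)) * (\<Prod>l\<in>I'. \<phi> l (h l)))"
      proof (intro sum_mono mult_right_mono prod_nonneg ballI nn)
        fix h
        show "(\<Sum>z\<in>A. \<Sum>y\<in>A. N ((h(m := z))(i := y)) powr (- \<rho>2) * (b m z * a y)) \<le> S2 * (L2_set (b m) A * L2_set a A)"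
        proof (rule schur_test)
          show "(\<Sum>y\<in>A. N ((h(m := z))(i := y)) powr (- \<rho>2)) \<le> S2" for z
            unfolding N_def by (rule fiber_sum_bound[OF S2(2) \<nu> i A])
          show "(\<Sum>z\<in>A. N ((h(m := z))(i := y)) powr (- \<rho>2)) \<le> S2" for y
            unfolding N_def fun_upd_twist[OF I'(5)] by (rule fiber_sum_bound[OF S2(2) \<nu> I'(6) A])
        qed (auto simp: nn)
      qed
      also have "\<dots> = (S2 * (L2_set (b m) A * L2_set a A)) * (\<Prod>l\<in>I'. \<Sum>k\<in>A. \<phi> l k)"
        using I' A by (simp add: prod_sum_PiE sum_distrib_left)
      also have "\<dots> \<le> (S2 * (L2_set (b m) A * L2_set a A)) * (S3 ^ r * (\<Prod>l\<in>I'. L2_set (b l) A))"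
        using S2 by (intro mult_left_mono Pphi) (auto simp: I'_def)
      also have "\<dots> = S2 * S3 ^ r * (L2_set a A * (L2_set (b m) A * (\<Prod>l\<in>I'. L2_set (b l) A)))" by (simp add: mult_ac)
      also have "L2_set (b m) A * (\<Prod>l\<in>I'. L2_set (b l) A) = B"
        unfolding B_def I'_def using I m by (simp add: prod.remove)
      finally show ?thesis by (simp add: I'_def)
    qed
    define c where "c = (2 * real (Suc r)) powr \<tau>"
    have pt: "N n powr (- \<alpha>) * (\<Prod>l<r. jap d (n l) powr (- q) * f l (n l)) \<le>
        c * (N n powr (- \<rho>1) * a (n i) * (\<Prod>l\<in>I. \<phi> l (n l)) +
          (\<Sum>m\<in>I. N n powr (- \<rho>2) * a (n i) * (b m (n m) * (\<Prod>l\<in>I - {m}. \<phi> l (n l)))))" for n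
    proof -
      have "jap d (n i) \<le> 1 + (site_norm d (signed_sum d r \<nu> n) + (\<Sum>l\<in>I. site_norm d (n l)))"
        using jap_le[of d "n i"] site_norm_le_others[OF \<nu> i, of n] by (simp add: I_def)
      also have "\<dots> \<le> N n + (N n + (\<Sum>l\<in>I. jap d (n l)))"
        unfolding N_def by (intro add_mono sum_mono site_norm_le_jap) auto
      also have "\<dots> \<le> 2 * (N n + (\<Sum>l\<in>I. jap d (n l)))"
        using sum_nonneg[of I "\<lambda>l. jap d (n l)"] by simp
      finally have y: "jap d (n i) \<le> 2 * (N n + (\<Sum>l\<in>I. jap d (n l)))" .
      define ab where "ab = a (n i) * (\<Prod>l\<in>I. b l (n l))"
      have ab: "0 \<le> ab" unfolding ab_def by (intro mult_nonneg_nonneg prod_nonneg nn)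
      define c' where "c' = (2 * real (1 + card I)) powr \<tau>"
      have c': "c' \<le> c" unfolding c_def c'_def using \<rho>(4) I(4) by (intro powr_mono2) auto
      have e: "jap d k powr (- q) * f i k = jap d k powr (s - q) * a k" for k
        by (simp add: a_def mult.assoc[symmetric] powr_add[symmetric])
      have e': "jap d k powr (- q) * f l k = jap d k powr (- t) * b l k" for k l
        by (simp add: b_def t_def mult.assoc[symmetric] powr_add[symmetric])
      have "(\<Prod>l<r. jap d (n l) powr (- q) * f l (n l)) =
          (jap d (n i) powr (- q) * f i (n i)) * (\<Prod>l\<in>I. jap d (n l) powr (- q) * f l (n l))"
        unfolding I_def using i by (intro prod.remove) auto
      also have "\<dots> = (jap d (n i) powr (s - q) * (\<Prod>l\<in>I. jap d (n l) powr (- t))) * ab"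
        unfolding e unfolding e' ab_def prod.distrib by (simp only: mult_ac)
      finally have "N n powr (- \<alpha>) * (\<Prod>l<r. jap d (n l) powr (- q) * f l (n l)) =
          (N n powr (- \<alpha>) * jap d (n i) powr (s - q) * (\<Prod>l\<in>I. jap d (n l) powr (- t))) * ab"
        by (simp only: mult_ac)
      also have "\<dots> \<le> (c' * (N n powr (- \<rho>1) * (\<Prod>l\<in>I. jap d (n l) powr (- t)) +
          (\<Sum>m\<in>I. N n powr (- \<rho>2) * (\<Prod>l\<in>I - {m}. jap d (n l) powr (- t))))) * ab"
        unfolding c'_def \<rho>1_def \<rho>2_def using I(1) \<rho>(4-6) y
        by (intro mult_right_mono[OF _ ab] weight_pointwise[where c = 2 and I = I and x = "\<lambda>l. jap d (n l)" and
              y = "jap d (n i)" and N = "N n" and \<tau> = \<tau> and t = t and \<sigma> = "s - q" and \<alpha> = \<alpha>])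
          (simp_all add: N_def)
      also have "\<dots> \<le> (c * (N n powr (- \<rho>1) * (\<Prod>l\<in>I. jap d (n l) powr (- t)) +
          (\<Sum>m\<in>I. N n powr (- \<rho>2) * (\<Prod>l\<in>I - {m}. jap d (n l) powr (- t))))) * ab"
        using c' by (intro mult_right_mono[OF _ ab] mult_right_mono add_nonneg_nonneg sum_nonneg mult_nonneg_nonneg prod_nonneg) auto
      also have "\<dots> = c * (N n powr (- \<rho>1) * (\<Prod>l\<in>I. jap d (n l) powr (- t)) * ab +
          (\<Sum>m\<in>I. N n powr (- \<rho>2) * (\<Prod>l\<in>I - {m}. jap d (n l) powr (- t)) * ab))"
        by (simp only: sum_distrib_right distrib_right mult.assoc)
      also have "N n powr (- \<rho>1) * (\<Prod>l\<in>I. jap d (n l) powr (- t)) * ab = N n powr (- \<rho>1) * a (n i) * (\<Prod>l\<in>I. \<phi> l (n l))"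
        by (simp only: ab_def \<phi>_def prod.distrib mult_ac)
      also have "(\<Sum>m\<in>I. N n powr (- \<rho>2) * (\<Prod>l\<in>I - {m}. jap d (n l) powr (- t)) * ab) =
          (\<Sum>m\<in>I. N n powr (- \<rho>2) * a (n i) * (b m (n m) * (\<Prod>l\<in>I - {m}. \<phi> l (n l))))"
      proof (rule sum.cong[OF refl])
        fix m assume m: "m \<in> I"
        have "(\<Prod>l\<in>I. b l (n l)) = b m (n m) * (\<Prod>l\<in>I - {m}. b l (n l))" using I(1) m by (rule prod.remove)
        then show "N n powr (- \<rho>2) * (\<Prod>l\<in>I - {m}. jap d (n l) powr (- t)) * ab =
            N n powr (- \<rho>2) * a (n i) * (b m (n m) * (\<Prod>l\<in>I - {m}. \<phi> l (n l)))"
          by (simp only: ab_def \<phi>_def prod.distrib mult_ac)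
      qed
      finally show ?thesis .
    qed
    have "(\<Sum>n\<in>tuples r A. N n powr (- \<alpha>) * (\<Prod>l<r. jap d (n l) powr (- q) * f l (n l))) \<le>
       (\<Sum>n\<in>tuples r A. c * (N n powr (- \<rho>1) * a (n i) * (\<Prod>l\<in>I. \<phi> l (n l)) +
          (\<Sum>m\<in>I. N n powr (- \<rho>2) * a (n i) * (b m (n m) * (\<Prod>l\<in>I - {m}. \<phi> l (n l))))))"
      by (intro sum_mono pt)
    also have "\<dots> = c * ((\<Sum>n\<in>tuples r A. N n powr (- \<rho>1) * a (n i) * (\<Prod>l\<in>I. \<phi> l (n l))) +
          (\<Sum>m\<in>I. \<Sum>n\<in>tuples r A. N n powr (- \<rho>2) * a (n i) * (b m (n m) * (\<Prod>l\<in>I - {m}. \<phi> l (n l)))))"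
    proof -
      have "(\<Sum>m\<in>I. \<Sum>n\<in>tuples r A. N n powr (- \<rho>2) * a (n i) * (b m (n m) * (\<Prod>l\<in>I - {m}. \<phi> l (n l)))) =
          (\<Sum>n\<in>tuples r A. \<Sum>m\<in>I. N n powr (- \<rho>2) * a (n i) * (b m (n m) * (\<Prod>l\<in>I - {m}. \<phi> l (n l))))"
        by (rule sum.swap)
      then show ?thesis by (simp only: sum.distrib sum_distrib_left[symmetric])
    qed
    also have "\<dots> \<le> c * (S1 * S3 ^ r * (L2_set a A * B) + (\<Sum>m\<in>I. S2 * S3 ^ r * (L2_set a A * B)))"
      using sum1 sum2 by (intro mult_left_mono add_mono sum_mono) (auto simp: c_def)
    also have "\<dots> \<le> c * (S1 * S3 ^ r * (L2_set a A * B) + real r * (S2 * S3 ^ r * (L2_set a A * B)))"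
      using I(4) S2(1) S3(1) Bnn by (intro mult_left_mono add_left_mono) (auto simp: c_def intro!: mult_right_mono)
    also have "\<dots> = C * (L2_set a A * B)" by (simp add: C_def c_def algebra_simps)
    finally show ?thesis unfolding N_def a_def B_def b_def I_def .
  qed
  have "0 \<le> C" unfolding C_def using S1 S2 S3 by (auto intro!: mult_nonneg_nonneg add_nonneg_nonneg)
  then show ?thesis using main by blast
qed

section \<open>Multilinear forms on Sobolev sequences\<close>

lemma jap_powr_sq: "jap d k powr (2 * s) * x\<^sup>2 = (jap d k powr s * x)\<^sup>2"
proof -
  have "jap d k powr (2 * s) = jap d k powr s * jap d k powr s" by (simp flip: powr_add)
  then show ?thesis by (simp add: power2_eq_square mult_ac)
qed

abbreviation wt :: "nat \<Rightarrow> real \<Rightarrow> field \<Rightarrow> site \<Rightarrow> real" where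
  "wt d s u \<equiv> \<lambda>k. jap d k powr s * cmod (u k)"

lemma hspace_altdef: "u \<in> hspace d Z s \<longleftrightarrow> (\<forall>k. k \<notin> Z \<longrightarrow> u k = 0) \<and> (\<lambda>k. (wt d s u k)\<^sup>2) summable_on Z"
  by (simp add: hspace_def jap_powr_sq)

lemma hnorm_altdef: "hnorm d Z s u = sqrt (\<Sum>\<^sub>\<infinity>k\<in>Z. (wt d s u k)\<^sup>2)"
  by (simp add: hnorm_def jap_powr_sq)

lemma hspace_vanishes: "u \<in> hspace d Z s \<Longrightarrow> k \<notin> Z \<Longrightarrow> u k = 0"
  by (simp add: hspace_altdef)

lemma hnorm_nonneg [simp]: "0 \<le> hnorm d Z s u"
  by (simp add: hnorm_altdef infsum_nonneg)

lemma L2_set_le_hnorm: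
  assumes "u \<in> hspace d Z s" "finite A" "A \<subseteq> Z"
  shows "L2_set (wt d s u) A \<le> hnorm d Z s u"
  unfolding hnorm_altdef L2_set_def using assms
  by (intro real_sqrt_le_mono finite_sum_le_infsum) (auto simp: hspace_altdef)

text \<open>
  Membership and norm are determined by the finite sections, which reduces all facts on these
  spaces to \<open>L2_set\<close>.
\<close>

lemma hspaceI:
  assumes "\<And>k. k \<notin> Z \<Longrightarrow> u k = 0" and K: "\<And>A. finite A \<Longrightarrow> A \<subseteq> Z \<Longrightarrow> L2_set (wt d s u) A \<le> K"
  shows "u \<in> hspace d Z s" "hnorm d Z s u \<le> K"
proof -
  have K0: "0 \<le> K" using K[of "{}"] by simp
  have fin: "(\<Sum>k\<in>A. (wt d s u k)\<^sup>2) \<le> K\<^sup>2" if "finite A" "A \<subseteq> Z" for A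
  proof -
    have "sqrt (\<Sum>k\<in>A. (wt d s u k)\<^sup>2) \<le> K" using K[OF that] by (simp add: L2_set_def)
    then show ?thesis by (simp add: real_sqrt_le_iff' sum_nonneg sqrt_le_D)
  qed
  then have sm: "(\<lambda>k. (wt d s u k)\<^sup>2) summable_on Z"
    by (intro nonneg_bdd_above_summable_on bdd_aboveI[of _ "K\<^sup>2"]) auto
  then show "u \<in> hspace d Z s" using assms(1) by (simp add: hspace_altdef)
  have "(\<Sum>\<^sub>\<infinity>k\<in>Z. (wt d s u k)\<^sup>2) \<le> K\<^sup>2" using sm fin by (rule infsum_le_finite_sums)
  then show "hnorm d Z s u \<le> K" unfolding hnorm_altdef using K0 by (intro real_le_lsqrt) auto
qed

lemma has_sum_finite_sum:
  fixes f :: "'i \<Rightarrow> 'a \<Rightarrow> 'b::topological_comm_monoid_add"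
  assumes "\<And>i. i \<in> I \<Longrightarrow> (f i has_sum S i) A"
  shows "((\<lambda>x. \<Sum>i\<in>I. f i x) has_sum (\<Sum>i\<in>I. S i)) A"
  using assms by (induction I rule: infinite_finite_induct) (auto intro: has_sum_add)

lemma hspace_dominated:
  assumes "u \<in> hspace d Z s" "\<And>k. cmod (v k) \<le> cmod (u k)"
  shows "v \<in> hspace d Z s" "hnorm d Z s v \<le> hnorm d Z s u"
proof -
  have "L2_set (wt d s v) A \<le> hnorm d Z s u" if "finite A" "A \<subseteq> Z" for A
    by (rule order_trans[OF _ L2_set_le_hnorm[OF assms(1) that]])
       (intro L2_set_mono mult_left_mono assms(2), auto)
  moreover have "v k = 0" if "k \<notin> Z" for k
    using assms(2)[of k] hspace_vanishes[OF assms(1) that] by simp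
  ultimately show "v \<in> hspace d Z s" "hnorm d Z s v \<le> hnorm d Z s u"
    using hspaceI[of Z v d s "hnorm d Z s u"] by auto
qed

lemma hspace_add:
  assumes "u \<in> hspace d Z s" "v \<in> hspace d Z s"
  shows "(\<lambda>k. u k + v k) \<in> hspace d Z s" "hnorm d Z s (\<lambda>k. u k + v k) \<le> hnorm d Z s u + hnorm d Z s v"
proof -
  have *: "L2_set (wt d s (\<lambda>k. u k + v k)) A \<le> hnorm d Z s u + hnorm d Z s v" if "finite A" "A \<subseteq> Z" for A
  proof -
    have "L2_set (wt d s (\<lambda>k. u k + v k)) A \<le> L2_set (\<lambda>k. wt d s u k + wt d s v k) A"
      by (intro L2_set_mono) (auto simp flip: distrib_left intro!: mult_left_mono norm_triangle_ineq)
    also have "\<dots> \<le> L2_set (wt d s u) A + L2_set (wt d s v) A" by (rule L2_set_triangle_ineq)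
    also have "\<dots> \<le> hnorm d Z s u + hnorm d Z s v" using assms that by (intro add_mono L2_set_le_hnorm)
    finally show ?thesis .
  qed
  have z: "u k + v k = 0" if "k \<notin> Z" for k using assms that by (simp add: hspace_vanishes)
  show "(\<lambda>k. u k + v k) \<in> hspace d Z s" "hnorm d Z s (\<lambda>k. u k + v k) \<le> hnorm d Z s u + hnorm d Z s v"
    using hspaceI[OF z *] by auto
qed

lemma hspace_cmult:
  assumes "u \<in> hspace d Z s"
  shows "(\<lambda>k. c * u k) \<in> hspace d Z s" "hnorm d Z s (\<lambda>k. c * u k) \<le> cmod c * hnorm d Z s u"
proof -
  have *: "L2_set (wt d s (\<lambda>k. c * u k)) A \<le> cmod c * hnorm d Z s u" if "finite A" "A \<subseteq> Z" for A
  proof -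
    have "L2_set (wt d s (\<lambda>k. c * u k)) A = cmod c * L2_set (wt d s u) A"
      by (simp add: L2_set_right_distrib norm_mult mult_ac)
    also have "\<dots> \<le> cmod c * hnorm d Z s u" using assms that by (intro mult_left_mono L2_set_le_hnorm) auto
    finally show ?thesis .
  qed
  have z: "c * u k = 0" if "k \<notin> Z" for k using assms that by (simp add: hspace_vanishes)
  show "(\<lambda>k. c * u k) \<in> hspace d Z s" "hnorm d Z s (\<lambda>k. c * u k) \<le> cmod c * hnorm d Z s u"
    using hspaceI[OF z *] by auto
qed

lemma hspace_zero: "(\<lambda>k. 0) \<in> hspace d Z s" by (simp add: hspace_altdef)

lemma hspace_uminus: "u \<in> hspace d Z s \<Longrightarrow> (\<lambda>k. - u k) \<in> hspace d Z s"
  using hspace_cmult(1)[of u d Z s "-1"] by simp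

lemma hspace_diff: "u \<in> hspace d Z s \<Longrightarrow> v \<in> hspace d Z s \<Longrightarrow> (\<lambda>k. u k - v k) \<in> hspace d Z s"
  using hspace_add(1)[OF _ hspace_uminus, of u d Z s v] by simp

lemma hspace_sum: "(\<And>i. i \<in> I \<Longrightarrow> u i \<in> hspace d Z s) \<Longrightarrow> (\<lambda>k. \<Sum>i\<in>I. u i k) \<in> hspace d Z s"
proof (induction I rule: infinite_finite_induct)
  case (insert i I)
  then show ?case using hspace_add(1)[of "u i" d Z s "\<lambda>k. \<Sum>i\<in>I. u i k"] by simp
qed (auto simp: hspace_zero)

lemma hspace_neg:
  assumes "0 \<le> s" "u \<in> hspace d Z s"
  shows "u \<in> hspace d Z (- s)" "hnorm d Z (- s) u \<le> hnorm d Z s u"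
proof -
  have *: "L2_set (wt d (- s) u) A \<le> hnorm d Z s u" if "finite A" "A \<subseteq> Z" for A
    using assms(1)
    by (intro order_trans[OF _ L2_set_le_hnorm[OF assms(2) that]] L2_set_mono mult_right_mono powr_mono) auto
  show "u \<in> hspace d Z (- s)" "hnorm d Z (- s) u \<le> hnorm d Z s u"
    using hspaceI[OF hspace_vanishes[OF assms(2)] *] by auto
qed

lemma hspace_finite_support:
  assumes "finite A" "A \<subseteq> Z"
  shows "(\<lambda>k. if k \<in> A then f k else 0) \<in> hspace d Z s"
    "hnorm d Z s (\<lambda>k. if k \<in> A then f k else 0) \<le> L2_set (wt d s f) A"
proof -
  have *: "L2_set (wt d s (\<lambda>k. if k \<in> A then f k else 0)) A' \<le> L2_set (wt d s f) A" if "finite A'" "A' \<subseteq> Z" for A'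
  proof -
    have "(\<Sum>k\<in>A'. (wt d s (\<lambda>k. if k \<in> A then f k else 0) k)\<^sup>2) =
        (\<Sum>k\<in>A' \<inter> A. (wt d s f k)\<^sup>2)"
      using that by (intro sum.mono_neutral_cong_right) auto
    also have "\<dots> \<le> (\<Sum>k\<in>A. (wt d s f k)\<^sup>2)" using assms by (intro sum_mono2) auto
    finally show ?thesis by (simp add: L2_set_def)
  qed
  have z: "(if k \<in> A then f k else 0) = 0" if "k \<notin> Z" for k using that assms by auto
  show "(\<lambda>k. if k \<in> A then f k else 0) \<in> hspace d Z s"
    "hnorm d Z s (\<lambda>k. if k \<in> A then f k else 0) \<le> L2_set (wt d s f) A"
    using hspaceI[OF z *] by auto
qed

lemma sign_conj_norm [simp]: "cmod (sign_conj \<sigma> z) = cmod z"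
  by (simp add: sign_conj_def)

lemma sign_conj_add: "sign_conj \<sigma> (x + y) = sign_conj \<sigma> x + sign_conj \<sigma> y"
  by (simp add: sign_conj_def)

lemma hspace_sign_conj:
  assumes "u \<in> hspace d Z s"
  shows "(\<lambda>k. sign_conj \<sigma> (u k)) \<in> hspace d Z s" "hnorm d Z s (\<lambda>k. sign_conj \<sigma> (u k)) \<le> hnorm d Z s u"
  using hspace_dominated[OF assms, of "\<lambda>k. sign_conj \<sigma> (u k)"] by auto

text \<open>
  Norms are recovered by duality: the test vector is \<open>\<langle>k\<rangle>\<^bsup>2s\<^esup>\<close> times the conjugate of \<open>e\<close>.
\<close>

lemma dual_bound:
  assumes "finite A" "A \<subseteq> Z" "0 \<le> K"
    and T: "\<And>\<psi>. (\<And>k. k \<notin> A \<Longrightarrow> \<psi> k = 0) \<Longrightarrow> cmod (\<Sum>k\<in>A. \<psi> k * e k) \<le> K * L2_set (wt d (- s) \<psi>) A"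
  shows "L2_set (wt d s e) A \<le> K"
proof -
  define \<psi> where "\<psi> = (\<lambda>k. if k \<in> A then of_real (jap d k powr (2 * s)) * cnj (e k) else 0)"
  define X where "X = L2_set (wt d s e) A"
  have "wt d (- s) \<psi> k = wt d s e k" if "k \<in> A" for k
    using that by (simp add: \<psi>_def norm_mult mult.assoc[symmetric] flip: powr_add)
  then have X: "L2_set (wt d (- s) \<psi>) A = X" unfolding X_def by (intro L2_set_cong) auto
  have "(\<Sum>k\<in>A. \<psi> k * e k) = of_real (\<Sum>k\<in>A. (wt d s e k)\<^sup>2)"
    unfolding of_real_sum
  proof (rule sum.cong[OF refl])
    fix k assume "k \<in> A"
    then have "\<psi> k * e k = of_real (jap d k powr (2 * s)) * (cnj (e k) * e k)" by (simp add: \<psi>_def)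
    also have "cnj (e k) * e k = of_real ((cmod (e k))\<^sup>2)" by (metis complex_norm_square mult.commute)
    finally show "\<psi> k * e k = of_real ((wt d s e k)\<^sup>2)" by (simp only: of_real_mult[symmetric] jap_powr_sq)
  qed
  then have "cmod (\<Sum>k\<in>A. \<psi> k * e k) = X\<^sup>2" by (simp add: X_def L2_set_def sum_nonneg del: of_real_sum)
  moreover have "cmod (\<Sum>k\<in>A. \<psi> k * e k) \<le> K * X" unfolding X[symmetric] by (rule T) (simp add: \<psi>_def)
  ultimately have "X * X \<le> K * X" by (simp add: power2_eq_square)
  moreover have "0 \<le> X" by (simp add: X_def)
  ultimately have "X \<le> K" using \<open>0 \<le> K\<close> by (cases "X = 0") (auto simp: mult_le_cancel_right)
  then show ?thesis by (simp add: X_def)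
qed

definition multiform :: "site set \<Rightarrow> nat \<Rightarrow> ((nat \<Rightarrow> site) \<Rightarrow> complex) \<Rightarrow> (nat \<Rightarrow> field) \<Rightarrow> complex" where
  "multiform Z r a \<phi> = (\<Sum>\<^sub>\<infinity>n\<in>tuples r Z. a n * (\<Prod>l<r. \<phi> l (n l)))"

definition delta :: "site \<Rightarrow> field" where "delta k = (\<lambda>j. if j = k then 1 else 0)"

text \<open>
  The estimate is required on finite sets only, with nonnegative arguments; this is what the
  multilinear estimate provides and what the summability over infinite sets of tuples follows
  from.
\<close>

locale bounded_form =
  fixes d :: nat and Z :: "site set" and s :: real and r :: nat and w :: "(nat \<Rightarrow> site) \<Rightarrow> real" and C :: real
  assumes s_nonneg: "0 \<le> s" and C_nonneg: "0 \<le> C"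
    and w_nonneg: "\<And>n. 0 \<le> w n"
    and finite_bound: "\<And>A i f. finite A \<Longrightarrow> A \<subseteq> Z \<Longrightarrow> i < r \<Longrightarrow> (\<And>l k. 0 \<le> f l k) \<Longrightarrow>
      (\<Sum>n\<in>tuples r A. w n * (\<Prod>l<r. f l (n l))) \<le>
       C * (L2_set (\<lambda>k. jap d k powr (- s) * f i k) A * (\<Prod>l\<in>{..<r} - {i}. L2_set (\<lambda>k. jap d k powr s * f l k) A))"
begin

abbreviation hn :: "field \<Rightarrow> real" where "hn \<equiv> hnorm d Z s"
abbreviation hm :: "field \<Rightarrow> real" where "hm \<equiv> hnorm d Z (- s)"

text \<open>
  The argument in the slot \<open>i\<close> may be as rough as an element of \<open>h\<^bsup>-s\<^esup>\<close>; this is what places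
  gradients in \<open>h\<^sup>s\<close>.
\<close>

definition slot :: "nat \<Rightarrow> (nat \<Rightarrow> field) \<Rightarrow> bool" where
  "slot i \<phi> \<longleftrightarrow> i < r \<and> \<phi> i \<in> hspace d Z (- s) \<and> (\<forall>l\<in>{..<r} - {i}. \<phi> l \<in> hspace d Z s)"

definition slot_bound :: "nat \<Rightarrow> (nat \<Rightarrow> field) \<Rightarrow> real" where
  "slot_bound i \<phi> = C * (hm (\<phi> i) * (\<Prod>l\<in>{..<r} - {i}. hn (\<phi> l)))"

lemma majorant_summable:
  assumes "slot i \<phi>"
  shows "(\<lambda>n. w n * (\<Prod>l<r. cmod (\<phi> l (n l)))) summable_on tuples r Z"
    "(\<Sum>\<^sub>\<infinity>n\<in>tuples r Z. w n * (\<Prod>l<r. cmod (\<phi> l (n l)))) \<le> slot_bound i \<phi>"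
proof -
  let ?g = "\<lambda>n. w n * (\<Prod>l<r. cmod (\<phi> l (n l)))"
  have fin: "sum ?g F \<le> slot_bound i \<phi>" if F: "finite F" "F \<subseteq> tuples r Z" for F
  proof -
    define A where "A = (\<Union>n\<in>F. n ` {..<r})"
    have A: "finite A" "A \<subseteq> Z" using F unfolding A_def tuples_def by auto
    have "F \<subseteq> tuples r A"
    proof
      fix n assume n: "n \<in> F"
      then have "n \<in> {..<r} \<rightarrow>\<^sub>E Z" using F by (auto simp: tuples_def)
      then show "n \<in> tuples r A" unfolding tuples_def
        using n by (intro PiE_I) (auto simp: A_def dest: PiE_arb)
    qed
    moreover have "finite (tuples r A)" unfolding tuples_def using A by (intro finite_PiE) auto
    ultimately have "sum ?g F \<le> (\<Sum>n\<in>tuples r A. ?g n)"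
      by (intro sum_mono2) (auto intro!: mult_nonneg_nonneg prod_nonneg w_nonneg)
    also have "\<dots> \<le> C * (L2_set (wt d (- s) (\<phi> i)) A * (\<Prod>l\<in>{..<r} - {i}. L2_set (wt d s (\<phi> l)) A))"
      using A assms by (intro finite_bound) (auto simp: slot_def)
    also have "\<dots> \<le> slot_bound i \<phi>"
      unfolding slot_bound_def using A assms C_nonneg
      by (intro mult_left_mono mult_mono L2_set_le_hnorm prod_mono conjI prod_nonneg) (auto simp: slot_def)
    finally show ?thesis .
  qed
  show sm: "?g summable_on tuples r Z"
    using fin by (intro nonneg_bdd_above_summable_on bdd_aboveI[of _ "slot_bound i \<phi>"])
      (auto intro!: mult_nonneg_nonneg prod_nonneg w_nonneg)
  show "infsum ?g (tuples r Z) \<le> slot_bound i \<phi>" using sm fin by (rule infsum_le_finite_sums)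
qed

definition dominated :: "((nat \<Rightarrow> site) \<Rightarrow> complex) \<Rightarrow> bool" where
  "dominated a \<longleftrightarrow> (\<forall>n\<in>tuples r Z. cmod (a n) \<le> w n)"

lemma multiform_summable:
  assumes "dominated a" "slot i \<phi>"
  shows "(\<lambda>n. norm (a n * (\<Prod>l<r. \<phi> l (n l)))) summable_on tuples r Z"
    "((\<lambda>n. a n * (\<Prod>l<r. \<phi> l (n l))) has_sum multiform Z r a \<phi>) (tuples r Z)"
    "cmod (multiform Z r a \<phi>) \<le> slot_bound i \<phi>"
proof -
  have le: "norm (a n * (\<Prod>l<r. \<phi> l (n l))) \<le> w n * (\<Prod>l<r. cmod (\<phi> l (n l)))" if "n \<in> tuples r Z" for n
    using assms(1) that unfolding norm_mult prod_norm[symmetric]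
    by (intro mult_right_mono prod_nonneg) (auto simp: dominated_def)
  show abs: "(\<lambda>n. norm (a n * (\<Prod>l<r. \<phi> l (n l)))) summable_on tuples r Z"
    by (rule summable_on_comparison_test[OF majorant_summable(1)[OF assms(2)]]) (use le in auto)
  then show hs: "((\<lambda>n. a n * (\<Prod>l<r. \<phi> l (n l))) has_sum multiform Z r a \<phi>) (tuples r Z)"
    unfolding multiform_def by (rule has_sum_infsum[OF Infinite_Sum.abs_summable_summable])
  have "cmod (multiform Z r a \<phi>) \<le> (\<Sum>\<^sub>\<infinity>n\<in>tuples r Z. w n * (\<Prod>l<r. cmod (\<phi> l (n l))))"
    using norm_infsum_le[OF hs has_sum_infsum[OF majorant_summable(1)[OF assms(2)]]] le by auto
  then show "cmod (multiform Z r a \<phi>) \<le> slot_bound i \<phi>"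
    using majorant_summable(2)[OF assms(2)] by linarith
qed

lemma slot_choose: "slot i \<phi> \<Longrightarrow> slot i \<psi> \<Longrightarrow> slot i (\<lambda>l. if l \<in> S then \<psi> l else \<phi> l)"
  by (auto simp: slot_def)

lemma slot_upd: "slot i \<phi> \<Longrightarrow> \<psi> \<in> hspace d Z (- s) \<Longrightarrow> slot i (\<phi>(i := \<psi>))"
  by (auto simp: slot_def)

lemma multiform_expand:
  assumes "dominated a" "slot i \<phi>" "slot i \<psi>"
  shows "multiform Z r a (\<lambda>l k. \<psi> l k + \<phi> l k) = (\<Sum>S\<in>Pow {..<r}. multiform Z r a (\<lambda>l. if l \<in> S then \<psi> l else \<phi> l))"
proof -
  have "((\<lambda>n. \<Sum>S\<in>Pow {..<r}. a n * (\<Prod>l<r. (if l \<in> S then \<psi> l else \<phi> l) (n l))) has_sum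
      (\<Sum>S\<in>Pow {..<r}. multiform Z r a (\<lambda>l. if l \<in> S then \<psi> l else \<phi> l))) (tuples r Z)"
    by (intro has_sum_finite_sum multiform_summable(2)[where i = i] assms slot_choose)
  also have "(\<lambda>n. \<Sum>S\<in>Pow {..<r}. a n * (\<Prod>l<r. (if l \<in> S then \<psi> l else \<phi> l) (n l))) =
      (\<lambda>n. a n * (\<Prod>l<r. \<psi> l (n l) + \<phi> l (n l)))"
  proof
    fix n
    have "(\<Prod>l<r. (if l \<in> S then \<psi> l else \<phi> l) (n l)) = (\<Prod>l\<in>S. \<psi> l (n l)) * (\<Prod>l\<in>{..<r} - S. \<phi> l (n l))"
      if "S \<in> Pow {..<r}" for S
    proof -
      have "(\<Prod>l<r. (if l \<in> S then \<psi> l else \<phi> l) (n l)) =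
          (\<Prod>l\<in>{..<r} - S. (if l \<in> S then \<psi> l else \<phi> l) (n l)) * (\<Prod>l\<in>S. (if l \<in> S then \<psi> l else \<phi> l) (n l))"
        using that by (intro prod.subset_diff) auto
      then show ?thesis by (simp add: mult.commute)
    qed
    then show "(\<Sum>S\<in>Pow {..<r}. a n * (\<Prod>l<r. (if l \<in> S then \<psi> l else \<phi> l) (n l))) =
        a n * (\<Prod>l<r. \<psi> l (n l) + \<phi> l (n l))"
      by (subst prod_add) (auto simp: sum_distrib_left)
  qed
  finally show ?thesis unfolding multiform_def by (rule infsumI)
qed

lemma multiform_slot_has_sum:
  assumes "dominated a" "slot i \<phi>" "\<psi> \<in> hspace d Z (- s)"
  shows "((\<lambda>k. \<psi> k * multiform Z r a (\<phi>(i := delta k))) has_sum multiform Z r a (\<phi>(i := \<psi>))) Z"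
proof -
  have i: "i < r" using assms(2) by (simp add: slot_def)
  define T where "T = (\<lambda>k. {n \<in> tuples r Z. n i = k})"
  define g where "g = (\<lambda>n. a n * (\<Prod>l<r. (\<phi>(i := \<psi>)) l (n l)))"
  have bij: "bij_betw snd (Sigma Z T) (tuples r Z)"
  proof (rule bij_betwI[where g = "\<lambda>n. (n i, n)"])
    show "(\<lambda>n. (n i, n)) \<in> tuples r Z \<rightarrow> Sigma Z T"
      using i by (auto simp: T_def tuples_def PiE_def Pi_def)
  qed (auto simp: T_def)
  have "(g has_sum multiform Z r a (\<phi>(i := \<psi>))) (tuples r Z)"
    unfolding g_def by (intro multiform_summable(2)[OF assms(1), where i = i] slot_upd assms)
  then have "((\<lambda>p. g (snd p)) has_sum multiform Z r a (\<phi>(i := \<psi>))) (Sigma Z T)"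
    by (simp add: has_sum_reindex_bij_betw[OF bij])
  then show ?thesis
  proof (rule has_sum_SigmaD)
    fix k assume k: "k \<in> Z"
    have "(\<lambda>j. if j \<in> {k} then 1 else 0) \<in> hspace d Z (- s)" by (rule hspace_finite_support) (use k in auto)
    then have "delta k \<in> hspace d Z (- s)" by (simp add: delta_def)
    then have "((\<lambda>n. \<psi> k * (a n * (\<Prod>l<r. (\<phi>(i := delta k)) l (n l)))) has_sum
        \<psi> k * multiform Z r a (\<phi>(i := delta k))) (tuples r Z)"
      by (intro has_sum_cmult_right multiform_summable(2)[OF assms(1), where i = i] slot_upd assms)
    also have "?this \<longleftrightarrow> ((\<lambda>n. g (snd (k, n))) has_sum \<psi> k * multiform Z r a (\<phi>(i := delta k))) (T k)"
    proof (rule has_sum_cong_neutral)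
      have split: "(\<Prod>l<r. (\<phi>(i := x)) l (n l)) = x (n i) * (\<Prod>l\<in>{..<r} - {i}. \<phi> l (n l))" for x :: field and n
        using i by (subst prod.remove[of _ i]) (auto intro!: prod.cong)
      show "\<psi> k * (a n * (\<Prod>l<r. (\<phi>(i := delta k)) l (n l))) = 0" if "n \<in> tuples r Z - T k" for n
        unfolding split using that by (auto simp: T_def delta_def)
      show "\<psi> k * (a n * (\<Prod>l<r. (\<phi>(i := delta k)) l (n l))) = g (snd (k, n))" if "n \<in> tuples r Z \<inter> T k" for n
        unfolding split g_def using that by (auto simp: T_def delta_def)
    qed (auto simp: T_def)
    finally show "((\<lambda>n. g (snd (k, n))) has_sum \<psi> k * multiform Z r a (\<phi>(i := delta k))) (T k)" .
  qed
qed

lemma multiform_slot_finite: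
  assumes "dominated a" "slot i \<phi>" "finite A" "A \<subseteq> Z" "\<And>k. k \<notin> A \<Longrightarrow> \<psi> k = 0"
  shows "multiform Z r a (\<phi>(i := \<psi>)) = (\<Sum>k\<in>A. \<psi> k * multiform Z r a (\<phi>(i := delta k)))"
proof -
  have "\<psi> = (\<lambda>k. if k \<in> A then \<psi> k else 0)" using assms(5) by auto
  then have "\<psi> \<in> hspace d Z (- s)" using hspace_finite_support(1)[OF assms(3,4), where f = \<psi>] by simp
  from multiform_slot_has_sum[OF assms(1,2) this]
  have "((\<lambda>k. \<psi> k * multiform Z r a (\<phi>(i := delta k))) has_sum multiform Z r a (\<phi>(i := \<psi>))) Z" .
  also have "?this \<longleftrightarrow> ((\<lambda>k. \<psi> k * multiform Z r a (\<phi>(i := delta k))) has_sum multiform Z r a (\<phi>(i := \<psi>))) A"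
    using assms(4,5) by (intro has_sum_cong_neutral) auto
  finally show ?thesis using assms(3) by (simp add: has_sum_finite_iff)
qed

text \<open>
  By duality: the form is bounded when the slot \<open>i\<close> is filled by an element of \<open>h\<^bsup>-s\<^esup>\<close>.
\<close>

lemma multiform_gradient:
  assumes "dominated a" "slot i \<phi>"
  shows "(\<lambda>k. multiform Z r a (\<phi>(i := delta k))) \<in> hspace d Z s"
proof (rule hspaceI(1))
  have i: "i < r" using assms by (simp add: slot_def)
  show "multiform Z r a (\<phi>(i := delta k)) = 0" if "k \<notin> Z" for k
    unfolding multiform_def
  proof (rule infsum_0)
    fix n assume "n \<in> tuples r Z"
    then have "n i \<in> Z" using i by (auto simp: tuples_def)
    then show "a n * (\<Prod>l<r. (\<phi>(i := delta k)) l (n l)) = 0"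
      using i that by (auto simp: delta_def intro!: prod_zero bexI[of _ i])
  qed
  fix A assume A: "finite A" "A \<subseteq> Z"
  show "L2_set (wt d s (\<lambda>k. multiform Z r a (\<phi>(i := delta k)))) A \<le> C * (\<Prod>l\<in>{..<r} - {i}. hn (\<phi> l))"
  proof (rule dual_bound[OF A])
    show "0 \<le> C * (\<Prod>l\<in>{..<r} - {i}. hn (\<phi> l))" using C_nonneg by (intro mult_nonneg_nonneg prod_nonneg) auto
    fix \<psi> :: field assume \<psi>: "\<And>k. k \<notin> A \<Longrightarrow> \<psi> k = 0"
    have e: "\<psi> = (\<lambda>k. if k \<in> A then \<psi> k else 0)" using \<psi> by auto
    have h: "\<psi> \<in> hspace d Z (- s)" "hm \<psi> \<le> L2_set (wt d (- s) \<psi>) A"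
      using hspace_finite_support[OF A, where f = \<psi> and d = d and s = "- s"] e by auto
    have "(\<Sum>k\<in>A. \<psi> k * multiform Z r a (\<phi>(i := delta k))) = multiform Z r a (\<phi>(i := \<psi>))"
      using multiform_slot_finite[OF assms A \<psi>] by simp
    also have "cmod \<dots> \<le> slot_bound i (\<phi>(i := \<psi>))"
      by (intro multiform_summable(3) assms slot_upd h)
    also have "\<dots> = C * (hm \<psi> * (\<Prod>l\<in>{..<r} - {i}. hn (\<phi> l)))"
      unfolding slot_bound_def by (intro arg_cong2[of _ _ _ _ "(*)"] refl prod.cong) auto
    also have "\<dots> \<le> C * (L2_set (wt d (- s) \<psi>) A * (\<Prod>l\<in>{..<r} - {i}. hn (\<phi> l)))"
      using h C_nonneg by (intro mult_left_mono mult_right_mono prod_nonneg) auto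
    finally show "cmod (\<Sum>k\<in>A. \<psi> k * multiform Z r a (\<phi>(i := delta k))) \<le>
        C * (\<Prod>l\<in>{..<r} - {i}. hn (\<phi> l)) * L2_set (wt d (- s) \<psi>) A" by (simp add: mult_ac)
  qed
qed

end

section \<open>Gradients of Hamiltonians\<close>

lemma jap_neq_0 [simp]: "jap d k \<noteq> 0"
  using jap_pos[of d k] by linarith

context bounded_form begin

lemma slot_of_all: "i < r \<Longrightarrow> (\<And>l. \<phi> l \<in> hspace d Z s) \<Longrightarrow> slot i \<phi>"
  using hspace_neg(1)[OF s_nonneg] by (auto simp: slot_def)

lemma slot_bound_le_prod:
  assumes "0 < r" "\<And>l. \<phi> l \<in> hspace d Z s"
  shows "slot_bound 0 \<phi> \<le> C * (\<Prod>l<r. hn (\<phi> l))"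
proof -
  have "(\<Prod>l<r. hn (\<phi> l)) = hn (\<phi> 0) * (\<Prod>l\<in>{..<r} - {0}. hn (\<phi> l))"
    using assms(1) by (intro prod.remove) auto
  then show ?thesis unfolding slot_bound_def
    using hspace_neg(2)[OF s_nonneg assms(2)[of 0]] C_nonneg
    by (auto intro!: mult_left_mono mult_right_mono prod_nonneg)
qed

text \<open>Expanding all slots, the terms with at least two increments form the remainder.\<close>

lemma multiform_taylor:
  assumes a: "dominated a" and "0 < r" and \<phi>: "\<And>l. \<phi> l \<in> hspace d Z s" and \<psi>: "\<And>l. \<psi> l \<in> hspace d Z s"
    and m: "\<And>l. hn (\<phi> l) \<le> m" and \<delta>: "\<And>l. hn (\<psi> l) \<le> \<delta>" "\<delta> \<le> 1"
  shows "cmod (multiform Z r a (\<lambda>l k. \<psi> l k + \<phi> l k) - multiform Z r a \<phi> - (\<Sum>i<r. multiform Z r a (\<phi>(i := \<psi> i)))) \<le>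
    C * 2 ^ r * (1 + m) ^ r * \<delta>\<^sup>2"
proof -
  define M where "M = (\<lambda>S. multiform Z r a (\<lambda>l. if l \<in> S then \<psi> l else \<phi> l))"
  define D where "D = {S \<in> Pow {..<r}. 2 \<le> card S}"
  have m0: "0 \<le> m" using m[of 0] hnorm_nonneg[of d Z s "\<phi> 0"] by linarith
  have \<delta>0: "0 \<le> \<delta>" using \<delta>(1)[of 0] hnorm_nonneg[of d Z s "\<psi> 0"] by linarith
  have "multiform Z r a (\<lambda>l k. \<psi> l k + \<phi> l k) = (\<Sum>S\<in>Pow {..<r}. M S)"
    unfolding M_def using \<open>0 < r\<close> by (intro multiform_expand[OF a, where i = 0] slot_of_all \<phi> \<psi>)
  also have "Pow {..<r} = insert {} ((\<lambda>i. {i}) ` {..<r} \<union> D)"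
  proof (intro equalityI subsetI)
    fix S assume S: "S \<in> Pow {..<r}"
    then have "finite S" by (auto intro: finite_subset)
    then consider "S = {}" | i where "S = {i}" | "2 \<le> card S"
      by (metis One_nat_def Suc_leI card_1_singletonE card_gt_0_iff le_neq_implies_less numeral_2_eq_2)
    then show "S \<in> insert {} ((\<lambda>i. {i}) ` {..<r} \<union> D)" using S by cases (auto simp: D_def)
  qed (auto simp: D_def)
  also have "(\<Sum>S\<in>insert {} ((\<lambda>i. {i}) ` {..<r} \<union> D). M S) = M {} + ((\<Sum>S\<in>(\<lambda>i. {i}) ` {..<r}. M S) + (\<Sum>S\<in>D. M S))"
    by (subst sum.insert, (auto simp: D_def)[2], subst sum.union_disjoint) (auto simp: D_def)
  also have "(\<Sum>S\<in>(\<lambda>i. {i}) ` {..<r}. M S) = (\<Sum>i<r. M {i})"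
    by (subst sum.reindex) auto
  also have "M {} = multiform Z r a \<phi>" by (simp add: M_def)
  also have "(\<Sum>i<r. M {i}) = (\<Sum>i<r. multiform Z r a (\<phi>(i := \<psi> i)))"
    unfolding M_def by (intro sum.cong refl arg_cong[of _ _ "multiform Z r a"] ext) auto
  finally have eq: "multiform Z r a (\<lambda>l k. \<psi> l k + \<phi> l k) - multiform Z r a \<phi> -
      (\<Sum>i<r. multiform Z r a (\<phi>(i := \<psi> i))) = (\<Sum>S\<in>D. M S)" by simp
  have "cmod (\<Sum>S\<in>D. M S) \<le> of_nat (card D) * (C * ((1 + m) ^ r * \<delta>\<^sup>2))"
  proof (rule order_trans[OF norm_sum sum_bounded_above])
    fix S assume S: "S \<in> D"
    then have S': "S \<subseteq> {..<r}" "2 \<le> card S" "finite S" by (auto simp: D_def intro: finite_subset)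
    let ?\<chi> = "\<lambda>l. if l \<in> S then \<psi> l else \<phi> l"
    have \<chi>: "?\<chi> l \<in> hspace d Z s" for l using \<phi> \<psi> by auto
    have "cmod (M S) \<le> slot_bound 0 ?\<chi>"
      unfolding M_def using \<open>0 < r\<close> by (intro multiform_summable(3)[OF a] slot_of_all \<chi>)
    also have "\<dots> \<le> C * (\<Prod>l<r. hn (?\<chi> l))" by (rule slot_bound_le_prod[OF \<open>0 < r\<close> \<chi>])
    also have "(\<Prod>l<r. hn (?\<chi> l)) \<le> (\<Prod>l<r. if l \<in> S then \<delta> else 1 + m)"
    proof (intro prod_mono conjI)
      fix l show "hn (?\<chi> l) \<le> (if l \<in> S then \<delta> else 1 + m)" using m[of l] \<delta>(1)[of l] by auto
    qed auto
    also have "\<dots> = (\<Prod>l\<in>{..<r} - S. if l \<in> S then \<delta> else 1 + m) * (\<Prod>l\<in>S. if l \<in> S then \<delta> else 1 + m)"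
      using S' by (intro prod.subset_diff) auto
    also have "\<dots> = (1 + m) ^ card ({..<r} - S) * \<delta> ^ card S" by simp
    also have "\<dots> \<le> (1 + m) ^ r * \<delta>\<^sup>2"
      using m0 \<delta>0 \<delta>(2) S'(2) card_mono[of "{..<r}" "{..<r} - S"]
      by (intro mult_mono power_increasing power_decreasing) auto
    finally show "cmod (M S) \<le> C * ((1 + m) ^ r * \<delta>\<^sup>2)" using C_nonneg by (simp add: mult_left_mono)
  qed
  also have "\<dots> \<le> 2 ^ r * (C * ((1 + m) ^ r * \<delta>\<^sup>2))"
  proof (intro mult_right_mono)
    have "card D \<le> card (Pow {..<r})" by (rule card_mono) (auto simp: D_def)
    also have "\<dots> = 2 ^ r" by (simp add: card_Pow)
    finally have "real (card D) \<le> real (2 ^ r)" by (rule of_nat_mono)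
    then show "real (card D) \<le> 2 ^ r" by simp
  qed (use C_nonneg m0 in auto)
  finally show ?thesis unfolding eq by (simp add: mult_ac)
qed

text \<open>
  A form with a rough argument in the slot \<open>i\<close> depends continuously on its smooth arguments. In
  the proof the increment of the slot \<open>i\<close> is set to zero, so that the expansion can be applied to
  all slots.
\<close>

lemma multiform_perturb:
  assumes a: "dominated a" and i: "i < r" "2 \<le> r" and \<phi>: "\<And>l. \<phi> l \<in> hspace d Z s" and \<psi>: "\<And>l. \<psi> l \<in> hspace d Z s"
    and m: "\<And>l. hn (\<phi> l) \<le> m" and \<tau>: "\<And>l. hn (\<psi> l) \<le> \<tau>" "\<tau> \<le> m" and x: "x \<in> hspace d Z (- s)"
  shows "cmod (multiform Z r a ((\<lambda>l k. \<psi> l k + \<phi> l k)(i := x)) - multiform Z r a (\<phi>(i := x))) \<le>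
    C * 2 ^ r * (\<tau> * m ^ (r - 2)) * hm x"
proof -
  define M where "M = (\<lambda>S. multiform Z r a (\<lambda>l. if l \<in> S then (\<psi>(i := (\<lambda>k. 0))) l else (\<phi>(i := x)) l))"
  define D where "D = Pow {..<r} - {{}}"
  have m0: "0 \<le> m" using m[of 0] hnorm_nonneg[of d Z s "\<phi> 0"] by linarith
  have \<tau>0: "0 \<le> \<tau>" using \<tau>(1)[of 0] hnorm_nonneg[of d Z s "\<psi> 0"] by linarith
  have slots: "slot i (\<psi>(i := (\<lambda>k. 0)))" "slot i (\<phi>(i := x))"
    using slot_upd[OF slot_of_all[OF i(1) \<psi>] hspace_zero] slot_upd[OF slot_of_all[OF i(1) \<phi>] x] by auto
  have "((\<lambda>l k. \<psi> l k + \<phi> l k)(i := x)) = (\<lambda>l k. (\<psi>(i := (\<lambda>k. 0))) l k + (\<phi>(i := x)) l k)" by auto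
  then have "multiform Z r a ((\<lambda>l k. \<psi> l k + \<phi> l k)(i := x)) = (\<Sum>S\<in>Pow {..<r}. M S)"
    unfolding M_def using multiform_expand[OF a slots(2,1)] by simp
  also have "\<dots> = M {} + (\<Sum>S\<in>D. M S)" unfolding D_def by (intro sum.remove) auto
  also have "M {} = multiform Z r a (\<phi>(i := x))" by (simp add: M_def fun_upd_def)
  finally have eq: "multiform Z r a ((\<lambda>l k. \<psi> l k + \<phi> l k)(i := x)) - multiform Z r a (\<phi>(i := x)) = (\<Sum>S\<in>D. M S)" by (simp only: add_diff_cancel_left')
  have "cmod (\<Sum>S\<in>D. M S) \<le> of_nat (card D) * (C * (hm x * (\<tau> * m ^ (r - 2))))"
  proof (rule order_trans[OF norm_sum sum_bounded_above])
    fix S assume S: "S \<in> D"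
    let ?\<chi> = "\<lambda>l. if l \<in> S then (\<psi>(i := (\<lambda>k. 0))) l else (\<phi>(i := x)) l"
    have "cmod (M S) \<le> slot_bound i ?\<chi>"
      unfolding M_def by (intro multiform_summable(3)[OF a] slot_choose slots)
    also have "\<dots> \<le> C * (hm x * (\<tau> * m ^ (r - 2)))"
    proof (cases "i \<in> S")
      case True
      then have "hm (?\<chi> i) = 0" by (simp add: hnorm_altdef)
      then have "slot_bound i ?\<chi> = 0" by (simp add: slot_bound_def)
      then show ?thesis using C_nonneg \<tau>0 m0 by simp
    next
      case False
      obtain l0 where l0: "l0 \<in> S" "l0 < r" "l0 \<noteq> i" using S False by (auto simp: D_def)
      have "(\<Prod>l\<in>{..<r} - {i}. hn (?\<chi> l)) \<le> (\<Prod>l\<in>{..<r} - {i}. if l = l0 then \<tau> else m)"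
      proof (intro prod_mono conjI)
        fix l assume "l \<in> {..<r} - {i}"
        then show "hn (?\<chi> l) \<le> (if l = l0 then \<tau> else m)"
          using m[of l] \<tau>(1)[of l] \<tau>(2) l0 by auto
      qed auto
      also have "\<dots> = \<tau> * (\<Prod>l\<in>{..<r} - {i} - {l0}. m)"
        using l0 by (subst prod.remove[of _ l0]) auto
      also have "(\<Prod>l\<in>{..<r} - {i} - {l0}. m) = m ^ (r - 2)"
        using l0 i by (simp add: numeral_2_eq_2)
      finally have "(\<Prod>l\<in>{..<r} - {i}. hn (?\<chi> l)) \<le> \<tau> * m ^ (r - 2)" .
      then show ?thesis unfolding slot_bound_def using C_nonneg False
        by (auto intro!: mult_left_mono)
    qed
    finally show "cmod (M S) \<le> C * (hm x * (\<tau> * m ^ (r - 2)))" .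
  qed
  also have "\<dots> \<le> 2 ^ r * (C * (hm x * (\<tau> * m ^ (r - 2))))"
  proof (intro mult_right_mono)
    have "card D \<le> card (Pow {..<r})" by (rule card_mono) (auto simp: D_def)
    also have "\<dots> = 2 ^ r" by (simp add: card_Pow)
    finally have "real (card D) \<le> real (2 ^ r)" by (rule of_nat_mono)
    then show "real (card D) \<le> 2 ^ r" by simp
  qed (use C_nonneg m0 \<tau>0 in auto)
  finally show ?thesis unfolding eq by (simp add: mult_ac)
qed

end

definition signed_field :: "(nat \<Rightarrow> int) \<Rightarrow> field \<Rightarrow> nat \<Rightarrow> field" where
  "signed_field \<sigma> u = (\<lambda>l k. sign_conj (\<sigma> l) (u k))"

text \<open>
  The candidate for the gradient. In the slot \<open>i\<close> a Hamiltonian is linear or antilinear in \<open>u\<close>,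
  according to the sign; with the real pairing, the linear slots contribute the conjugates of
  their coefficients.
\<close>

definition ham_grad :: "site set \<Rightarrow> nat \<Rightarrow> hamiltonian \<Rightarrow> field \<Rightarrow> field" where
  "ham_grad Z r H u k = (\<Sum>\<sigma>\<in>signs r. \<Sum>i<r. sign_conj (- \<sigma> i) (multiform Z r (H \<sigma>) ((signed_field \<sigma> u)(i := delta k))))"

lemma ham_fun_multiform: "ham_fun Z r H u = Re (\<Sum>\<sigma>\<in>signs r. multiform Z r (H \<sigma>) (signed_field \<sigma> u))"
  by (simp add: ham_fun_def multiform_def signed_field_def)

lemma finite_signs: "finite (signs r)"
  unfolding signs_def tuples_def by (intro finite_PiE) auto

lemma card_signs: "card (signs r) = 2 ^ r"
  unfolding signs_def tuples_def by (subst card_PiE) (auto simp: numeral_2_eq_2)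

context bounded_form begin

lemma hspace_signed_field: "u \<in> hspace d Z s \<Longrightarrow> signed_field \<sigma> u l \<in> hspace d Z s"
  and hn_signed_field: "u \<in> hspace d Z s \<Longrightarrow> hn (signed_field \<sigma> u l) \<le> hn u"
  unfolding signed_field_def by (auto intro: hspace_sign_conj)

lemma ham_grad_in_hspace:
  assumes "\<And>\<sigma>. \<sigma> \<in> signs r \<Longrightarrow> dominated (H \<sigma>)" "u \<in> hspace d Z s"
  shows "ham_grad Z r H u \<in> hspace d Z s"
proof -
  have "(\<lambda>k. \<Sum>\<sigma>\<in>signs r. \<Sum>i<r. sign_conj (- \<sigma> i) (multiform Z r (H \<sigma>) ((signed_field \<sigma> u)(i := delta k)))) \<in> hspace d Z s"
    using assms by (intro hspace_sum hspace_sign_conj(1) multiform_gradient slot_of_all hspace_signed_field) auto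
  then show ?thesis by (simp add: ham_grad_def[abs_def])
qed

lemma ham_grad_pairing:
  assumes H: "\<And>\<sigma>. \<sigma> \<in> signs r \<Longrightarrow> dominated (H \<sigma>)" and u: "u \<in> hspace d Z s" and v: "v \<in> hspace d Z (- s)"
  shows "l2_pair Z (ham_grad Z r H u) v =
    (\<Sum>\<sigma>\<in>signs r. \<Sum>i<r. Re (multiform Z r (H \<sigma>) ((signed_field \<sigma> u)(i := signed_field \<sigma> v i))))"
proof -
  have "((\<lambda>k. \<Sum>\<sigma>\<in>signs r. \<Sum>i<r. Re (signed_field \<sigma> v i k * multiform Z r (H \<sigma>) ((signed_field \<sigma> u)(i := delta k)))) has_sum
      (\<Sum>\<sigma>\<in>signs r. \<Sum>i<r. Re (multiform Z r (H \<sigma>) ((signed_field \<sigma> u)(i := signed_field \<sigma> v i))))) Z"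
    unfolding signed_field_def[of _ v]
    by (intro has_sum_finite_sum has_sum_Re multiform_slot_has_sum H slot_of_all hspace_signed_field u
        hspace_sign_conj(1) v) auto
  also have "(\<lambda>k. \<Sum>\<sigma>\<in>signs r. \<Sum>i<r. Re (signed_field \<sigma> v i k * multiform Z r (H \<sigma>) ((signed_field \<sigma> u)(i := delta k)))) =
      (\<lambda>k. Re (cnj (ham_grad Z r H u k) * v k))"
  proof
    fix k
    have "Re (signed_field \<sigma> v i k * x) = Re (cnj (sign_conj (- \<sigma> i) x) * v k)" if "\<sigma> \<in> signs r" "i < r" for \<sigma> i x
      using signs_cases[OF that] by (auto simp: signed_field_def sign_conj_def)
    then show "(\<Sum>\<sigma>\<in>signs r. \<Sum>i<r. Re (signed_field \<sigma> v i k * multiform Z r (H \<sigma>) ((signed_field \<sigma> u)(i := delta k)))) =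
        Re (cnj (ham_grad Z r H u k) * v k)"
      unfolding ham_grad_def cnj_sum sum_distrib_right Re_sum by (intro sum.cong refl) auto
  qed
  finally show ?thesis unfolding l2_pair_def by (rule infsumI)
qed

lemma ham_fun_has_gradient:
  assumes H: "\<And>\<sigma>. \<sigma> \<in> signs r \<Longrightarrow> dominated (H \<sigma>)" and u: "u \<in> hspace d Z s" and "0 < r"
  shows "has_h_gradient d Z s (ham_fun Z r H) u (ham_grad Z r H u)"
  unfolding has_h_gradient_def
proof (intro conjI allI impI)
  show "ham_grad Z r H u \<in> hspace d Z (- s)"
    using ham_grad_in_hspace[OF H u] by (intro hspace_neg(1)[OF s_nonneg])
  fix e :: real assume e: "0 < e"
  define K where "K = 2 ^ r * (C * 2 ^ r * (1 + hn u) ^ r) + 1"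
  have K: "0 < K" using C_nonneg by (auto simp: K_def intro!: add_nonneg_pos mult_nonneg_nonneg)
  show "\<exists>\<delta>>0. \<forall>v\<in>hspace d Z s. hn v < \<delta> \<longrightarrow>
      \<bar>ham_fun Z r H (\<lambda>k. u k + v k) - ham_fun Z r H u - l2_pair Z (ham_grad Z r H u) v\<bar> \<le> e * hn v"
  proof (intro exI[of _ "min 1 (e / K)"] conjI ballI impI)
    show "0 < min 1 (e / K)" using e K by simp
    fix v assume v: "v \<in> hspace d Z s" and small: "hn v < min 1 (e / K)"
    define R where "R = (\<lambda>\<sigma>. multiform Z r (H \<sigma>) (signed_field \<sigma> (\<lambda>k. u k + v k)) - multiform Z r (H \<sigma>) (signed_field \<sigma> u) -
        (\<Sum>i<r. multiform Z r (H \<sigma>) ((signed_field \<sigma> u)(i := signed_field \<sigma> v i))))"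
    have R: "cmod (R \<sigma>) \<le> C * 2 ^ r * (1 + hn u) ^ r * (hn v)\<^sup>2" if "\<sigma> \<in> signs r" for \<sigma>
    proof -
      have "signed_field \<sigma> (\<lambda>k. u k + v k) = (\<lambda>l k. signed_field \<sigma> v l k + signed_field \<sigma> u l k)"
        by (simp add: signed_field_def sign_conj_add add.commute)
      then show ?thesis unfolding R_def
        using multiform_taylor[OF H[OF that] \<open>0 < r\<close>, of "signed_field \<sigma> u" "signed_field \<sigma> v" "hn u" "hn v"]
          hspace_signed_field hn_signed_field u v small by simp
    qed
    have "l2_pair Z (ham_grad Z r H u) v =
        (\<Sum>\<sigma>\<in>signs r. \<Sum>i<r. Re (multiform Z r (H \<sigma>) ((signed_field \<sigma> u)(i := signed_field \<sigma> v i))))"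
      using H u hspace_neg(1)[OF s_nonneg v] by (rule ham_grad_pairing)
    then have "ham_fun Z r H (\<lambda>k. u k + v k) - ham_fun Z r H u - l2_pair Z (ham_grad Z r H u) v = Re (\<Sum>\<sigma>\<in>signs r. R \<sigma>)"
      unfolding ham_fun_multiform R_def by (simp add: sum_subtractf)
    also have "\<bar>\<dots>\<bar> \<le> cmod (\<Sum>\<sigma>\<in>signs r. R \<sigma>)" by (rule abs_Re_le_cmod)
    also have "\<dots> \<le> of_nat (card (signs r)) * (C * 2 ^ r * (1 + hn u) ^ r * (hn v)\<^sup>2)"
      by (intro order_trans[OF norm_sum sum_bounded_above] R)
    also have "\<dots> = (2 ^ r * (C * 2 ^ r * (1 + hn u) ^ r)) * hn v * hn v"
      by (simp add: card_signs power2_eq_square)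
    also have "\<dots> \<le> K * hn v * hn v" by (intro mult_right_mono) (auto simp: K_def)
    also have "\<dots> \<le> e * hn v"
    proof (rule mult_right_mono)
      have "hn v \<le> e / K" using small by simp
      then show "K * hn v \<le> e" using K by (simp add: pos_le_divide_eq mult.commute)
    qed simp
    finally show "\<bar>ham_fun Z r H (\<lambda>k. u k + v k) - ham_fun Z r H u - l2_pair Z (ham_grad Z r H u) v\<bar> \<le> e * hn v" .
  qed
qed

end

lemma l2_pair_has_sum:
  assumes "g \<in> hspace d Z (- s)" "v \<in> hspace d Z s"
  shows "((\<lambda>k. Re (cnj (g k) * v k)) has_sum l2_pair Z g v) Z"
  unfolding l2_pair_def
proof (intro has_sum_infsum, rule Infinite_Sum.abs_summable_summable)
  have "(\<lambda>k. (wt d (- s) g k)\<^sup>2 + (wt d s v k)\<^sup>2) summable_on Z"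
    using assms by (intro summable_on_add) (auto simp: hspace_altdef)
  then show "(\<lambda>k. norm (Re (cnj (g k) * v k))) summable_on Z"
  proof (rule summable_on_comparison_test)
    fix k
    have "norm (Re (cnj (g k) * v k)) \<le> cmod (g k) * cmod (v k)"
      using abs_Re_le_cmod[of "cnj (g k) * v k"] by (simp add: norm_mult)
    also have "\<dots> = wt d (- s) g k * wt d s v k"
      by (simp add: powr_minus mult_ac)
    also have "\<dots> \<le> (wt d (- s) g k)\<^sup>2 + (wt d s v k)\<^sup>2"
    proof -
      define x where "x = wt d (- s) g k"
      define y where "y = wt d s v k"
      have "2 * x * y \<le> x\<^sup>2 + y\<^sup>2" by (rule sum_squares_bound)
      moreover have "0 \<le> x * y" by (simp add: x_def y_def)
      ultimately have "x * y \<le> x\<^sup>2 + y\<^sup>2" by linarith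
      then show ?thesis by (simp only: x_def y_def)
    qed
    finally show "norm (Re (cnj (g k) * v k)) \<le> (wt d (- s) g k)\<^sup>2 + (wt d s v k)\<^sup>2" .
  qed auto
qed

lemma has_h_gradient_add:
  assumes "has_h_gradient d Z s F u f" "has_h_gradient d Z s G u g"
  shows "has_h_gradient d Z s (\<lambda>v. F v + G v) u (\<lambda>k. f k + g k)"
  unfolding has_h_gradient_def
proof (intro conjI allI impI)
  have fg: "f \<in> hspace d Z (- s)" "g \<in> hspace d Z (- s)" using assms by (auto simp: has_h_gradient_def)
  then show "(\<lambda>k. f k + g k) \<in> hspace d Z (- s)" by (rule hspace_add)
  have pair: "l2_pair Z (\<lambda>k. f k + g k) v = l2_pair Z f v + l2_pair Z g v" if "v \<in> hspace d Z s" for v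
  proof -
    have "((\<lambda>k. Re (cnj (f k) * v k) + Re (cnj (g k) * v k)) has_sum (l2_pair Z f v + l2_pair Z g v)) Z"
      by (intro has_sum_add l2_pair_has_sum[where d = d and s = s] fg that)
    then show ?thesis unfolding l2_pair_def[of _ "\<lambda>k. f k + g k"]
      by (intro infsumI) (simp add: distrib_right)
  qed
  fix e :: real assume "0 < e"
  then have e2: "0 < e / 2" by simp
  obtain \<delta>1 where 1: "\<delta>1 > 0" "\<And>v. v \<in> hspace d Z s \<Longrightarrow> hnorm d Z s v < \<delta>1 \<Longrightarrow> \<bar>F (\<lambda>k. u k + v k) - F u - l2_pair Z f v\<bar> \<le> e / 2 * hnorm d Z s v"
    using assms(1) e2 unfolding has_h_gradient_def by blast
  obtain \<delta>2 where 2: "\<delta>2 > 0" "\<And>v. v \<in> hspace d Z s \<Longrightarrow> hnorm d Z s v < \<delta>2 \<Longrightarrow> \<bar>G (\<lambda>k. u k + v k) - G u - l2_pair Z g v\<bar> \<le> e / 2 * hnorm d Z s v"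
    using assms(2) e2 unfolding has_h_gradient_def by blast
  show "\<exists>\<delta>>0. \<forall>v\<in>hspace d Z s. hnorm d Z s v < \<delta> \<longrightarrow>
      \<bar>F (\<lambda>k. u k + v k) + G (\<lambda>k. u k + v k) - (F u + G u) - l2_pair Z (\<lambda>k. f k + g k) v\<bar> \<le> e * hnorm d Z s v"
  proof (intro exI[of _ "min \<delta>1 \<delta>2"] conjI ballI impI)
    fix v assume "v \<in> hspace d Z s" "hnorm d Z s v < min \<delta>1 \<delta>2"
    then have "\<bar>F (\<lambda>k. u k + v k) - F u - l2_pair Z f v\<bar> \<le> e / 2 * hnorm d Z s v"
      "\<bar>G (\<lambda>k. u k + v k) - G u - l2_pair Z g v\<bar> \<le> e / 2 * hnorm d Z s v"
      "l2_pair Z (\<lambda>k. f k + g k) v = l2_pair Z f v + l2_pair Z g v"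
      using 1(2)[of v] 2(2)[of v] pair[of v] by auto
    moreover have "e / 2 * hnorm d Z s v + e / 2 * hnorm d Z s v = e * hnorm d Z s v" by simp
    ultimately show "\<bar>F (\<lambda>k. u k + v k) + G (\<lambda>k. u k + v k) - (F u + G u) - l2_pair Z (\<lambda>k. f k + g k) v\<bar> \<le> e * hnorm d Z s v"
      by linarith
  qed (use 1 2 in auto)
qed

lemma has_h_gradient_zero: "has_h_gradient d Z s (\<lambda>v. 0) u (\<lambda>k. 0)"
  unfolding has_h_gradient_def by (auto simp: hspace_zero l2_pair_def intro!: exI[of _ 1])

lemma has_h_gradient_sum:
  assumes "\<And>j. j \<in> S \<Longrightarrow> has_h_gradient d Z s (F j) u (f j)"
  shows "has_h_gradient d Z s (\<lambda>v. \<Sum>j\<in>S. F j v) u (\<lambda>k. \<Sum>j\<in>S. f j k)"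
  using assms
proof (induction S rule: infinite_finite_induct)
  case (insert j S)
  then show ?case using has_h_gradient_add[of d Z s "F j" u "f j" "\<lambda>v. \<Sum>j\<in>S. F j v" "\<lambda>k. \<Sum>j\<in>S. f j k"] by simp
qed (auto simp: has_h_gradient_zero)

text \<open>
  Two gradients are compared on small multiples of \<open>f k - g k\<close> placed at a single site.
\<close>

lemma has_h_gradient_unique:
  assumes "has_h_gradient d Z s F u f" "has_h_gradient d Z s F u g"
  shows "f = g"
proof
  fix k
  have fg: "f \<in> hspace d Z (- s)" "g \<in> hspace d Z (- s)" using assms by (auto simp: has_h_gradient_def)
  show "f k = g k"
  proof (cases "k \<in> Z")
    case False
    then show ?thesis using fg by (simp add: hspace_vanishes)
  next
    case True
    define D where "D = cmod (f k - g k)"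
    define c where "c = f k - g k"
    define J where "J = jap d k powr s"
    have J: "0 < J" by (simp add: J_def)
    define v where "v = (\<lambda>t j. if j \<in> {k} then of_real t * c else 0)"
    have v: "v t \<in> hspace d Z s" "hnorm d Z s (v t) \<le> \<bar>t\<bar> * (J * D)" for t
      unfolding v_def using hspace_finite_support[of "{k}" Z, where f = "\<lambda>_. of_real t * c" and d = d and s = s] True
      by (auto simp: norm_mult D_def c_def J_def mult_ac)
    have pair: "l2_pair Z h (v t) = Re (cnj (h k) * (of_real t * c))" for h t
    proof -
      have "((\<lambda>j. Re (cnj (h j) * v t j)) has_sum Re (cnj (h k) * (of_real t * c))) {k}"
        by (rule has_sum_finiteI) (auto simp: v_def)
      also have "?this \<longleftrightarrow> ((\<lambda>j. Re (cnj (h j) * v t j)) has_sum Re (cnj (h k) * (of_real t * c))) Z"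
        using True by (intro has_sum_cong_neutral) (auto simp: v_def)
      finally show ?thesis unfolding l2_pair_def by (rule infsumI)
    qed
    have "D\<^sup>2 \<le> e * (2 * (J * D))" if e: "0 < e" for e :: real
    proof -
      obtain \<delta>1 where 1: "\<delta>1 > 0" "\<And>v. v \<in> hspace d Z s \<Longrightarrow> hnorm d Z s v < \<delta>1 \<Longrightarrow> \<bar>F (\<lambda>k. u k + v k) - F u - l2_pair Z f v\<bar> \<le> e * hnorm d Z s v"
        using assms(1) e unfolding has_h_gradient_def by blast
      obtain \<delta>2 where 2: "\<delta>2 > 0" "\<And>v. v \<in> hspace d Z s \<Longrightarrow> hnorm d Z s v < \<delta>2 \<Longrightarrow> \<bar>F (\<lambda>k. u k + v k) - F u - l2_pair Z g v\<bar> \<le> e * hnorm d Z s v"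
        using assms(2) e unfolding has_h_gradient_def by blast
      define t where "t = min \<delta>1 \<delta>2 / (2 * (J * D + 1))"
      have JD: "0 \<le> J * D" using J by (simp add: D_def)
      have t: "0 < t" using 1 2 JD by (simp add: t_def)
      have "t * (J * D) \<le> t * (J * D + 1)" using t by simp
      also have "\<dots> = min \<delta>1 \<delta>2 / 2" using JD by (simp add: t_def field_simps)
      also have "\<dots> < min \<delta>1 \<delta>2" using 1(1) 2(1) by (auto simp: min_def)
      finally have "hnorm d Z s (v t) < min \<delta>1 \<delta>2" using v(2)[of t] t by simp
      then have "\<bar>l2_pair Z f (v t) - l2_pair Z g (v t)\<bar> \<le> 2 * (e * hnorm d Z s (v t))"
        using 1(2)[OF v(1)[of t]] 2(2)[OF v(1)[of t]] by linarith
      also have "\<dots> \<le> 2 * (e * (t * (J * D)))" using v(2)[of t] t e by simp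
      also have "l2_pair Z f (v t) - l2_pair Z g (v t) = Re (cnj c * (of_real t * c))"
        unfolding pair by (simp add: c_def algebra_simps)
      also have "Re (cnj c * (of_real t * c)) = t * D\<^sup>2"
        by (simp add: D_def c_def[symmetric] cmod_power2) (simp add: power2_eq_square algebra_simps)
      finally have "t * D\<^sup>2 \<le> t * (e * (2 * (J * D)))" using t by (simp add: mult_ac)
      then show ?thesis using t by simp
    qed
    note small = this
    have "D = 0"
    proof (rule ccontr)
      assume "D \<noteq> 0"
      then have D: "0 < D" by (simp add: D_def)
      then have "D\<^sup>2 \<le> D / (4 * J) * (2 * (J * D))" using J by (intro small) simp
      also have "\<dots> = D\<^sup>2 / 2" using J by (simp add: power2_eq_square field_simps)
      finally show False using D by simp
    qed
    then show ?thesis by (simp add: D_def)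
  qed
qed

lemma h_gradient_eqI: "has_h_gradient d Z s F u g \<Longrightarrow> h_gradient d Z s F u = g"
  unfolding h_gradient_def using has_h_gradient_unique by (intro the_equality) auto

lemma Z2_has_gradient:
  assumes "bounded ((\<lambda>n. jap d n powr (- 2 * s) * \<omega> n) ` Z)" "u \<in> hspace d Z s"
  shows "has_h_gradient d Z s (Z2 Z \<omega>) u (\<lambda>k. of_real (\<omega> k) * u k)"
proof -
  obtain b where b: "\<And>k. k \<in> Z \<Longrightarrow> \<bar>jap d k powr (- 2 * s) * \<omega> k\<bar> \<le> b" "0 < b"
    using assms(1) unfolding bounded_pos by auto
  have \<omega>: "\<bar>\<omega> k\<bar> \<le> b * jap d k powr (2 * s)" if "k \<in> Z" for k
  proof -
    have "jap d k powr (2 * s) * \<bar>jap d k powr (- 2 * s) * \<omega> k\<bar> \<le> jap d k powr (2 * s) * b"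
      by (intro mult_left_mono b that) auto
    also have "jap d k powr (2 * s) * \<bar>jap d k powr (- 2 * s) * \<omega> k\<bar> = \<bar>\<omega> k\<bar>"
      by (simp add: abs_mult mult.assoc[symmetric] powr_add[symmetric])
    finally show ?thesis by (simp add: mult.commute)
  qed
  have energy: "\<bar>\<omega> k * (cmod (v k))\<^sup>2\<bar> \<le> b * (wt d s v k)\<^sup>2" if "k \<in> Z" for k and v :: field
  proof -
    have "\<bar>\<omega> k * (cmod (v k))\<^sup>2\<bar> \<le> (b * jap d k powr (2 * s)) * (cmod (v k))\<^sup>2"
      using \<omega>[OF that] by (simp add: abs_mult mult_right_mono)
    then show ?thesis by (simp add: jap_powr_sq mult.assoc)
  qed
  have sm: "(\<lambda>k. \<omega> k * (cmod (v k))\<^sup>2) summable_on Z"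
    and le: "\<bar>\<Sum>\<^sub>\<infinity>k\<in>Z. \<omega> k * (cmod (v k))\<^sup>2\<bar> \<le> b * (hnorm d Z s v)\<^sup>2" if v: "v \<in> hspace d Z s" for v
  proof -
    have w: "(\<lambda>k. (wt d s v k)\<^sup>2) summable_on Z" using v by (simp add: hspace_altdef)
    have bw: "((\<lambda>k. b * (wt d s v k)\<^sup>2) has_sum b * (hnorm d Z s v)\<^sup>2) Z"
      using has_sum_cmult_right[OF has_sum_infsum[OF w], of b]
      by (simp add: hnorm_altdef infsum_nonneg)
    have "(\<lambda>k. norm (\<omega> k * (cmod (v k))\<^sup>2)) summable_on Z"
      by (rule summable_on_comparison_test[OF has_sum_imp_summable[OF bw]]) (use energy in auto)
    then show sm: "(\<lambda>k. \<omega> k * (cmod (v k))\<^sup>2) summable_on Z" by (rule Infinite_Sum.abs_summable_summable)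
    show "\<bar>\<Sum>\<^sub>\<infinity>k\<in>Z. \<omega> k * (cmod (v k))\<^sup>2\<bar> \<le> b * (hnorm d Z s v)\<^sup>2"
      using norm_infsum_le[OF has_sum_infsum[OF sm] bw] energy by simp
  qed
  have gr: "(\<lambda>k. of_real (\<omega> k) * u k) \<in> hspace d Z (- s)"
  proof (rule hspaceI(1))
    fix A assume A: "finite A" "A \<subseteq> Z"
    have "L2_set (wt d (- s) (\<lambda>k. of_real (\<omega> k) * u k)) A \<le> L2_set (\<lambda>k. b * wt d s u k) A"
    proof (rule L2_set_mono)
      fix k assume "k \<in> A"
      then have "\<bar>\<omega> k\<bar> * (jap d k powr (- s) * cmod (u k)) \<le> b * jap d k powr (2 * s) * (jap d k powr (- s) * cmod (u k))"
        using A by (intro mult_right_mono \<omega>) auto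
      also have "\<dots> = b * wt d s u k"
      proof -
        have "jap d k powr (2 * s) * jap d k powr (- s) = jap d k powr s" by (simp flip: powr_add)
        then show ?thesis by (metis mult.assoc)
      qed
      finally show "wt d (- s) (\<lambda>k. of_real (\<omega> k) * u k) k \<le> b * wt d s u k" by (simp add: norm_mult mult_ac)
    qed auto
    also have "\<dots> = b * L2_set (wt d s u) A" using b by (simp add: L2_set_right_distrib)
    also have "\<dots> \<le> b * hnorm d Z s u" using b A assms(2) by (intro mult_left_mono L2_set_le_hnorm) auto
    finally show "L2_set (wt d (- s) (\<lambda>k. of_real (\<omega> k) * u k)) A \<le> b * hnorm d Z s u" .
  qed (use assms(2) in \<open>simp add: hspace_vanishes\<close>)
  have rem: "Z2 Z \<omega> (\<lambda>k. u k + v k) - Z2 Z \<omega> u - l2_pair Z (\<lambda>k. of_real (\<omega> k) * u k) v =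
      1 / 2 * (\<Sum>\<^sub>\<infinity>k\<in>Z. \<omega> k * (cmod (v k))\<^sup>2)" if v: "v \<in> hspace d Z s" for v
  proof -
    have "((\<lambda>k. \<omega> k * (cmod (u k))\<^sup>2 + (2 * Re (cnj (of_real (\<omega> k) * u k) * v k) + \<omega> k * (cmod (v k))\<^sup>2)) has_sum
        (\<Sum>\<^sub>\<infinity>k\<in>Z. \<omega> k * (cmod (u k))\<^sup>2) + (2 * l2_pair Z (\<lambda>k. of_real (\<omega> k) * u k) v + (\<Sum>\<^sub>\<infinity>k\<in>Z. \<omega> k * (cmod (v k))\<^sup>2))) Z"
      by (intro has_sum_add has_sum_cmult_right has_sum_infsum sm l2_pair_has_sum[OF gr] v assms(2))
    also have "(\<lambda>k. \<omega> k * (cmod (u k))\<^sup>2 + (2 * Re (cnj (of_real (\<omega> k) * u k) * v k) + \<omega> k * (cmod (v k))\<^sup>2)) =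
        (\<lambda>k. \<omega> k * (cmod (u k + v k))\<^sup>2)"
      by (rule ext, simp only: cmod_power2) (simp add: power2_eq_square algebra_simps)
    finally have "(\<Sum>\<^sub>\<infinity>k\<in>Z. \<omega> k * (cmod (u k + v k))\<^sup>2) = (\<Sum>\<^sub>\<infinity>k\<in>Z. \<omega> k * (cmod (u k))\<^sup>2) +
        (2 * l2_pair Z (\<lambda>k. of_real (\<omega> k) * u k) v + (\<Sum>\<^sub>\<infinity>k\<in>Z. \<omega> k * (cmod (v k))\<^sup>2))"
      by (rule infsumI)
    then show ?thesis unfolding Z2_def by (simp add: algebra_simps)
  qed
  show ?thesis
    unfolding has_h_gradient_def
  proof (intro conjI allI impI gr)
    fix e :: real assume e: "0 < e"
    show "\<exists>\<delta>>0. \<forall>v\<in>hspace d Z s. hnorm d Z s v < \<delta> \<longrightarrow>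
        \<bar>Z2 Z \<omega> (\<lambda>k. u k + v k) - Z2 Z \<omega> u - l2_pair Z (\<lambda>k. of_real (\<omega> k) * u k) v\<bar> \<le> e * hnorm d Z s v"
    proof (intro exI[of _ "e / b"] conjI ballI impI)
      fix v assume v: "v \<in> hspace d Z s" "hnorm d Z s v < e / b"
      have "\<bar>1 / 2 * (\<Sum>\<^sub>\<infinity>k\<in>Z. \<omega> k * (cmod (v k))\<^sup>2)\<bar> \<le> b * (hnorm d Z s v)\<^sup>2"
        using le[OF v(1)] by simp
      also have "\<dots> = (b * hnorm d Z s v) * hnorm d Z s v" by (simp add: power2_eq_square)
      also have "\<dots> \<le> e * hnorm d Z s v"
        using v(2) b by (intro mult_right_mono) (auto simp: field_simps)
      finally show "\<bar>Z2 Z \<omega> (\<lambda>k. u k + v k) - Z2 Z \<omega> u - l2_pair Z (\<lambda>k. of_real (\<omega> k) * u k) v\<bar> \<le> e * hnorm d Z s v"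
        unfolding rem[OF v(1)] .
    qed (use e b in auto)
  qed
qed

section \<open>Truncation of a Hamiltonian to finitely many modes\<close>

lemma finite_sign_tuples: "finite (tuples r (signs d))"
  unfolding tuples_def by (intro finite_PiE finite_signs) auto

lemma sign_tuples_nonempty: "tuples r (signs d) \<noteq> {}"
proof -
  have "(\<lambda>i\<in>{..<r}. \<lambda>j\<in>{..<d}. 1) \<in> tuples r (signs d)"
    by (auto simp: tuples_def signs_def)
  then show ?thesis by blast
qed

text \<open>
  The harmonic mean in the norm is a sum after inversion, so that the multilinear estimate can be
  applied to each choice of reflections separately.
\<close>

lemma inverse_ham_weight:
  "inverse (ham_weight d q \<alpha> r n) = 1 / real (card (tuples r (signs d))) *
     (\<Sum>\<nu>\<in>tuples r (signs d). jap d (signed_sum d r \<nu> n) powr (- \<alpha>) * (\<Prod>l<r. jap d (n l) powr (- q)))"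
proof -
  have "(\<Prod>l<r. jap d (n l) powr (- q)) = inverse (\<Prod>l<r. jap d (n l) powr q)"
    using prod_inversef[of "\<lambda>l. jap d (n l) powr q" "{..<r}"] by (simp add: o_def powr_minus)
  then show ?thesis
    by (simp add: ham_weight_def hmean_def powr_minus sum_distrib_right[symmetric] divide_inverse)
qed

lemma ham_weight_pos: "0 < ham_weight d q \<alpha> r n"
proof -
  have c: "0 < card (tuples r (signs d))"
    using finite_sign_tuples sign_tuples_nonempty by (simp add: card_gt_0_iff)
  have "0 < inverse (ham_weight d q \<alpha> r n)"
    unfolding inverse_ham_weight using c finite_sign_tuples sign_tuples_nonempty
    by (intro mult_pos_pos sum_pos prod_pos) auto
  then show ?thesis by simp
qed

definition form_bound :: "nat \<Rightarrow> real \<Rightarrow> real \<Rightarrow> real \<Rightarrow> nat \<Rightarrow> real \<Rightarrow> bool" where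
  "form_bound d s q \<alpha> r C \<longleftrightarrow> 0 \<le> C \<and> (\<forall>A i f. finite A \<longrightarrow> A \<subseteq> Zd d \<longrightarrow> i < r \<longrightarrow> (\<forall>l k. 0 \<le> f l k) \<longrightarrow>
    (\<Sum>n\<in>tuples r A. inverse (ham_weight d q \<alpha> r n) * (\<Prod>l<r. f l (n l))) \<le>
    C * (L2_set (\<lambda>k. jap d k powr (- s) * f i k) A * (\<Prod>l\<in>{..<r} - {i}. L2_set (\<lambda>k. jap d k powr s * f l k) A)))"

lemma form_bound_exists:
  assumes "d \<ge> 1" "\<alpha> > max (real d - q) (real d / 2)" "real d / 2 - q < s" "s < \<alpha> - real d / 2 + q" "q \<ge> 0"
  shows "\<exists>C. form_bound d s q \<alpha> r C"
proof -
  obtain C where C: "C \<ge> 0" "\<And>A \<nu> i f. finite A \<Longrightarrow> A \<subseteq> Zd d \<Longrightarrow> \<nu> \<in> tuples r (signs d) \<Longrightarrow> i < r \<Longrightarrow> (\<forall>l k. 0 \<le> f l k) \<Longrightarrow>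
    (\<Sum>n\<in>tuples r A. jap d (signed_sum d r \<nu> n) powr (- \<alpha>) * (\<Prod>l<r. jap d (n l) powr (- q) * f l (n l))) \<le>
    C * (L2_set (\<lambda>k. jap d k powr (- s) * f i k) A * (\<Prod>l\<in>{..<r} - {i}. L2_set (\<lambda>k. jap d k powr s * f l k) A))"
    using multilinear_kernel_bound[of d \<alpha> s q r] assms by auto
  have "form_bound d s q \<alpha> r C"
    unfolding form_bound_def
  proof (intro conjI C allI impI)
    fix A i and f :: "nat \<Rightarrow> site \<Rightarrow> real"
    assume A: "finite A" "A \<subseteq> Zd d" and i: "i < r" and f: "\<forall>l k. 0 \<le> f l k"
    define X where "X = C * (L2_set (\<lambda>k. jap d k powr (- s) * f i k) A * (\<Prod>l\<in>{..<r} - {i}. L2_set (\<lambda>k. jap d k powr s * f l k) A))"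
    let ?T = "tuples r (signs d)"
    have "(\<Sum>n\<in>tuples r A. inverse (ham_weight d q \<alpha> r n) * (\<Prod>l<r. f l (n l))) =
        1 / real (card ?T) * (\<Sum>n\<in>tuples r A. \<Sum>\<nu>\<in>?T. jap d (signed_sum d r \<nu> n) powr (- \<alpha>) * (\<Prod>l<r. jap d (n l) powr (- q) * f l (n l)))"
      unfolding inverse_ham_weight prod.distrib sum_distrib_left sum_distrib_right
      by (intro sum.cong refl) (simp add: mult_ac)
    also have "\<dots> = 1 / real (card ?T) * (\<Sum>\<nu>\<in>?T. \<Sum>n\<in>tuples r A. jap d (signed_sum d r \<nu> n) powr (- \<alpha>) * (\<Prod>l<r. jap d (n l) powr (- q) * f l (n l)))"
      by (subst sum.swap) simp
    also have "\<dots> \<le> 1 / real (card ?T) * (of_nat (card ?T) * X)"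
      unfolding X_def by (intro mult_left_mono sum_bounded_above C A i f) auto
    also have "\<dots> = X" using finite_sign_tuples[of r d] sign_tuples_nonempty[of r d] by simp
    finally show "(\<Sum>n\<in>tuples r A. inverse (ham_weight d q \<alpha> r n) * (\<Prod>l<r. f l (n l))) \<le> X" .
  qed
  then show ?thesis by blast
qed

text \<open>
  A choice of the constant that depends on the listed parameters only, as the final statement
  requires.
\<close>

definition form_const :: "nat \<Rightarrow> real \<Rightarrow> real \<Rightarrow> real \<Rightarrow> nat \<Rightarrow> real" where
  "form_const d s q \<alpha> r = (SOME C. form_bound d s q \<alpha> r C)"

lemma form_const:
  assumes "d \<ge> 1" "\<alpha> > max (real d - q) (real d / 2)" "real d / 2 - q < s" "s < \<alpha> - real d / 2 + q" "q \<ge> 0"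
  shows "form_bound d s q \<alpha> r (form_const d s q \<alpha> r)"
  unfolding form_const_def using form_bound_exists[OF assms] by (rule someI_ex)

lemma bounded_form_ham_weight:
  assumes "form_bound d s q \<alpha> r C" "0 \<le> s" "Z \<subseteq> Zd d" "0 \<le> c"
  shows "bounded_form d Z s r (\<lambda>n. c * inverse (ham_weight d q \<alpha> r n)) (c * C)"
proof
  fix A i and f :: "nat \<Rightarrow> site \<Rightarrow> real"
  assume A: "finite A" "A \<subseteq> Z" "i < r" "\<And>l k. 0 \<le> f l k"
  define X where "X = L2_set (\<lambda>k. jap d k powr (- s) * f i k) A * (\<Prod>l\<in>{..<r} - {i}. L2_set (\<lambda>k. jap d k powr s * f l k) A)"
  have "A \<subseteq> Zd d" using A assms(3) by blast
  then have "(\<Sum>n\<in>tuples r A. inverse (ham_weight d q \<alpha> r n) * (\<Prod>l<r. f l (n l))) \<le> C * X"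
    using A assms(1) unfolding form_bound_def X_def by blast
  then have "c * (\<Sum>n\<in>tuples r A. inverse (ham_weight d q \<alpha> r n) * (\<Prod>l<r. f l (n l))) \<le> c * (C * X)"
    using assms(4) by (rule mult_left_mono)
  then show "(\<Sum>n\<in>tuples r A. c * inverse (ham_weight d q \<alpha> r n) * (\<Prod>l<r. f l (n l))) \<le> c * C * X"
    by (simp add: sum_distrib_left mult.assoc)
qed (use assms in \<open>auto simp: form_bound_def less_imp_le[OF ham_weight_pos]\<close>)

lemma ham_norm_dominated:
  assumes "ham_norm d Z q \<alpha> r H \<le> ennreal c" "0 \<le> c" "\<sigma> \<in> signs r" "n \<in> tuples r Z"
  shows "cmod (H \<sigma> n) \<le> c * inverse (ham_weight d q \<alpha> r n)"
proof -
  have "ennreal (ham_weight d q \<alpha> r n * cmod (H \<sigma> n)) \<le> ham_norm d Z q \<alpha> r H"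
    unfolding ham_norm_def using assms(3,4) by (intro SUP_upper2[of "(\<sigma>, n)"]) auto
  also have "\<dots> \<le> ennreal c" by fact
  finally have "ham_weight d q \<alpha> r n * cmod (H \<sigma> n) \<le> c" using assms(2) by (simp add: ennreal_le_iff)
  then show ?thesis using ham_weight_pos[of d q \<alpha> r n] by (simp add: field_simps)
qed

text \<open>
  The restriction of a formal Hamiltonian to the modes in \<open>B\<close>, as a polynomial in independent
  variables \<open>u\<^sub>k\<close> and conjugates.
\<close>

definition ham_poly :: "site set \<Rightarrow> nat \<Rightarrow> hamiltonian \<Rightarrow> site poly_fun" where
  "ham_poly B r H z = (\<Sum>\<sigma>\<in>signs r. \<Sum>n\<in>tuples r B. H \<sigma> n * (\<Prod>l<r. z (n l, \<sigma> l = 1)))"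

definition conj_pair :: "field \<Rightarrow> site \<times> bool \<Rightarrow> complex" where
  "conj_pair u v = (if snd v then u (fst v) else cnj (u (fst v)))"

definition word :: "nat \<Rightarrow> (nat \<Rightarrow> int) \<Rightarrow> (nat \<Rightarrow> site) \<Rightarrow> (site \<times> bool) multiset" where
  "word r \<sigma> n = image_mset (\<lambda>l. (n l, \<sigma> l = 1)) (mset_set {..<r})"

lemma mon_image_mset_set:
  "finite I \<Longrightarrow> mon (image_mset x (mset_set I)) z = (\<Prod>l\<in>I. z (x l))"
  by (induction I rule: finite_induct) auto

lemma mon_word: "mon (word r \<sigma> n) z = (\<Prod>l<r. z (n l, \<sigma> l = 1))"
  by (simp add: word_def mon_image_mset_set)

lemma sum_word_derivative:
  fixes h :: "site \<times> bool \<Rightarrow> 'b::comm_semiring_1"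
  shows "(\<Sum>v\<in>#word r \<sigma> n. h v * mon (word r \<sigma> n - {#v#}) z) =
    (\<Sum>i<r. h (n i, \<sigma> i = 1) * (\<Prod>l\<in>{..<r} - {i}. z (n l, \<sigma> l = 1)))"
proof -
  let ?x = "\<lambda>l. (n l, \<sigma> l = 1)"
  have "(\<Sum>v\<in>#word r \<sigma> n. h v * mon (word r \<sigma> n - {#v#}) z) =
      (\<Sum>i\<in>#mset_set {..<r}. h (?x i) * mon (word r \<sigma> n - {#?x i#}) z)"
    unfolding word_def by (simp add: image_mset.compositionality o_def)
  also have "\<dots> = (\<Sum>i<r. h (?x i) * mon (word r \<sigma> n - {#?x i#}) z)"
    by (simp add: sum_unfold_sum_mset)
  also have "\<dots> = (\<Sum>i<r. h (?x i) * (\<Prod>l\<in>{..<r} - {i}. z (?x l)))"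
  proof (rule sum.cong[OF refl])
    fix i assume i: "i \<in> {..<r}"
    then have "mset_set {..<r} = add_mset i (mset_set ({..<r} - {i}))"
      by (metis finite_lessThan mset_set.remove)
    then have "word r \<sigma> n - {#?x i#} = image_mset ?x (mset_set ({..<r} - {i}))"
      unfolding word_def by simp
    then show "h (?x i) * mon (word r \<sigma> n - {#?x i#}) z = h (?x i) * (\<Prod>l\<in>{..<r} - {i}. z (?x l))"
      by (simp add: mon_image_mset_set)
  qed
  finally show ?thesis .
qed

lemma finite_tuples: "finite B \<Longrightarrow> finite (tuples r B)"
  unfolding tuples_def by (intro finite_PiE) auto

lemma set_word: "n \<in> tuples r B \<Longrightarrow> set_mset (word r \<sigma> n) \<subseteq> vars B"
  by (auto simp: word_def tuples_def)

lemma size_word [simp]: "size (word r \<sigma> n) = r"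
  by (simp add: word_def)

text \<open>
  One presentation of the polynomial serves both for its derivatives and for the derivatives of
  its majorant; the two formulas, tested against an arbitrary \<open>h\<close>, avoid counting how often a
  variable occurs in a monomial.
\<close>

lemma ham_poly_terms:
  assumes "finite B"
  shows "\<exists>ts. ham_poly B r H = ev ts \<and> homog B r ts \<and>
    (\<forall>h z. (\<Sum>v\<in>vars B. h v * maj (dterms v ts) z) = (\<Sum>\<sigma>\<in>signs r. \<Sum>n\<in>tuples r B. cmod (H \<sigma> n) *
       (\<Sum>i<r. h (n i, \<sigma> i = 1) * (\<Prod>l\<in>{..<r} - {i}. z (n l, \<sigma> l = 1))))) \<and>
    (\<forall>h z. (\<Sum>v\<in>vars B. h v * ev (dterms v ts) z) = (\<Sum>\<sigma>\<in>signs r. \<Sum>n\<in>tuples r B. H \<sigma> n *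
       (\<Sum>i<r. h (n i, \<sigma> i = 1) * (\<Prod>l\<in>{..<r} - {i}. z (n l, \<sigma> l = 1)))))"
proof -
  have fin: "finite (signs r \<times> tuples r B)" using finite_signs finite_tuples[OF assms] by blast
  obtain xs where xs: "set xs = signs r \<times> tuples r B" "distinct xs" using finite_distinct_list[OF fin] by auto
  define ts where "ts = map (\<lambda>(\<sigma>, n). (H \<sigma> n, word r \<sigma> n)) xs"
  have sum_xs: "(\<Sum>p\<leftarrow>xs. f p) = (\<Sum>\<sigma>\<in>signs r. \<Sum>n\<in>tuples r B. f (\<sigma>, n))" for f :: "_ \<Rightarrow> 'c::comm_monoid_add"
    using xs by (simp add: sum_list_distinct_conv_sum_set sum.cartesian_product)
  show ?thesis
  proof (intro exI[of _ ts] conjI allI)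
    have "ev ts z = (\<Sum>p\<leftarrow>xs. H (fst p) (snd p) * mon (word r (fst p) (snd p)) z)" for z
      unfolding ts_def by (induction xs) auto
    then show "ham_poly B r H = ev ts" by (auto simp: sum_xs ham_poly_def mon_word)
    show "homog B r ts" unfolding homog_def
    proof clarify
      fix a m assume "(a, m) \<in> set ts"
      then obtain \<sigma> n where "n \<in> tuples r B" "m = word r \<sigma> n" using xs by (auto simp: ts_def)
      then show "size m = r \<and> set_mset m \<subseteq> vars B" using set_word by simp
    qed
    have V: "set_mset (word r (fst p) (snd p)) \<subseteq> vars B" if "p \<in> set xs" for p
    proof (rule set_word)
      show "snd p \<in> tuples r B" using that unfolding xs(1) by (simp add: mem_Times_iff)
    qed
    have "(\<Sum>v\<in>vars B. h v * maj (dterms v ts) z) =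
        (\<Sum>p\<leftarrow>xs. cmod (H (fst p) (snd p)) * (\<Sum>v\<in>#word r (fst p) (snd p). h v * mon (word r (fst p) (snd p) - {#v#}) z))" for h z
      unfolding ts_def using V
    proof (induction xs)
      case (Cons p xs)
      have *: "(\<Sum>v\<in>vars B. h v * (of_nat (count (word r (fst p) (snd p)) v) * mon (word r (fst p) (snd p) - {#v#}) z)) =
          (\<Sum>v\<in>#word r (fst p) (snd p). h v * mon (word r (fst p) (snd p) - {#v#}) z)"
        using Cons.prems assms by (intro sum_dmon) auto
      have "h v * maj (dterms v (map (\<lambda>(\<sigma>, n). (H \<sigma> n, word r \<sigma> n)) (p # xs))) z =
          cmod (H (fst p) (snd p)) * (h v * (of_nat (count (word r (fst p) (snd p)) v) * mon (word r (fst p) (snd p) - {#v#}) z)) +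
          h v * maj (dterms v (map (\<lambda>(\<sigma>, n). (H \<sigma> n, word r \<sigma> n)) xs)) z" for v
        by (simp add: case_prod_unfold norm_mult algebra_simps)
      then show ?case using Cons * by (simp add: sum.distrib sum_distrib_left[symmetric])
    qed simp
    then show "(\<Sum>v\<in>vars B. h v * maj (dterms v ts) z) = (\<Sum>\<sigma>\<in>signs r. \<Sum>n\<in>tuples r B. cmod (H \<sigma> n) *
       (\<Sum>i<r. h (n i, \<sigma> i = 1) * (\<Prod>l\<in>{..<r} - {i}. z (n l, \<sigma> l = 1))))" for h z
      by (simp add: sum_xs sum_word_derivative)
    have "(\<Sum>v\<in>vars B. h v * ev (dterms v ts) z) =
        (\<Sum>p\<leftarrow>xs. H (fst p) (snd p) * (\<Sum>v\<in>#word r (fst p) (snd p). h v * mon (word r (fst p) (snd p) - {#v#}) z))" for h z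
      unfolding ts_def using V
    proof (induction xs)
      case (Cons p xs)
      have *: "(\<Sum>v\<in>vars B. of_nat (count (word r (fst p) (snd p)) v) * (h v * mon (word r (fst p) (snd p) - {#v#}) z)) =
          (\<Sum>v\<in>#word r (fst p) (snd p). h v * mon (word r (fst p) (snd p) - {#v#}) z)"
        using Cons.prems assms by (intro sum_count_eq_sum_mset) auto
      have "h v * ev (dterms v (map (\<lambda>(\<sigma>, n). (H \<sigma> n, word r \<sigma> n)) (p # xs))) z =
          H (fst p) (snd p) * (of_nat (count (word r (fst p) (snd p)) v) * (h v * mon (word r (fst p) (snd p) - {#v#}) z)) +
          h v * ev (dterms v (map (\<lambda>(\<sigma>, n). (H \<sigma> n, word r \<sigma> n)) xs)) z" for v
        by (simp add: case_prod_unfold norm_mult algebra_simps)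
      then show ?case using Cons * by (simp add: sum.distrib sum_distrib_left[symmetric])
    qed simp
    then show "(\<Sum>v\<in>vars B. h v * ev (dterms v ts) z) = (\<Sum>\<sigma>\<in>signs r. \<Sum>n\<in>tuples r B. H \<sigma> n *
       (\<Sum>i<r. h (n i, \<sigma> i = 1) * (\<Prod>l\<in>{..<r} - {i}. z (n l, \<sigma> l = 1))))" for h z
      by (simp add: sum_xs sum_word_derivative)
  qed
qed

lemma conj_pair_sign: "conj_pair u (k, c = 1) = sign_conj c (u k)"
  by (cases "c = 1") (simp_all add: conj_pair_def sign_conj_def)

lemma pd_ham_poly:
  assumes "finite B" "k \<in> B"
  shows "pd (k, b) (ham_poly B r H) (conj_pair u) =
    (\<Sum>\<sigma>\<in>signs r. \<Sum>i<r. if (\<sigma> i = 1) = b then multiform B r (H \<sigma>) ((signed_field \<sigma> u)(i := delta k)) else 0)"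
proof -
  obtain ts where ts: "ham_poly B r H = ev ts" "homog B r ts"
    "\<forall>h z. (\<Sum>v\<in>vars B. h v * maj (dterms v ts) z) = (\<Sum>\<sigma>\<in>signs r. \<Sum>n\<in>tuples r B. cmod (H \<sigma> n) *
       (\<Sum>i<r. h (n i, \<sigma> i = 1) * (\<Prod>l\<in>{..<r} - {i}. z (n l, \<sigma> l = 1))))"
    and ts3: "\<forall>h z. (\<Sum>v\<in>vars B. h v * ev (dterms v ts) z) = (\<Sum>\<sigma>\<in>signs r. \<Sum>n\<in>tuples r B. H \<sigma> n *
       (\<Sum>i<r. h (n i, \<sigma> i = 1) * (\<Prod>l\<in>{..<r} - {i}. z (n l, \<sigma> l = 1))))"
    using ham_poly_terms[OF assms(1), of r H] by blast
  let ?h = "\<lambda>v. if v = (k, b) then 1 else (0::complex)"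
  have "pd (k, b) (ham_poly B r H) (conj_pair u) = (\<Sum>v\<in>vars B. ?h v * ev (dterms v ts) (conj_pair u))"
  proof -
    have "(\<Sum>v\<in>vars B. ?h v * ev (dterms v ts) (conj_pair u)) =
        (\<Sum>v\<in>vars B. if v = (k, b) then ev (dterms v ts) (conj_pair u) else 0)"
      by (intro sum.cong) auto
    also have "\<dots> = ev (dterms (k, b) ts) (conj_pair u)" using assms by (subst sum.delta) auto
    finally show ?thesis by (simp add: ts(1))
  qed
  also have "\<dots> = (\<Sum>\<sigma>\<in>signs r. \<Sum>n\<in>tuples r B. \<Sum>i<r. H \<sigma> n *
      (?h (n i, \<sigma> i = 1) * (\<Prod>l\<in>{..<r} - {i}. conj_pair u (n l, \<sigma> l = 1))))"
    unfolding ts3[rule_format] by (simp only: sum_distrib_left)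
  also have "\<dots> = (\<Sum>\<sigma>\<in>signs r. \<Sum>i<r. \<Sum>n\<in>tuples r B. H \<sigma> n *
      (?h (n i, \<sigma> i = 1) * (\<Prod>l\<in>{..<r} - {i}. conj_pair u (n l, \<sigma> l = 1))))"
    by (intro sum.cong refl sum.swap)
  also have "\<dots> = (\<Sum>\<sigma>\<in>signs r. \<Sum>i<r. if (\<sigma> i = 1) = b then multiform B r (H \<sigma>) ((signed_field \<sigma> u)(i := delta k)) else 0)"
  proof (intro sum.cong refl)
    fix \<sigma> i assume i: "i \<in> {..<r}"
    have split: "(\<Prod>l<r. ((signed_field \<sigma> u)(i := delta k)) l (n l)) =
        delta k (n i) * (\<Prod>l\<in>{..<r} - {i}. conj_pair u (n l, \<sigma> l = 1))" for n
      using i by (subst prod.remove[of _ i]) (auto simp: signed_field_def conj_pair_sign intro!: prod.cong)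
    show "(\<Sum>n\<in>tuples r B. H \<sigma> n * (?h (n i, \<sigma> i = 1) * (\<Prod>l\<in>{..<r} - {i}. conj_pair u (n l, \<sigma> l = 1)))) =
        (if (\<sigma> i = 1) = b then multiform B r (H \<sigma>) ((signed_field \<sigma> u)(i := delta k)) else 0)"
      unfolding multiform_def split using finite_tuples[OF assms(1), of r]
      by (auto simp: delta_def intro!: sum.cong sum.neutral)
  qed
  finally show ?thesis .
qed

definition real_ham :: "site set \<Rightarrow> nat \<Rightarrow> hamiltonian \<Rightarrow> bool" where
  "real_ham B r H \<longleftrightarrow> (\<forall>\<sigma>\<in>signs r. \<forall>n\<in>tuples r B. H (\<lambda>i\<in>{..<r}. - \<sigma> i) n = cnj (H \<sigma> n))"

definition flip_signs :: "nat \<Rightarrow> (nat \<Rightarrow> int) \<Rightarrow> nat \<Rightarrow> int" where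
  "flip_signs r \<sigma> = (\<lambda>i\<in>{..<r}. - \<sigma> i)"

lemma flip_signs_in: "\<sigma> \<in> signs r \<Longrightarrow> flip_signs r \<sigma> \<in> signs r"
  by (auto simp: flip_signs_def signs_def tuples_def PiE_def Pi_def)

lemma flip_flip: "\<sigma> \<in> signs r \<Longrightarrow> flip_signs r (flip_signs r \<sigma>) = \<sigma>"
  by (rule ext) (auto simp: flip_signs_def signs_def tuples_def PiE_def extensional_def)

lemma sum_flip_signs: "(\<Sum>\<sigma>\<in>signs r. f (flip_signs r \<sigma>)) = (\<Sum>\<sigma>\<in>signs r. f \<sigma>)"
  by (rule sum.reindex_bij_witness[of _ "flip_signs r" "flip_signs r"]) (auto simp: flip_flip flip_signs_in)

lemma cnj_multiform_flip:
  assumes "finite B" "real_ham B r H" "\<sigma> \<in> signs r"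
  shows "cnj (multiform B r (H \<sigma>) ((signed_field \<sigma> u)(i := delta k))) =
    multiform B r (H (flip_signs r \<sigma>)) ((signed_field (flip_signs r \<sigma>) u)(i := delta k))"
proof -
  have "cnj (\<Prod>l<r. ((signed_field \<sigma> u)(i := delta k)) l (n l)) =
      (\<Prod>l<r. ((signed_field (flip_signs r \<sigma>) u)(i := delta k)) l (n l))" for n
    unfolding cnj_prod using signs_cases[OF assms(3)]
    by (intro prod.cong refl) (auto simp: signed_field_def sign_conj_def delta_def flip_signs_def)
  then show ?thesis
    unfolding multiform_def using finite_tuples[OF assms(1), of r] assms(2,3)
    by (simp add: real_ham_def flip_signs_def)
qed

text \<open>
  For a real Hamiltonian the derivatives with respect to \<open>u\<^sub>k\<close> and its conjugate are conjugate to
  each other: flipping all signs exchanges the linear and the antilinear slots and conjugates the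
  coefficients. The gradient is the sum of the two contributions, whence the factor \<open>2\<close>.
\<close>

lemma ham_grad_eq_pd:
  assumes "finite B" "k \<in> B" "real_ham B r H"
  shows "2 * pd (k, False) (ham_poly B r H) (conj_pair u) = ham_grad B r H u k"
    "2 * pd (k, True) (ham_poly B r H) (conj_pair u) = cnj (ham_grad B r H u k)"
proof -
  define G where "G = (\<lambda>\<sigma> i. multiform B r (H \<sigma>) ((signed_field \<sigma> u)(i := delta k)))"
  define X where "X = (\<Sum>\<sigma>\<in>signs r. \<Sum>i<r. if \<sigma> i = 1 then cnj (G \<sigma> i) else 0)"
  define Y where "Y = (\<Sum>\<sigma>\<in>signs r. \<Sum>i<r. if \<sigma> i = 1 then 0 else G \<sigma> i)"
  have "X = (\<Sum>\<sigma>\<in>signs r. \<Sum>i<r. if flip_signs r \<sigma> i = 1 then 0 else G (flip_signs r \<sigma>) i)"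
    unfolding X_def
  proof (intro sum.cong refl)
    fix \<sigma> i assume "\<sigma> \<in> signs r" "i \<in> {..<r}"
    then show "(if \<sigma> i = 1 then cnj (G \<sigma> i) else 0) = (if flip_signs r \<sigma> i = 1 then 0 else G (flip_signs r \<sigma>) i)"
      using signs_cases[of \<sigma> r i] cnj_multiform_flip[OF assms(1,3), of \<sigma> u i k]
      by (auto simp: flip_signs_def G_def)
  qed
  also have "\<dots> = Y" unfolding Y_def by (rule sum_flip_signs)
  finally have XY: "X = Y" .
  have g: "ham_grad B r H u k = X + Y"
  proof -
    have "ham_grad B r H u k = (\<Sum>\<sigma>\<in>signs r. \<Sum>i<r. sign_conj (- \<sigma> i) (G \<sigma> i))"
      by (simp add: ham_grad_def G_def)
    also have "\<dots> = X + Y"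
    unfolding X_def Y_def sum.distrib[symmetric]
  proof (intro sum.cong refl)
    fix \<sigma> i assume "\<sigma> \<in> signs r" "i \<in> {..<r}"
    then show "sign_conj (- \<sigma> i) (G \<sigma> i) = (if \<sigma> i = 1 then cnj (G \<sigma> i) else 0) + (if \<sigma> i = 1 then 0 else G \<sigma> i)"
      using signs_cases[of \<sigma> r i] by (auto simp: sign_conj_def)
  qed
    finally show ?thesis .
  qed
  have "pd (k, False) (ham_poly B r H) (conj_pair u) = Y"
    unfolding pd_ham_poly[OF assms(1,2)] Y_def G_def by (intro sum.cong refl) auto
  then show "2 * pd (k, False) (ham_poly B r H) (conj_pair u) = ham_grad B r H u k" using g XY by simp
  have "pd (k, True) (ham_poly B r H) (conj_pair u) = cnj X"
    unfolding pd_ham_poly[OF assms(1,2)] X_def G_def cnj_sum by (intro sum.cong refl) auto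
  then show "2 * pd (k, True) (ham_poly B r H) (conj_pair u) = cnj (ham_grad B r H u k)" using g XY by simp
qed

lemma multiform_restrict:
  assumes "B \<subseteq> Z" "\<And>l k. l < r \<Longrightarrow> k \<notin> B \<Longrightarrow> \<phi> l k = 0"
  shows "multiform Z r a \<phi> = multiform B r a \<phi>"
  unfolding multiform_def
proof (rule infsum_cong_neutral)
  fix n assume n: "n \<in> tuples r Z - tuples r B"
  then obtain l where "l < r" "n l \<notin> B" unfolding tuples_def by (auto simp: PiE_def Pi_def)
  then have "(\<Prod>l<r. \<phi> l (n l)) = 0" using assms(2) by (intro prod_zero) auto
  then show "a n * (\<Prod>l<r. \<phi> l (n l)) = 0" by simp
next
  fix n assume "n \<in> tuples r B - tuples r Z"
  then show "a n * (\<Prod>l<r. \<phi> l (n l)) = 0" using assms(1) unfolding tuples_def by (auto simp: PiE_def Pi_def)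
qed simp

lemma multiform_cong:
  assumes "\<And>l k. l < r \<Longrightarrow> k \<in> B \<Longrightarrow> \<phi> l k = \<psi> l k"
  shows "multiform B r a \<phi> = multiform B r a \<psi>"
  unfolding multiform_def
  by (intro infsum_cong arg_cong2[of _ _ _ _ "(*)"] refl prod.cong) (auto intro!: assms simp: tuples_def)

lemma ham_grad_restrict:
  assumes "B \<subseteq> Z" "k \<in> B"
  shows "ham_grad Z r H (\<lambda>k. if k \<in> B then u k else 0) k = ham_grad B r H u k"
proof -
  have "multiform Z r a ((signed_field \<sigma> (\<lambda>k. if k \<in> B then u k else 0))(i := delta k)) =
      multiform B r a ((signed_field \<sigma> u)(i := delta k))" for a \<sigma> i
  proof -
    have "multiform Z r a ((signed_field \<sigma> (\<lambda>k. if k \<in> B then u k else 0))(i := delta k)) =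
        multiform B r a ((signed_field \<sigma> (\<lambda>k. if k \<in> B then u k else 0))(i := delta k))"
      using assms by (intro multiform_restrict) (auto simp: signed_field_def sign_conj_def delta_def)
    also have "\<dots> = multiform B r a ((signed_field \<sigma> u)(i := delta k))"
      by (rule multiform_cong) (auto simp: signed_field_def)
    finally show ?thesis .
  qed
  then show ?thesis unfolding ham_grad_def by simp
qed

lemma L2_set_wt_sum:
  "L2_set (wt d s (\<lambda>k. \<Sum>i\<in>I. e i k)) A \<le> (\<Sum>i\<in>I. L2_set (wt d s (e i)) A)"
proof (induction I rule: infinite_finite_induct)
  case (insert i I)
  have "L2_set (wt d s (\<lambda>k. e i k + (\<Sum>i\<in>I. e i k))) A \<le> L2_set (\<lambda>k. wt d s (e i) k + wt d s (\<lambda>k. \<Sum>i\<in>I. e i k) k) A"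
    by (intro L2_set_mono) (auto simp flip: distrib_left intro!: mult_left_mono norm_triangle_ineq)
  also have "\<dots> \<le> L2_set (wt d s (e i)) A + L2_set (wt d s (\<lambda>k. \<Sum>i\<in>I. e i k)) A" by (rule L2_set_triangle_ineq)
  finally show ?case using insert by simp
qed (auto simp: L2_set_def)

context bounded_form begin

text \<open>
  Truncating the Hamiltonian amounts, at sites of \<open>B\<close>, to truncating its argument. So the error is
  a perturbation of the smooth arguments of a form by the tail of \<open>u\<close>, hence small in \<open>h\<^sup>s\<close> and all
  the more in \<open>h\<^bsup>-s\<^esup>\<close>.
\<close>

lemma ham_grad_truncation_error:
  assumes H: "\<And>\<sigma>. \<sigma> \<in> signs r \<Longrightarrow> dominated (H \<sigma>)" and u: "u \<in> hspace d Z s" and B: "finite B" "B \<subseteq> Z" and "2 \<le> r"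
    and m: "hn u \<le> m" and \<tau>: "hn (\<lambda>k. if k \<in> B then 0 else u k) \<le> \<tau>" "\<tau> \<le> m"
  shows "L2_set (wt d (- s) (\<lambda>k. ham_grad Z r H u k - ham_grad B r H u k)) B \<le> real r * 2 ^ r * (C * 2 ^ r * (\<tau> * m ^ (r - 2)))"
proof -
  define uB where "uB = (\<lambda>k. if k \<in> B then u k else 0)"
  define ut where "ut = (\<lambda>k. if k \<in> B then 0 else u k)"
  have uB: "uB \<in> hspace d Z s" "hn uB \<le> hn u" unfolding uB_def by (rule hspace_dominated[OF u]; simp)+
  have ut: "ut \<in> hspace d Z s" unfolding ut_def by (rule hspace_dominated[OF u]) simp
  have m0: "0 \<le> m" using m hnorm_nonneg[of d Z s u] by linarith
  have \<tau>0: "0 \<le> \<tau>" using \<tau>(1) hnorm_nonneg[of d Z s "\<lambda>k. if k \<in> B then 0 else u k"] by linarith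
  define K where "K = C * 2 ^ r * (\<tau> * m ^ (r - 2))"
  have K0: "0 \<le> K" using C_nonneg m0 \<tau>0 by (simp add: K_def)
  define e where "e = (\<lambda>\<sigma> i k. multiform Z r (H \<sigma>) ((signed_field \<sigma> u)(i := delta k)) - multiform Z r (H \<sigma>) ((signed_field \<sigma> uB)(i := delta k)))"
  have e: "L2_set (wt d s (e \<sigma> i)) B \<le> K" if \<sigma>: "\<sigma> \<in> signs r" and i: "i < r" for \<sigma> i
  proof (rule dual_bound[OF B K0])
    fix \<psi> :: field assume \<psi>: "\<And>k. k \<notin> B \<Longrightarrow> \<psi> k = 0"
    have eq: "\<psi> = (\<lambda>k. if k \<in> B then \<psi> k else 0)" using \<psi> by auto
    have h: "\<psi> \<in> hspace d Z (- s)" "hm \<psi> \<le> L2_set (wt d (- s) \<psi>) B"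
      using hspace_finite_support[OF B, where f = \<psi> and d = d and s = "- s"] eq by auto
    have fin: "multiform Z r (H \<sigma>) ((signed_field \<sigma> w)(i := \<psi>)) = (\<Sum>k\<in>B. \<psi> k * multiform Z r (H \<sigma>) ((signed_field \<sigma> w)(i := delta k)))"
      if "w \<in> hspace d Z s" for w
      using that by (intro multiform_slot_finite H \<sigma> slot_of_all i hspace_signed_field B \<psi>)
    have split: "signed_field \<sigma> u = (\<lambda>l k. signed_field \<sigma> ut l k + signed_field \<sigma> uB l k)"
      by (intro ext) (auto simp: signed_field_def ut_def uB_def sign_conj_def)
    have "(\<Sum>k\<in>B. \<psi> k * e \<sigma> i k) = multiform Z r (H \<sigma>) ((signed_field \<sigma> u)(i := \<psi>)) - multiform Z r (H \<sigma>) ((signed_field \<sigma> uB)(i := \<psi>))"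
      unfolding fin[OF u] fin[OF uB(1)] e_def by (simp add: right_diff_distrib sum_subtractf)
    also have "cmod \<dots> \<le> C * 2 ^ r * (\<tau> * m ^ (r - 2)) * hm \<psi>"
      unfolding split
    proof (rule multiform_perturb[OF H[OF \<sigma>] i \<open>2 \<le> r\<close>])
      show "hn (signed_field \<sigma> uB l) \<le> m" for l
        using hn_signed_field[OF uB(1), of \<sigma> l] uB(2) m by linarith
      show "hn (signed_field \<sigma> ut l) \<le> \<tau>" for l
        using hn_signed_field[OF ut, of \<sigma> l] \<tau>(1) by (simp add: ut_def)
    qed (use uB ut \<tau> h hspace_signed_field in auto)
    also have "\<dots> \<le> K * L2_set (wt d (- s) \<psi>) B" unfolding K_def[symmetric] using h K0 by (intro mult_left_mono)
    finally show "cmod (\<Sum>k\<in>B. \<psi> k * e \<sigma> i k) \<le> K * L2_set (wt d (- s) \<psi>) B" .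
  qed
  have diff: "ham_grad Z r H u k - ham_grad B r H u k = (\<Sum>\<sigma>\<in>signs r. \<Sum>i<r. sign_conj (- \<sigma> i) (e \<sigma> i k))" if "k \<in> B" for k
  proof -
    have sc: "sign_conj c x - sign_conj c y = sign_conj c (x - y)" for c x y by (simp add: sign_conj_def)
    have "ham_grad B r H u k = ham_grad Z r H uB k"
      unfolding uB_def using that B by (simp add: ham_grad_restrict)
    moreover have "ham_grad Z r H u k - ham_grad Z r H uB k = (\<Sum>\<sigma>\<in>signs r. \<Sum>i<r.
        sign_conj (- \<sigma> i) (multiform Z r (H \<sigma>) ((signed_field \<sigma> u)(i := delta k))) -
        sign_conj (- \<sigma> i) (multiform Z r (H \<sigma>) ((signed_field \<sigma> uB)(i := delta k))))"
      by (simp only: ham_grad_def sum_subtractf)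
    ultimately show ?thesis by (simp only: sc e_def)
  qed
  have "L2_set (wt d (- s) (\<lambda>k. ham_grad Z r H u k - ham_grad B r H u k)) B \<le>
      L2_set (wt d s (\<lambda>k. \<Sum>\<sigma>\<in>signs r. \<Sum>i<r. sign_conj (- \<sigma> i) (e \<sigma> i k))) B"
    using s_nonneg by (intro L2_set_mono) (auto simp: diff intro!: mult_right_mono powr_mono)
  also have "\<dots> \<le> (\<Sum>\<sigma>\<in>signs r. L2_set (wt d s (\<lambda>k. \<Sum>i<r. sign_conj (- \<sigma> i) (e \<sigma> i k))) B)"
    by (rule L2_set_wt_sum)
  also have "\<dots> \<le> (\<Sum>\<sigma>\<in>signs r. \<Sum>i<r. L2_set (wt d s (\<lambda>k. sign_conj (- \<sigma> i) (e \<sigma> i k))) B)"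
    by (intro sum_mono L2_set_wt_sum)
  also have "\<dots> \<le> (\<Sum>\<sigma>\<in>signs r. \<Sum>i<r. K)" using e by (intro sum_mono) auto
  also have "\<dots> = real r * 2 ^ r * K" by (simp add: card_signs)
  finally show ?thesis unfolding K_def .
qed

text \<open>
  The bound holds with a constant that does not depend on \<open>B\<close>. Each of the \<open>r\<close> slots in which the
  derivative can fall and each of the \<open>2\<^sup>r\<close> choices of signs contributes \<open>C\<close>.
\<close>

lemma ham_poly_adm:
  assumes H: "\<And>\<sigma>. \<sigma> \<in> signs r \<Longrightarrow> dominated (H \<sigma>)" and B: "finite B" "B \<subseteq> Z"
  shows "adm (\<lambda>k. jap d k powr s) B r (real r * 2 ^ r * C) (ham_poly B r H)"
proof -
  let ?W = "\<lambda>k. jap d k powr s"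
  obtain ts where ts: "ham_poly B r H = ev ts" "homog B r ts"
    "\<forall>h z. (\<Sum>v\<in>vars B. h v * maj (dterms v ts) z) = (\<Sum>\<sigma>\<in>signs r. \<Sum>n\<in>tuples r B. cmod (H \<sigma> n) *
       (\<Sum>i<r. h (n i, \<sigma> i = 1) * (\<Prod>l\<in>{..<r} - {i}. z (n l, \<sigma> l = 1))))"
    "\<forall>h z. (\<Sum>v\<in>vars B. h v * ev (dterms v ts) z) = (\<Sum>\<sigma>\<in>signs r. \<Sum>n\<in>tuples r B. H \<sigma> n *
       (\<Sum>i<r. h (n i, \<sigma> i = 1) * (\<Prod>l\<in>{..<r} - {i}. z (n l, \<sigma> l = 1))))"
    using ham_poly_terms[OF B(1), of r H] by blast
  have "tame ?W B r (real r * 2 ^ r * C) ts"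
    unfolding tame_def
  proof (intro conjI ts(2) allI impI)
    fix R and h z :: "site \<times> bool \<Rightarrow> real"
    assume R: "0 < R" and h: "\<forall>v. 0 \<le> h v" and z: "\<forall>v. 0 \<le> z v" "wnorm ?W B z \<le> R"
    have sub: "L2_set (\<lambda>k. f (k, b)) B \<le> L2_set f (vars B)" for f :: "site \<times> bool \<Rightarrow> real" and b
    proof -
      have "(\<Sum>k\<in>B. (f (k, b))\<^sup>2) = (\<Sum>v\<in>(\<lambda>k. (k, b)) ` B. (f v)\<^sup>2)" by (subst sum.reindex) (auto simp: inj_on_def)
      also have "\<dots> \<le> (\<Sum>v\<in>vars B. (f v)\<^sup>2)" using B by (intro sum_mono2) auto
      finally show ?thesis by (simp add: L2_set_def)
    qed
    have slot: "(\<Sum>n\<in>tuples r B. cmod (H \<sigma> n) * (h (n i, \<sigma> i = 1) * (\<Prod>l\<in>{..<r} - {i}. z (n l, \<sigma> l = 1)))) \<le>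
        C * (dnorm ?W B h * R ^ (r - 1))" if \<sigma>: "\<sigma> \<in> signs r" and i: "i < r" for \<sigma> i
    proof -
      define f where "f = (\<lambda>l k. if l = i then h (k, \<sigma> i = 1) else z (k, \<sigma> l = 1))"
      have split: "(\<Prod>l<r. f l (n l)) = h (n i, \<sigma> i = 1) * (\<Prod>l\<in>{..<r} - {i}. z (n l, \<sigma> l = 1))" for n
        using i by (subst prod.remove[of _ i]) (auto simp: f_def intro!: prod.cong)
      have f: "0 \<le> f l k" for l k using h z by (auto simp: f_def)
      have "tuples r B \<subseteq> tuples r Z" using B by (auto simp: tuples_def PiE_def Pi_def)
      then have dom: "cmod (H \<sigma> n) \<le> w n" if "n \<in> tuples r B" for n
        using H[OF \<sigma>] that by (auto simp: dominated_def)
      have "(\<Sum>n\<in>tuples r B. cmod (H \<sigma> n) * (\<Prod>l<r. f l (n l))) \<le> (\<Sum>n\<in>tuples r B. w n * (\<Prod>l<r. f l (n l)))"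
        using dom f by (intro sum_mono mult_right_mono prod_nonneg) auto
      also have "\<dots> \<le> C * (L2_set (\<lambda>k. jap d k powr (- s) * f i k) B * (\<Prod>l\<in>{..<r} - {i}. L2_set (\<lambda>k. ?W k * f l k) B))"
        using f B i by (intro finite_bound)
      also have "\<dots> \<le> C * (dnorm ?W B h * (\<Prod>l\<in>{..<r} - {i}. R))"
      proof (intro mult_left_mono mult_mono prod_mono conjI C_nonneg)
        have "L2_set (\<lambda>k. jap d k powr (- s) * f i k) B = L2_set (\<lambda>k. h (k, \<sigma> i = 1) / ?W (fst (k, \<sigma> i = 1))) B"
          by (intro L2_set_cong refl) (simp add: f_def powr_minus divide_inverse)
        also have "\<dots> \<le> dnorm ?W B h" unfolding dnorm_def by (rule sub)
        finally show "L2_set (\<lambda>k. jap d k powr (- s) * f i k) B \<le> dnorm ?W B h" .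
        fix l assume l: "l \<in> {..<r} - {i}"
        have "L2_set (\<lambda>k. ?W k * f l k) B = L2_set (\<lambda>k. ?W (fst (k, \<sigma> l = 1)) * z (k, \<sigma> l = 1)) B"
          using l by (intro L2_set_cong refl) (simp add: f_def)
        also have "\<dots> \<le> wnorm ?W B z" unfolding wnorm_def by (rule sub)
        finally show "L2_set (\<lambda>k. ?W k * f l k) B \<le> R" using z(2) by linarith
      qed (auto intro!: prod_nonneg)
      finally show ?thesis unfolding split using i by simp
    qed
    have "(\<Sum>v\<in>vars B. h v * maj (dterms v ts) z) = (\<Sum>\<sigma>\<in>signs r. \<Sum>i<r. \<Sum>n\<in>tuples r B.
        cmod (H \<sigma> n) * (h (n i, \<sigma> i = 1) * (\<Prod>l\<in>{..<r} - {i}. z (n l, \<sigma> l = 1))))"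
      unfolding ts(3)[rule_format] sum_distrib_left by (intro sum.cong refl sum.swap)
    also have "\<dots> \<le> (\<Sum>\<sigma>\<in>signs r. \<Sum>i<r. C * (dnorm ?W B h * R ^ (r - 1)))"
      using slot by (intro sum_mono) auto
    also have "\<dots> = real r * 2 ^ r * C * R ^ (r - 1) * dnorm ?W B h" by (simp add: card_signs)
    finally show "(\<Sum>v\<in>vars B. h v * maj (dterms v ts) z) \<le> real r * 2 ^ r * C * R ^ (r - 1) * dnorm ?W B h" .
  qed
  then show ?thesis unfolding adm_def using ts(1) by blast
qed

end

section \<open>Tails, small divisors and clusters\<close>

lemma tail_small:
  assumes u: "u \<in> hspace d Z s" and "0 < \<delta>"
  shows "\<exists>B. finite B \<and> B \<subseteq> Z \<and> hnorm d Z s (\<lambda>k. if k \<in> B then 0 else u k) \<le> \<delta>"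
proof -
  let ?f = "\<lambda>k. (wt d s u k)\<^sup>2"
  have sm: "?f summable_on Z" using u by (simp add: hspace_altdef)
  have "\<exists>B. finite B \<and> B \<subseteq> Z \<and> infsum ?f Z - \<delta>\<^sup>2 < sum ?f B"
  proof (rule ccontr)
    assume neg: "\<not> ?thesis"
    have "sum ?f B \<le> infsum ?f Z - \<delta>\<^sup>2" if "finite B" "B \<subseteq> Z" for B
    proof (rule ccontr)
      assume "\<not> sum ?f B \<le> infsum ?f Z - \<delta>\<^sup>2"
      then have "infsum ?f Z - \<delta>\<^sup>2 < sum ?f B" by (simp only: not_le)
      with neg that show False by blast
    qed
    then have "infsum ?f Z \<le> infsum ?f Z - \<delta>\<^sup>2" by (intro infsum_le_finite_sums sm)
    then show False using \<open>0 < \<delta>\<close> by simp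
  qed
  then obtain B where B: "finite B" "B \<subseteq> Z" "infsum ?f Z - \<delta>\<^sup>2 < sum ?f B" by blast
  have "hnorm d Z s (\<lambda>k. if k \<in> B then 0 else u k) \<le> \<delta>"
  proof (rule hspaceI(2))
    fix A assume A: "finite A" "A \<subseteq> Z"
    have "(\<Sum>k\<in>A. (wt d s (\<lambda>k. if k \<in> B then 0 else u k) k)\<^sup>2) = sum ?f (A - B)"
      using A by (intro sum.mono_neutral_cong_right) auto
    also have "\<dots> = sum ?f (A \<union> B) - sum ?f B"
    proof -
      have "sum ?f ((A - B) \<union> B) = sum ?f (A - B) + sum ?f B"
        using A B by (intro sum.union_disjoint) auto
      moreover have "(A - B) \<union> B = A \<union> B" by auto
      ultimately show ?thesis by simp
    qed
    also have "sum ?f (A \<union> B) \<le> infsum ?f Z" using A B sm by (intro finite_sum_le_infsum) auto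
    finally have "(\<Sum>k\<in>A. (wt d s (\<lambda>k. if k \<in> B then 0 else u k) k)\<^sup>2) \<le> \<delta>\<^sup>2" using B(3) by linarith
    then show "L2_set (wt d s (\<lambda>k. if k \<in> B then 0 else u k)) A \<le> \<delta>"
      unfolding L2_set_def using \<open>0 < \<delta>\<close> by (intro real_le_lsqrt) (auto intro: sum_nonneg)
  qed (use u in \<open>simp add: hspace_vanishes\<close>)
  then show ?thesis using B by blast
qed

text \<open>
  A single finite set of modes works for a whole time interval, by continuity in \<open>h\<^sup>s\<close> and
  compactness.
\<close>

lemma uniform_tail:
  assumes u: "u \<in> h_C0 d Z s" and "0 < \<delta>" and B0: "finite B0" "B0 \<subseteq> Z"
  shows "\<exists>B. finite B \<and> B0 \<subseteq> B \<and> B \<subseteq> Z \<and>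
    (\<forall>t. \<bar>t\<bar> \<le> T \<longrightarrow> hnorm d Z s (\<lambda>k. if k \<in> B then 0 else u t k) \<le> \<delta>)"
proof -
  have uh: "u t \<in> hspace d Z s" for t using u by (simp add: h_C0_def)
  have "\<forall>t. \<exists>B. finite B \<and> B \<subseteq> Z \<and> hnorm d Z s (\<lambda>k. if k \<in> B then 0 else u t k) \<le> \<delta> / 2"
    using tail_small[OF uh, of "\<delta> / 2"] \<open>0 < \<delta>\<close> by simp
  then obtain Bt where Bt: "\<And>t. finite (Bt t)" "\<And>t. Bt t \<subseteq> Z"
      "\<And>t. hnorm d Z s (\<lambda>k. if k \<in> Bt t then 0 else u t k) \<le> \<delta> / 2" by metis
  have "\<forall>t. \<exists>e>0. \<forall>\<tau>. dist \<tau> t < e \<longrightarrow> hnorm d Z s (\<lambda>k. u \<tau> k - u t k) \<le> \<delta> / 2"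
  proof
    fix t
    have "((\<lambda>\<tau>. hnorm d Z s (\<lambda>k. u \<tau> k - u t k)) \<longlongrightarrow> 0) (at t)" using u by (simp add: h_C0_def)
    then have "\<forall>\<^sub>F \<tau> in at t. hnorm d Z s (\<lambda>k. u \<tau> k - u t k) < \<delta> / 2"
      using \<open>0 < \<delta>\<close> by (intro order_tendstoD) auto
    then obtain e where e: "e > 0" "\<And>\<tau>. \<tau> \<noteq> t \<Longrightarrow> dist \<tau> t < e \<Longrightarrow> hnorm d Z s (\<lambda>k. u \<tau> k - u t k) < \<delta> / 2"
      unfolding eventually_at by auto
    have "hnorm d Z s (\<lambda>k. u t k - u t k) \<le> \<delta> / 2" using \<open>0 < \<delta>\<close> by (simp add: hnorm_altdef)
    then show "\<exists>e>0. \<forall>\<tau>. dist \<tau> t < e \<longrightarrow> hnorm d Z s (\<lambda>k. u \<tau> k - u t k) \<le> \<delta> / 2"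
    proof (intro exI[of _ e] conjI allI impI)
      show "hnorm d Z s (\<lambda>k. u \<tau> k - u t k) \<le> \<delta> / 2" if "dist \<tau> t < e" for \<tau>
        using that e(2)[of \<tau>] \<open>hnorm d Z s (\<lambda>k. u t k - u t k) \<le> \<delta> / 2\<close> by (cases "\<tau> = t") auto
    qed (rule e(1))
  qed
  then obtain e where e: "\<And>t. e t > 0" "\<And>t \<tau>. dist \<tau> t < e t \<Longrightarrow> hnorm d Z s (\<lambda>k. u \<tau> k - u t k) \<le> \<delta> / 2" by metis
  have "{- T..T} \<subseteq> (\<Union>t\<in>{- T..T}. ball t (e t))" using e(1) by auto
  then obtain D where D: "finite D" "{- T..T} \<subseteq> (\<Union>t\<in>D. ball t (e t))"
    by (rule compactE_image[OF compact_Icc, rotated]) auto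
  define B where "B = B0 \<union> (\<Union>t\<in>D. Bt t)"
  have "hnorm d Z s (\<lambda>k. if k \<in> B then 0 else u \<tau> k) \<le> \<delta>" if "\<bar>\<tau>\<bar> \<le> T" for \<tau>
  proof -
    have "\<tau> \<in> {- T..T}" using that by auto
    then obtain t where t: "t \<in> D" "dist t \<tau> < e t" using D(2) by auto
    let ?a = "\<lambda>k. if k \<in> B then 0 else u t k" and ?b = "\<lambda>k. if k \<in> B then 0 else u \<tau> k - u t k"
    have w: "(\<lambda>k. if k \<in> Bt t then 0 else u t k) \<in> hspace d Z s"
      by (rule hspace_dominated(1)[OF uh[of t]]) simp
    have a: "?a \<in> hspace d Z s" "hnorm d Z s ?a \<le> \<delta> / 2"
    proof -
      have le: "cmod (?a k) \<le> cmod (if k \<in> Bt t then 0 else u t k)" for k using t(1) by (auto simp: B_def)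
      show "?a \<in> hspace d Z s" "hnorm d Z s ?a \<le> \<delta> / 2"
        using hspace_dominated[OF w le] Bt(3)[of t] by auto
    qed
    have df: "(\<lambda>k. u \<tau> k - u t k) \<in> hspace d Z s" by (intro hspace_diff uh)
    have b: "?b \<in> hspace d Z s" "hnorm d Z s ?b \<le> \<delta> / 2"
    proof -
      have le: "cmod (?b k) \<le> cmod (u \<tau> k - u t k)" for k by simp
      show "?b \<in> hspace d Z s" "hnorm d Z s ?b \<le> \<delta> / 2"
        using hspace_dominated[OF df le] e(2)[of \<tau> t] t(2) by (auto simp: dist_commute)
    qed
    have "(\<lambda>k. if k \<in> B then 0 else u \<tau> k) = (\<lambda>k. ?a k + ?b k)" by auto
    then show ?thesis using hspace_add(2)[OF a(1) b(1)] a(2) b(2) by simp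
  qed
  moreover have "finite B" "B0 \<subseteq> B" "B \<subseteq> Z" using B0 D(1) Bt by (auto simp: B_def)
  ultimately show ?thesis by blast
qed

text \<open>
  Differentiability in \<open>h\<^bsup>-s\<^esup>\<close> suffices for the individual modes.
\<close>

lemma component_derivative:
  assumes "h_C1_deriv d Z s u u'" "k \<in> Z"
  shows "((\<lambda>\<tau>. u \<tau> k) has_vector_derivative u' t k) (at t)"
proof -
  define q where "q = (\<lambda>\<tau> k. (u \<tau> k - u t k) / of_real (\<tau> - t) - u' t k)"
  have uh: "u \<tau> \<in> hspace d Z s" "u' \<tau> \<in> hspace d Z s" for \<tau>
    using assms(1) by (auto simp: h_C1_deriv_def h_C0_def)
  have "(\<lambda>k. inverse (of_real (\<tau> - t)) * (u \<tau> k - u t k) - u' t k) \<in> hspace d Z s" for \<tau>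
    by (intro hspace_diff hspace_cmult uh)
  then have q: "q \<tau> \<in> hspace d Z s" for \<tau> by (simp add: q_def divide_inverse mult.commute)
  have le: "cmod (q \<tau> k) \<le> jap d k powr (- s) * hnorm d Z s (q \<tau>)" for \<tau>
  proof -
    have "wt d s (q \<tau>) k = L2_set (wt d s (q \<tau>)) {k}" by (simp add: L2_set_def)
    also have "\<dots> \<le> hnorm d Z s (q \<tau>)" using assms(2) by (intro L2_set_le_hnorm q) auto
    finally have "jap d k powr (- s) * wt d s (q \<tau>) k \<le> jap d k powr (- s) * hnorm d Z s (q \<tau>)"
      by (rule mult_left_mono) simp
    then show ?thesis by (simp add: mult.assoc[symmetric] flip: powr_add)
  qed
  have "((\<lambda>\<tau>. hnorm d Z s (q \<tau>)) \<longlongrightarrow> 0) (at t)"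
    using assms(1) unfolding h_C1_deriv_def q_def by blast
  then have "((\<lambda>\<tau>. jap d k powr (- s) * hnorm d Z s (q \<tau>)) \<longlongrightarrow> 0) (at t)"
    by (rule tendsto_mult_right_zero)
  then have "((\<lambda>\<tau>. cmod (q \<tau> k)) \<longlongrightarrow> 0) (at t)"
    by (rule Lim_null_comparison[rotated]) (use le in auto)
  moreover have "\<forall>\<^sub>F \<tau> in at t. cmod (q \<tau> k) = norm (u \<tau> k - u t k - (\<tau> - t) *\<^sub>R u' t k) / norm (\<tau> - t)"
  proof (rule eventually_at_filter[THEN iffD2], rule always_eventually, intro allI impI)
    fix \<tau> assume "\<tau> \<noteq> t"
    then have "q \<tau> k = (u \<tau> k - u t k - (\<tau> - t) *\<^sub>R u' t k) / of_real (\<tau> - t)"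
      by (simp add: q_def scaleR_conv_of_real diff_divide_distrib)
    then show "cmod (q \<tau> k) = norm (u \<tau> k - u t k - (\<tau> - t) *\<^sub>R u' t k) / norm (\<tau> - t)"
      by (simp add: norm_divide flip: of_real_diff)
  qed
  ultimately have "((\<lambda>\<tau>. norm (u \<tau> k - u t k - (\<tau> - t) *\<^sub>R u' t k) / norm (\<tau> - t)) \<longlongrightarrow> 0) (at t)"
    by (rule Lim_transform_eventually)
  then show ?thesis
    unfolding has_vector_derivative_def has_derivative_iff_norm
    by (auto intro: bounded_linear_scaleR_left)
qed

lemma sum_pairs: "(\<Sum>i<2 * h. g i) = (\<Sum>i<h. g (2 * i) + g (2 * i + 1 :: nat))"
  for g :: "nat \<Rightarrow> 'b::comm_monoid_add"
  by (induction h) (auto simp: add.assoc)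

lemma sum_mset_nth: "(\<Sum>v\<in>#mset xs. f v) = (\<Sum>i<length xs. f (xs ! i))"
proof -
  have "(\<Sum>v\<in>#mset xs. f v) = sum_list (map f xs)" by (simp flip: sum_mset_sum_list mset_map)
  also have "\<dots> = (\<Sum>i<length xs. f (xs ! i))" by (simp add: sum_list_sum_nth atLeast0LessThan)
  finally show ?thesis .
qed

text \<open>
  Neither the divisor nor the weights change when every site of the cluster is replaced by \<open>n\<^sub>0\<close>.
  As the weight is nonzero, \<open>n\<^sub>0\<close> is then among the sites in the definition of \<open>kappa\<close>, and so
  \<open>kappa\<close> is at most \<open>\<langle>n\<^sub>0\<rangle>\<close>. In the resonant alternative of the non-resonance condition the pairs
  have opposite signs and equal frequencies, so the weight of the cluster would be zero.
\<close>

lemma small_divisor_bound: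
  assumes nr: "strongly_nonresonant d Z \<beta> \<gamma> Nmax r \<omega>" and n0: "n\<^sub>0 \<in> Z" "ereal (jap d n\<^sub>0) \<le> Nmax"
    and m: "set_mset m \<subseteq> vars Z" "size m = j" "1 \<le> j" "j \<le> r" and "0 < \<beta> j" "0 < \<gamma> j"
    and weight: "qweight (\<lambda>k. if \<omega> k = \<omega> n\<^sub>0 then 1 else 0) m \<noteq> 0"
  shows "\<gamma> j * jap d n\<^sub>0 powr (- \<beta> j) \<le> cmod (qweight (\<lambda>k. of_real (\<omega> k)) m)"
proof -
  obtain xs where xs: "mset xs = m" using ex_mset by blast
  have len: "length xs = j" using xs m(2) by auto
  have xsZ: "fst (xs ! i) \<in> Z" if "i < j" for i
  proof -
    have "xs ! i \<in># m" using that len xs by auto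
    then have "xs ! i \<in> vars Z" using m(1) by blast
    then show ?thesis by (auto simp: mem_Times_iff)
  qed
  define \<sigma> :: "nat \<Rightarrow> int" where "\<sigma> = (\<lambda>i\<in>{..<j}. if snd (xs ! i) then 1 else - 1)"
  define n where "n = (\<lambda>i\<in>{..<j}. if \<omega> (fst (xs ! i)) = \<omega> n\<^sub>0 then n\<^sub>0 else fst (xs ! i))"
  have \<sigma>: "\<sigma> \<in> signs j" by (auto simp: \<sigma>_def signs_def tuples_def)
  have n: "n \<in> tuples j Z" using xsZ n0 by (auto simp: n_def tuples_def)
  have \<omega>n: "\<omega> (n i) = \<omega> (fst (xs ! i))" if "i < j" for i using that by (simp add: n_def)
  have sg: "sg (xs ! i) = of_int (\<sigma> i)" if "i < j" for i
    using that by (cases "xs ! i") (auto simp: \<sigma>_def)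
  have qw: "qweight (\<lambda>k. g (\<omega> k)) m = (\<Sum>i<j. of_int (\<sigma> i) * g (\<omega> (n i)))" for g :: "real \<Rightarrow> complex"
    unfolding qweight_def xs[symmetric] sum_mset_nth len by (intro sum.cong refl) (simp add: sg \<omega>n)
  have "qweight (\<lambda>k. if \<omega> k = \<omega> n\<^sub>0 then 1 else 0) m = (\<Sum>i<j. of_int (\<sigma> i) * (if \<omega> (n i) = \<omega> n\<^sub>0 then 1 else 0))"
    by (rule qw)
  also have "\<dots> = of_int (\<Sum>i<j. if \<omega> (n i) = \<omega> n\<^sub>0 then \<sigma> i else 0)"
    unfolding of_int_sum by (intro sum.cong refl) auto
  finally have eq: "qweight (\<lambda>k. if \<omega> k = \<omega> n\<^sub>0 then 1 else 0) m =
      of_int (\<Sum>i<j. if \<omega> (n i) = \<omega> n\<^sub>0 then \<sigma> i else 0)" .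
  have S0: "(\<Sum>i<j. if \<omega> (n i) = \<omega> n\<^sub>0 then \<sigma> i else 0) \<noteq> 0"
  proof
    assume "(\<Sum>i<j. if \<omega> (n i) = \<omega> n\<^sub>0 then \<sigma> i else 0) = 0"
    with eq have "qweight (\<lambda>k. if \<omega> k = \<omega> n\<^sub>0 then 1 else 0) m = 0" by (simp only: of_int_0)
    with weight show False by contradiction
  qed
  have "\<exists>i<j. \<omega> (n i) = \<omega> n\<^sub>0"
  proof (rule ccontr)
    assume "\<not> ?thesis"
    then have "(\<Sum>i<j. if \<omega> (n i) = \<omega> n\<^sub>0 then \<sigma> i else 0) = 0" by (intro sum.neutral) auto
    with S0 show False by contradiction
  qed
  then obtain i0 where i0: "i0 < j" "\<omega> (n i0) = \<omega> n\<^sub>0" by blast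
  have ni0: "n i0 = n\<^sub>0" using i0 by (auto simp: n_def split: if_splits)
  have "(\<Sum>k | k < j \<and> \<omega> (n k) = \<omega> (n i0). \<sigma> k) = (\<Sum>i<j. if \<omega> (n i) = \<omega> n\<^sub>0 then \<sigma> i else 0)"
    unfolding i0(2) by (subst sum.inter_filter[symmetric]) auto
  then have idx: "i0 \<in> {i. i < j \<and> (\<Sum>k | k < j \<and> \<omega> (n k) = \<omega> (n i). \<sigma> k) \<noteq> 0}" using S0 i0(1) by auto
  have k1: "kappa d \<omega> j \<sigma> n \<le> ereal (jap d n\<^sub>0)"
    unfolding kappa_def using INF_lower[OF idx, of "\<lambda>i. ereal (jap d (n i))"] ni0 by simp
  have k2: "1 \<le> kappa d \<omega> j \<sigma> n"
    unfolding kappa_def by (intro INF_greatest) simp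
  obtain \<kappa> where \<kappa>: "kappa d \<omega> j \<sigma> n = ereal \<kappa>" "1 \<le> \<kappa>" "\<kappa> \<le> jap d n\<^sub>0"
    using k1 k2 by (cases "kappa d \<omega> j \<sigma> n") auto
  have "kappa d \<omega> j \<sigma> n \<le> Nmax" using k1 n0(2) by (rule order_trans)
  moreover have "j \<in> {1..r}" using m by simp
  ultimately have "\<bar>\<Sum>i<j. of_int (\<sigma> i) * \<omega> (n i)\<bar> \<ge> \<gamma> j * real_of_ereal (kappa d \<omega> j \<sigma> n) powr (- \<beta> j) \<or>
      even j \<and> (\<exists>\<rho>. \<rho> permutes {..<j} \<and> (\<forall>i < j div 2. \<sigma> (\<rho> (2 * i)) = - \<sigma> (\<rho> (2 * i + 1)) \<and>
        \<omega> (n (\<rho> (2 * i))) = \<omega> (n (\<rho> (2 * i + 1)))))"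
    using nr \<sigma> n unfolding strongly_nonresonant_def by (elim ballE[of _ _ j] ballE[of _ _ n] ballE[of _ _ \<sigma>] impE) simp_all
  then consider
      "\<bar>\<Sum>i<j. of_int (\<sigma> i) * \<omega> (n i)\<bar> \<ge> \<gamma> j * real_of_ereal (kappa d \<omega> j \<sigma> n) powr (- \<beta> j)"
    | \<rho> where "even j" "\<rho> permutes {..<j}" "\<forall>i < j div 2. \<sigma> (\<rho> (2 * i)) = - \<sigma> (\<rho> (2 * i + 1)) \<and>
        \<omega> (n (\<rho> (2 * i))) = \<omega> (n (\<rho> (2 * i + 1)))"
    by blast
  then show ?thesis
  proof cases
    case 1
    have "qweight (\<lambda>k. of_real (\<omega> k)) m = of_real (\<Sum>i<j. of_int (\<sigma> i) * \<omega> (n i))"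
      using qw[of of_real] by simp
    then have "cmod (qweight (\<lambda>k. of_real (\<omega> k)) m) = \<bar>\<Sum>i<j. of_int (\<sigma> i) * \<omega> (n i)\<bar>"
      by (simp only: norm_of_real)
    moreover have "\<gamma> j * jap d n\<^sub>0 powr (- \<beta> j) \<le> \<gamma> j * \<kappa> powr (- \<beta> j)"
      using \<kappa> assms(8,9) by (intro mult_left_mono powr_mono2') auto
    ultimately show ?thesis using 1 \<kappa>(1) by simp
  next
    case (2 \<rho>)
    let ?f = "\<lambda>i. if \<omega> (n i) = \<omega> n\<^sub>0 then \<sigma> i else 0"
    have "(\<Sum>i<j. ?f i) = (\<Sum>i<j. ?f (\<rho> i))"
      using sum.permute[OF 2(2), of ?f] by (simp add: o_def)
    also have "\<dots> = (\<Sum>i<2 * (j div 2). ?f (\<rho> i))" using 2(1) by simp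
    also have "\<dots> = (\<Sum>i<j div 2. ?f (\<rho> (2 * i)) + ?f (\<rho> (2 * i + 1)))" by (rule sum_pairs)
    also have "\<dots> = 0" using 2(3) by (intro sum.neutral) auto
    finally show ?thesis using S0 by simp
  qed
qed

lemma coercive_finite_cluster:
  assumes "coercive d Z \<omega>" "Z \<subseteq> Zd d"
  shows "finite {k \<in> Z. \<omega> k = \<omega>\<^sub>0}"
proof -
  have "\<forall>\<^sub>F k in inf (filtercomap (site_norm d) at_top) (principal Z). \<bar>\<omega>\<^sub>0\<bar> < \<bar>\<omega> k\<bar>"
    using assms(1) unfolding coercive_def filterlim_at_top_dense by blast
  then obtain N where N: "\<And>k. site_norm d k \<ge> N \<Longrightarrow> k \<in> Z \<Longrightarrow> \<bar>\<omega>\<^sub>0\<bar> < \<bar>\<omega> k\<bar>"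
    unfolding eventually_inf_principal eventually_filtercomap_at_top_linorder by blast
  have "{k \<in> Z. \<omega> k = \<omega>\<^sub>0} \<subseteq> {..<d} \<rightarrow>\<^sub>E {- \<lceil>\<bar>N\<bar>\<rceil>..\<lceil>\<bar>N\<bar>\<rceil>}"
  proof
    fix k assume "k \<in> {k \<in> Z. \<omega> k = \<omega>\<^sub>0}"
    then have k: "k \<in> Z" "\<omega> k = \<omega>\<^sub>0" by auto
    then have less: "site_norm d k < N" using N[of k] by force
    have "k i \<in> {- \<lceil>\<bar>N\<bar>\<rceil>..\<lceil>\<bar>N\<bar>\<rceil>}" if "i < d" for i
    proof -
      have "\<bar>real_of_int (k i)\<bar> \<le> site_norm d k"
        unfolding site_norm_L2 using that member_le_L2_set[of "{..<d}" i "\<lambda>i. \<bar>real_of_int (k i)\<bar>"]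
        by (simp add: L2_set_def)
      then have "\<bar>real_of_int (k i)\<bar> \<le> of_int \<lceil>\<bar>N\<bar>\<rceil>" using less by linarith
      then show ?thesis by auto
    qed
    moreover have "k \<in> Zd d" using k assms(2) by blast
    ultimately show "k \<in> {..<d} \<rightarrow>\<^sub>E {- \<lceil>\<bar>N\<bar>\<rceil>..\<lceil>\<bar>N\<bar>\<rceil>}" unfolding Zd_def PiE_def Pi_def by blast
  qed
  then show ?thesis by (rule finite_subset) (intro finite_PiE, auto)
qed

lemma L2_set_vars: "finite B \<Longrightarrow> L2_set (\<lambda>v. f (fst v)) (vars B) \<le> 2 * L2_set f B"
proof -
  have "(\<Sum>v\<in>vars B. (f (fst v))\<^sup>2) = (\<Sum>k\<in>B. \<Sum>b\<in>(UNIV::bool set). (f k)\<^sup>2)"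
    unfolding sum.cartesian_product by (intro sum.cong) auto
  also have "\<dots> = 2 * (\<Sum>k\<in>B. (f k)\<^sup>2)" by (simp add: sum_distrib_left UNIV_bool)
  finally have "L2_set (\<lambda>v. f (fst v)) (vars B) = sqrt (2 * (\<Sum>k\<in>B. (f k)\<^sup>2))" by (simp add: L2_set_def)
  also have "\<dots> \<le> sqrt (4 * (\<Sum>k\<in>B. (f k)\<^sup>2))" by (intro real_sqrt_le_mono mult_right_mono sum_nonneg) auto
  also have "\<dots> = 2 * L2_set f B" by (simp add: L2_set_def real_sqrt_mult)
  finally show ?thesis .
qed

section \<open>Conservation of the super-actions\<close>

text \<open>
  Sums and absolute values take the place of maxima: they bound all entries at once and are
  nonnegative for arbitrary arguments.
\<close>

definition sd_const :: "(nat \<Rightarrow> real) \<Rightarrow> nat \<Rightarrow> real" where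
  "sd_const \<gamma> r = 1 + (\<Sum>j\<in>{3..r}. inverse \<bar>\<gamma> j\<bar>)"

definition sd_exponent :: "(nat \<Rightarrow> real) \<Rightarrow> nat \<Rightarrow> real" where
  "sd_exponent \<beta> r = (\<Sum>j\<in>{3..r}. \<bar>\<beta> j\<bar>)"

text \<open>
  The lowest degree of the perturbation is not an argument, so the sums start at \<open>3\<close>; whatever \<open>c\<close>
  is at degrees that do not occur, it only increases the constant.
\<close>

definition ham_const :: "nat \<Rightarrow> real \<Rightarrow> real \<Rightarrow> real \<Rightarrow> nat \<Rightarrow> (nat \<Rightarrow> real) \<Rightarrow> real" where
  "ham_const d s q \<alpha> r c = real r * 2 ^ r * (\<Sum>j\<in>{3..<r}. \<bar>c j\<bar>) * (\<Sum>j\<in>{3..<r}. \<bar>form_const d s q \<alpha> j\<bar>)"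

lemma sd_const_ge_1: "1 \<le> sd_const \<gamma> r"
  by (simp add: sd_const_def sum_nonneg)

lemma sd_exponent_nonneg: "0 \<le> sd_exponent \<beta> r"
  by (simp add: sd_exponent_def sum_nonneg)

lemma sd_bound:
  assumes "j \<in> {3..r}" "0 < \<gamma> j" "0 < \<beta> j" "1 \<le> x"
  shows "1 / (sd_const \<gamma> r * x powr sd_exponent \<beta> r) \<le> \<gamma> j * x powr (- \<beta> j)"
proof -
  have "inverse \<bar>\<gamma> j\<bar> \<le> (\<Sum>j\<in>{3..r}. inverse \<bar>\<gamma> j\<bar>)" using assms(1) by (intro member_le_sum) auto
  then have 1: "inverse (\<gamma> j) \<le> sd_const \<gamma> r" using assms(2) by (simp add: sd_const_def)
  have "\<bar>\<beta> j\<bar> \<le> sd_exponent \<beta> r" unfolding sd_exponent_def using assms(1) by (intro member_le_sum) auto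
  then have "x powr \<beta> j \<le> x powr sd_exponent \<beta> r" using assms(3,4) by (intro powr_mono) auto
  with 1 have "inverse (\<gamma> j) * x powr \<beta> j \<le> sd_const \<gamma> r * x powr sd_exponent \<beta> r"
    using assms sd_const_ge_1[of \<gamma> r] by (intro mult_mono) auto
  moreover have "0 < inverse (\<gamma> j) * x powr \<beta> j" using assms by simp
  ultimately have "1 / (sd_const \<gamma> r * x powr sd_exponent \<beta> r) \<le> 1 / (inverse (\<gamma> j) * x powr \<beta> j)"
    by (intro frac_le) auto
  also have "\<dots> = \<gamma> j * x powr (- \<beta> j)" by (simp add: powr_minus divide_inverse)
  finally show ?thesis .
qed

lemma cluster_action:
  assumes "finite B" "{k \<in> Z. \<omega> k = \<omega>\<^sub>0} \<subseteq> B" "B \<subseteq> Z"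
  shows "quad B (\<lambda>k. if \<omega> k = \<omega>\<^sub>0 then 1 else 0) (conj_pair u) =
    of_real (\<Sum>\<^sub>\<infinity>k\<in>{k \<in> Z. \<omega> k = \<omega>\<^sub>0}. (cmod (u k))\<^sup>2)"
proof -
  have fin: "finite {k \<in> Z. \<omega> k = \<omega>\<^sub>0}" using assms(1,2) by (rule rev_finite_subset)
  have "quad B (\<lambda>k. if \<omega> k = \<omega>\<^sub>0 then 1 else 0) (conj_pair u) =
      (\<Sum>k\<in>B. if \<omega> k = \<omega>\<^sub>0 then of_real ((cmod (u k))\<^sup>2) else 0)"
    unfolding quad_def
    by (intro sum.cong refl) (simp add: conj_pair_def complex_norm_square del: of_real_power)
  also have "\<dots> = (\<Sum>k\<in>{k \<in> Z. \<omega> k = \<omega>\<^sub>0}. of_real ((cmod (u k))\<^sup>2))"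
    using assms by (intro sum.mono_neutral_cong_right) auto
  finally show ?thesis using fin by simp
qed

lemma super_action_le:
  assumes "u \<in> hspace d Z s" "0 \<le> s" "hnorm d Z s u \<le> \<epsilon>"
  shows "super_action Z \<omega> n u \<le> \<epsilon>\<^sup>2" "0 \<le> super_action Z \<omega> n u"
proof -
  show "0 \<le> super_action Z \<omega> n u" unfolding super_action_def by (rule infsum_nonneg) simp
  have e0: "0 \<le> \<epsilon>" using assms(3) hnorm_nonneg[of d Z s u] by linarith
  have fin: "(\<Sum>k\<in>F. (cmod (u k))\<^sup>2) \<le> \<epsilon>\<^sup>2" if "finite F" "F \<subseteq> {k \<in> Z. \<omega> k = \<omega> n}" for F
  proof -
    have "(\<Sum>k\<in>F. (cmod (u k))\<^sup>2) = (L2_set (\<lambda>k. cmod (u k)) F)\<^sup>2" by (simp add: L2_set_def sum_nonneg)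
    also have "\<dots> \<le> (L2_set (wt d s u) F)\<^sup>2"
    proof (intro power_mono L2_set_mono)
      fix k
      have "1 \<le> jap d k powr s" using assms(2) by (intro ge_one_powr_ge_zero) auto
      then show "cmod (u k) \<le> wt d s u k" using mult_right_mono[of 1 "jap d k powr s" "cmod (u k)"] by simp
    qed auto
    also have "\<dots> \<le> \<epsilon>\<^sup>2"
      using that assms by (intro power_mono order_trans[OF L2_set_le_hnorm[OF assms(1)] assms(3)]) auto
    finally show ?thesis .
  qed
  show "super_action Z \<omega> n u \<le> \<epsilon>\<^sup>2"
    unfolding super_action_def
  proof (rule infsum_le_finite_sums[OF _ fin])
    show "(\<lambda>k. (cmod (u k))\<^sup>2) summable_on {k \<in> Z. \<omega> k = \<omega> n}"
      using fin by (intro nonneg_bdd_above_summable_on bdd_aboveI[of _ "\<epsilon>\<^sup>2"]) auto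
  qed auto
qed

lemma powi_neg_diff:
  fixes x :: real
  assumes "b \<le> a"
  shows "x powi (- (int a - int b)) = 1 / x ^ (a - b)"
proof -
  have e: "- (int a - int b) = - int (a - b)" using assms by simp
  show ?thesis unfolding e power_int_minus power_int_of_nat by (simp add: divide_inverse)
qed

text \<open>
  The reduction to finitely many modes. The tail of the solution is made so small that the
  truncation error does not exceed the given bound on the force; this doubles the force, and the
  passage from modes to pairs of variables doubles it again, which gives \<open>4 * K\<close>.
\<close>

lemma small_amplitude_drift:
  fixes \<eta> \<epsilon> K :: real
  assumes d: "d \<ge> 1" and s: "s \<ge> 0" and rp: "r > p" "p \<ge> 3" and Z: "Z \<subseteq> Zd d" and \<eta>: "\<eta> > 0"
    and bdd: "bounded ((\<lambda>n. jap d n powr (- 2 * s) * \<omega> n) ` Z)"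
    and pos: "\<And>j. j \<in> {1..r} \<Longrightarrow> \<beta> j > 0 \<and> \<gamma> j > 0"
    and nr: "strongly_nonresonant d Z \<beta> \<gamma> Nmax r \<omega>"
    and c: "\<And>j. j \<in> {p..<r} \<Longrightarrow> c j > 0"
    and P: "\<And>j. j \<in> {p..<r} \<Longrightarrow> P j \<in> ham_class d Z q \<alpha> j \<and> ham_norm d Z q \<alpha> j (P j) \<le> ennreal (c j / \<eta> ^ (j - 2))"
    and \<alpha>: "\<alpha> > max (real d - q) (real d / 2)" and s1: "real d / 2 - q < s" and s2: "s < \<alpha> - real d / 2 + q" and q: "q \<ge> 0"
    and K: "K > 0" and \<epsilon>: "\<epsilon> > 0" "\<epsilon> \<le> \<eta>"
    and u: "u \<in> h_C0 d Z s" and u': "h_C1_deriv d Z (- s) u u'" and F: "\<And>t. F t \<in> hspace d Z (- s)"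
    and eq: "\<And>t k. k \<in> Z \<Longrightarrow> \<i> * u' t k = h_gradient d Z s (Z2 Z \<omega>) (u t) k +
        h_gradient d Z s (\<lambda>v. \<Sum>j\<in>{p..<r}. ham_fun Z j (P j) v) (u t) k + F t k"
    and F_le: "\<And>t. hnorm d Z (- s) (F t) \<le> K * \<epsilon> ^ (r - 1) / \<eta> ^ (r - 2)"
    and u_le: "\<And>t. hnorm d Z s (u t) \<le> \<epsilon>"
    and coer: "coercive d Z \<omega>" and n: "n \<in> Z" "ereal (jap d n) \<le> Nmax"
    and t: "\<bar>t\<bar> * (\<epsilon> / \<eta>) ^ (r - p) \<le> 1"
  shows "\<bar>super_action Z \<omega> n (u t) - super_action Z \<omega> n (u 0)\<bar> \<le>
    drift_const r (ham_const d s q \<alpha> r c) (4 * K) * (2 * (sd_const \<gamma> r * jap d n powr sd_exponent \<beta> r)) ^ (2 * r) *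
      (\<epsilon>\<^sup>2 * (\<epsilon> / \<eta>) ^ (p - 2))"
proof -
  have uh: "u \<tau> \<in> hspace d Z s" for \<tau> using u by (simp add: h_C0_def)
  define W where "W = (\<lambda>k. jap d k powr s)"
  have W: "1 \<le> W k" for k unfolding W_def using s by (intro ge_one_powr_ge_zero) auto
  define \<Lambda> where "\<Lambda> = sd_const \<gamma> r * jap d n powr sd_exponent \<beta> r"
  have "1 \<le> jap d n powr sd_exponent \<beta> r" using sd_exponent_nonneg by (intro ge_one_powr_ge_zero) auto
  then have \<Lambda>: "1 \<le> \<Lambda>" unfolding \<Lambda>_def using sd_const_ge_1[of \<gamma> r] mult_mono[of 1 "sd_const \<gamma> r" 1 "jap d n powr sd_exponent \<beta> r"] by simp
  define cl where "cl = {k \<in> Z. \<omega> k = \<omega> n}"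
  have cl: "finite cl" "cl \<subseteq> Z" unfolding cl_def using coercive_finite_cluster[OF coer Z] by auto
  define c' where "c' = (\<lambda>j. c j / \<eta> ^ (j - 2))"
  define FC where "FC = (\<lambda>j. form_const d s q \<alpha> j)"
  have FCb: "form_bound d s q \<alpha> j (FC j)" for j unfolding FC_def by (rule form_const[OF d \<alpha> s1 s2 q])
  have FC0: "0 \<le> FC j" for j using FCb[of j] by (simp add: form_bound_def)
  have c'0: "0 \<le> c' j" if "j \<in> {p..<r}" for j using c[OF that] \<eta> by (simp add: c'_def)
  have bf: "bounded_form d Z s j (\<lambda>n. c' j * inverse (ham_weight d q \<alpha> j n)) (c' j * FC j)" if "j \<in> {p..<r}" for j
    using FCb s Z c'0[OF that] by (rule bounded_form_ham_weight)
  have dom: "bounded_form.dominated Z j (\<lambda>n. c' j * inverse (ham_weight d q \<alpha> j n)) (P j \<sigma>)" if "j \<in> {p..<r}" "\<sigma> \<in> signs j" for j \<sigma>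
    unfolding bounded_form.dominated_def[OF bf[OF that(1)]]
  proof
    fix n assume n: "n \<in> tuples j Z"
    have "ham_norm d Z q \<alpha> j (P j) \<le> ennreal (c' j)" using P[OF that(1)] by (simp add: c'_def)
    then show "cmod (P j \<sigma> n) \<le> c' j * inverse (ham_weight d q \<alpha> j n)"
      using c'0[OF that(1)] that(2) n by (rule ham_norm_dominated)
  qed
  have grad: "h_gradient d Z s (\<lambda>v. \<Sum>j\<in>{p..<r}. ham_fun Z j (P j) v) (u \<tau>) = (\<lambda>k. \<Sum>j\<in>{p..<r}. ham_grad Z j (P j) (u \<tau>) k)" for \<tau>
  proof (intro h_gradient_eqI has_h_gradient_sum)
    fix j assume j: "j \<in> {p..<r}"
    show "has_h_gradient d Z s (ham_fun Z j (P j)) (u \<tau>) (ham_grad Z j (P j) (u \<tau>))"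
      using dom[OF j] uh j rp by (intro bounded_form.ham_fun_has_gradient[OF bf[OF j]]) auto
  qed
  have gradZ: "h_gradient d Z s (Z2 Z \<omega>) (u \<tau>) = (\<lambda>k. of_real (\<omega> k) * u \<tau> k)" for \<tau>
    by (intro h_gradient_eqI Z2_has_gradient bdd uh)
  define E0 where "E0 = K * \<epsilon> ^ (r - 1) / \<eta> ^ (r - 2)"
  have E0: "0 < E0" using K \<epsilon> \<eta> by (simp add: E0_def)
  \<comment> \<open>By \<open>ham_grad_truncation_error\<close>, a tail of size \<open>\<tau>0\<close> causes an error of size at most \<open>S * \<tau>0\<close>.\<close>
  define S where "S = (\<Sum>j\<in>{p..<r}. real j * 2 ^ j * (c' j * FC j * 2 ^ j * \<epsilon> ^ (j - 2)))"
  have S: "0 \<le> S" unfolding S_def using c'0 FC0 \<epsilon> by (intro sum_nonneg mult_nonneg_nonneg) auto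
  define \<tau>0 where "\<tau>0 = min \<epsilon> (E0 / (S + 1))"
  have \<tau>0: "0 < \<tau>0" "\<tau>0 \<le> \<epsilon>" "S * \<tau>0 \<le> E0"
  proof -
    have "S * \<tau>0 \<le> S * (E0 / (S + 1))" using S by (intro mult_left_mono) (auto simp: \<tau>0_def)
    also have "\<dots> \<le> E0" using S E0 by (simp add: field_simps)
    finally show "S * \<tau>0 \<le> E0" .
  qed (use \<epsilon> E0 S in \<open>auto simp: \<tau>0_def\<close>)
  obtain B where B: "finite B" "cl \<subseteq> B" "B \<subseteq> Z"
    and tail: "\<And>\<tau>. \<bar>\<tau>\<bar> \<le> \<bar>t\<bar> \<Longrightarrow> hnorm d Z s (\<lambda>k. if k \<in> B then 0 else u \<tau> k) \<le> \<tau>0"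
    using uniform_tail[OF u \<tau>0(1) cl, of "\<bar>t\<bar>"] by auto
  define err where "err = (\<lambda>\<tau> k. \<Sum>j\<in>{p..<r}. ham_grad Z j (P j) (u \<tau>) k - ham_grad B j (P j) (u \<tau>) k)"
  have err: "L2_set (wt d (- s) (err \<tau>)) B \<le> E0" if \<tau>: "\<bar>\<tau>\<bar> \<le> \<bar>t\<bar>" for \<tau>
  proof -
    have "L2_set (wt d (- s) (err \<tau>)) B \<le> (\<Sum>j\<in>{p..<r}. L2_set (wt d (- s) (\<lambda>k. ham_grad Z j (P j) (u \<tau>) k - ham_grad B j (P j) (u \<tau>) k)) B)"
      unfolding err_def by (rule L2_set_wt_sum)
    also have "\<dots> \<le> (\<Sum>j\<in>{p..<r}. real j * 2 ^ j * (c' j * FC j * 2 ^ j * (\<tau>0 * \<epsilon> ^ (j - 2))))"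
      using dom uh B u_le tail[OF \<tau>] \<tau>0 rp
      by (intro sum_mono bounded_form.ham_grad_truncation_error[OF bf]) auto
    also have "\<dots> = S * \<tau>0" unfolding S_def sum_distrib_right by (intro sum.cong refl) (simp add: mult_ac)
    finally show ?thesis using \<tau>0(3) by linarith
  qed
  \<comment> \<open>On the modes of \<open>B\<close> the equation is that of \<open>Htot\<close>, with the truncation error counted as a
    part of the force \<open>g\<close>.\<close>
  define Q where "Q = (\<lambda>j. ham_poly B j (P j))"
  define Htot where "Htot = (\<lambda>z. quad B (\<lambda>k. of_real (\<omega> k) / 2) z + (\<Sum>j\<in>{p..<r}. Q j z))"
  define \<zeta> where "\<zeta> = (\<lambda>\<tau>. conj_pair (u \<tau>))"
  define g where "g = (\<lambda>\<tau> k. err \<tau> k + F \<tau> k)"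
  define \<phi> where "\<phi> = (\<lambda>\<tau> v. if snd v then - \<i> * g \<tau> (fst v) else \<i> * cnj (g \<tau> (fst v)))"
  define CH where "CH = ham_const d s q \<alpha> r c"
  have CH: "0 \<le> CH" unfolding CH_def ham_const_def by (intro mult_nonneg_nonneg sum_nonneg) auto
  have adm: "adm W B j (CH / \<eta> ^ (j - 2)) (Q j)" if j: "p \<le> j" "j < r" for j
  proof (rule adm_mono)
    have j': "j \<in> {p..<r}" "j \<in> {3..<r}" using j rp by auto
    show "adm W B j (real j * 2 ^ j * (c' j * FC j)) (Q j)"
      unfolding Q_def W_def using dom j' B by (intro bounded_form.ham_poly_adm[OF bf]) auto
    have a: "real j * 2 ^ j \<le> real r * 2 ^ r" using j by (intro mult_mono power_increasing) auto
    have "\<bar>c j\<bar> \<le> (\<Sum>j\<in>{3..<r}. \<bar>c j\<bar>)" using j' by (intro member_le_sum) auto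
    moreover have "\<bar>FC j\<bar> \<le> (\<Sum>j\<in>{3..<r}. \<bar>FC j\<bar>)" using j' by (intro member_le_sum) auto
    ultimately have b: "c j * FC j \<le> (\<Sum>j\<in>{3..<r}. \<bar>c j\<bar>) * (\<Sum>j\<in>{3..<r}. \<bar>FC j\<bar>)"
      using FC0[of j] c[OF j'(1)] by (intro mult_mono) (auto intro: sum_nonneg)
    have "real j * 2 ^ j * (c j * FC j) \<le> real r * 2 ^ r * ((\<Sum>j\<in>{3..<r}. \<bar>c j\<bar>) * (\<Sum>j\<in>{3..<r}. \<bar>FC j\<bar>))"
      using a b by (rule mult_mono) (use FC0[of j] c[OF j'(1)] in auto)
    then have "real j * 2 ^ j * (c j * FC j) \<le> CH" by (simp add: CH_def ham_const_def FC_def mult.assoc)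
    then have "real j * 2 ^ j * (c j * FC j) / \<eta> ^ (j - 2) \<le> CH / \<eta> ^ (j - 2)" using \<eta> by (intro divide_right_mono) auto
    then show "real j * 2 ^ j * (c' j * FC j) \<le> CH / \<eta> ^ (j - 2)" by (simp add: c'_def mult_ac)
  qed
  have polyQ: "is_poly (Q j)" if "j \<in> {p..<r}" for j using adm[of j] that adm_is_poly by auto
  have real: "real_ham B j (P j)" if "j \<in> {p..<r}" for j
  proof -
    have "tuples j B \<subseteq> tuples j Z" using B by (auto simp: tuples_def PiE_def Pi_def)
    then show ?thesis using P[OF that] unfolding ham_class_def real_ham_def by blast
  qed
  have gF: "2 * pd (k, False) Htot (\<zeta> \<tau>) = of_real (\<omega> k) * u \<tau> k + (\<Sum>j\<in>{p..<r}. ham_grad B j (P j) (u \<tau>) k)"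
    and gT: "2 * pd (k, True) Htot (\<zeta> \<tau>) = cnj (of_real (\<omega> k) * u \<tau> k + (\<Sum>j\<in>{p..<r}. ham_grad B j (P j) (u \<tau>) k))"
    if k: "k \<in> B" for k \<tau>
  proof -
    have split: "2 * pd (k, b) Htot (\<zeta> \<tau>) = of_real (\<omega> k) * \<zeta> \<tau> (k, \<not> b) + (\<Sum>j\<in>{p..<r}. 2 * pd (k, b) (Q j) (\<zeta> \<tau>))" for b
    proof -
      have "pd (k, b) Htot (\<zeta> \<tau>) = pd (k, b) (quad B (\<lambda>k. of_real (\<omega> k) / 2)) (\<zeta> \<tau>) + (\<Sum>j\<in>{p..<r}. pd (k, b) (Q j) (\<zeta> \<tau>))"
        unfolding Htot_def using polyQ
        by (subst pd_add, simp, intro is_poly_sum, simp, subst pd_sum) auto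
      also have "pd (k, b) (quad B (\<lambda>k. of_real (\<omega> k) / 2)) (\<zeta> \<tau>) = of_real (\<omega> k) / 2 * \<zeta> \<tau> (k, \<not> b)"
        using k B by (subst pd_quad) auto
      finally show ?thesis by (simp add: distrib_left sum_distrib_left)
    qed
    show "2 * pd (k, False) Htot (\<zeta> \<tau>) = of_real (\<omega> k) * u \<tau> k + (\<Sum>j\<in>{p..<r}. ham_grad B j (P j) (u \<tau>) k)"
      unfolding split using ham_grad_eq_pd(1)[OF B(1) k real] by (simp add: \<zeta>_def Q_def conj_pair_def)
    show "2 * pd (k, True) Htot (\<zeta> \<tau>) = cnj (of_real (\<omega> k) * u \<tau> k + (\<Sum>j\<in>{p..<r}. ham_grad B j (P j) (u \<tau>) k))"
      unfolding split using ham_grad_eq_pd(2)[OF B(1) k real] by (simp add: \<zeta>_def Q_def conj_pair_def)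
  qed
  have evol: "u' \<tau> k = - 2 * \<i> * pd (k, False) Htot (\<zeta> \<tau>) - \<i> * g \<tau> k" if k: "k \<in> B" for k \<tau>
  proof -
    have "\<i> * u' \<tau> k = of_real (\<omega> k) * u \<tau> k + (\<Sum>j\<in>{p..<r}. ham_grad Z j (P j) (u \<tau>) k) + F \<tau> k"
      using eq[of k \<tau>] k B by (auto simp: grad gradZ)
    also have "\<dots> = 2 * pd (k, False) Htot (\<zeta> \<tau>) + g \<tau> k"
      unfolding gF[OF k] by (simp add: g_def err_def sum_subtractf)
    finally have e: "\<i> * u' \<tau> k = 2 * pd (k, False) Htot (\<zeta> \<tau>) + g \<tau> k" .
    have "u' \<tau> k = - \<i> * (2 * pd (k, False) Htot (\<zeta> \<tau>) + g \<tau> k)"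
      unfolding e[symmetric] by (simp flip: mult.assoc)
    also have "\<dots> = - 2 * \<i> * pd (k, False) Htot (\<zeta> \<tau>) - \<i> * g \<tau> k"
      by (simp add: distrib_left)
    finally show ?thesis .
  qed
  have deriv: "((\<lambda>\<tau>. \<zeta> \<tau> v) has_vector_derivative
      (- 2 * \<i> * sg v * pd (bar v) Htot (\<zeta> \<tau>) + \<phi> \<tau> v)) (at \<tau>)" if v: "v \<in> vars B" for \<tau> v
  proof -
    obtain k b where [simp]: "v = (k, b)" by force
    have k: "k \<in> B" "k \<in> Z" using v B by auto
    have du: "((\<lambda>\<tau>. u \<tau> k) has_vector_derivative u' \<tau> k) (at \<tau>)" by (rule component_derivative[OF u' k(2)])
    show ?thesis
    proof (cases b)
      case True
      then show ?thesis using du evol[OF k(1), of \<tau>] by (simp add: \<zeta>_def \<phi>_def conj_pair_def)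
    next
      case False
      have "cnj (u' \<tau> k) = \<i> * cnj (2 * pd (k, False) Htot (\<zeta> \<tau>)) + \<i> * cnj (g \<tau> k)"
        unfolding evol[OF k(1)] by (simp add: mult_ac)
      also have "cnj (2 * pd (k, False) Htot (\<zeta> \<tau>)) = 2 * pd (k, True) Htot (\<zeta> \<tau>)"
        unfolding gF[OF k(1)] gT[OF k(1)] ..
      finally have "((\<lambda>\<tau>. cnj (u \<tau> k)) has_vector_derivative \<i> * (2 * pd (k, True) Htot (\<zeta> \<tau>)) + \<i> * cnj (g \<tau> k)) (at \<tau>)"
        using has_vector_derivative_cnj[OF du] by simp
      then show ?thesis using False by (simp add: \<zeta>_def \<phi>_def conj_pair_def mult_ac)
    qed
  qed
  have size: "wnorm W B (\<lambda>v. cmod (\<zeta> \<tau> v)) \<le> 2 * \<epsilon>" for \<tau>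
  proof -
    have "wnorm W B (\<lambda>v. cmod (\<zeta> \<tau> v)) = L2_set (\<lambda>v. wt d s (u \<tau>) (fst v)) (vars B)"
      unfolding wnorm_def by (intro L2_set_cong refl) (simp add: \<zeta>_def conj_pair_def W_def)
    also have "\<dots> \<le> 2 * L2_set (wt d s (u \<tau>)) B" by (rule L2_set_vars[OF B(1)])
    also have "L2_set (wt d s (u \<tau>)) B \<le> \<epsilon>" using L2_set_le_hnorm[OF uh B(1,3), of \<tau>] u_le[of \<tau>] by linarith
    finally show ?thesis by simp
  qed
  have force: "dnorm W B (\<lambda>v. cmod (\<phi> \<tau> v)) \<le> (4 * K) * \<epsilon> * (\<epsilon> / \<eta>) ^ (r - 2)" if \<tau>: "\<bar>\<tau>\<bar> \<le> \<bar>t\<bar>" for \<tau>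
  proof -
    have "dnorm W B (\<lambda>v. cmod (\<phi> \<tau> v)) = L2_set (\<lambda>v. wt d (- s) (g \<tau>) (fst v)) (vars B)"
      unfolding dnorm_def by (intro L2_set_cong refl) (simp add: \<phi>_def norm_mult W_def powr_minus divide_inverse)
    also have "\<dots> \<le> 2 * L2_set (wt d (- s) (g \<tau>)) B" by (rule L2_set_vars[OF B(1)])
    also have "L2_set (wt d (- s) (g \<tau>)) B \<le> L2_set (\<lambda>k. wt d (- s) (err \<tau>) k + wt d (- s) (F \<tau>) k) B"
      unfolding g_def by (intro L2_set_mono) (auto simp flip: distrib_left intro!: mult_left_mono norm_triangle_ineq)
    also have "\<dots> \<le> L2_set (wt d (- s) (err \<tau>)) B + L2_set (wt d (- s) (F \<tau>)) B" by (rule L2_set_triangle_ineq)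
    also have "\<dots> \<le> E0 + E0"
      using err[OF \<tau>] L2_set_le_hnorm[OF F B(1,3), of \<tau>] F_le[of \<tau>] unfolding E0_def by linarith
    also have "2 * (E0 + E0) = (4 * K) * \<epsilon> * (\<epsilon> / \<eta>) ^ (r - 2)"
    proof -
      have "r - 1 = Suc (r - 2)" using rp by simp
      then have "\<epsilon> ^ (r - 1) = \<epsilon> * \<epsilon> ^ (r - 2)" by (simp only: power_Suc)
      then show ?thesis by (simp add: E0_def power_divide)
    qed
    finally show ?thesis by simp
  qed
  have nonres: "1 / \<Lambda> \<le> cmod (qweight (\<lambda>k. of_real (\<omega> k)) m)"
    if m: "set_mset m \<subseteq> vars B" "3 \<le> size m" "size m < r" "qweight (\<lambda>k. if \<omega> k = \<omega> n then 1 else 0) m \<noteq> 0" for m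
  proof -
    have "set_mset m \<subseteq> vars Z" using m(1) B(3) by blast
    then have "\<gamma> (size m) * jap d n powr (- \<beta> (size m)) \<le> cmod (qweight (\<lambda>k. of_real (\<omega> k)) m)"
      using m pos[of "size m"] by (intro small_divisor_bound[OF nr n]) auto
    moreover have "1 / \<Lambda> \<le> \<gamma> (size m) * jap d n powr (- \<beta> (size m))"
      unfolding \<Lambda>_def using m pos[of "size m"] by (intro sd_bound) auto
    ultimately show ?thesis by linarith
  qed
  let ?J = "quad B (\<lambda>k. if \<omega> k = \<omega> n then 1 else 0)"
  have "cmod (?J (\<zeta> t) - ?J (\<zeta> 0)) \<le> drift_const r CH (4 * K) * (2 * \<Lambda>) ^ (2 * r) * (\<epsilon>\<^sup>2 * (\<epsilon> / \<eta>) ^ (p - 2))"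
    by (rule scaled_action_drift[where P = Q and \<phi> = \<phi> and W = W, OF B(1) W \<Lambda> \<eta> \<epsilon> rp(2,1) nonres adm CH _ size force])
       (use deriv K t in \<open>auto simp: Htot_def\<close>)
  moreover have "?J (\<zeta> \<tau>) = of_real (super_action Z \<omega> n (u \<tau>))" for \<tau>
    unfolding \<zeta>_def super_action_def using B cl by (intro cluster_action) (auto simp: cl_def)
  ultimately show ?thesis
    by (simp add: CH_def \<Lambda>_def flip: of_real_diff)
qed

text \<open>
  The summand \<open>2\<close> covers the case of large amplitudes, where only \<open>J \<le> \<epsilon>\<^sup>2\<close> is used.
\<close>

definition final_const :: "real \<Rightarrow> nat \<Rightarrow> real \<Rightarrow> (nat \<Rightarrow> real) \<Rightarrow> real \<Rightarrow> nat \<Rightarrow> real \<Rightarrow> (nat \<Rightarrow> real) \<Rightarrow> real" where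
  "final_const K r s \<gamma> \<alpha> d q c =
     \<bar>drift_const r (ham_const d s q \<alpha> r c) (4 * K) * (2 * sd_const \<gamma> r) ^ (2 * r)\<bar> + 2"

theorem theorem5p1:
  "\<exists>(b :: (nat \<Rightarrow> real) \<Rightarrow> nat \<Rightarrow> real)
     (M :: real \<Rightarrow> nat \<Rightarrow> real \<Rightarrow> (nat \<Rightarrow> real) \<Rightarrow> real \<Rightarrow> nat \<Rightarrow> real \<Rightarrow> (nat \<Rightarrow> real) \<Rightarrow> real).
    (\<forall>K r s \<gamma> \<alpha> d q c. M K r s \<gamma> \<alpha> d q c > 0) \<and>
    (\<forall>(d::nat) (s::real) (r::nat) (p::nat) (Z :: site set) (Nmax::ereal) (\<eta>::real)
      (\<omega> :: site \<Rightarrow> real) (\<beta> :: nat \<Rightarrow> real) (\<gamma> :: nat \<Rightarrow> real)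
      (P :: nat \<Rightarrow> hamiltonian) (c :: nat \<Rightarrow> real) (\<alpha>::real) (q::real)
      (K::real) (\<epsilon>\<^sub>1::real)
      (u :: real \<Rightarrow> field) (u' :: real \<Rightarrow> field) (F :: real \<Rightarrow> field).
        d \<ge> 1 \<longrightarrow> s \<ge> 0 \<longrightarrow> r > p \<longrightarrow> p \<ge> 3 \<longrightarrow> Z \<subseteq> Zd d \<longrightarrow> Nmax \<ge> 1 \<longrightarrow> \<eta> > 0 \<longrightarrow>
        bounded ((\<lambda>n. jap d n powr (- 2 * s) * \<omega> n) ` Z) \<longrightarrow>
        (\<forall>j\<in>{1..r}. \<beta> j > 0 \<and> \<gamma> j > 0) \<longrightarrow>
        strongly_nonresonant d Z \<beta> \<gamma> Nmax r \<omega> \<longrightarrow>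
        (\<forall>j\<in>{p..r-1}. c j > 0) \<longrightarrow>
        (\<forall>j\<in>{p..r-1}. P j \<in> ham_class d Z q \<alpha> j \<and>
           ham_norm d Z q \<alpha> j (P j) \<le> ennreal (c j * \<eta> powi (- (int j - 2)))) \<longrightarrow>
        \<alpha> > max (real d - q) (real d / 2) \<longrightarrow>
        real d / 2 - q < s \<longrightarrow> s < \<alpha> - real d / 2 + q \<longrightarrow> q \<ge> 0 \<longrightarrow>
        K > 0 \<longrightarrow> \<epsilon>\<^sub>1 > 0 \<longrightarrow>
        u \<in> h_C0b d Z s \<longrightarrow> h_C1_deriv d Z (- s) u u' \<longrightarrow> F \<in> h_C0b d Z (- s) \<longrightarrow>
        (\<forall>t. \<forall>k\<in>Z. \<i> * u' t k =
           h_gradient d Z s (Z2 Z \<omega>) (u t) k +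
           h_gradient d Z s (\<lambda>v. \<Sum>j\<in>{p..r-1}. ham_fun Z j (P j) v) (u t) k +
           F t k) \<longrightarrow>
        (\<forall>t. hnorm d Z (- s) (F t) \<le> K * \<eta> powi (- (int r - 2)) * \<epsilon>\<^sub>1 ^ (r - 1)) \<longrightarrow>
        (\<forall>t. hnorm d Z s (u t) \<le> \<epsilon>\<^sub>1) \<longrightarrow>
        coercive d Z \<omega> \<longrightarrow>
        (\<forall>n\<in>Z. \<forall>t::real.
           \<bar>t\<bar> < (\<epsilon>\<^sub>1 / \<eta>) powi (- (int r - int p)) \<and> ereal (jap d n) \<le> Nmax \<longrightarrow>
           \<bar>super_action Z \<omega> n (u t) - super_action Z \<omega> n (u 0)\<bar>
             \<le> M K r s (restrict \<gamma> {3..r}) \<alpha> d q (restrict c {p..r-1}) *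
               \<eta> powi (- (int p - 2)) * jap d n powr (b (restrict \<beta> {3..r}) r) * \<epsilon>\<^sub>1 ^ p))"
proof (intro exI[of _ "\<lambda>\<beta> r. sd_exponent \<beta> r * (2 * real r)"] exI[of _ final_const] conjI allI impI ballI)
  \<comment> \<open>The exponent is the one of the small divisors times \<open>2 * r\<close>, the power of \<open>\<Lambda>\<close> in
    \<open>small_amplitude_drift\<close>.\<close>
  show "final_const K r s \<gamma> \<alpha> d q c > 0" for K r s \<gamma> \<alpha> d q c
    unfolding final_const_def by linarith
next
  fix d :: nat and s :: real and r p :: nat and Z :: "site set" and Nmax :: ereal and \<eta> :: real
    and \<omega> :: "site \<Rightarrow> real" and \<beta> \<gamma> :: "nat \<Rightarrow> real" and P :: "nat \<Rightarrow> hamiltonian" and c :: "nat \<Rightarrow> real"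
    and \<alpha> q K \<epsilon> :: real and u u' F :: "real \<Rightarrow> field" and n :: site and t :: real
  assume d: "d \<ge> 1" and s: "s \<ge> 0" and rp: "r > p" "p \<ge> 3" and Z: "Z \<subseteq> Zd d" and "Nmax \<ge> 1" and \<eta>: "\<eta> > 0"
    and bdd: "bounded ((\<lambda>n. jap d n powr (- 2 * s) * \<omega> n) ` Z)"
    and pos: "\<forall>j\<in>{1..r}. \<beta> j > 0 \<and> \<gamma> j > 0"
    and nr: "strongly_nonresonant d Z \<beta> \<gamma> Nmax r \<omega>"
    and c: "\<forall>j\<in>{p..r-1}. c j > 0"
    and P: "\<forall>j\<in>{p..r-1}. P j \<in> ham_class d Z q \<alpha> j \<and>
           ham_norm d Z q \<alpha> j (P j) \<le> ennreal (c j * \<eta> powi (- (int j - 2)))"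
    and \<alpha>: "\<alpha> > max (real d - q) (real d / 2)" and s1: "real d / 2 - q < s" and s2: "s < \<alpha> - real d / 2 + q" and q: "q \<ge> 0"
    and K: "K > 0" and \<epsilon>: "\<epsilon> > 0"
    and u: "u \<in> h_C0b d Z s" and u': "h_C1_deriv d Z (- s) u u'" and F: "F \<in> h_C0b d Z (- s)"
    and eq: "\<forall>t. \<forall>k\<in>Z. \<i> * u' t k =
           h_gradient d Z s (Z2 Z \<omega>) (u t) k +
           h_gradient d Z s (\<lambda>v. \<Sum>j\<in>{p..r-1}. ham_fun Z j (P j) v) (u t) k +
           F t k"
    and F_le: "\<forall>t. hnorm d Z (- s) (F t) \<le> K * \<eta> powi (- (int r - 2)) * \<epsilon> ^ (r - 1)"
    and u_le: "\<forall>t. hnorm d Z s (u t) \<le> \<epsilon>"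
    and coer: "coercive d Z \<omega>" and n: "n \<in> Z"
    and tN: "\<bar>t\<bar> < (\<epsilon> / \<eta>) powi (- (int r - int p)) \<and> ereal (jap d n) \<le> Nmax"
  define \<gamma>' where "\<gamma>' = restrict \<gamma> {3..r}"
  define \<beta>' where "\<beta>' = restrict \<beta> {3..r}"
  define cr where "cr = restrict c {p..r-1}"
  define D where "D = drift_const r (ham_const d s q \<alpha> r cr) (4 * K)"
  define J where "J = jap d n powr (sd_exponent \<beta>' r * (2 * real r))"
  define x where "x = \<epsilon> / \<eta>"
  have x: "0 < x" using \<epsilon> \<eta> by (simp add: x_def)
  have set_eq: "{p..r - 1} = {p..<r}" using rp by auto
  have J1: "1 \<le> J" unfolding J_def using sd_exponent_nonneg by (intro ge_one_powr_ge_zero) auto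
  have uC: "u \<in> h_C0 d Z s" "u \<tau> \<in> hspace d Z s" for \<tau> using u by (auto simp: h_C0b_def h_C0_def)
  have scale: "\<eta> powi (- (int p - 2)) * \<epsilon> ^ p = \<epsilon>\<^sup>2 * x ^ (p - 2)"
  proof -
    have "p = 2 + (p - 2)" using rp by simp
    then have "\<epsilon> ^ p = \<epsilon> ^ 2 * \<epsilon> ^ (p - 2)" by (metis power_add)
    then show ?thesis using powi_neg_diff[of 2 p \<eta>] rp by (simp add: x_def power_divide)
  qed
  have main: "\<bar>super_action Z \<omega> n (u t) - super_action Z \<omega> n (u 0)\<bar> \<le> (\<bar>D * (2 * sd_const \<gamma>' r) ^ (2 * r)\<bar> + 2) * J * (\<epsilon>\<^sup>2 * x ^ (p - 2))"
  proof (cases "\<epsilon> \<le> \<eta>")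
    case False
    then have "1 \<le> x" using \<eta> by (simp add: x_def)
    then have "1 \<le> x ^ (p - 2)" by (rule one_le_power)
    then have "1 * (\<epsilon>\<^sup>2 * 1) \<le> J * (\<epsilon>\<^sup>2 * x ^ (p - 2))" using J1 by (intro mult_mono mult_left_mono) auto
    moreover have "\<bar>super_action Z \<omega> n (u t) - super_action Z \<omega> n (u 0)\<bar> \<le> 2 * \<epsilon>\<^sup>2"
      using super_action_le[OF uC(2) s u_le[rule_format], of \<omega> n] by (smt (verit))
    moreover have "2 * (J * (\<epsilon>\<^sup>2 * x ^ (p - 2))) \<le> (\<bar>D * (2 * sd_const \<gamma>' r) ^ (2 * r)\<bar> + 2) * (J * (\<epsilon>\<^sup>2 * x ^ (p - 2)))"
      using J1 x by (intro mult_right_mono) auto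
    ultimately show ?thesis by (simp add: mult.assoc)
  next
    case True
    have t: "\<bar>t\<bar> * x ^ (r - p) \<le> 1"
    proof -
      have "\<bar>t\<bar> < 1 / x ^ (r - p)" using tN powi_neg_diff[of p r x] rp by (simp add: x_def)
      then show ?thesis using x by (simp add: field_simps)
    qed
    have pow: "\<eta> powi (- (int j - 2)) = 1 / \<eta> ^ (j - 2)" if "2 \<le> j" for j
      using powi_neg_diff[of 2 j \<eta>] that by simp
    have drift: "\<bar>super_action Z \<omega> n (u t) - super_action Z \<omega> n (u 0)\<bar> \<le>
      drift_const r (ham_const d s q \<alpha> r cr) (4 * K) * (2 * (sd_const \<gamma> r * jap d n powr sd_exponent \<beta> r)) ^ (2 * r) *
        (\<epsilon>\<^sup>2 * (\<epsilon> / \<eta>) ^ (p - 2))"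
    proof (rule small_amplitude_drift[where Z = Z and P = P and F = F and u' = u' and Nmax = Nmax])
      show "cr j > 0" if "j \<in> {p..<r}" for j using c that unfolding cr_def set_eq by simp
      show "P j \<in> ham_class d Z q \<alpha> j \<and> ham_norm d Z q \<alpha> j (P j) \<le> ennreal (cr j / \<eta> ^ (j - 2))" if "j \<in> {p..<r}" for j
      proof -
        have j2: "2 \<le> j" using that rp by simp
        have e: "c j * \<eta> powi (- (int j - 2)) = c j / \<eta> ^ (j - 2)"
          unfolding pow[OF j2] by simp
        have "P j \<in> ham_class d Z q \<alpha> j \<and> ham_norm d Z q \<alpha> j (P j) \<le> ennreal (c j * \<eta> powi (- (int j - 2)))"
          using P that unfolding set_eq by blast
        moreover have "cr j = c j" using that unfolding cr_def set_eq by simp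
        ultimately show ?thesis by (simp only: e)
      qed
      show "hnorm d Z (- s) (F \<tau>) \<le> K * \<epsilon> ^ (r - 1) / \<eta> ^ (r - 2)" for \<tau>
        using F_le pow[of r] rp by (simp add: mult_ac)
      show "\<i> * u' \<tau> k = h_gradient d Z s (Z2 Z \<omega>) (u \<tau>) k +
          h_gradient d Z s (\<lambda>v. \<Sum>j\<in>{p..<r}. ham_fun Z j (P j) v) (u \<tau>) k + F \<tau> k" if "k \<in> Z" for \<tau> k
        using eq that unfolding set_eq by blast
      show "F \<tau> \<in> hspace d Z (- s)" for \<tau> using F by (auto simp: h_C0b_def h_C0_def)
    qed (use d s rp Z \<eta> bdd pos nr \<alpha> s1 s2 q K \<epsilon> True uC u' u_le coer n tN t in \<open>auto simp: x_def\<close>)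
    have g: "sd_const \<gamma> r = sd_const \<gamma>' r" "sd_exponent \<beta> r = sd_exponent \<beta>' r"
      by (simp_all add: sd_const_def sd_exponent_def \<gamma>'_def \<beta>'_def)
    have "(2 * (sd_const \<gamma>' r * jap d n powr sd_exponent \<beta>' r)) ^ (2 * r) = (2 * sd_const \<gamma>' r) ^ (2 * r) * J"
    proof -
      have "(jap d n powr sd_exponent \<beta>' r) ^ (2 * r) = J"
        unfolding J_def by (subst powr_power) (auto simp: mult_ac)
      then show ?thesis by (simp only: power_mult_distrib mult.assoc)
    qed
    with drift have "\<bar>super_action Z \<omega> n (u t) - super_action Z \<omega> n (u 0)\<bar> \<le>
        (D * (2 * sd_const \<gamma>' r) ^ (2 * r)) * (J * (\<epsilon>\<^sup>2 * x ^ (p - 2)))"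
      by (simp add: g D_def x_def mult_ac)
    also have "\<dots> \<le> (\<bar>D * (2 * sd_const \<gamma>' r) ^ (2 * r)\<bar> + 2) * (J * (\<epsilon>\<^sup>2 * x ^ (p - 2)))"
      using J1 x by (intro mult_right_mono) auto
    finally show ?thesis by (simp add: mult.assoc)
  qed
  have "final_const K r s \<gamma>' \<alpha> d q cr * \<eta> powi (- (int p - 2)) * J * \<epsilon> ^ p =
      (\<bar>D * (2 * sd_const \<gamma>' r) ^ (2 * r)\<bar> + 2) * J * (\<eta> powi (- (int p - 2)) * \<epsilon> ^ p)"
    by (simp add: final_const_def D_def mult_ac)
  with main show "\<bar>super_action Z \<omega> n (u t) - super_action Z \<omega> n (u 0)\<bar> \<le>
      final_const K r s (restrict \<gamma> {3..r}) \<alpha> d q (restrict c {p..r-1}) * \<eta> powi (- (int p - 2)) *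
      jap d n powr (sd_exponent (restrict \<beta> {3..r}) r * (2 * real r)) * \<epsilon> ^ p"
    unfolding scale J_def[symmetric] \<gamma>'_def[symmetric] \<beta>'_def[symmetric] cr_def[symmetric] by (simp only:)
qed

end
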